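(* Let $R$ be a commutative Artinian local ring and let $A$ be an Artin $R$-algebra which is connected, basic and not simple. Let $T^{\bullet} : \cdots \to 0 \to T^{-1} \overset{\alpha}{\to} T^{0} \to 0 \to \cdots$ be a two-term tilting complex in $\mathscr{K}^{\mathrm{b}}(\mathcal{P}_{A})$, and let $B=\mathrm{End}_{\mathscr{K}(A)}(T^{\bullet})$. Let $\mathfrak{a} = \mathrm{ann}_{A}(\mathrm{H}^{0}(T^{\bullet}))$, $\mathfrak{a}^{\prime} = \mathrm{ann}_{A}(\mathrm{H}^{-1}(\nu T^{\bullet}))$, $\mathfrak{b} = \mathrm{ann}_{B}(\mathrm{Hom}_{\mathscr{K}(A)}(A,T^{\bullet}))$ and $\mathfrak{b}^{\prime} = \mathrm{ann}_{B}(\mathrm{Hom}_{\mathscr{K}(A)}(A,\nu T^{\bullet}[-1]))$, where $\nu$ is the Nakayama functor of $A$. Then there are algebra isomorphisms (1) $\mathrm{End}_{A/\mathfrak{a}}(\mathrm{Hom}_{\mathscr{K}(A)}(A,T^{\bullet})) \cong B/\mathfrak{b}$; (2) $\mathrm{End}_{A/\mathfrak{a}^{\prime}}(\mathrm{Hom}_{\mathscr{K}(A)}(A,\nu T^{\bullet}[-1])) \cong B/\mathfrak{b}^{\prime}$.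
   Context: An Artin $R$-algebra is a ring $A$ with a ring homomorphism $R\to A$ whose image lies in the center of $A$, such that $A$ is finitely generated as an $R$-module. $\mathrm{mod}\text{-}A$ is the category of finitely generated right $A$-modules. $\mathcal{P}_{A}$ and $\mathcal{I}_A$ are the full subcategories of projective, respectively injective, modules in $\mathrm{mod}\text{-}A$. $\mathscr{K}(A)$ is the homotopy category of cochain complexes over $\mathrm{mod}\text{-}A$, and $\mathscr{K}^{\mathrm{b}}(\mathcal{P}_{A})$, $\mathscr{K}^{\mathrm{b}}(\mathcal{I}_{A})$ are its full subcategories of bounded complexes over $\mathcal{P}_A$, $\mathcal{I}_A$. Modules are viewed as complexes concentrated in degree $0$. $\mathrm{ann}$ denotes the annihilator. $D=\mathrm{Hom}_{R}(-,E(R/\mathfrak{m}))$, where $\mathfrak{m}$ is the maximal ideal of $R$ and $E(R/\mathfrak{m})$ is an injective envelope of $R/\mathfrak{m}$. The Nakayama functor is $\nu = -\otimes_{A} DA : \mathrm{mod}\text{-}A\to\mathrm{mod}\text{-}A$, applied termwise to complexes; it induces equivalences $\mathcal{P}_A\to\mathcal{I}_A$ and $\mathscr{K}^{\mathrm{b}}(\mathcal{P}_{A})\to\mathscr{K}^{\mathrm{b}}(\mathcal{I}_{A})$, hence an algebra isomorphism $B\cong\mathrm{End}_{\mathscr{K}(A)}(\nu T^{\bullet})$. A complex $T^{\bullet}\in\mathscr{K}^{\mathrm{b}}(\mathcal{P}_{A})$ is a tilting complex if $\mathrm{Hom}_{\mathscr{K}(A)}(T^{\bullet},T^{\bullet}[i])=0$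 for all $i\neq 0$ and $\mathrm{add}(T^{\bullet})$ (direct summands of finite direct sums of copies of $T^{\bullet}$) generates $\mathscr{K}^{\mathrm{b}}(\mathcal{P}_{A})$ as a triangulated category. It is two-term if $T^{i}=0$ for $i\notin\{-1,0\}$. $\mathrm{Hom}_{\mathscr{K}(A)}(A,T^{\bullet})$ and $\mathrm{Hom}_{\mathscr{K}(A)}(A,\nu T^{\bullet}[-1])$ are right $A$-modules via precomposition (using $A\cong\mathrm{End}_A(A_A)$), and left $B$-modules via postcomposition (in the second case through $B\cong\mathrm{End}_{\mathscr{K}(A)}(\nu T^{\bullet})$). As right $A$-modules, $\mathrm{Hom}_{\mathscr{K}(A)}(A,T^{\bullet})\cong\mathrm{H}^{0}(T^{\bullet})=\mathrm{Cok}\,\alpha$ and $\mathrm{Hom}_{\mathscr{K}(A)}(A,\nu T^{\bullet}[-1])\cong\mathrm{H}^{-1}(\nu T^{\bullet})=\mathrm{Ker}\,\nu(\alpha)$; thus they are right modules over $A/\mathfrak{a}$ and $A/\mathfrak{a}'$ respectively. *)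

theory Defs
  imports "HOL-Algebra.Module" "HOL-Algebra.Chinese_Remainder" "HOL-Algebra.Free_Abelian_Groups"
begin

text \<open>
  Conventions.  The scalar slot \<open>smult\<close> of the record \<open>module\<close> holds the \<^emph>\<open>right\<close> action:
  \<open>a \<odot>\<^bsub>M\<^esub> x\<close> stands for \<open>x \<cdot> a\<close>.  Over a commutative ring there is no difference between left and
  right, so the same notion of linear map serves for the library's \<open>module R E\<close>.
  Linear maps and chain maps are extensional (\<open>undefined\<close> off the carrier), so that
  equality of maps is equality of functions.  Endomorphisms are composed as functions and hence
  act from the left on right modules.
\<close>

section \<open>Right modules\<close>

text \<open>The slots \<open>mult\<close> and \<open>one\<close> inherited from the record \<open>ring\<close> carry no information in a module.\<close>

definition mk_module ::
  "'m set \<Rightarrow> 'm \<Rightarrow> ('m \<Rightarrow> 'm \<Rightarrow> 'm) \<Rightarrow> ('a \<Rightarrow> 'm \<Rightarrow> 'm) \<Rightarrow> ('a, 'm) module" where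
  "mk_module C z p s =
     \<lparr>carrier = C, monoid.mult = (\<lambda>x y. undefined), one = undefined, ring.zero = z, add = p, smult = s\<rparr>"

locale right_module = R?: ring R + M?: abelian_group M
  for R :: "('a, 'k) ring_scheme" (structure) and M :: "('a, 'm, 'l) module_scheme" (structure) +
  assumes smult_closed [simp, intro]:
      "\<lbrakk>a \<in> carrier R; x \<in> carrier M\<rbrakk> \<Longrightarrow> a \<odot>\<^bsub>M\<^esub> x \<in> carrier M"
    and smult_l_distr:
      "\<lbrakk>a \<in> carrier R; b \<in> carrier R; x \<in> carrier M\<rbrakk> \<Longrightarrow>
       (a \<oplus>\<^bsub>R\<^esub> b) \<odot>\<^bsub>M\<^esub> x = a \<odot>\<^bsub>M\<^esub> x \<oplus>\<^bsub>M\<^esub> b \<odot>\<^bsub>M\<^esub> x"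
    and smult_r_distr:
      "\<lbrakk>a \<in> carrier R; x \<in> carrier M; y \<in> carrier M\<rbrakk> \<Longrightarrow>
       a \<odot>\<^bsub>M\<^esub> (x \<oplus>\<^bsub>M\<^esub> y) = a \<odot>\<^bsub>M\<^esub> x \<oplus>\<^bsub>M\<^esub> a \<odot>\<^bsub>M\<^esub> y"
    and smult_assoc:
      "\<lbrakk>a \<in> carrier R; b \<in> carrier R; x \<in> carrier M\<rbrakk> \<Longrightarrow>
       (a \<otimes>\<^bsub>R\<^esub> b) \<odot>\<^bsub>M\<^esub> x = b \<odot>\<^bsub>M\<^esub> (a \<odot>\<^bsub>M\<^esub> x)"
    and smult_one [simp]:
      "x \<in> carrier M \<Longrightarrow> \<one>\<^bsub>R\<^esub> \<odot>\<^bsub>M\<^esub> x = x"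

definition mod_hom ::
  "('a, 'k) ring_scheme \<Rightarrow> ('a, 'm, 'k1) module_scheme \<Rightarrow> ('a, 'n, 'k2) module_scheme \<Rightarrow> ('m \<Rightarrow> 'n) set" where
  "mod_hom A M N = {f \<in> carrier M \<rightarrow>\<^sub>E carrier N.
     (\<forall>x\<in>carrier M. \<forall>y\<in>carrier M. f (x \<oplus>\<^bsub>M\<^esub> y) = f x \<oplus>\<^bsub>N\<^esub> f y) \<and>
     (\<forall>a\<in>carrier A. \<forall>x\<in>carrier M. f (a \<odot>\<^bsub>M\<^esub> x) = a \<odot>\<^bsub>N\<^esub> f x)}"

definition mod_iso ::
  "('a, 'k) ring_scheme \<Rightarrow> ('a, 'm, 'k1) module_scheme \<Rightarrow> ('a, 'n, 'k2) module_scheme \<Rightarrow> bool" where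
  "mod_iso A M N \<longleftrightarrow> (\<exists>f\<in>mod_hom A M N. bij_betw f (carrier M) (carrier N))"

definition zero_module :: "('a, 'm, 'k) module_scheme \<Rightarrow> bool" where
  "zero_module M \<longleftrightarrow> carrier M = {\<zero>\<^bsub>M\<^esub>}"

definition fin_gen :: "('a, 'k) ring_scheme \<Rightarrow> ('a, 'm, 'k1) module_scheme \<Rightarrow> bool" where
  "fin_gen A M \<longleftrightarrow> (\<exists>G. finite G \<and> G \<subseteq> carrier M \<and>
     (\<forall>x\<in>carrier M. \<exists>c\<in>G \<rightarrow> carrier A. x = (\<Oplus>\<^bsub>M\<^esub>g\<in>G. c g \<odot>\<^bsub>M\<^esub> g)))"

text \<open>\<open>fg_module A\<close> is the class of objects of mod-\<open>A\<close>.\<close>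

definition fg_module :: "('a, 'k) ring_scheme \<Rightarrow> ('a, 'm, 'k1) module_scheme \<Rightarrow> bool" where
  "fg_module A M \<longleftrightarrow> right_module A M \<and> fin_gen A M"

definition regular :: "'a ring \<Rightarrow> ('a, 'a) module" where
  "regular A = mk_module (carrier A) \<zero>\<^bsub>A\<^esub> (\<oplus>\<^bsub>A\<^esub>) (\<lambda>a x. x \<otimes>\<^bsub>A\<^esub> a)"

definition restrict_scalars :: "('r \<Rightarrow> 'a) \<Rightarrow> ('a, 'm) module \<Rightarrow> ('r, 'm) module" where
  "restrict_scalars \<phi> M = mk_module (carrier M) \<zero>\<^bsub>M\<^esub> (\<oplus>\<^bsub>M\<^esub>) (\<lambda>r x. \<phi> r \<odot>\<^bsub>M\<^esub> x)"

text \<open>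
  A module over \<open>'a\<close> is quantified over only with elements in \<open>(nat \<Rightarrow> 'a) set\<close>: every finitely
  generated module is a quotient of some \<open>A\<^sup>n\<close>, so up to isomorphism all of mod-\<open>A\<close> lives there
  (lemma \<open>fg_module_in_univ\<close> below).
\<close>

type_synonym 'a univ = "(nat \<Rightarrow> 'a) set"

lemma fg_module_transport:
  fixes A :: "('a, 'k) ring_scheme" and M :: "('a, 'm, 'l) module_scheme" and \<psi> :: "'m \<Rightarrow> 'n"
  assumes M: "fg_module A M" and inj: "inj_on \<psi> (carrier M)"
  shows "\<exists>M' :: ('a, 'n) module. fg_module A M' \<and> mod_iso A M M'"
proof -
  interpret M: right_module A M using M by (simp add: fg_module_def)
  define \<iota> where "\<iota> = inv_into (carrier M) \<psi>"
  have \<iota>: "\<iota> (\<psi> x) = x" if "x \<in> carrier M" for x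
    using inj that by (simp add: \<iota>_def)
  define M' :: "('a, 'n) module" where
    "M' = mk_module (\<psi> ` carrier M) (\<psi> \<zero>\<^bsub>M\<^esub>) (\<lambda>u v. \<psi> (\<iota> u \<oplus>\<^bsub>M\<^esub> \<iota> v)) (\<lambda>a u. \<psi> (a \<odot>\<^bsub>M\<^esub> \<iota> u))"
  have car: "carrier M' = \<psi> ` carrier M" and zero: "\<zero>\<^bsub>M'\<^esub> = \<psi> \<zero>\<^bsub>M\<^esub>"
    by (simp_all add: M'_def mk_module_def)
  have add: "\<psi> x \<oplus>\<^bsub>M'\<^esub> \<psi> y = \<psi> (x \<oplus>\<^bsub>M\<^esub> y)" if "x \<in> carrier M" "y \<in> carrier M" for x y
    using that by (simp add: M'_def mk_module_def \<iota>)
  have smul: "a \<odot>\<^bsub>M'\<^esub> \<psi> x = \<psi> (a \<odot>\<^bsub>M\<^esub> x)" if "x \<in> carrier M" for a x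
    using that by (simp add: M'_def mk_module_def \<iota>)
  have "abelian_group M'"
  proof (rule abelian_groupI)
    show "\<exists>y\<in>carrier M'. y \<oplus>\<^bsub>M'\<^esub> x = \<zero>\<^bsub>M'\<^esub>" if x: "x \<in> carrier M'" for x
    proof -
      obtain z where z: "z \<in> carrier M" "x = \<psi> z" using x by (auto simp: car)
      then have "\<psi> (\<ominus>\<^bsub>M\<^esub> z) \<oplus>\<^bsub>M'\<^esub> x = \<zero>\<^bsub>M'\<^esub>" by (simp add: add zero M.M.l_neg)
      with z show ?thesis by (auto simp: car)
    qed
  qed (auto simp: car add zero M.M.a_ac)
  then interpret M': right_module A M'
    by (intro right_module.intro M.R.ring_axioms right_module_axioms.intro)
       (auto simp: car add smul M.smult_l_distr M.smult_r_distr M.smult_assoc)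
  have sum: "\<psi> (finsum M f F) = finsum M' (\<lambda>x. \<psi> (f x)) F"
    if "finite F" "f \<in> F \<rightarrow> carrier M" for F :: "'m set" and f
    using that
  proof (induction F)
    case empty
    then show ?case by (simp add: zero)
  next
    case (insert x F)
    then have "f \<in> F \<rightarrow> carrier M" "f x \<in> carrier M" by auto
    moreover from this have "(\<lambda>x. \<psi> (f x)) \<in> F \<rightarrow> carrier M'" by (auto simp: car)
    ultimately show ?case
      using insert by (simp add: car add[symmetric] M.M.finsum_closed)
  qed
  obtain G where G: "finite G" "G \<subseteq> carrier M"
    and gen: "\<And>x. x \<in> carrier M \<Longrightarrow> \<exists>c\<in>G \<rightarrow> carrier A. x = (\<Oplus>\<^bsub>M\<^esub>g\<in>G. c g \<odot>\<^bsub>M\<^esub> g)"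
    using M unfolding fg_module_def fin_gen_def by blast
  have "fin_gen A M'"
    unfolding fin_gen_def
  proof (intro exI[of _ "\<psi> ` G"] conjI ballI)
    fix u assume "u \<in> carrier M'"
    then obtain x where x: "x \<in> carrier M" "u = \<psi> x" by (auto simp: car)
    obtain c where c: "c \<in> G \<rightarrow> carrier A" "x = (\<Oplus>\<^bsub>M\<^esub>g\<in>G. c g \<odot>\<^bsub>M\<^esub> g)" using gen[OF x(1)] by blast
    have injG: "inj_on \<psi> G" using inj G(2) by (rule inj_on_subset)
    have "(\<Oplus>\<^bsub>M'\<^esub>v\<in>\<psi> ` G. c (\<iota> v) \<odot>\<^bsub>M'\<^esub> v) = (\<Oplus>\<^bsub>M'\<^esub>g\<in>G. c (\<iota> (\<psi> g)) \<odot>\<^bsub>M'\<^esub> \<psi> g)"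
      using G c injG by (intro M'.M.finsum_reindex) (force simp: car smul \<iota>)+
    also have "\<dots> = (\<Oplus>\<^bsub>M'\<^esub>g\<in>G. \<psi> (c g \<odot>\<^bsub>M\<^esub> g))"
      using G c by (intro M'.M.finsum_cong') (force simp: car smul \<iota>)+
    also have "\<dots> = \<psi> x"
      unfolding c(2) using G c by (intro sum[symmetric]) force+
    finally have "u = (\<Oplus>\<^bsub>M'\<^esub>v\<in>\<psi> ` G. c (\<iota> v) \<odot>\<^bsub>M'\<^esub> v)" using x by simp
    moreover have "(\<lambda>v. c (\<iota> v)) \<in> \<psi> ` G \<rightarrow> carrier A"
      using G c by (force simp: \<iota>)
    ultimately show "\<exists>c\<in>\<psi> ` G \<rightarrow> carrier A. u = (\<Oplus>\<^bsub>M'\<^esub>g\<in>\<psi> ` G. c g \<odot>\<^bsub>M'\<^esub> g)"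
      by (intro bexI[of _ "\<lambda>v. c (\<iota> v)"])
  qed (use G in \<open>auto simp: car\<close>)
  moreover have "restrict \<psi> (carrier M) \<in> mod_hom A M M'"
    by (auto simp: mod_hom_def car add smul)
  moreover have "bij_betw (restrict \<psi> (carrier M)) (carrier M) (carrier M')"
    using inj by (simp add: bij_betw_def car inj_on_restrict_eq)
  ultimately show ?thesis
    using M'.right_module_axioms unfolding fg_module_def mod_iso_def by blast
qed

lemma fg_module_in_univ:
  fixes A :: "('a, 'k) ring_scheme" and M :: "('a, 'm, 'l) module_scheme"
  assumes M: "fg_module A M"
  shows "\<exists>M' :: ('a, 'a univ) module. fg_module A M' \<and> mod_iso A M M'"
proof -
  obtain G where G: "finite G" "G \<subseteq> carrier M"
    and gen: "\<And>x. x \<in> carrier M \<Longrightarrow> \<exists>c\<in>G \<rightarrow> carrier A. x = (\<Oplus>\<^bsub>M\<^esub>g\<in>G. c g \<odot>\<^bsub>M\<^esub> g)"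
    using M unfolding fg_module_def fin_gen_def by blast
  interpret M: right_module A M using M by (simp add: fg_module_def)
  obtain k :: "'m \<Rightarrow> nat" where k: "inj_on k G"
    using finite_imp_inj_to_nat_seg[OF G(1)] by metis
  define \<psi> :: "'m \<Rightarrow> 'a univ" where
    "\<psi> x = {c. (\<forall>g\<in>G. c (k g) \<in> carrier A) \<and> (\<Oplus>\<^bsub>M\<^esub>g\<in>G. c (k g) \<odot>\<^bsub>M\<^esub> g) = x}" for x
  have "\<exists>d. d \<in> \<psi> x" if x: "x \<in> carrier M" for x
  proof -
    obtain c where c: "c \<in> G \<rightarrow> carrier A" "x = (\<Oplus>\<^bsub>M\<^esub>g\<in>G. c g \<odot>\<^bsub>M\<^esub> g)" using gen[OF x] by blast
    have "(\<Oplus>\<^bsub>M\<^esub>g\<in>G. c (inv_into G k (k g)) \<odot>\<^bsub>M\<^esub> g) = x"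
      unfolding c(2) using G(2) c(1) k by (intro M.M.finsum_cong') (auto simp: Pi_iff subset_iff)
    then have "(\<lambda>j. c (inv_into G k j)) \<in> \<psi> x"
      using c(1) k by (simp add: \<psi>_def Pi_iff)
    then show ?thesis by (rule exI[of "\<lambda>d. d \<in> \<psi> x"])
  qed
  then have "inj_on \<psi> (carrier M)"
    unfolding inj_on_def \<psi>_def by blast
  with M show ?thesis by (rule fg_module_transport)
qed

definition projective :: "'a ring \<Rightarrow> ('a, 'm) module \<Rightarrow> bool" where
  "projective A P \<longleftrightarrow> fg_module A P \<and>
     (\<forall>(M :: ('a, 'a univ) module) (N :: ('a, 'a univ) module).
        fg_module A M \<longrightarrow> fg_module A N \<longrightarrow>
        (\<forall>g\<in>mod_hom A M N. \<forall>f\<in>mod_hom A P N. g ` carrier M = carrier N \<longrightarrow>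
          (\<exists>h\<in>mod_hom A P M. \<forall>x\<in>carrier P. g (h x) = f x)))"

definition annihilator ::
  "('b, 'k) ring_scheme \<Rightarrow> ('b \<Rightarrow> 'm \<Rightarrow> 'm) \<Rightarrow> ('a, 'm) module \<Rightarrow> 'b set" where
  "annihilator S act M = {s \<in> carrier S. \<forall>x\<in>carrier M. act s x = \<zero>\<^bsub>M\<^esub>}"

text \<open>A module annihilated by the ideal \<open>I\<close>, as a module over the quotient ring; its scalars are cosets.\<close>

definition quot_module :: "('a, 'm) module \<Rightarrow> ('a set, 'm) module" where
  "quot_module M = mk_module (carrier M) \<zero>\<^bsub>M\<^esub> (\<oplus>\<^bsub>M\<^esub>) (\<lambda>C x. THE y. \<forall>a\<in>C. a \<odot>\<^bsub>M\<^esub> x = y)"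

definition mod_end :: "('a, 'k) ring_scheme \<Rightarrow> ('a, 'm) module \<Rightarrow> ('m \<Rightarrow> 'm) ring" where
  "mod_end A M = \<lparr>carrier = mod_hom A M M, monoid.mult = compose (carrier M),
     one = (\<lambda>x\<in>carrier M. x), ring.zero = (\<lambda>x\<in>carrier M. \<zero>\<^bsub>M\<^esub>),
     add = (\<lambda>f g. \<lambda>x\<in>carrier M. f x \<oplus>\<^bsub>M\<^esub> g x)\<rparr>"

text \<open>\<open>R\<close>-algebras are rings \<open>S\<close> with a structure map \<open>\<sigma> : R \<rightarrow> S\<close>.\<close>

definition algebra_iso ::
  "'r ring \<Rightarrow> 'b ring \<Rightarrow> ('r \<Rightarrow> 'b) \<Rightarrow> 'c ring \<Rightarrow> ('r \<Rightarrow> 'c) \<Rightarrow> bool" where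
  "algebra_iso R S \<sigma> S' \<sigma>' \<longleftrightarrow> (\<exists>h\<in>ring_iso S S'. \<forall>r\<in>carrier R. h (\<sigma> r) = \<sigma>' r)"

definition mod_end_str :: "('a, 'm) module \<Rightarrow> ('r \<Rightarrow> 'a) \<Rightarrow> 'r \<Rightarrow> 'm \<Rightarrow> 'm" where
  "mod_end_str M \<sigma> r = (\<lambda>x\<in>carrier M. \<sigma> r \<odot>\<^bsub>M\<^esub> x)"

definition quot_str :: "'a ring \<Rightarrow> 'a set \<Rightarrow> ('r \<Rightarrow> 'a) \<Rightarrow> 'r \<Rightarrow> 'a set" where
  "quot_str S I \<sigma> r = I +>\<^bsub>S\<^esub> \<sigma> r"


section \<open>The base ring and Artin algebras\<close>

locale artinian_local_ring = cring R + maximalideal m R for m and R (structure) +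
  assumes maximal_unique: "maximalideal n R \<Longrightarrow> n = m"
    and descending_chain:
      "\<lbrakk>\<And>k :: nat. ideal (I k) R; \<And>k. I (Suc k) \<subseteq> I k\<rbrakk> \<Longrightarrow> \<exists>n. \<forall>k\<ge>n. I k = I n"

locale artin_algebra = R: cring R + A: ring A
  for R :: "'r ring" and A :: "'a ring" and \<phi> :: "'r \<Rightarrow> 'a" +
  assumes str_hom: "\<phi> \<in> ring_hom R A"
    and str_central: "\<lbrakk>r \<in> carrier R; a \<in> carrier A\<rbrakk> \<Longrightarrow> \<phi> r \<otimes>\<^bsub>A\<^esub> a = a \<otimes>\<^bsub>A\<^esub> \<phi> r"
    and str_fin_gen: "fin_gen R (restrict_scalars \<phi> (regular A))"

definition connected_ring :: "'a ring \<Rightarrow> bool" where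
  "connected_ring A \<longleftrightarrow> carrier A \<noteq> {\<zero>\<^bsub>A\<^esub>} \<and>
     \<not> (\<exists>(S :: 'a ring) (S' :: 'a ring). ring S \<and> ring S' \<and>
           carrier S \<noteq> {\<zero>\<^bsub>S\<^esub>} \<and> carrier S' \<noteq> {\<zero>\<^bsub>S'\<^esub>} \<and> A \<simeq> RDirProd S S')"

definition simple_ring :: "'a ring \<Rightarrow> bool" where
  "simple_ring A \<longleftrightarrow> carrier A \<noteq> {\<zero>\<^bsub>A\<^esub>} \<and> (\<forall>I. ideal I A \<longrightarrow> I = {\<zero>\<^bsub>A\<^esub>} \<or> I = carrier A)"

definition idem :: "'a ring \<Rightarrow> 'a \<Rightarrow> bool" where
  "idem A e \<longleftrightarrow> e \<in> carrier A \<and> e \<otimes>\<^bsub>A\<^esub> e = e"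

definition primitive_idem :: "'a ring \<Rightarrow> 'a \<Rightarrow> bool" where
  "primitive_idem A e \<longleftrightarrow> idem A e \<and> e \<noteq> \<zero>\<^bsub>A\<^esub> \<and>
     (\<forall>f g. idem A f \<longrightarrow> idem A g \<longrightarrow> f \<otimes>\<^bsub>A\<^esub> g = \<zero>\<^bsub>A\<^esub> \<longrightarrow> g \<otimes>\<^bsub>A\<^esub> f = \<zero>\<^bsub>A\<^esub> \<longrightarrow> e = f \<oplus>\<^bsub>A\<^esub> g \<longrightarrow>
        f = \<zero>\<^bsub>A\<^esub> \<or> g = \<zero>\<^bsub>A\<^esub>)"

definition idem_module :: "'a ring \<Rightarrow> 'a \<Rightarrow> ('a, 'a) module" where
  "idem_module A e = (regular A)\<lparr>carrier := (\<lambda>a. e \<otimes>\<^bsub>A\<^esub> a) ` carrier A\<rparr>"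

text \<open>
  \<open>A\<^sub>A\<close> is a direct sum of pairwise non-isomorphic indecomposables \<open>eA\<close>, for a complete set of
  primitive orthogonal idempotents \<open>e\<close>.
\<close>

definition basic_ring :: "'a ring \<Rightarrow> bool" where
  "basic_ring A \<longleftrightarrow> (\<exists>S. finite S \<and> (\<forall>e\<in>S. primitive_idem A e) \<and>
     (\<forall>e\<in>S. \<forall>f\<in>S. e \<noteq> f \<longrightarrow> e \<otimes>\<^bsub>A\<^esub> f = \<zero>\<^bsub>A\<^esub> \<and> \<not> mod_iso A (idem_module A e) (idem_module A f)) \<and>
     (\<Oplus>\<^bsub>A\<^esub>e\<in>S. e) = \<one>\<^bsub>A\<^esub>)"


section \<open>Injective envelopes and the Nakayama functor\<close>

definition residue_module :: "'r ring \<Rightarrow> 'r set \<Rightarrow> ('r, 'r set) module" where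
  "residue_module R I = mk_module (carrier (R Quot I)) \<zero>\<^bsub>R Quot I\<^esub> (\<oplus>\<^bsub>R Quot I\<^esub>)
     (\<lambda>r C. (I +>\<^bsub>R\<^esub> r) \<otimes>\<^bsub>R Quot I\<^esub> C)"

text \<open>
  The test modules range over all \<open>R\<close>-modules in \<open>'r univ\<close>, finitely generated or not.  They
  include copies of all ideals of \<open>R\<close>, so by Baer's criterion this is injectivity among all modules.
\<close>

definition injective_module :: "'r ring \<Rightarrow> ('r, 'e) module \<Rightarrow> bool" where
  "injective_module R E \<longleftrightarrow> module R E \<and>
     (\<forall>(M :: ('r, 'r univ) module) (N :: ('r, 'r univ) module).
        module R M \<longrightarrow> module R N \<longrightarrow>
        (\<forall>i\<in>mod_hom R M N. \<forall>f\<in>mod_hom R M E. inj_on i (carrier M) \<longrightarrow>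
          (\<exists>g\<in>mod_hom R N E. \<forall>x\<in>carrier M. g (i x) = f x)))"

definition injective_envelope :: "'r ring \<Rightarrow> ('r, 'm) module \<Rightarrow> ('r, 'e) module \<Rightarrow> bool" where
  "injective_envelope R M E \<longleftrightarrow> injective_module R E \<and>
     (\<exists>i\<in>mod_hom R M E. inj_on i (carrier M) \<and>
        (\<forall>N. submodule N R E \<longrightarrow> N \<inter> i ` carrier M = {\<zero>\<^bsub>E\<^esub>} \<longrightarrow> N = {\<zero>\<^bsub>E\<^esub>}))"

text \<open>\<open>lsmult\<close> is a left action, commuting with the right action \<open>smult\<close>.\<close>

record ('a, 'm) bimodule = "('a, 'm) module" +
  lsmult :: "'a \<Rightarrow> 'm \<Rightarrow> 'm"

text \<open>\<open>DA = Hom\<^sub>R(A, E)\<close> with \<open>(f \<cdot> a)(x) = f(ax)\<close> and \<open>(a \<cdot> f)(x) = f(xa)\<close>.\<close>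

definition dual_bimodule ::
  "'r ring \<Rightarrow> 'a ring \<Rightarrow> ('r \<Rightarrow> 'a) \<Rightarrow> ('r, 'e) module \<Rightarrow> ('a, 'a \<Rightarrow> 'e) bimodule" where
  "dual_bimodule R A \<phi> E =
     \<lparr>carrier = mod_hom R (restrict_scalars \<phi> (regular A)) E,
      monoid.mult = (\<lambda>f g. undefined), one = undefined,
      ring.zero = (\<lambda>x\<in>carrier A. \<zero>\<^bsub>E\<^esub>), add = (\<lambda>f g. \<lambda>x\<in>carrier A. f x \<oplus>\<^bsub>E\<^esub> g x),
      smult = (\<lambda>a f. \<lambda>x\<in>carrier A. f (a \<otimes>\<^bsub>A\<^esub> x)),
      lsmult = (\<lambda>a f. \<lambda>x\<in>carrier A. f (x \<otimes>\<^bsub>A\<^esub> a))\<rparr>"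

text \<open>
  \<open>X \<otimes>\<^sub>A D\<close>: the free abelian group on the pairs \<open>(x, d)\<close> modulo the subgroup generated by
  biadditivity and \<open>xa \<otimes> d = x \<otimes> ad\<close>.
\<close>

definition tensor_free ::
  "('a, 'm) module \<Rightarrow> ('a, 'd) bimodule \<Rightarrow> (('m \<times> 'd) \<Rightarrow>\<^sub>0 int) monoid" where
  "tensor_free X D = free_Abelian_group (carrier X \<times> carrier D)"

definition tensor_rel ::
  "'a ring \<Rightarrow> ('a, 'm) module \<Rightarrow> ('a, 'd) bimodule \<Rightarrow> (('m \<times> 'd) \<Rightarrow>\<^sub>0 int) set" where
  "tensor_rel A X D = generate (tensor_free X D)
     ({frag_of (x \<oplus>\<^bsub>X\<^esub> y, d) - frag_of (x, d) - frag_of (y, d) |x y d.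
         x \<in> carrier X \<and> y \<in> carrier X \<and> d \<in> carrier D} \<union>
      {frag_of (x, d \<oplus>\<^bsub>D\<^esub> d') - frag_of (x, d) - frag_of (x, d') |x d d'.
         x \<in> carrier X \<and> d \<in> carrier D \<and> d' \<in> carrier D} \<union>
      {frag_of (a \<odot>\<^bsub>X\<^esub> x, d) - frag_of (x, lsmult D a d) |a x d.
         a \<in> carrier A \<and> x \<in> carrier X \<and> d \<in> carrier D})"

definition tensor_class ::
  "'a ring \<Rightarrow> ('a, 'm) module \<Rightarrow> ('a, 'd) bimodule \<Rightarrow> (('m \<times> 'd) \<Rightarrow>\<^sub>0 int) \<Rightarrow> (('m \<times> 'd) \<Rightarrow>\<^sub>0 int) set" where
  "tensor_class A X D u = tensor_rel A X D #>\<^bsub>tensor_free X D\<^esub> u"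

text \<open>Operations on cosets are unions over representatives, as in the library's \<open>rcoset_mult\<close>.\<close>

definition tensor ::
  "'a ring \<Rightarrow> ('a, 'm) module \<Rightarrow> ('a, 'd) bimodule \<Rightarrow> ('a, (('m \<times> 'd) \<Rightarrow>\<^sub>0 int) set) module" where
  "tensor A X D = (let Q = tensor_free X D Mod tensor_rel A X D in
     mk_module (carrier Q) \<one>\<^bsub>Q\<^esub> (\<otimes>\<^bsub>Q\<^esub>)
       (\<lambda>a C. \<Union>u\<in>C. tensor_class A X D (frag_extend (\<lambda>(x, d). frag_of (x, a \<odot>\<^bsub>D\<^esub> d)) u)))"

definition tensor_map ::
  "'a ring \<Rightarrow> ('a, 'm) module \<Rightarrow> ('a, 'n) module \<Rightarrow> ('a, 'd) bimodule \<Rightarrow> ('m \<Rightarrow> 'n) \<Rightarrow>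
   (('m \<times> 'd) \<Rightarrow>\<^sub>0 int) set \<Rightarrow> (('n \<times> 'd) \<Rightarrow>\<^sub>0 int) set" where
  "tensor_map A X Y D f = (\<lambda>C\<in>carrier (tensor A X D).
     \<Union>u\<in>C. tensor_class A Y D (frag_extend (\<lambda>(x, d). frag_of (f x, d)) u))"


section \<open>Complexes and the homotopy category\<close>

record ('a, 'm) cochain =
  obj :: "int \<Rightarrow> ('a, 'm) module"
  dif :: "int \<Rightarrow> 'm \<Rightarrow> 'm"

definition is_complex :: "'a ring \<Rightarrow> ('a, 'm) cochain \<Rightarrow> bool" where
  "is_complex A X \<longleftrightarrow> (\<forall>i. fg_module A (obj X i) \<and> dif X i \<in> mod_hom A (obj X i) (obj X (i + 1)) \<and>
     (\<forall>x\<in>carrier (obj X i). dif X (i + 1) (dif X i x) = \<zero>\<^bsub>obj X (i + 2)\<^esub>))"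

definition Kb_proj :: "'a ring \<Rightarrow> ('a, 'm) cochain \<Rightarrow> bool" where
  "Kb_proj A X \<longleftrightarrow> is_complex A X \<and> (\<forall>i. projective A (obj X i)) \<and>
     (\<exists>n. \<forall>i. \<bar>i\<bar> > n \<longrightarrow> zero_module (obj X i))"

definition chain_maps ::
  "'a ring \<Rightarrow> ('a, 'm) cochain \<Rightarrow> ('a, 'n) cochain \<Rightarrow> (int \<Rightarrow> 'm \<Rightarrow> 'n) set" where
  "chain_maps A X Y = {f. \<forall>i. f i \<in> mod_hom A (obj X i) (obj Y i) \<and>
     (\<forall>x\<in>carrier (obj X i). f (i + 1) (dif X i x) = dif Y i (f i x))}"

definition ch_id :: "('a, 'm) cochain \<Rightarrow> int \<Rightarrow> 'm \<Rightarrow> 'm" where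
  "ch_id X i = (\<lambda>x\<in>carrier (obj X i). x)"

definition ch_zero :: "('a, 'm) cochain \<Rightarrow> ('a, 'n) cochain \<Rightarrow> int \<Rightarrow> 'm \<Rightarrow> 'n" where
  "ch_zero X Y i = (\<lambda>x\<in>carrier (obj X i). \<zero>\<^bsub>obj Y i\<^esub>)"

definition ch_add ::
  "('a, 'm) cochain \<Rightarrow> ('a, 'n) cochain \<Rightarrow> (int \<Rightarrow> 'm \<Rightarrow> 'n) \<Rightarrow> (int \<Rightarrow> 'm \<Rightarrow> 'n) \<Rightarrow> int \<Rightarrow> 'm \<Rightarrow> 'n" where
  "ch_add X Y f g i = (\<lambda>x\<in>carrier (obj X i). f i x \<oplus>\<^bsub>obj Y i\<^esub> g i x)"

definition ch_comp ::
  "('a, 'm) cochain \<Rightarrow> (int \<Rightarrow> 'n \<Rightarrow> 'o) \<Rightarrow> (int \<Rightarrow> 'm \<Rightarrow> 'n) \<Rightarrow> int \<Rightarrow> 'm \<Rightarrow> 'o" where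
  "ch_comp X g f i = compose (carrier (obj X i)) (g i) (f i)"

definition homotopic ::
  "'a ring \<Rightarrow> ('a, 'm) cochain \<Rightarrow> ('a, 'n) cochain \<Rightarrow> ((int \<Rightarrow> 'm \<Rightarrow> 'n) \<times> (int \<Rightarrow> 'm \<Rightarrow> 'n)) set" where
  "homotopic A X Y = {(f, g). f \<in> chain_maps A X Y \<and> g \<in> chain_maps A X Y \<and>
     (\<exists>s. \<forall>i. s i \<in> mod_hom A (obj X i) (obj Y (i - 1)) \<and>
        (\<forall>x\<in>carrier (obj X i).
           f i x = g i x \<oplus>\<^bsub>obj Y i\<^esub> (dif Y (i - 1) (s i x) \<oplus>\<^bsub>obj Y i\<^esub> s (i + 1) (dif X i x))))}"

definition khom ::
  "'a ring \<Rightarrow> ('a, 'm) cochain \<Rightarrow> ('a, 'n) cochain \<Rightarrow> (int \<Rightarrow> 'm \<Rightarrow> 'n) set set" where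
  "khom A X Y = chain_maps A X Y // homotopic A X Y"

definition k_class ::
  "'a ring \<Rightarrow> ('a, 'm) cochain \<Rightarrow> ('a, 'n) cochain \<Rightarrow> (int \<Rightarrow> 'm \<Rightarrow> 'n) \<Rightarrow> (int \<Rightarrow> 'm \<Rightarrow> 'n) set" where
  "k_class A X Y f = homotopic A X Y `` {f}"

definition k_id :: "'a ring \<Rightarrow> ('a, 'm) cochain \<Rightarrow> (int \<Rightarrow> 'm \<Rightarrow> 'm) set" where
  "k_id A X = k_class A X X (ch_id X)"

definition k_zero ::
  "'a ring \<Rightarrow> ('a, 'm) cochain \<Rightarrow> ('a, 'n) cochain \<Rightarrow> (int \<Rightarrow> 'm \<Rightarrow> 'n) set" where
  "k_zero A X Y = k_class A X Y (ch_zero X Y)"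

definition k_add ::
  "'a ring \<Rightarrow> ('a, 'm) cochain \<Rightarrow> ('a, 'n) cochain \<Rightarrow>
   (int \<Rightarrow> 'm \<Rightarrow> 'n) set \<Rightarrow> (int \<Rightarrow> 'm \<Rightarrow> 'n) set \<Rightarrow> (int \<Rightarrow> 'm \<Rightarrow> 'n) set" where
  "k_add A X Y F G = (\<Union>f\<in>F. \<Union>g\<in>G. k_class A X Y (ch_add X Y f g))"

text \<open>The composite \<open>G \<circ> F\<close> of \<open>F : X \<rightarrow> Y\<close> and \<open>G : Y \<rightarrow> Z\<close>.\<close>

definition k_comp ::
  "'a ring \<Rightarrow> ('a, 'm) cochain \<Rightarrow> ('a, 'o) cochain \<Rightarrow>
   (int \<Rightarrow> 'n \<Rightarrow> 'o) set \<Rightarrow> (int \<Rightarrow> 'm \<Rightarrow> 'n) set \<Rightarrow> (int \<Rightarrow> 'm \<Rightarrow> 'o) set" where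
  "k_comp A X Z G F = (\<Union>g\<in>G. \<Union>f\<in>F. k_class A X Z (ch_comp X g f))"

definition k_iso :: "'a ring \<Rightarrow> ('a, 'm) cochain \<Rightarrow> ('a, 'n) cochain \<Rightarrow> bool" where
  "k_iso A X Y \<longleftrightarrow> (\<exists>F\<in>khom A X Y. \<exists>G\<in>khom A Y X.
     k_comp A X X G F = k_id A X \<and> k_comp A Y Y F G = k_id A Y)"

text \<open>\<open>shift n X = X[n]\<close>\<close>

definition shift :: "int \<Rightarrow> ('a, 'm) cochain \<Rightarrow> ('a, 'm) cochain" where
  "shift n X = \<lparr>obj = (\<lambda>i. obj X (i + n)),
     dif = (\<lambda>i. if even n then dif X (i + n)
                else (\<lambda>x\<in>carrier (obj X (i + n)). \<ominus>\<^bsub>obj X (i + n + 1)\<^esub> dif X (i + n) x))\<rparr>"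

definition k_shift ::
  "'a ring \<Rightarrow> int \<Rightarrow> ('a, 'm) cochain \<Rightarrow> ('a, 'n) cochain \<Rightarrow>
   (int \<Rightarrow> 'm \<Rightarrow> 'n) set \<Rightarrow> (int \<Rightarrow> 'm \<Rightarrow> 'n) set" where
  "k_shift A n X Y F = (\<Union>f\<in>F. k_class A (shift n X) (shift n Y) (\<lambda>i. f (i + n)))"

definition dsum :: "('a, 'm) module \<Rightarrow> ('a, 'n) module \<Rightarrow> ('a, 'm \<times> 'n) module" where
  "dsum M N = mk_module (carrier M \<times> carrier N) (\<zero>\<^bsub>M\<^esub>, \<zero>\<^bsub>N\<^esub>)
     (\<lambda>(x, y) (x', y'). (x \<oplus>\<^bsub>M\<^esub> x', y \<oplus>\<^bsub>N\<^esub> y')) (\<lambda>a (x, y). (a \<odot>\<^bsub>M\<^esub> x, a \<odot>\<^bsub>N\<^esub> y))"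

definition dpower :: "nat \<Rightarrow> ('a, 'm) module \<Rightarrow> ('a, nat \<Rightarrow> 'm) module" where
  "dpower n M = mk_module ({..<n} \<rightarrow>\<^sub>E carrier M) (\<lambda>k\<in>{..<n}. \<zero>\<^bsub>M\<^esub>)
     (\<lambda>x y. \<lambda>k\<in>{..<n}. x k \<oplus>\<^bsub>M\<^esub> y k) (\<lambda>a x. \<lambda>k\<in>{..<n}. a \<odot>\<^bsub>M\<^esub> x k)"

definition ch_dsum :: "('a, 'm) cochain \<Rightarrow> ('a, 'n) cochain \<Rightarrow> ('a, 'm \<times> 'n) cochain" where
  "ch_dsum X Y = \<lparr>obj = (\<lambda>i. dsum (obj X i) (obj Y i)),
     dif = (\<lambda>i. \<lambda>(x, y)\<in>carrier (dsum (obj X i) (obj Y i)). (dif X i x, dif Y i y))\<rparr>"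

definition ch_dpower :: "nat \<Rightarrow> ('a, 'm) cochain \<Rightarrow> ('a, nat \<Rightarrow> 'm) cochain" where
  "ch_dpower n X = \<lparr>obj = (\<lambda>i. dpower n (obj X i)),
     dif = (\<lambda>i. \<lambda>x\<in>carrier (dpower n (obj X i)). \<lambda>k\<in>{..<n}. dif X i (x k))\<rparr>"

definition cone ::
  "('a, 'm) cochain \<Rightarrow> ('a, 'n) cochain \<Rightarrow> (int \<Rightarrow> 'm \<Rightarrow> 'n) \<Rightarrow> ('a, 'm \<times> 'n) cochain" where
  "cone X Y f = \<lparr>obj = (\<lambda>i. dsum (obj X (i + 1)) (obj Y i)),
     dif = (\<lambda>i. \<lambda>(x, y)\<in>carrier (dsum (obj X (i + 1)) (obj Y i)).
              (\<ominus>\<^bsub>obj X (i + 2)\<^esub> dif X (i + 1) x, f (i + 1) x \<oplus>\<^bsub>obj Y (i + 1)\<^esub> dif Y i y))\<rparr>"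

text \<open>\<open>stalk M\<close> is \<open>M\<close> concentrated in degree 0.\<close>

definition stalk :: "('a, 'm) module \<Rightarrow> ('a, 'm) cochain" where
  "stalk M = (let ob = (\<lambda>i. if i = 0 then M else M\<lparr>carrier := {\<zero>\<^bsub>M\<^esub>}\<rparr>) in
     \<lparr>obj = ob, dif = (\<lambda>i. \<lambda>x\<in>carrier (ob i). \<zero>\<^bsub>M\<^esub>)\<rparr>)"

definition cohomology :: "('a, 'm) cochain \<Rightarrow> int \<Rightarrow> ('a, 'm set) module" where
  "cohomology X i = (let M = obj X i; Z = {x \<in> carrier M. dif X i x = \<zero>\<^bsub>obj X (i + 1)\<^esub>};
       Bd = dif X (i - 1) ` carrier (obj X (i - 1)) in
     mk_module ((\<lambda>x. Bd +>\<^bsub>M\<^esub> x) ` Z) Bd (\<lambda>C C'. C <+>\<^bsub>M\<^esub> C')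
       (\<lambda>a C. \<Union>x\<in>C. Bd +>\<^bsub>M\<^esub> (a \<odot>\<^bsub>M\<^esub> x)))"


section \<open>Tilting complexes\<close>

definition two_term :: "('a, 'm) cochain \<Rightarrow> bool" where
  "two_term T \<longleftrightarrow> (\<forall>i. i \<notin> {-1, 0} \<longrightarrow> zero_module (obj T i))"

definition in_add :: "'a ring \<Rightarrow> ('a, 'm) cochain \<Rightarrow> ('a, 'a univ) cochain \<Rightarrow> bool" where
  "in_add A T X \<longleftrightarrow> Kb_proj A X \<and>
     (\<exists>(Y :: ('a, 'a univ) cochain) n. Kb_proj A Y \<and> k_iso A (ch_dsum X Y) (ch_dpower n T))"

text \<open>
  The smallest full triangulated subcategory, closed under isomorphism, that contains
  \<open>add(T)\<close>.  Each complex over the projectives in mod-\<open>A\<close> has an isomorphic copy in the universe.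
\<close>

inductive generated :: "'a ring \<Rightarrow> ('a, 'm) cochain \<Rightarrow> ('a, 'a univ) cochain \<Rightarrow> bool"
  for A T where
  gen_add: "in_add A T X \<Longrightarrow> generated A T X"
| gen_shift: "generated A T X \<Longrightarrow> generated A T (shift n X)"
| gen_iso: "generated A T X \<Longrightarrow> Kb_proj A Y \<Longrightarrow> k_iso A X Y \<Longrightarrow> generated A T Y"
| gen_cone: "generated A T X \<Longrightarrow> generated A T Y \<Longrightarrow> f \<in> chain_maps A X Y \<Longrightarrow>
     Kb_proj A Z \<Longrightarrow> k_iso A Z (cone X Y f) \<Longrightarrow> generated A T Z"

definition tilting_complex :: "'a ring \<Rightarrow> ('a, 'm) cochain \<Rightarrow> bool" where
  "tilting_complex A T \<longleftrightarrow> Kb_proj A T \<and>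
     (\<forall>i. i \<noteq> 0 \<longrightarrow> khom A T (shift i T) = {k_zero A T (shift i T)}) \<and>
     (\<forall>X. Kb_proj A X \<longrightarrow> generated A T X)"

definition k_end :: "'a ring \<Rightarrow> ('a, 'm) cochain \<Rightarrow> (int \<Rightarrow> 'm \<Rightarrow> 'm) set ring" where
  "k_end A T = \<lparr>carrier = khom A T T, monoid.mult = k_comp A T T, one = k_id A T,
     ring.zero = k_zero A T T, add = k_add A T T\<rparr>"

definition k_end_str ::
  "'a ring \<Rightarrow> ('a, 'm) cochain \<Rightarrow> ('r \<Rightarrow> 'a) \<Rightarrow> 'r \<Rightarrow> (int \<Rightarrow> 'm \<Rightarrow> 'm) set" where
  "k_end_str A T \<phi> r = k_class A T T (\<lambda>i. \<lambda>x\<in>carrier (obj T i). \<phi> r \<odot>\<^bsub>obj T i\<^esub> x)"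

text \<open>
  \<open>Hom(A, X)\<close> in the homotopy category as a right module: \<open>a\<close> acts by precomposition with the
  endomorphism \<open>x \<mapsto> ax\<close> of \<open>A\<^sub>A\<close>.
\<close>

definition lmult :: "'a ring \<Rightarrow> 'a \<Rightarrow> int \<Rightarrow> 'a \<Rightarrow> 'a" where
  "lmult A a i = (\<lambda>x\<in>carrier (obj (stalk (regular A)) i). a \<otimes>\<^bsub>A\<^esub> x)"

definition khom_module ::
  "'a ring \<Rightarrow> ('a, 'm) cochain \<Rightarrow> ('a, (int \<Rightarrow> 'a \<Rightarrow> 'm) set) module" where
  "khom_module A X = (let S = stalk (regular A) in
     mk_module (khom A S X) (k_zero A S X) (k_add A S X)
       (\<lambda>a F. k_comp A S X F (k_class A S S (lmult A a))))"

definition nakayama ::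
  "'r ring \<Rightarrow> 'a ring \<Rightarrow> ('r \<Rightarrow> 'a) \<Rightarrow> ('r, 'e) module \<Rightarrow> ('a, 'm) cochain \<Rightarrow>
   ('a, (('m \<times> ('a \<Rightarrow> 'e)) \<Rightarrow>\<^sub>0 int) set) cochain" where
  "nakayama R A \<phi> E X = (let D = dual_bimodule R A \<phi> E in
     \<lparr>obj = (\<lambda>i. tensor A (obj X i) D), dif = (\<lambda>i. tensor_map A (obj X i) (obj X (i + 1)) D (dif X i))\<rparr>)"

definition k_nakayama ::
  "'r ring \<Rightarrow> 'a ring \<Rightarrow> ('r \<Rightarrow> 'a) \<Rightarrow> ('r, 'e) module \<Rightarrow> ('a, 'm) cochain \<Rightarrow> ('a, 'n) cochain \<Rightarrow>
   (int \<Rightarrow> 'm \<Rightarrow> 'n) set \<Rightarrow>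
   (int \<Rightarrow> (('m \<times> ('a \<Rightarrow> 'e)) \<Rightarrow>\<^sub>0 int) set \<Rightarrow> (('n \<times> ('a \<Rightarrow> 'e)) \<Rightarrow>\<^sub>0 int) set) set" where
  "k_nakayama R A \<phi> E X Y F = (\<Union>f\<in>F. k_class A (nakayama R A \<phi> E X) (nakayama R A \<phi> E Y)
     (\<lambda>i. tensor_map A (obj X i) (obj Y i) (dual_bimodule R A \<phi> E) (f i)))"

text \<open>
  The left actions of \<open>B = End(T)\<close>: by postcomposition on \<open>Hom(A, T)\<close>, and through
  \<open>B \<cong> End(\<nu>T)\<close> and the shift on \<open>Hom(A, \<nu>T[-1])\<close>.
\<close>

definition act_T ::
  "'a ring \<Rightarrow> ('a, 'm) cochain \<Rightarrow> (int \<Rightarrow> 'm \<Rightarrow> 'm) set \<Rightarrow>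
   (int \<Rightarrow> 'a \<Rightarrow> 'm) set \<Rightarrow> (int \<Rightarrow> 'a \<Rightarrow> 'm) set" where
  "act_T A T b F = k_comp A (stalk (regular A)) T b F"

definition act_nuT ::
  "'r ring \<Rightarrow> 'a ring \<Rightarrow> ('r \<Rightarrow> 'a) \<Rightarrow> ('r, 'e) module \<Rightarrow> ('a, 'm) cochain \<Rightarrow>
   (int \<Rightarrow> 'm \<Rightarrow> 'm) set \<Rightarrow> (int \<Rightarrow> 'a \<Rightarrow> (('m \<times> ('a \<Rightarrow> 'e)) \<Rightarrow>\<^sub>0 int) set) set \<Rightarrow>
   (int \<Rightarrow> 'a \<Rightarrow> (('m \<times> ('a \<Rightarrow> 'e)) \<Rightarrow>\<^sub>0 int) set) set" where
  "act_nuT R A \<phi> E T b F = (let nuT = nakayama R A \<phi> E T in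
     k_comp A (stalk (regular A)) (shift (-1) nuT) (k_shift A (-1) nuT nuT (k_nakayama R A \<phi> E T T b)) F)"

end

theory Submission
  imports "HOL-Algebra.Ring_Divisibility" Defs
begin

text \<open>
  In both parts \<open>B\<close> acts on a right \<open>A\<close>-module \<open>H\<close>, and the ideal divided out is the kernel of this
  action; so the point is that every endomorphism of \<open>H\<close> is induced by one of \<open>T\<close>.  Write
  \<open>\<alpha> : P \<rightarrow> Q\<close> for the differential of \<open>T\<close>.

  For \<open>H = Cok \<alpha>\<close>, lift an endomorphism along \<open>Q \<rightarrow> Cok \<alpha>\<close> and then along \<open>\<alpha>\<close>; projectivity of the
  two terms suffices.

  For \<open>H = K = Ker \<nu>(\<alpha>)\<close>, the pairing \<open>\<langle>\<xi>, x \<otimes> d\<rangle> = d(\<xi> x)\<close> identifies \<open>P \<otimes> DA\<close> with the \<open>R\<close>-dual of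
  \<open>P* = Hom(P, A)\<close>, and \<open>K\<close> with the annihilator of the image of \<open>\<alpha>* : Q* \<rightarrow> P*\<close>.  By Matlis duality
  every \<open>R\<close>-linear functional on \<open>K\<close> is some \<open>\<langle>\<eta>, -\<rangle>\<close>, and every element of \<open>P*\<close> orthogonal to \<open>K\<close>
  lies in the image of \<open>\<alpha>*\<close>.  Given \<open>\<gamma> : K \<rightarrow> K\<close> and a dual basis \<open>(p, \<xi>\<^sub>p)\<close> of \<open>P\<close>, choose
  \<open>\<eta>\<^sub>p\<close> with \<open>\<langle>\<xi>\<^sub>p, \<gamma> u\<rangle> = \<langle>\<eta>\<^sub>p, u\<rangle>\<close> on \<open>K\<close>.  Then \<open>f x = \<Sum> p \<cdot> \<eta>\<^sub>p(x)\<close> induces \<open>\<gamma>\<close>; for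
  \<open>\<zeta>\<close> in \<open>Q*\<close> the map \<open>\<zeta> \<circ> \<alpha> \<circ> f\<close> is orthogonal to \<open>K\<close>, hence of the form \<open>\<omega> \<circ> \<alpha>\<close>, and a dual
  basis of \<open>Q\<close> turns this into a partner of \<open>f\<close> on \<open>Q\<close>.
\<close>

section \<open>Modules and linear maps\<close>

text \<open>Everything is computed on elements: a class in Hom(A, X) is a cocycle of degree 0 modulo
  coboundaries. For Cok \<alpha> a map between such classes still has to be lifted through a
  quotient. For \<nu>T[-1] the coboundaries vanish, since T has no term in degree -2, so an
  endomorphism is a map on K itself.

  The obstacle is double duality: M = Hom(P, A) has to reach every functional on Hom(M/N, E), for N
  the image of the dual of \<alpha>. The usual argument counts lengths. Here the minimum condition
  on ideals takes the place of length: a functional that is an evaluation on a small space of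
  functionals is corrected across one simple quotient at a time, and these quotients come from
  hyperplanes in ideals.

  The \<eta> attached to the dual basis elements are chosen independently of each other. That they
  still assemble to a map inducing \<gamma> is due to the A-linearity of \<gamma>: a coefficient in
  A can be moved from the functional to the argument and through \<gamma>, so agreement against the
  dual basis spreads to all of Hom(P, A).\<close>

lemma mk_module_simps [simp]:
  "carrier (mk_module C z p s) = C" "\<zero>\<^bsub>mk_module C z p s\<^esub> = z"
  "x \<oplus>\<^bsub>mk_module C z p s\<^esub> y = p x y" "a \<odot>\<^bsub>mk_module C z p s\<^esub> x = s a x"
  by (simp_all add: mk_module_def)

lemma right_moduleI:
  assumes "ring A" "abelian_group M"
    and "\<And>a x. \<lbrakk>a \<in> carrier A; x \<in> carrier M\<rbrakk> \<Longrightarrow> a \<odot>\<^bsub>M\<^esub> x \<in> carrier M"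
    and "\<And>a b x. \<lbrakk>a \<in> carrier A; b \<in> carrier A; x \<in> carrier M\<rbrakk> \<Longrightarrow>
       (a \<oplus>\<^bsub>A\<^esub> b) \<odot>\<^bsub>M\<^esub> x = a \<odot>\<^bsub>M\<^esub> x \<oplus>\<^bsub>M\<^esub> b \<odot>\<^bsub>M\<^esub> x"
    and "\<And>a x y. \<lbrakk>a \<in> carrier A; x \<in> carrier M; y \<in> carrier M\<rbrakk> \<Longrightarrow>
       a \<odot>\<^bsub>M\<^esub> (x \<oplus>\<^bsub>M\<^esub> y) = a \<odot>\<^bsub>M\<^esub> x \<oplus>\<^bsub>M\<^esub> a \<odot>\<^bsub>M\<^esub> y"
    and "\<And>a b x. \<lbrakk>a \<in> carrier A; b \<in> carrier A; x \<in> carrier M\<rbrakk> \<Longrightarrow>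
       (a \<otimes>\<^bsub>A\<^esub> b) \<odot>\<^bsub>M\<^esub> x = b \<odot>\<^bsub>M\<^esub> (a \<odot>\<^bsub>M\<^esub> x)"
    and "\<And>x. x \<in> carrier M \<Longrightarrow> \<one>\<^bsub>A\<^esub> \<odot>\<^bsub>M\<^esub> x = x"
  shows "right_module A M"
  using assms by (intro right_module.intro right_module_axioms.intro) auto

context right_module
begin

lemma smult_r_null [simp]:
  assumes "a \<in> carrier R" shows "a \<odot>\<^bsub>M\<^esub> \<zero>\<^bsub>M\<^esub> = \<zero>\<^bsub>M\<^esub>"
proof -
  have "a \<odot>\<^bsub>M\<^esub> \<zero>\<^bsub>M\<^esub> \<oplus>\<^bsub>M\<^esub> a \<odot>\<^bsub>M\<^esub> \<zero>\<^bsub>M\<^esub> = a \<odot>\<^bsub>M\<^esub> \<zero>\<^bsub>M\<^esub>"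
    using assms smult_r_distr[of a "\<zero>\<^bsub>M\<^esub>" "\<zero>\<^bsub>M\<^esub>"] by simp
  then show ?thesis using assms by (metis M.add.r_cancel_one M.zero_closed smult_closed)
qed

lemma smult_l_null [simp]:
  assumes "x \<in> carrier M" shows "\<zero>\<^bsub>R\<^esub> \<odot>\<^bsub>M\<^esub> x = \<zero>\<^bsub>M\<^esub>"
proof -
  have "\<zero>\<^bsub>R\<^esub> \<odot>\<^bsub>M\<^esub> x \<oplus>\<^bsub>M\<^esub> \<zero>\<^bsub>R\<^esub> \<odot>\<^bsub>M\<^esub> x = \<zero>\<^bsub>R\<^esub> \<odot>\<^bsub>M\<^esub> x"
    using assms smult_l_distr[of "\<zero>\<^bsub>R\<^esub>" "\<zero>\<^bsub>R\<^esub>" x] by simp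
  then show ?thesis using assms by (metis M.add.r_cancel_one R.zero_closed smult_closed)
qed

lemma smult_r_minus:
  assumes "a \<in> carrier R" "x \<in> carrier M"
  shows "a \<odot>\<^bsub>M\<^esub> (\<ominus>\<^bsub>M\<^esub> x) = \<ominus>\<^bsub>M\<^esub> (a \<odot>\<^bsub>M\<^esub> x)"
proof -
  have "a \<odot>\<^bsub>M\<^esub> (\<ominus>\<^bsub>M\<^esub> x) \<oplus>\<^bsub>M\<^esub> a \<odot>\<^bsub>M\<^esub> x = \<zero>\<^bsub>M\<^esub>"
    using assms smult_r_distr[of a "\<ominus>\<^bsub>M\<^esub> x" x] by (simp add: M.l_neg)
  then show ?thesis using assms by (simp add: M.minus_equality)
qed

lemma smult_l_minus:
  assumes "a \<in> carrier R" "x \<in> carrier M"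
  shows "(\<ominus>\<^bsub>R\<^esub> a) \<odot>\<^bsub>M\<^esub> x = \<ominus>\<^bsub>M\<^esub> (a \<odot>\<^bsub>M\<^esub> x)"
proof -
  have "(\<ominus>\<^bsub>R\<^esub> a) \<odot>\<^bsub>M\<^esub> x \<oplus>\<^bsub>M\<^esub> a \<odot>\<^bsub>M\<^esub> x = \<zero>\<^bsub>M\<^esub>"
    using assms smult_l_distr[of "\<ominus>\<^bsub>R\<^esub> a" a x] by (simp add: R.l_neg)
  then show ?thesis using assms by (simp add: M.minus_equality)
qed

end

lemma mod_homI:
  assumes "f \<in> extensional (carrier M)" "\<And>x. x \<in> carrier M \<Longrightarrow> f x \<in> carrier N"
    and "\<And>x y. \<lbrakk>x \<in> carrier M; y \<in> carrier M\<rbrakk> \<Longrightarrow> f (x \<oplus>\<^bsub>M\<^esub> y) = f x \<oplus>\<^bsub>N\<^esub> f y"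
    and "\<And>a x. \<lbrakk>a \<in> carrier A; x \<in> carrier M\<rbrakk> \<Longrightarrow> f (a \<odot>\<^bsub>M\<^esub> x) = a \<odot>\<^bsub>N\<^esub> f x"
  shows "f \<in> mod_hom A M N"
  using assms by (auto simp: mod_hom_def PiE_def)

lemma mod_hom_closed: "\<lbrakk>f \<in> mod_hom A M N; x \<in> carrier M\<rbrakk> \<Longrightarrow> f x \<in> carrier N"
  by (auto simp: mod_hom_def)

lemma mod_hom_add:
  "\<lbrakk>f \<in> mod_hom A M N; x \<in> carrier M; y \<in> carrier M\<rbrakk> \<Longrightarrow> f (x \<oplus>\<^bsub>M\<^esub> y) = f x \<oplus>\<^bsub>N\<^esub> f y"
  by (auto simp: mod_hom_def)

lemma mod_hom_smult:
  "\<lbrakk>f \<in> mod_hom A M N; a \<in> carrier A; x \<in> carrier M\<rbrakk> \<Longrightarrow> f (a \<odot>\<^bsub>M\<^esub> x) = a \<odot>\<^bsub>N\<^esub> f x"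
  by (auto simp: mod_hom_def)

lemma mod_hom_extensional: "f \<in> mod_hom A M N \<Longrightarrow> f \<in> extensional (carrier M)"
  by (auto simp: mod_hom_def PiE_def)

lemma mod_hom_eqI:
  assumes "f \<in> mod_hom A M N" "g \<in> mod_hom A M N'" "\<And>x. x \<in> carrier M \<Longrightarrow> f x = g x"
  shows "f = g"
  using assms by (intro extensionalityI[OF mod_hom_extensional mod_hom_extensional]) auto

lemma mod_hom_zero:
  assumes f: "f \<in> mod_hom A M N" and M: "abelian_group M" and N: "abelian_group N"
  shows "f \<zero>\<^bsub>M\<^esub> = \<zero>\<^bsub>N\<^esub>"
proof -
  interpret M: abelian_group M by fact
  interpret N: abelian_group N by fact
  have "f \<zero>\<^bsub>M\<^esub> \<oplus>\<^bsub>N\<^esub> f \<zero>\<^bsub>M\<^esub> = f \<zero>\<^bsub>M\<^esub>"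
    using mod_hom_add[OF f M.zero_closed M.zero_closed] by simp
  then show ?thesis using mod_hom_closed[OF f M.zero_closed] by simp
qed

lemma mod_hom_minus:
  assumes f: "f \<in> mod_hom A M N" and M: "abelian_group M" and N: "abelian_group N"
    and x: "x \<in> carrier M"
  shows "f (\<ominus>\<^bsub>M\<^esub> x) = \<ominus>\<^bsub>N\<^esub> f x"
proof -
  interpret M: abelian_group M by fact
  interpret N: abelian_group N by fact
  have "f (\<ominus>\<^bsub>M\<^esub> x) \<oplus>\<^bsub>N\<^esub> f x = \<zero>\<^bsub>N\<^esub>"
    using mod_hom_add[OF f, of "\<ominus>\<^bsub>M\<^esub> x" x] mod_hom_zero[OF f M N] x by (simp add: M.l_neg)
  then show ?thesis using mod_hom_closed[OF f] x by (simp add: N.minus_equality)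
qed

lemma mod_hom_finsum:
  assumes f: "f \<in> mod_hom A M N" and M: "abelian_group M" and N: "abelian_group N"
    and "finite I" "x \<in> I \<rightarrow> carrier M"
  shows "f (\<Oplus>\<^bsub>M\<^esub>i\<in>I. x i) = (\<Oplus>\<^bsub>N\<^esub>i\<in>I. f (x i))"
proof -
  interpret M: abelian_group M by fact
  interpret N: abelian_group N by fact
  show ?thesis
    using assms(4,5)
  proof (induction I)
    case empty
    then show ?case by (simp add: mod_hom_zero[OF f M N])
  next
    case (insert i I)
    then have "(\<lambda>i. f (x i)) \<in> I \<rightarrow> carrier N" "f (x i) \<in> carrier N"
      by (auto intro: mod_hom_closed[OF f])
    with insert show ?case by (simp add: mod_hom_add[OF f])
  qed
qed

lemma mod_hom_compose:
  assumes f: "f \<in> mod_hom A M N" and g: "g \<in> mod_hom A N P" and "right_module A M"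
  shows "compose (carrier M) g f \<in> mod_hom A M P"
proof -
  interpret M: right_module A M by fact
  show ?thesis
    by (rule mod_homI)
      (auto simp: compose_def mod_hom_add[OF f] mod_hom_add[OF g] mod_hom_closed[OF f]
        mod_hom_closed[OF g] mod_hom_smult[OF f] mod_hom_smult[OF g])
qed

lemma (in right_module) mod_hom_id: "(\<lambda>x\<in>carrier M. x) \<in> mod_hom R M M"
  by (rule mod_homI) auto

lemma mod_hom_zero_map:
  assumes "right_module A M" "right_module A N"
  shows "(\<lambda>x\<in>carrier M. \<zero>\<^bsub>N\<^esub>) \<in> mod_hom A M N"
proof -
  interpret M: right_module A M by fact
  interpret N: right_module A N by fact
  show ?thesis by (rule mod_homI) auto
qed

lemma mod_hom_plus:
  assumes f: "f \<in> mod_hom A M N" and g: "g \<in> mod_hom A M N"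
    and "right_module A M" "right_module A N"
  shows "(\<lambda>x\<in>carrier M. f x \<oplus>\<^bsub>N\<^esub> g x) \<in> mod_hom A M N"
proof -
  interpret M: right_module A M by fact
  interpret N: right_module A N by fact
  show ?thesis
    by (rule mod_homI)
      (auto simp: mod_hom_add[OF f] mod_hom_add[OF g] mod_hom_closed[OF f] mod_hom_closed[OF g]
        mod_hom_smult[OF f] mod_hom_smult[OF g] N.smult_r_distr N.M.a_ac)
qed

lemma mod_hom_uminus:
  assumes f: "f \<in> mod_hom A M N" and "right_module A M" "right_module A N"
  shows "(\<lambda>x\<in>carrier M. \<ominus>\<^bsub>N\<^esub> f x) \<in> mod_hom A M N"
proof -
  interpret M: right_module A M by fact
  interpret N: right_module A N by fact
  show ?thesis
    by (rule mod_homI)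
      (auto simp: mod_hom_add[OF f] mod_hom_closed[OF f] mod_hom_smult[OF f] N.smult_r_minus
        N.M.minus_add)
qed

lemma mod_hom_inv:
  assumes f: "f \<in> mod_hom A M N" and bij: "bij_betw f (carrier M) (carrier N)"
    and "right_module A M" "right_module A N"
  shows "(\<lambda>y\<in>carrier N. inv_into (carrier M) f y) \<in> mod_hom A N M"
proof -
  interpret M: right_module A M by fact
  interpret N: right_module A N by fact
  have inj: "inj_on f (carrier M)" and im: "f ` carrier M = carrier N"
    using bij by (auto simp: bij_betw_def)
  have c: "inv_into (carrier M) f y \<in> carrier M" "f (inv_into (carrier M) f y) = y"
    if "y \<in> carrier N" for y
    using that im by (auto intro: inv_into_into f_inv_into_f)
  show ?thesis
    by (rule mod_homI)
       (auto simp: c mod_hom_add[OF f] mod_hom_smult[OF f] intro!: inj_onD[OF inj])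
qed

section \<open>Coefficients in the regular module, finite generation and dual bases\<close>

lemma right_module_regular:
  assumes "ring A"
  shows "right_module A (regular A)"
proof -
  interpret A: ring A by fact
  have "abelian_group (regular A)"
    by (rule abelian_groupI) (auto simp: regular_def A.a_ac intro!: A.add.l_inv_ex)
  then show ?thesis
    by (rule right_moduleI[OF assms]) (auto simp: regular_def A.l_distr A.r_distr A.m_assoc)
qed

text \<open>The maps built from a dual basis all have this shape. Linearity rests on the right
  actions matching: \<xi>(xa) = \<xi>(x)a in A, and y(\<xi>(x)a) = (y\<xi>(x))a in
  \<open>N\<close>.\<close>

lemma mod_hom_finsum_smult:
  assumes M: "right_module A M" and N: "right_module A N" and I: "finite I"
    and \<xi>: "\<And>i. i \<in> I \<Longrightarrow> \<xi> i \<in> mod_hom A M (regular A)"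
    and y: "\<And>i. i \<in> I \<Longrightarrow> y i \<in> carrier N"
  shows "(\<lambda>x\<in>carrier M. \<Oplus>\<^bsub>N\<^esub>i\<in>I. \<xi> i x \<odot>\<^bsub>N\<^esub> y i) \<in> mod_hom A M N"
proof -
  interpret M: right_module A M by fact
  interpret N: right_module A N by fact
  have c: "\<xi> i x \<in> carrier A" if "i \<in> I" "x \<in> carrier M" for i x
    using mod_hom_closed[OF \<xi> that(2)] that by (simp add: regular_def)
  have c': "(\<lambda>i. \<xi> i x \<odot>\<^bsub>N\<^esub> y i) \<in> I \<rightarrow> carrier N" if "x \<in> carrier M" for x
    using that c y by auto
  show ?thesis
  proof (rule mod_homI)
    fix u v assume uv: "u \<in> carrier M" "v \<in> carrier M"
    have "(\<Oplus>\<^bsub>N\<^esub>i\<in>I. \<xi> i (u \<oplus>\<^bsub>M\<^esub> v) \<odot>\<^bsub>N\<^esub> y i) =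
        (\<Oplus>\<^bsub>N\<^esub>i\<in>I. \<xi> i u \<odot>\<^bsub>N\<^esub> y i \<oplus>\<^bsub>N\<^esub> \<xi> i v \<odot>\<^bsub>N\<^esub> y i)"
      using uv c y by (intro N.M.finsum_cong') (auto simp: mod_hom_add[OF \<xi>] regular_def N.smult_l_distr)
    also have "\<dots> = (\<Oplus>\<^bsub>N\<^esub>i\<in>I. \<xi> i u \<odot>\<^bsub>N\<^esub> y i) \<oplus>\<^bsub>N\<^esub> (\<Oplus>\<^bsub>N\<^esub>i\<in>I. \<xi> i v \<odot>\<^bsub>N\<^esub> y i)"
      using c' uv by (intro N.M.finsum_addf) auto
    finally show "(\<lambda>x\<in>carrier M. \<Oplus>\<^bsub>N\<^esub>i\<in>I. \<xi> i x \<odot>\<^bsub>N\<^esub> y i) (u \<oplus>\<^bsub>M\<^esub> v) =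
        (\<lambda>x\<in>carrier M. \<Oplus>\<^bsub>N\<^esub>i\<in>I. \<xi> i x \<odot>\<^bsub>N\<^esub> y i) u \<oplus>\<^bsub>N\<^esub> (\<lambda>x\<in>carrier M. \<Oplus>\<^bsub>N\<^esub>i\<in>I. \<xi> i x \<odot>\<^bsub>N\<^esub> y i) v"
      using uv by simp
  next
    fix a u assume au: "a \<in> carrier A" "u \<in> carrier M"
    have "(\<Oplus>\<^bsub>N\<^esub>i\<in>I. \<xi> i (a \<odot>\<^bsub>M\<^esub> u) \<odot>\<^bsub>N\<^esub> y i) = (\<Oplus>\<^bsub>N\<^esub>i\<in>I. a \<odot>\<^bsub>N\<^esub> (\<xi> i u \<odot>\<^bsub>N\<^esub> y i))"
      using au c y
      by (intro N.M.finsum_cong') (auto simp: mod_hom_smult[OF \<xi>] regular_def N.smult_assoc)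
    also have "\<dots> = a \<odot>\<^bsub>N\<^esub> (\<Oplus>\<^bsub>N\<^esub>i\<in>I. \<xi> i u \<odot>\<^bsub>N\<^esub> y i)"
    proof -
      \<comment> \<open>The induction runs over subsets of \<open>I\<close>, because
        \<open>\<xi>\<close> and \<open>y\<close> are controlled only there.\<close>
      have "finite J \<Longrightarrow> J \<subseteq> I \<Longrightarrow>
          (\<Oplus>\<^bsub>N\<^esub>i\<in>J. a \<odot>\<^bsub>N\<^esub> (\<xi> i u \<odot>\<^bsub>N\<^esub> y i)) = a \<odot>\<^bsub>N\<^esub> (\<Oplus>\<^bsub>N\<^esub>i\<in>J. \<xi> i u \<odot>\<^bsub>N\<^esub> y i)" for J
      proof (induction J rule: finite_induct)
        case (insert j J)
        have "(\<lambda>i. \<xi> i u \<odot>\<^bsub>N\<^esub> y i) \<in> J \<rightarrow> carrier N" "(\<lambda>i. a \<odot>\<^bsub>N\<^esub> (\<xi> i u \<odot>\<^bsub>N\<^esub> y i)) \<in> J \<rightarrow> carrier N"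
          "\<xi> j u \<odot>\<^bsub>N\<^esub> y j \<in> carrier N"
          using insert.prems au c y by (auto simp: subset_iff)
        with insert au show ?case by (simp add: N.smult_r_distr)
      qed (use au in simp)
      with I show ?thesis by simp
    qed
    finally show "(\<lambda>x\<in>carrier M. \<Oplus>\<^bsub>N\<^esub>i\<in>I. \<xi> i x \<odot>\<^bsub>N\<^esub> y i) (a \<odot>\<^bsub>M\<^esub> u) =
        a \<odot>\<^bsub>N\<^esub> (\<lambda>x\<in>carrier M. \<Oplus>\<^bsub>N\<^esub>i\<in>I. \<xi> i x \<odot>\<^bsub>N\<^esub> y i) u"
      using au by simp
  qed (use c' in auto)
qed

text \<open>\<open>fin_gen\<close> wants a set of generators, whereas the family \<open>e\<close>
  may repeat an element; coefficients of equal generators have to be added up before they form a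
  function on the image of \<open>e\<close>.\<close>

lemma fin_gen_indexed:
  assumes M: "right_module A M" and I: "finite I" and e: "\<And>i. i \<in> I \<Longrightarrow> e i \<in> carrier M"
    and gen: "\<And>x. x \<in> carrier M \<Longrightarrow> \<exists>c\<in>I \<rightarrow> carrier A. x = (\<Oplus>\<^bsub>M\<^esub>i\<in>I. c i \<odot>\<^bsub>M\<^esub> e i)"
  shows "fin_gen A M"
proof -
  interpret M: right_module A M by fact
  have "\<exists>d\<in>e ` I \<rightarrow> carrier A. (\<Oplus>\<^bsub>M\<^esub>i\<in>J. c i \<odot>\<^bsub>M\<^esub> e i) = (\<Oplus>\<^bsub>M\<^esub>g\<in>e ` I. d g \<odot>\<^bsub>M\<^esub> g)"
    if "finite J" "J \<subseteq> I" "c \<in> I \<rightarrow> carrier A" for J c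
    using that
  proof (induction J)
    case empty
    have "(\<Oplus>\<^bsub>M\<^esub>g\<in>e ` I. \<zero>\<^bsub>A\<^esub> \<odot>\<^bsub>M\<^esub> g) = (\<Oplus>\<^bsub>M\<^esub>g\<in>e ` I. \<zero>\<^bsub>M\<^esub>)"
      using e by (intro M.M.finsum_cong') auto
    then show ?case by (intro bexI[of _ "\<lambda>_. \<zero>\<^bsub>A\<^esub>"]) auto
  next
    case (insert j J)
    then obtain d where d: "d \<in> e ` I \<rightarrow> carrier A"
      "(\<Oplus>\<^bsub>M\<^esub>i\<in>J. c i \<odot>\<^bsub>M\<^esub> e i) = (\<Oplus>\<^bsub>M\<^esub>g\<in>e ` I. d g \<odot>\<^bsub>M\<^esub> g)" by auto
    have j: "j \<in> I" "c j \<in> carrier A" "e j \<in> carrier M" using insert.prems e by auto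
    have cJ: "(\<lambda>i. c i \<odot>\<^bsub>M\<^esub> e i) \<in> J \<rightarrow> carrier M" using insert.prems e by (auto simp: subset_iff)
    \<comment> \<open>\<open>d'\<close> carries the one new coefficient; it is added to
      \<open>d\<close> because \<open>e j\<close> may already occur among the earlier
      generators.\<close>
    define d' where "d' g = (if e j = g then c j else \<zero>\<^bsub>A\<^esub>)" for g
    have dc: "d g \<odot>\<^bsub>M\<^esub> g \<in> carrier M" "d' g \<odot>\<^bsub>M\<^esub> g \<in> carrier M" "d g \<in> carrier A" "d' g \<in> carrier A"
      "g \<in> carrier M" if "g \<in> e ` I" for g
      using that e d j by (auto simp: d'_def)
    have "(\<Oplus>\<^bsub>M\<^esub>g\<in>e ` I. (d' g \<oplus>\<^bsub>A\<^esub> d g) \<odot>\<^bsub>M\<^esub> g) = (\<Oplus>\<^bsub>M\<^esub>g\<in>e ` I. d' g \<odot>\<^bsub>M\<^esub> g \<oplus>\<^bsub>M\<^esub> d g \<odot>\<^bsub>M\<^esub> g)"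
      using dc by (intro M.M.finsum_cong') (auto simp: M.smult_l_distr)
    also have "\<dots> = (\<Oplus>\<^bsub>M\<^esub>g\<in>e ` I. d' g \<odot>\<^bsub>M\<^esub> g) \<oplus>\<^bsub>M\<^esub> (\<Oplus>\<^bsub>M\<^esub>g\<in>e ` I. d g \<odot>\<^bsub>M\<^esub> g)"
      using dc by (intro M.M.finsum_addf) auto
    also have "(\<Oplus>\<^bsub>M\<^esub>g\<in>e ` I. d' g \<odot>\<^bsub>M\<^esub> g) = (\<Oplus>\<^bsub>M\<^esub>g\<in>e ` I. if e j = g then c j \<odot>\<^bsub>M\<^esub> g else \<zero>\<^bsub>M\<^esub>)"
      using e j by (intro M.M.finsum_cong') (auto simp: d'_def)
    also have "\<dots> = c j \<odot>\<^bsub>M\<^esub> e j"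
      using j I e by (intro M.M.finsum_singleton) (auto simp: j)
    finally have "(\<Oplus>\<^bsub>M\<^esub>i\<in>insert j J. c i \<odot>\<^bsub>M\<^esub> e i) = (\<Oplus>\<^bsub>M\<^esub>g\<in>e ` I. (d' g \<oplus>\<^bsub>A\<^esub> d g) \<odot>\<^bsub>M\<^esub> g)"
      using insert j cJ d(2) by simp
    moreover have "(\<lambda>g. d' g \<oplus>\<^bsub>A\<^esub> d g) \<in> e ` I \<rightarrow> carrier A" using dc by auto
    ultimately show ?case by (intro bexI[of _ "\<lambda>g. d' g \<oplus>\<^bsub>A\<^esub> d g"]) auto
  qed
  from this[OF I subset_refl] gen show ?thesis
    unfolding fin_gen_def using I e by (intro exI[of _ "e ` I"]) (force)
qed

text \<open>The free module on a finite generating set \<open>G\<close> maps onto \<open>P\<close>;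
  projectivity splits this map, and \<open>\<xi> g\<close> is the coordinate of the splitting at
  \<open>g\<close>.\<close>

lemma projective_dual_basis:
  assumes "projective A P"
  obtains G \<xi> where "finite G" "G \<subseteq> carrier P"
    "\<And>g. g \<in> G \<Longrightarrow> \<xi> g \<in> mod_hom A P (regular A)"
    "\<And>x. x \<in> carrier P \<Longrightarrow> x = (\<Oplus>\<^bsub>P\<^esub>g\<in>G. \<xi> g x \<odot>\<^bsub>P\<^esub> g)"
proof -
  have P: "fg_module A P" using assms by (simp add: projective_def)
  interpret P: right_module A P using P by (simp add: fg_module_def)
  obtain G where G: "finite G" "G \<subseteq> carrier P"
    and gen: "\<And>x. x \<in> carrier P \<Longrightarrow> \<exists>c\<in>G \<rightarrow> carrier A. x = (\<Oplus>\<^bsub>P\<^esub>g\<in>G. c g \<odot>\<^bsub>P\<^esub> g)"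
    using P unfolding fg_module_def fin_gen_def by blast
  \<comment> \<open>The free right module on \<open>G\<close>, realised by extensional
    functions.\<close>
  define F where "F = mk_module (G \<rightarrow>\<^sub>E carrier A) (\<lambda>k\<in>G. \<zero>\<^bsub>A\<^esub>) (\<lambda>x y. \<lambda>k\<in>G. x k \<oplus>\<^bsub>A\<^esub> y k)
     (\<lambda>a x. \<lambda>k\<in>G. x k \<otimes>\<^bsub>A\<^esub> a)"
  have cF: "carrier F = G \<rightarrow>\<^sub>E carrier A" by (simp add: F_def)
  have "abelian_group F"
  proof (rule abelian_groupI)
    fix x assume "x \<in> carrier F"
    then show "\<exists>y\<in>carrier F. y \<oplus>\<^bsub>F\<^esub> x = \<zero>\<^bsub>F\<^esub>"
      by (intro bexI[of _ "\<lambda>k\<in>G. \<ominus>\<^bsub>A\<^esub> x k"]) (auto simp: F_def intro!: restrict_ext P.R.l_neg)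
  qed (auto simp: F_def fun_eq_iff restrict_def, auto simp: PiE_def Pi_def extensional_def P.R.a_ac)
  then have F: "right_module A F"
    by (rule right_moduleI[OF P.R.ring_axioms])
       (auto simp: F_def fun_eq_iff restrict_def,
        auto simp: PiE_def Pi_def extensional_def P.R.l_distr P.R.r_distr P.R.m_assoc)
  interpret F: right_module A F by (rule F)
  interpret A: right_module A "regular A" by (rule right_module_regular[OF P.R.ring_axioms])
  have sF: "(a \<odot>\<^bsub>F\<^esub> x) k = x k \<otimes>\<^bsub>A\<^esub> a" if "k \<in> G" for a x k
    using that by (simp add: F_def)
  define ev where "ev g = (\<lambda>v\<in>carrier F. v g)" for g
  have ev: "ev g \<in> mod_hom A F (regular A)" if "g \<in> G" for g
    using that unfolding ev_def by (intro mod_homI) (auto simp: F_def regular_def PiE_mem)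
  define e where "e g = (\<lambda>k\<in>G. if g = k then \<one>\<^bsub>A\<^esub> else \<zero>\<^bsub>A\<^esub>)" for g
  have e: "e g \<in> carrier F" for g by (auto simp: F_def e_def)
  have "fin_gen A F"
  proof (rule fin_gen_indexed[OF F G(1)])
    fix v assume v: "v \<in> carrier F"
    then have vi: "v i \<in> carrier A" if "i \<in> G" for i
      using that by (auto simp: cF)
    have c: "(\<lambda>i. v i \<odot>\<^bsub>F\<^esub> e i) \<in> G \<rightarrow> carrier F" using vi e by auto
    have "v k = (\<Oplus>\<^bsub>F\<^esub>i\<in>G. v i \<odot>\<^bsub>F\<^esub> e i) k" if k: "k \<in> G" for k
    proof -
      have "(\<Oplus>\<^bsub>F\<^esub>i\<in>G. v i \<odot>\<^bsub>F\<^esub> e i) k = ev k (\<Oplus>\<^bsub>F\<^esub>i\<in>G. v i \<odot>\<^bsub>F\<^esub> e i)"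
        using c by (simp add: ev_def F.M.finsum_closed)
      also have "\<dots> = (\<Oplus>\<^bsub>regular A\<^esub>i\<in>G. ev k (v i \<odot>\<^bsub>F\<^esub> e i))"
        by (rule mod_hom_finsum[OF ev[OF k] F.M.abelian_group_axioms A.M.abelian_group_axioms G(1) c])
      also have "\<dots> = (\<Oplus>\<^bsub>regular A\<^esub>i\<in>G. if k = i then v i else \<zero>\<^bsub>regular A\<^esub>)"
        using vi k e
        by (intro A.M.finsum_cong') (auto simp: mod_hom_smult[OF ev[OF k]] regular_def ev_def sF, auto simp: e_def)
      also have "\<dots> = v k"
        using v k G by (intro A.M.finsum_singleton) (auto simp: cF regular_def)
      finally show ?thesis by simp
    qed
    moreover have "(\<Oplus>\<^bsub>F\<^esub>i\<in>G. v i \<odot>\<^bsub>F\<^esub> e i) \<in> carrier F"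
      using c by (rule F.M.finsum_closed)
    ultimately have "v = (\<Oplus>\<^bsub>F\<^esub>i\<in>G. v i \<odot>\<^bsub>F\<^esub> e i)"
      using v unfolding cF by (intro PiE_ext) auto
    then show "\<exists>c\<in>G \<rightarrow> carrier A. v = (\<Oplus>\<^bsub>F\<^esub>i\<in>G. c i \<odot>\<^bsub>F\<^esub> e i)"
      using v by (intro bexI[of _ v]) (auto simp: cF)
  qed (rule e)
  then have Ffg: "fg_module A F" using F by (simp add: fg_module_def)
  define s where "s = (\<lambda>v\<in>carrier F. \<Oplus>\<^bsub>P\<^esub>g\<in>G. ev g v \<odot>\<^bsub>P\<^esub> g)"
  have s: "s \<in> mod_hom A F P"
    unfolding s_def using ev G by (intro mod_hom_finsum_smult[OF F P.right_module_axioms]) auto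
  have s_surj: "\<exists>v\<in>carrier F. s v = x" if x: "x \<in> carrier P" for x
  proof -
    obtain c where c: "c \<in> G \<rightarrow> carrier A" "x = (\<Oplus>\<^bsub>P\<^esub>g\<in>G. c g \<odot>\<^bsub>P\<^esub> g)" using gen[OF x] by blast
    have c': "restrict c G \<in> carrier F" using c by (auto simp: cF)
    then have "s (restrict c G) = x"
      unfolding s_def c(2) using c G by (auto simp: ev_def intro!: P.M.finsum_cong')
    with c' show ?thesis by blast
  qed
  \<comment> \<open>\<open>projective\<close> tests only modules in \<open>'a univ\<close>, so the
    surjection \<open>s\<close> from \<open>F\<close> to \<open>P\<close> is carried over to copies
    \<open>F'\<close> and \<open>P'\<close> before it can be split.\<close>
  obtain F' :: "('a, 'a univ) module" and j where F': "fg_module A F'"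
    and j: "j \<in> mod_hom A F F'" "bij_betw j (carrier F) (carrier F')"
    using fg_module_in_univ[OF Ffg] by (auto simp: mod_iso_def)
  obtain P' :: "('a, 'a univ) module" and k where P': "fg_module A P'"
    and k: "k \<in> mod_hom A P P'" "bij_betw k (carrier P) (carrier P')"
    using fg_module_in_univ[OF P] by (auto simp: mod_iso_def)
  interpret F': right_module A F' using F' by (simp add: fg_module_def)
  interpret P': right_module A P' using P' by (simp add: fg_module_def)
  define j' where "j' = (\<lambda>y\<in>carrier F'. inv_into (carrier F) j y)"
  have j': "j' \<in> mod_hom A F' F"
    unfolding j'_def using j F F'.right_module_axioms by (rule mod_hom_inv)
  have jj: "j' (j v) = v" if "v \<in> carrier F" for v
    using that j(2) mod_hom_closed[OF j(1)] by (auto simp: j'_def bij_betw_def)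
  define q where "q = compose (carrier F') k (compose (carrier F') s j')"
  have q: "q \<in> mod_hom A F' P'"
    unfolding q_def by (intro mod_hom_compose[OF _ k(1)] mod_hom_compose[OF j' s] F'.right_module_axioms)
  have "q ` carrier F' = carrier P'"
  proof
    show "q ` carrier F' \<subseteq> carrier P'" using mod_hom_closed[OF q] by auto
    show "carrier P' \<subseteq> q ` carrier F'"
    proof
      fix y assume "y \<in> carrier P'"
      then have "y \<in> k ` carrier P" using k(2) by (simp add: bij_betw_def)
      then obtain x where x: "x \<in> carrier P" "k x = y" by auto
      obtain v where v: "v \<in> carrier F" "s v = x" using s_surj[OF x(1)] by blast
      then have "q (j v) = y" using x mod_hom_closed[OF j(1)] by (simp add: q_def compose_def jj)
      then show "y \<in> q ` carrier F'" using mod_hom_closed[OF j(1) v(1)] by auto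
    qed
  qed
  then obtain h where h: "h \<in> mod_hom A P F'" "\<And>x. x \<in> carrier P \<Longrightarrow> q (h x) = k x"
    using assms F' P' q k(1) unfolding projective_def by metis
  define \<xi> where "\<xi> g = compose (carrier P) (ev g) (compose (carrier P) j' h)" for g
  show thesis
  proof (rule that[of G \<xi>])
    show "\<xi> g \<in> mod_hom A P (regular A)" if "g \<in> G" for g
      unfolding \<xi>_def by (intro mod_hom_compose[OF mod_hom_compose[OF h(1) j'] ev[OF that]] P.right_module_axioms)
    fix x assume x: "x \<in> carrier P"
    have c: "h x \<in> carrier F'" "j' (h x) \<in> carrier F"
      using mod_hom_closed[OF h(1) x] mod_hom_closed[OF j'] by auto
    \<comment> \<open>As \<open>k\<close> is injective, this says that \<open>j'\<close> after
      \<open>h\<close> is a section of \<open>s\<close>.\<close>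
    have "k (s (j' (h x))) = k x" using h(2)[OF x] c by (simp add: q_def compose_def)
    then have "x = s (j' (h x))"
      using k(2) x mod_hom_closed[OF s c(2)] by (auto simp: bij_betw_def inj_on_def)
    also have "\<dots> = (\<Oplus>\<^bsub>P\<^esub>g\<in>G. \<xi> g x \<odot>\<^bsub>P\<^esub> g)"
      unfolding s_def using c x by (simp add: \<xi>_def compose_def)
    finally show "x = (\<Oplus>\<^bsub>P\<^esub>g\<in>G. \<xi> g x \<odot>\<^bsub>P\<^esub> g)" .
  qed (use G in auto)
qed

section \<open>The homotopy category\<close>

text \<open>The linear part of \<open>is_complex\<close>. This is the level at which stalks, shifts
  and tensored complexes are shown to be complexes, so it is common to all of them.\<close>

locale mod_complex =
  fixes A :: "'a ring" and X :: "('a, 'm) cochain"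
  assumes obj_module: "right_module A (obj X i)"
    and dif_hom: "dif X i \<in> mod_hom A (obj X i) (obj X (i + 1))"
    and dif_dif: "x \<in> carrier (obj X i) \<Longrightarrow> dif X (i + 1) (dif X i x) = \<zero>\<^bsub>obj X (i + 2)\<^esub>"
begin

lemma obj_group: "abelian_group (obj X i)"
  using obj_module[of i] by (simp add: right_module_def)

lemma ring_axioms: "ring A"
  using obj_module[of 0] by (simp add: right_module_def)

lemma dif_closed: "x \<in> carrier (obj X i) \<Longrightarrow> dif X i x \<in> carrier (obj X (i + 1))"
  by (rule mod_hom_closed[OF dif_hom])

lemma dif_pred_hom: "dif X (i - 1) \<in> mod_hom A (obj X (i - 1)) (obj X i)"
  using dif_hom[of "i - 1"] by simp

lemma dif_pred_dif: "x \<in> carrier (obj X (i - 1)) \<Longrightarrow> dif X i (dif X (i - 1) x) = \<zero>\<^bsub>obj X (i + 1)\<^esub>"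
  using dif_dif[of x "i - 1"] by (simp add: algebra_simps)

end

lemma is_complex_imp_mod_complex: "is_complex A X \<Longrightarrow> mod_complex A X"
  unfolding is_complex_def fg_module_def by (intro mod_complex.intro) blast+

lemma chain_mapsI:
  assumes "\<And>i. f i \<in> mod_hom A (obj X i) (obj Y i)"
    and "\<And>i x. x \<in> carrier (obj X i) \<Longrightarrow> f (i + 1) (dif X i x) = dif Y i (f i x)"
  shows "f \<in> chain_maps A X Y"
  using assms by (simp add: chain_maps_def)

lemma chain_map_hom: "f \<in> chain_maps A X Y \<Longrightarrow> f i \<in> mod_hom A (obj X i) (obj Y i)"
  by (simp add: chain_maps_def)

lemma chain_map_closed:
  "\<lbrakk>f \<in> chain_maps A X Y; x \<in> carrier (obj X i)\<rbrakk> \<Longrightarrow> f i x \<in> carrier (obj Y i)"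
  using mod_hom_closed[OF chain_map_hom] .

lemma chain_map_dif:
  "\<lbrakk>f \<in> chain_maps A X Y; x \<in> carrier (obj X i)\<rbrakk> \<Longrightarrow> f (i + 1) (dif X i x) = dif Y i (f i x)"
  by (simp add: chain_maps_def)

lemma chain_map_dif_pred:
  assumes "f \<in> chain_maps A X Y" "x \<in> carrier (obj X (i - 1))"
  shows "f i (dif X (i - 1) x) = dif Y (i - 1) (f (i - 1) x)"
  using chain_map_dif[OF assms] by simp

lemma chain_map_eqI:
  assumes "f \<in> chain_maps A X Y" "g \<in> chain_maps A X Y'"
    and "\<And>i x. x \<in> carrier (obj X i) \<Longrightarrow> f i x = g i x"
  shows "f = g"
  using mod_hom_eqI[OF chain_map_hom[OF assms(1)] chain_map_hom[OF assms(2)]] assms(3) by blast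

lemma (in mod_complex) ch_id_chain_map: "ch_id X \<in> chain_maps A X X"
  unfolding ch_id_def
  by (rule chain_mapsI) (auto intro: right_module.mod_hom_id[OF obj_module] simp: dif_closed)

lemma ch_comp_chain_map:
  assumes "mod_complex A X" and f: "f \<in> chain_maps A X Y" and g: "g \<in> chain_maps A Y Z"
  shows "ch_comp X g f \<in> chain_maps A X Z"
proof -
  interpret X: mod_complex A X by fact
  show ?thesis
    unfolding ch_comp_def
  proof (rule chain_mapsI)
    show "compose (carrier (obj X i)) (g i) (f i) \<in> mod_hom A (obj X i) (obj Z i)" for i
      by (rule mod_hom_compose[OF chain_map_hom[OF f] chain_map_hom[OF g] X.obj_module])
  qed (simp add: compose_def X.dif_closed chain_map_closed[OF f] chain_map_dif[OF f] chain_map_dif[OF g])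
qed

context
  fixes A :: "'a ring" and X :: "('a, 'm) cochain" and Y :: "('a, 'n) cochain"
  assumes X: "mod_complex A X" and Y: "mod_complex A Y"
begin

interpretation X: mod_complex A X by (rule X)
interpretation Y: mod_complex A Y by (rule Y)
interpretation YM: right_module A "obj Y i" for i by (rule Y.obj_module)
interpretation XM: right_module A "obj X i" for i by (rule X.obj_module)

lemma ch_zero_chain_map: "ch_zero X Y \<in> chain_maps A X Y"
  unfolding ch_zero_def
  by (rule chain_mapsI)
    (auto intro: mod_hom_zero_map[OF X.obj_module Y.obj_module]
      simp: X.dif_closed mod_hom_zero[OF Y.dif_hom Y.obj_group Y.obj_group])

lemma ch_add_chain_map:
  assumes f: "f \<in> chain_maps A X Y" and g: "g \<in> chain_maps A X Y"
  shows "ch_add X Y f g \<in> chain_maps A X Y"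
  unfolding ch_add_def
proof (rule chain_mapsI)
  show "(\<lambda>x\<in>carrier (obj X i). f i x \<oplus>\<^bsub>obj Y i\<^esub> g i x) \<in> mod_hom A (obj X i) (obj Y i)" for i
    by (rule mod_hom_plus[OF chain_map_hom[OF f] chain_map_hom[OF g] X.obj_module Y.obj_module])
qed (simp add: X.dif_closed chain_map_closed[OF f] chain_map_closed[OF g] chain_map_dif[OF f]
    chain_map_dif[OF g] mod_hom_add[OF Y.dif_hom])

lemma ch_uminus_chain_map:
  assumes f: "f \<in> chain_maps A X Y"
  shows "(\<lambda>i. \<lambda>x\<in>carrier (obj X i). \<ominus>\<^bsub>obj Y i\<^esub> f i x) \<in> chain_maps A X Y"
proof (rule chain_mapsI)
  show "(\<lambda>x\<in>carrier (obj X i). \<ominus>\<^bsub>obj Y i\<^esub> f i x) \<in> mod_hom A (obj X i) (obj Y i)" for i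
    by (rule mod_hom_uminus[OF chain_map_hom[OF f] X.obj_module Y.obj_module])
qed (simp add: X.dif_closed chain_map_closed[OF f] chain_map_dif[OF f]
    mod_hom_minus[OF Y.dif_hom Y.obj_group Y.obj_group])

lemma homotopicI:
  assumes "f \<in> chain_maps A X Y" "g \<in> chain_maps A X Y"
    and "\<And>i. s i \<in> mod_hom A (obj X i) (obj Y (i - 1))"
    and "\<And>i x. x \<in> carrier (obj X i) \<Longrightarrow>
           f i x = g i x \<oplus>\<^bsub>obj Y i\<^esub> (dif Y (i - 1) (s i x) \<oplus>\<^bsub>obj Y i\<^esub> s (i + 1) (dif X i x))"
  shows "(f, g) \<in> homotopic A X Y"
  using assms unfolding homotopic_def by blast

text \<open>The last two facts settle the index once and for all: \<open>s (i + 1)\<close> is typed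
  into degree i + 1 - 1, and its values are needed in degree i.\<close>

lemma homotopicE:
  assumes "(f, g) \<in> homotopic A X Y"
  obtains s where "f \<in> chain_maps A X Y" "g \<in> chain_maps A X Y"
    "\<And>i. s i \<in> mod_hom A (obj X i) (obj Y (i - 1))"
    "\<And>i x. x \<in> carrier (obj X i) \<Longrightarrow>
           f i x = g i x \<oplus>\<^bsub>obj Y i\<^esub> (dif Y (i - 1) (s i x) \<oplus>\<^bsub>obj Y i\<^esub> s (i + 1) (dif X i x))"
    "\<And>i x. x \<in> carrier (obj X i) \<Longrightarrow> dif Y (i - 1) (s i x) \<in> carrier (obj Y i)"
    "\<And>i x. x \<in> carrier (obj X i) \<Longrightarrow> s (i + 1) (dif X i x) \<in> carrier (obj Y i)"
proof -
  obtain s where s: "f \<in> chain_maps A X Y" "g \<in> chain_maps A X Y"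
    "\<And>i. s i \<in> mod_hom A (obj X i) (obj Y (i - 1))"
    "\<And>i x. x \<in> carrier (obj X i) \<Longrightarrow>
           f i x = g i x \<oplus>\<^bsub>obj Y i\<^esub> (dif Y (i - 1) (s i x) \<oplus>\<^bsub>obj Y i\<^esub> s (i + 1) (dif X i x))"
    using assms unfolding homotopic_def by blast
  have "s (i + 1) y \<in> carrier (obj Y i)" if "y \<in> carrier (obj X (i + 1))" for i y
    using mod_hom_closed[OF s(3) that] by simp
  then show thesis
    using mod_hom_closed[OF Y.dif_pred_hom] mod_hom_closed[OF s(3)] X.dif_closed
    by (intro that[OF s]) blast+
qed

lemma homotopic_refl:
  assumes f: "f \<in> chain_maps A X Y" shows "(f, f) \<in> homotopic A X Y"
proof (rule homotopicI[OF f f, of "\<lambda>i. \<lambda>x\<in>carrier (obj X i). \<zero>\<^bsub>obj Y (i - 1)\<^esub>"])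
  show "(\<lambda>x\<in>carrier (obj X i). \<zero>\<^bsub>obj Y (i - 1)\<^esub>) \<in> mod_hom A (obj X i) (obj Y (i - 1))" for i
    by (rule mod_hom_zero_map[OF X.obj_module Y.obj_module])
qed (simp add: X.dif_closed chain_map_closed[OF f] mod_hom_zero[OF Y.dif_pred_hom Y.obj_group Y.obj_group])

lemma homotopic_sym:
  assumes "(f, g) \<in> homotopic A X Y" shows "(g, f) \<in> homotopic A X Y"
  using assms
proof (rule homotopicE)
  fix s
  assume f: "f \<in> chain_maps A X Y" and g: "g \<in> chain_maps A X Y"
    and s: "\<And>i. s i \<in> mod_hom A (obj X i) (obj Y (i - 1))"
    and e: "\<And>i x. x \<in> carrier (obj X i) \<Longrightarrow>
           f i x = g i x \<oplus>\<^bsub>obj Y i\<^esub> (dif Y (i - 1) (s i x) \<oplus>\<^bsub>obj Y i\<^esub> s (i + 1) (dif X i x))"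
    and c: "\<And>i x. x \<in> carrier (obj X i) \<Longrightarrow> dif Y (i - 1) (s i x) \<in> carrier (obj Y i)"
    "\<And>i x. x \<in> carrier (obj X i) \<Longrightarrow> s (i + 1) (dif X i x) \<in> carrier (obj Y i)"
  show ?thesis
  proof (rule homotopicI[OF g f, of "\<lambda>i. \<lambda>x\<in>carrier (obj X i). \<ominus>\<^bsub>obj Y (i - 1)\<^esub> s i x"])
    fix i x assume x: "x \<in> carrier (obj X i)"
    have "dif Y (i - 1) (\<ominus>\<^bsub>obj Y (i - 1)\<^esub> s i x) = \<ominus>\<^bsub>obj Y i\<^esub> dif Y (i - 1) (s i x)"
      by (rule mod_hom_minus[OF Y.dif_pred_hom Y.obj_group Y.obj_group mod_hom_closed[OF s x]])
    then show "g i x = f i x \<oplus>\<^bsub>obj Y i\<^esub>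
        (dif Y (i - 1) ((\<lambda>x\<in>carrier (obj X i). \<ominus>\<^bsub>obj Y (i - 1)\<^esub> s i x) x) \<oplus>\<^bsub>obj Y i\<^esub>
         (\<lambda>x\<in>carrier (obj X (i + 1)). \<ominus>\<^bsub>obj Y (i + 1 - 1)\<^esub> s (i + 1) x) (dif X i x))"
      using x c[OF x] chain_map_closed[OF g x]
      by (simp add: X.dif_closed e[OF x] YM.M.a_assoc YM.M.minus_add[symmetric] YM.M.r_neg)
  qed (rule mod_hom_uminus[OF s X.obj_module Y.obj_module])
qed

lemma homotopic_add:
  assumes "(f, f') \<in> homotopic A X Y" "(g, g') \<in> homotopic A X Y"
  shows "(ch_add X Y f g, ch_add X Y f' g') \<in> homotopic A X Y"
  using assms(1)
proof (rule homotopicE)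
  fix s
  assume f: "f \<in> chain_maps A X Y" and f': "f' \<in> chain_maps A X Y"
    and s: "\<And>i. s i \<in> mod_hom A (obj X i) (obj Y (i - 1))"
    and e: "\<And>i x. x \<in> carrier (obj X i) \<Longrightarrow>
           f i x = f' i x \<oplus>\<^bsub>obj Y i\<^esub> (dif Y (i - 1) (s i x) \<oplus>\<^bsub>obj Y i\<^esub> s (i + 1) (dif X i x))"
    and c: "\<And>i x. x \<in> carrier (obj X i) \<Longrightarrow> dif Y (i - 1) (s i x) \<in> carrier (obj Y i)"
    "\<And>i x. x \<in> carrier (obj X i) \<Longrightarrow> s (i + 1) (dif X i x) \<in> carrier (obj Y i)"
  show ?thesis
    using assms(2)
  proof (rule homotopicE)
    fix t
    assume g: "g \<in> chain_maps A X Y" and g': "g' \<in> chain_maps A X Y"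
      and t: "\<And>i. t i \<in> mod_hom A (obj X i) (obj Y (i - 1))"
      and e': "\<And>i x. x \<in> carrier (obj X i) \<Longrightarrow>
           g i x = g' i x \<oplus>\<^bsub>obj Y i\<^esub> (dif Y (i - 1) (t i x) \<oplus>\<^bsub>obj Y i\<^esub> t (i + 1) (dif X i x))"
      and c': "\<And>i x. x \<in> carrier (obj X i) \<Longrightarrow> dif Y (i - 1) (t i x) \<in> carrier (obj Y i)"
      "\<And>i x. x \<in> carrier (obj X i) \<Longrightarrow> t (i + 1) (dif X i x) \<in> carrier (obj Y i)"
    show ?thesis
    proof (rule homotopicI[OF ch_add_chain_map[OF f g] ch_add_chain_map[OF f' g'],
          of "\<lambda>i. \<lambda>x\<in>carrier (obj X i). s i x \<oplus>\<^bsub>obj Y (i - 1)\<^esub> t i x"])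
      fix i x assume x: "x \<in> carrier (obj X i)"
      have "dif Y (i - 1) (s i x \<oplus>\<^bsub>obj Y (i - 1)\<^esub> t i x) =
          dif Y (i - 1) (s i x) \<oplus>\<^bsub>obj Y i\<^esub> dif Y (i - 1) (t i x)"
        by (rule mod_hom_add[OF Y.dif_pred_hom mod_hom_closed[OF s x] mod_hom_closed[OF t x]])
      then show "ch_add X Y f g i x = ch_add X Y f' g' i x \<oplus>\<^bsub>obj Y i\<^esub>
        (dif Y (i - 1) ((\<lambda>x\<in>carrier (obj X i). s i x \<oplus>\<^bsub>obj Y (i - 1)\<^esub> t i x) x) \<oplus>\<^bsub>obj Y i\<^esub>
         (\<lambda>x\<in>carrier (obj X (i + 1)). s (i + 1) x \<oplus>\<^bsub>obj Y (i + 1 - 1)\<^esub> t (i + 1) x) (dif X i x))"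
        using x c[OF x] c'[OF x] chain_map_closed[OF f' x] chain_map_closed[OF g' x]
        by (simp add: ch_add_def X.dif_closed e[OF x] e'[OF x] YM.M.a_ac)
    qed (rule mod_hom_plus[OF s t X.obj_module Y.obj_module])
  qed
qed

lemma homotopic_trans:
  assumes "(f, g) \<in> homotopic A X Y" "(g, h) \<in> homotopic A X Y"
  shows "(f, h) \<in> homotopic A X Y"
  using assms(1)
proof (rule homotopicE)
  fix s
  assume f: "f \<in> chain_maps A X Y" and g: "g \<in> chain_maps A X Y"
    and s: "\<And>i. s i \<in> mod_hom A (obj X i) (obj Y (i - 1))"
    and e: "\<And>i x. x \<in> carrier (obj X i) \<Longrightarrow>
           f i x = g i x \<oplus>\<^bsub>obj Y i\<^esub> (dif Y (i - 1) (s i x) \<oplus>\<^bsub>obj Y i\<^esub> s (i + 1) (dif X i x))"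
    and c: "\<And>i x. x \<in> carrier (obj X i) \<Longrightarrow> dif Y (i - 1) (s i x) \<in> carrier (obj Y i)"
    "\<And>i x. x \<in> carrier (obj X i) \<Longrightarrow> s (i + 1) (dif X i x) \<in> carrier (obj Y i)"
  show ?thesis
    using assms(2)
  proof (rule homotopicE)
    fix t
    assume h: "h \<in> chain_maps A X Y"
      and t: "\<And>i. t i \<in> mod_hom A (obj X i) (obj Y (i - 1))"
      and e': "\<And>i x. x \<in> carrier (obj X i) \<Longrightarrow>
           g i x = h i x \<oplus>\<^bsub>obj Y i\<^esub> (dif Y (i - 1) (t i x) \<oplus>\<^bsub>obj Y i\<^esub> t (i + 1) (dif X i x))"
      and c': "\<And>i x. x \<in> carrier (obj X i) \<Longrightarrow> dif Y (i - 1) (t i x) \<in> carrier (obj Y i)"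
      "\<And>i x. x \<in> carrier (obj X i) \<Longrightarrow> t (i + 1) (dif X i x) \<in> carrier (obj Y i)"
    show ?thesis
    proof (rule homotopicI[OF f h, of "\<lambda>i. \<lambda>x\<in>carrier (obj X i). s i x \<oplus>\<^bsub>obj Y (i - 1)\<^esub> t i x"])
      fix i x assume x: "x \<in> carrier (obj X i)"
      have "dif Y (i - 1) (s i x \<oplus>\<^bsub>obj Y (i - 1)\<^esub> t i x) =
          dif Y (i - 1) (s i x) \<oplus>\<^bsub>obj Y i\<^esub> dif Y (i - 1) (t i x)"
        by (rule mod_hom_add[OF Y.dif_pred_hom mod_hom_closed[OF s x] mod_hom_closed[OF t x]])
      then show "f i x = h i x \<oplus>\<^bsub>obj Y i\<^esub>
        (dif Y (i - 1) ((\<lambda>x\<in>carrier (obj X i). s i x \<oplus>\<^bsub>obj Y (i - 1)\<^esub> t i x) x) \<oplus>\<^bsub>obj Y i\<^esub>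
         (\<lambda>x\<in>carrier (obj X (i + 1)). s (i + 1) x \<oplus>\<^bsub>obj Y (i + 1 - 1)\<^esub> t (i + 1) x) (dif X i x))"
        using x c[OF x] c'[OF x] chain_map_closed[OF h x]
        by (simp add: X.dif_closed e[OF x] e'[OF x] YM.M.a_ac)
    qed (rule mod_hom_plus[OF s t X.obj_module Y.obj_module])
  qed
qed

lemma equiv_homotopic: "equiv (chain_maps A X Y) (homotopic A X Y)"
proof (rule equivI)
  show "homotopic A X Y \<subseteq> chain_maps A X Y \<times> chain_maps A X Y" by (auto simp: homotopic_def)
  show "refl_on (chain_maps A X Y) (homotopic A X Y)"
    by (auto intro!: refl_onI homotopic_refl)
  show "sym (homotopic A X Y)" by (auto intro: symI homotopic_sym)
  show "trans (homotopic A X Y)" by (auto intro: transI homotopic_trans)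
qed

lemma k_class_eq_iff:
  assumes "f \<in> chain_maps A X Y" "g \<in> chain_maps A X Y"
  shows "k_class A X Y f = k_class A X Y g \<longleftrightarrow> (f, g) \<in> homotopic A X Y"
  unfolding k_class_def using equiv_homotopic assms by (simp add: equiv_class_eq_iff)

lemma k_classI:
  assumes "(f, g) \<in> homotopic A X Y" shows "k_class A X Y f = k_class A X Y g"
  unfolding k_class_def by (rule equiv_class_eq[OF equiv_homotopic assms])

lemma mem_k_class: "g \<in> k_class A X Y f \<longleftrightarrow> (f, g) \<in> homotopic A X Y"
  by (simp add: k_class_def)

lemma khom_iff: "F \<in> khom A X Y \<longleftrightarrow> (\<exists>f\<in>chain_maps A X Y. F = k_class A X Y f)"
  unfolding khom_def k_class_def by (auto simp: quotient_def)

text \<open>\<open>k_add\<close> is a union over all representatives. Homotopic summands have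
  homotopic sums, so all members of the union coincide.\<close>

lemma k_add_class:
  assumes f: "f \<in> chain_maps A X Y" and g: "g \<in> chain_maps A X Y"
  shows "k_add A X Y (k_class A X Y f) (k_class A X Y g) = k_class A X Y (ch_add X Y f g)"
proof -
  have "k_class A X Y (ch_add X Y f' g') = k_class A X Y (ch_add X Y f g)"
    if "f' \<in> k_class A X Y f" "g' \<in> k_class A X Y g" for f' g'
    using that by (intro k_classI homotopic_add) (auto simp: mem_k_class intro: homotopic_sym)
  moreover have "f \<in> k_class A X Y f" "g \<in> k_class A X Y g"
    by (simp_all add: mem_k_class homotopic_refl f g)
  ultimately show ?thesis unfolding k_add_def by blast
qed

end

context
  fixes A :: "'a ring" and X :: "('a, 'm) cochain" and Y :: "('a, 'n) cochain"
    and Z :: "('a, 'o) cochain"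
  assumes X: "mod_complex A X" and Y: "mod_complex A Y" and Z: "mod_complex A Z"
begin

interpretation X: mod_complex A X by (rule X)
interpretation Y: mod_complex A Y by (rule Y)
interpretation Z: mod_complex A Z by (rule Z)
interpretation ZM: right_module A "obj Z i" for i by (rule Z.obj_module)

text \<open>\<open>g\<close> commutes with the differentials, so following the homotopy by
  \<open>g\<close> in degree i - 1 gives a homotopy of the composites.\<close>

lemma homotopic_comp_left:
  assumes "(f, f') \<in> homotopic A X Y" and g: "g \<in> chain_maps A Y Z"
  shows "(ch_comp X g f, ch_comp X g f') \<in> homotopic A X Z"
  using X Y assms(1)
proof (rule homotopicE)
  fix s
  assume f: "f \<in> chain_maps A X Y" and f': "f' \<in> chain_maps A X Y"
    and s: "\<And>i. s i \<in> mod_hom A (obj X i) (obj Y (i - 1))"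
    and e: "\<And>i x. x \<in> carrier (obj X i) \<Longrightarrow>
           f i x = f' i x \<oplus>\<^bsub>obj Y i\<^esub> (dif Y (i - 1) (s i x) \<oplus>\<^bsub>obj Y i\<^esub> s (i + 1) (dif X i x))"
    and c: "\<And>i x. x \<in> carrier (obj X i) \<Longrightarrow> dif Y (i - 1) (s i x) \<in> carrier (obj Y i)"
    "\<And>i x. x \<in> carrier (obj X i) \<Longrightarrow> s (i + 1) (dif X i x) \<in> carrier (obj Y i)"
  interpret YM: right_module A "obj Y i" for i by (rule Y.obj_module)
  show ?thesis
  proof (rule homotopicI[OF X Z ch_comp_chain_map[OF X f g] ch_comp_chain_map[OF X f' g],
        of "\<lambda>i. compose (carrier (obj X i)) (g (i - 1)) (s i)"])
    fix i x assume x: "x \<in> carrier (obj X i)"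
    have "dif Z (i - 1) (g (i - 1) (s i x)) = g i (dif Y (i - 1) (s i x))"
      using chain_map_dif_pred[OF g mod_hom_closed[OF s x]] by simp
    then show "ch_comp X g f i x = ch_comp X g f' i x \<oplus>\<^bsub>obj Z i\<^esub>
        (dif Z (i - 1) (compose (carrier (obj X i)) (g (i - 1)) (s i) x) \<oplus>\<^bsub>obj Z i\<^esub>
         compose (carrier (obj X (i + 1))) (g (i + 1 - 1)) (s (i + 1)) (dif X i x))"
      using x c[OF x] chain_map_closed[OF f' x]
      by (simp add: ch_comp_def compose_def X.dif_closed e[OF x] mod_hom_add[OF chain_map_hom[OF g]])
  qed (rule mod_hom_compose[OF s chain_map_hom[OF g] X.obj_module])
qed

lemma homotopic_comp_right:
  assumes f: "f \<in> chain_maps A X Y" and "(g, g') \<in> homotopic A Y Z"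
  shows "(ch_comp X g f, ch_comp X g' f) \<in> homotopic A X Z"
  using Y Z assms(2)
proof (rule homotopicE)
  fix s
  assume g: "g \<in> chain_maps A Y Z" and g': "g' \<in> chain_maps A Y Z"
    and s: "\<And>i. s i \<in> mod_hom A (obj Y i) (obj Z (i - 1))"
    and e: "\<And>i x. x \<in> carrier (obj Y i) \<Longrightarrow>
           g i x = g' i x \<oplus>\<^bsub>obj Z i\<^esub> (dif Z (i - 1) (s i x) \<oplus>\<^bsub>obj Z i\<^esub> s (i + 1) (dif Y i x))"
  show ?thesis
  proof (rule homotopicI[OF X Z ch_comp_chain_map[OF X f g] ch_comp_chain_map[OF X f g'],
        of "\<lambda>i. compose (carrier (obj X i)) (s i) (f i)"])
    fix i x assume x: "x \<in> carrier (obj X i)"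
    show "ch_comp X g f i x = ch_comp X g' f i x \<oplus>\<^bsub>obj Z i\<^esub>
        (dif Z (i - 1) (compose (carrier (obj X i)) (s i) (f i) x) \<oplus>\<^bsub>obj Z i\<^esub>
         compose (carrier (obj X (i + 1))) (s (i + 1)) (f (i + 1)) (dif X i x))"
      using x chain_map_closed[OF f x]
      by (simp add: ch_comp_def compose_def X.dif_closed e chain_map_dif[OF f])
  qed (rule mod_hom_compose[OF chain_map_hom[OF f] s X.obj_module])
qed

text \<open>Both representatives may change; the two one-sided invariances are chained through the
  composite of the old \<open>g\<close> with the new \<open>f'\<close>.\<close>

lemma k_comp_class:
  assumes f: "f \<in> chain_maps A X Y" and g: "g \<in> chain_maps A Y Z"
  shows "k_comp A X Z (k_class A Y Z g) (k_class A X Y f) = k_class A X Z (ch_comp X g f)"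
proof -
  have "k_class A X Z (ch_comp X g' f') = k_class A X Z (ch_comp X g f)"
    if "f' \<in> k_class A X Y f" "g' \<in> k_class A Y Z g" for f' g'
  proof -
    have fg: "(f, f') \<in> homotopic A X Y" "(g, g') \<in> homotopic A Y Z"
      using that by (simp_all add: k_class_def)
    then have "f' \<in> chain_maps A X Y" by (simp add: homotopic_def)
    with fg have "(ch_comp X g f, ch_comp X g' f') \<in> homotopic A X Z"
      by (intro homotopic_trans[OF X Z homotopic_comp_left[OF _ g] homotopic_comp_right])
    then show ?thesis using k_classI[OF X Z] by metis
  qed
  moreover have "f \<in> k_class A X Y f" "g \<in> k_class A Y Z g"
    using homotopic_refl[OF X Y f] homotopic_refl[OF Y Z g] by (simp_all add: k_class_def)
  ultimately show ?thesis unfolding k_comp_def by blast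
qed

end

text \<open>Every ring law already holds for chain maps, degree by degree and as an equality of
  extensional functions; it passes to classes because sums and composites are computed on
  representatives.\<close>

lemma ring_k_end:
  assumes X: "mod_complex A X"
  shows "ring (k_end A X)"
proof -
  interpret X: mod_complex A X by fact
  interpret XM: right_module A "obj X i" for i by (rule X.obj_module)
  let ?c = "k_class A X X" and ?K = "k_end A X" and ?Ch = "chain_maps A X X"
  have E: "\<exists>f\<in>?Ch. F = ?c f" if "F \<in> carrier ?K" for F
    using that khom_iff[OF X X] by (simp add: k_end_def)
  have C: "?c f \<in> carrier ?K" if "f \<in> ?Ch" for f
    using that khom_iff[OF X X] by (auto simp: k_end_def)
  have add: "?c f \<oplus>\<^bsub>?K\<^esub> ?c g = ?c (ch_add X X f g)" if "f \<in> ?Ch" "g \<in> ?Ch" for f g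
    using that by (simp add: k_end_def k_add_class[OF X X])
  have mult: "?c g \<otimes>\<^bsub>?K\<^esub> ?c f = ?c (ch_comp X g f)" if "f \<in> ?Ch" "g \<in> ?Ch" for f g
    using that by (simp add: k_end_def k_comp_class[OF X X X])
  have zero: "\<zero>\<^bsub>?K\<^esub> = ?c (ch_zero X X)" and one: "\<one>\<^bsub>?K\<^esub> = ?c (ch_id X)"
    by (simp_all add: k_end_def k_zero_def k_id_def)
  note ch = ch_add_chain_map[OF X X] ch_comp_chain_map[OF X, of _ X _ X] ch_zero_chain_map[OF X X] X.ch_id_chain_map
  note ev = ch_add_def ch_comp_def ch_zero_def ch_id_def compose_def
  show ?thesis
  proof (rule ringI)
    show "abelian_group ?K"
    proof (rule abelian_groupI)
      fix F G assume "F \<in> carrier ?K" "G \<in> carrier ?K"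
      then obtain f g where fg: "f \<in> ?Ch" "g \<in> ?Ch" "F = ?c f" "G = ?c g" using E by metis
      then show "F \<oplus>\<^bsub>?K\<^esub> G \<in> carrier ?K" by (simp add: add C ch)
      have "ch_add X X f g = ch_add X X g f"
        using fg by (intro chain_map_eqI[of _ A X X _ X] ch)
          (auto simp: ev chain_map_closed intro: XM.M.a_comm)
      with fg show "F \<oplus>\<^bsub>?K\<^esub> G = G \<oplus>\<^bsub>?K\<^esub> F" by (simp add: add)
      fix H assume "H \<in> carrier ?K"
      then obtain h where h: "h \<in> ?Ch" "H = ?c h" using E by metis
      have "ch_add X X (ch_add X X f g) h = ch_add X X f (ch_add X X g h)"
        using fg h by (intro chain_map_eqI[of _ A X X _ X] ch)
          (auto simp: ev chain_map_closed intro: XM.M.a_assoc)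
      with fg h show "F \<oplus>\<^bsub>?K\<^esub> G \<oplus>\<^bsub>?K\<^esub> H = F \<oplus>\<^bsub>?K\<^esub> (G \<oplus>\<^bsub>?K\<^esub> H)" by (simp add: add ch)
    next
      show "\<zero>\<^bsub>?K\<^esub> \<in> carrier ?K" by (simp add: zero C ch)
      fix F assume "F \<in> carrier ?K"
      then obtain f where f: "f \<in> ?Ch" "F = ?c f" using E by metis
      have "ch_add X X (ch_zero X X) f = f"
        using f by (intro chain_map_eqI[of _ A X X _ X] ch) (auto simp: ev chain_map_closed)
      with f show "\<zero>\<^bsub>?K\<^esub> \<oplus>\<^bsub>?K\<^esub> F = F" by (simp add: zero add ch)
      let ?g = "\<lambda>i. \<lambda>x\<in>carrier (obj X i). \<ominus>\<^bsub>obj X i\<^esub> f i x"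
      have g: "?g \<in> ?Ch" by (rule ch_uminus_chain_map[OF X X f(1)])
      have "ch_add X X ?g f = ch_zero X X"
        using f by (intro chain_map_eqI[of _ A X X _ X] ch g)
          (auto simp: ev chain_map_closed XM.M.l_neg)
      then show "\<exists>G\<in>carrier ?K. G \<oplus>\<^bsub>?K\<^esub> F = \<zero>\<^bsub>?K\<^esub>"
        using f g by (intro bexI[of _ "?c ?g"]) (simp_all add: add zero C)
    qed
    show "monoid ?K"
    proof (rule monoidI)
      show "\<one>\<^bsub>?K\<^esub> \<in> carrier ?K" by (simp add: one C ch)
      fix F assume "F \<in> carrier ?K"
      then obtain f where f: "f \<in> ?Ch" "F = ?c f" using E by metis
      have "ch_comp X (ch_id X) f = f" "ch_comp X f (ch_id X) = f"
        using f by (auto intro!: chain_map_eqI[of _ A X X _ X] ch simp: ev chain_map_closed)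
      with f show "\<one>\<^bsub>?K\<^esub> \<otimes>\<^bsub>?K\<^esub> F = F" "F \<otimes>\<^bsub>?K\<^esub> \<one>\<^bsub>?K\<^esub> = F" by (simp_all add: one mult ch)
      fix G assume "G \<in> carrier ?K"
      then obtain g where g: "g \<in> ?Ch" "G = ?c g" using E by metis
      with f show "F \<otimes>\<^bsub>?K\<^esub> G \<in> carrier ?K" by (simp add: mult C ch)
      fix H assume "H \<in> carrier ?K"
      then obtain h where h: "h \<in> ?Ch" "H = ?c h" using E by metis
      have "ch_comp X (ch_comp X f g) h = ch_comp X f (ch_comp X g h)"
        using f g h by (intro chain_map_eqI[of _ A X X _ X] ch) (auto simp: ev chain_map_closed)
      with f g h show "F \<otimes>\<^bsub>?K\<^esub> G \<otimes>\<^bsub>?K\<^esub> H = F \<otimes>\<^bsub>?K\<^esub> (G \<otimes>\<^bsub>?K\<^esub> H)" by (simp add: mult ch)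
    qed
    fix F G H assume "F \<in> carrier ?K" "G \<in> carrier ?K" "H \<in> carrier ?K"
    then obtain f g h where fgh: "f \<in> ?Ch" "F = ?c f" "g \<in> ?Ch" "G = ?c g" "h \<in> ?Ch" "H = ?c h"
      using E by metis
    have "ch_comp X (ch_add X X f g) h = ch_add X X (ch_comp X f h) (ch_comp X g h)"
      "ch_comp X h (ch_add X X f g) = ch_add X X (ch_comp X h f) (ch_comp X h g)"
      using fgh
      by (auto intro!: chain_map_eqI[of _ A X X _ X] ch
          simp: ev chain_map_closed mod_hom_add[OF chain_map_hom[OF fgh(5)]])
    with fgh show "(F \<oplus>\<^bsub>?K\<^esub> G) \<otimes>\<^bsub>?K\<^esub> H = F \<otimes>\<^bsub>?K\<^esub> H \<oplus>\<^bsub>?K\<^esub> G \<otimes>\<^bsub>?K\<^esub> H"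
      "H \<otimes>\<^bsub>?K\<^esub> (F \<oplus>\<^bsub>?K\<^esub> G) = H \<otimes>\<^bsub>?K\<^esub> F \<oplus>\<^bsub>?K\<^esub> H \<otimes>\<^bsub>?K\<^esub> G"
      by (simp_all add: add mult ch)
  qed
qed

section \<open>Maps from the regular module\<close>

definition cocycles :: "('a, 'm) cochain \<Rightarrow> int \<Rightarrow> 'm set" where
  "cocycles X i = {z \<in> carrier (obj X i). dif X i z = \<zero>\<^bsub>obj X (i + 1)\<^esub>}"

definition coboundaries :: "('a, 'm) cochain \<Rightarrow> int \<Rightarrow> 'm set" where
  "coboundaries X i = dif X (i - 1) ` carrier (obj X (i - 1))"

context mod_complex
begin

lemma coboundaries_subset: "coboundaries X i \<subseteq> cocycles X i"
  using mod_hom_closed[OF dif_pred_hom] by (auto simp: coboundaries_def cocycles_def dif_pred_dif)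

lemma cocycles_carrier: "z \<in> cocycles X i \<Longrightarrow> z \<in> carrier (obj X i)"
  by (simp add: cocycles_def)

lemma cocycles_closed:
  shows "\<zero>\<^bsub>obj X i\<^esub> \<in> cocycles X i"
    and "\<lbrakk>z \<in> cocycles X i; z' \<in> cocycles X i\<rbrakk> \<Longrightarrow> z \<oplus>\<^bsub>obj X i\<^esub> z' \<in> cocycles X i"
    and "z \<in> cocycles X i \<Longrightarrow> \<ominus>\<^bsub>obj X i\<^esub> z \<in> cocycles X i"
    and "\<lbrakk>a \<in> carrier A; z \<in> cocycles X i\<rbrakk> \<Longrightarrow> a \<odot>\<^bsub>obj X i\<^esub> z \<in> cocycles X i"
proof -
  interpret M: right_module A "obj X i" by (rule obj_module)
  interpret N: right_module A "obj X (i + 1)" by (rule obj_module)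
  show "\<zero>\<^bsub>obj X i\<^esub> \<in> cocycles X i"
    by (simp add: cocycles_def mod_hom_zero[OF dif_hom obj_group obj_group])
  show "z \<oplus>\<^bsub>obj X i\<^esub> z' \<in> cocycles X i" if "z \<in> cocycles X i" "z' \<in> cocycles X i"
    using that by (simp add: cocycles_def mod_hom_add[OF dif_hom])
  show "\<ominus>\<^bsub>obj X i\<^esub> z \<in> cocycles X i" if "z \<in> cocycles X i"
    using that by (simp add: cocycles_def mod_hom_minus[OF dif_hom obj_group obj_group])
  show "a \<odot>\<^bsub>obj X i\<^esub> z \<in> cocycles X i" if "a \<in> carrier A" "z \<in> cocycles X i"
    using that by (simp add: cocycles_def mod_hom_smult[OF dif_hom])
qed

lemma coboundaries_closed:
  shows "\<zero>\<^bsub>obj X i\<^esub> \<in> coboundaries X i"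
    and "\<lbrakk>z \<in> coboundaries X i; z' \<in> coboundaries X i\<rbrakk> \<Longrightarrow> z \<oplus>\<^bsub>obj X i\<^esub> z' \<in> coboundaries X i"
    and "z \<in> coboundaries X i \<Longrightarrow> \<ominus>\<^bsub>obj X i\<^esub> z \<in> coboundaries X i"
    and "\<lbrakk>a \<in> carrier A; z \<in> coboundaries X i\<rbrakk> \<Longrightarrow> a \<odot>\<^bsub>obj X i\<^esub> z \<in> coboundaries X i"
proof -
  interpret M: right_module A "obj X i" by (rule obj_module)
  interpret N: right_module A "obj X (i - 1)" by (rule obj_module)
  have I: "dif X (i - 1) w \<in> coboundaries X i" if "w \<in> carrier (obj X (i - 1))" for w
    using that by (simp add: coboundaries_def)
  have E: "\<exists>w\<in>carrier (obj X (i - 1)). z = dif X (i - 1) w" if "z \<in> coboundaries X i" for z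
    using that by (auto simp: coboundaries_def)
  show "\<zero>\<^bsub>obj X i\<^esub> \<in> coboundaries X i"
    using I[of "\<zero>\<^bsub>obj X (i - 1)\<^esub>"] by (simp add: mod_hom_zero[OF dif_pred_hom obj_group obj_group])
  show "z \<oplus>\<^bsub>obj X i\<^esub> z' \<in> coboundaries X i" if "z \<in> coboundaries X i" "z' \<in> coboundaries X i"
    using E[OF that(1)] E[OF that(2)] I
    by (metis N.M.a_closed mod_hom_add[OF dif_pred_hom])
  show "\<ominus>\<^bsub>obj X i\<^esub> z \<in> coboundaries X i" if "z \<in> coboundaries X i"
    using E[OF that] I
    by (metis N.M.a_inv_closed mod_hom_minus[OF dif_pred_hom obj_group obj_group])
  show "a \<odot>\<^bsub>obj X i\<^esub> z \<in> coboundaries X i" if "a \<in> carrier A" "z \<in> coboundaries X i"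
    using E[OF that(2)] I that(1)
    by (metis N.smult_closed mod_hom_smult[OF dif_pred_hom])
qed

text \<open>The action on a coset is a union over its members, which equals the zero coset iff every
  member is sent into the coboundaries. This brings the annihilator to the form in which
  \<open>algebra_iso_action\<close> asks for it.\<close>

lemma annihilator_cohomology:
  "annihilator A (smult (cohomology X i)) (cohomology X i) =
     {a \<in> carrier A. \<forall>z\<in>cocycles X i. a \<odot>\<^bsub>obj X i\<^esub> z \<in> coboundaries X i}"
proof -
  interpret M: right_module A "obj X i" by (rule obj_module)
  let ?B = "coboundaries X i" and ?Z = "cocycles X i" and ?M = "obj X i"
  have BZ: "?B \<subseteq> ?Z" by (rule coboundaries_subset)
  have BM: "?B \<subseteq> carrier ?M" using BZ cocycles_carrier by blast
  have "subgroup ?B (add_monoid ?M)"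
    using BM coboundaries_closed(1)[of i] coboundaries_closed(2,3) by (intro M.M.add.subgroupI) (auto simp: a_inv_def)
  then interpret B: abelian_subgroup ?B ?M
    by (intro abelian_subgroupI3 additive_subgroupI M.M.abelian_group_axioms)
  have zero: "\<zero>\<^bsub>cohomology X i\<^esub> = ?B" and car: "carrier (cohomology X i) = (\<lambda>x. ?B +>\<^bsub>?M\<^esub> x) ` ?Z"
    and smult: "a \<odot>\<^bsub>cohomology X i\<^esub> C = (\<Union>x\<in>C. ?B +>\<^bsub>?M\<^esub> (a \<odot>\<^bsub>?M\<^esub> x))" for a C
    by (simp_all add: cohomology_def Let_def cocycles_def coboundaries_def)
  have self: "x \<in> ?B +>\<^bsub>?M\<^esub> x" if "x \<in> carrier ?M" for x
    using that by (rule B.a_rcos_self)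
  have const: "?B +>\<^bsub>?M\<^esub> x = ?B" if "x \<in> ?B" for x
    using that by (rule B.a_rcos_const)
  have "(\<forall>C\<in>carrier (cohomology X i). a \<odot>\<^bsub>cohomology X i\<^esub> C = ?B) \<longleftrightarrow> (\<forall>z\<in>?Z. a \<odot>\<^bsub>?M\<^esub> z \<in> ?B)"
    if a: "a \<in> carrier A" for a
  proof
    assume L: "\<forall>C\<in>carrier (cohomology X i). a \<odot>\<^bsub>cohomology X i\<^esub> C = ?B"
    show "\<forall>z\<in>?Z. a \<odot>\<^bsub>?M\<^esub> z \<in> ?B"
    proof
      fix z assume z: "z \<in> ?Z"
      then have "(\<Union>x\<in>?B +>\<^bsub>?M\<^esub> z. ?B +>\<^bsub>?M\<^esub> (a \<odot>\<^bsub>?M\<^esub> x)) = ?B"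
        using L by (auto simp: car smult)
      moreover have "z \<in> ?B +>\<^bsub>?M\<^esub> z" "a \<odot>\<^bsub>?M\<^esub> z \<in> ?B +>\<^bsub>?M\<^esub> (a \<odot>\<^bsub>?M\<^esub> z)"
        using a cocycles_carrier[OF z] by (auto intro: self)
      ultimately show "a \<odot>\<^bsub>?M\<^esub> z \<in> ?B" by blast
    qed
  next
    assume Rt: "\<forall>z\<in>?Z. a \<odot>\<^bsub>?M\<^esub> z \<in> ?B"
    show "\<forall>C\<in>carrier (cohomology X i). a \<odot>\<^bsub>cohomology X i\<^esub> C = ?B"
    proof
      fix C assume "C \<in> carrier (cohomology X i)"
      then obtain z where z: "z \<in> ?Z" "C = ?B +>\<^bsub>?M\<^esub> z" by (auto simp: car)
      \<comment> \<open>Coboundaries are cocycles, so a coset of a cocycle consists of cocycles and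
        the assumption covers each \<open>x\<close> in the union.\<close>
      have "x \<in> ?Z" if "x \<in> C" for x
        using that z BZ cocycles_closed(2) by (auto simp: a_r_coset_def')
      then have "?B +>\<^bsub>?M\<^esub> (a \<odot>\<^bsub>?M\<^esub> x) = ?B" if "x \<in> C" for x
        using Rt that const by blast
      moreover have "z \<in> C" using z self cocycles_carrier by blast
      ultimately show "a \<odot>\<^bsub>cohomology X i\<^esub> C = ?B" unfolding smult by blast
    qed
  qed
  then show ?thesis by (auto simp: annihilator_def zero)
qed

lemma ideal_annihilator_cohomology:
  "ideal (annihilator A (smult (cohomology X i)) (cohomology X i)) A"
proof -
  interpret M: right_module A "obj X i" by (rule obj_module)
  note cl = coboundaries_closed cocycles_closed cocycles_carrier
  show ?thesis
    unfolding annihilator_cohomology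
  proof (rule idealI[OF ring_axioms])
    show "subgroup {a \<in> carrier A. \<forall>z\<in>cocycles X i. a \<odot>\<^bsub>obj X i\<^esub> z \<in> coboundaries X i} (add_monoid A)"
      by (rule M.R.add.subgroupI)
        (auto simp: cl M.smult_l_distr M.smult_l_minus a_inv_def[symmetric] intro!: exI[of _ "\<zero>\<^bsub>A\<^esub>"])
  qed (auto simp: cl M.smult_assoc)
qed

end

lemma stalk_obj: "obj (stalk M) i = (if i = 0 then M else M\<lparr>carrier := {\<zero>\<^bsub>M\<^esub>}\<rparr>)"
  and stalk_dif: "dif (stalk M) i = (\<lambda>x\<in>carrier (obj (stalk M) i). \<zero>\<^bsub>M\<^esub>)"
  by (simp_all add: stalk_def Let_def)

lemma right_module_trivial:
  assumes "right_module A M"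
  shows "right_module A (M\<lparr>carrier := {\<zero>\<^bsub>M\<^esub>}\<rparr>)"
proof -
  interpret M: right_module A M by fact
  have "abelian_group (M\<lparr>carrier := {\<zero>\<^bsub>M\<^esub>}\<rparr>)"
    by (rule abelian_groupI) auto
  then show ?thesis
    by (rule right_moduleI[OF M.R.ring_axioms]) auto
qed

lemma stalk_complex:
  assumes M: "right_module A M"
  shows "mod_complex A (stalk M)"
proof -
  interpret M: right_module A M by fact
  have obj: "right_module A (obj (stalk M) i)" for i
    using M right_module_trivial[OF M] by (simp add: stalk_obj)
  have "dif (stalk M) i = (\<lambda>x\<in>carrier (obj (stalk M) i). \<zero>\<^bsub>obj (stalk M) (i + 1)\<^esub>)" for i
    by (simp add: stalk_dif stalk_obj)
  then have dif: "dif (stalk M) i \<in> mod_hom A (obj (stalk M) i) (obj (stalk M) (i + 1))" for i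
    using mod_hom_zero_map[OF obj obj] by simp
  show ?thesis
    by (rule mod_complex.intro[OF obj dif]) (simp add: stalk_dif stalk_obj)
qed

abbreviation regular_stalk :: "'a ring \<Rightarrow> ('a, 'a) cochain" where
  "regular_stalk A \<equiv> stalk (regular A)"

text \<open>\<open>N\<close> is an arbitrary family because the lemma serves two purposes: with the
  terms of X it gives the chain map of an element, with the terms of X moved down by one degree it
  gives a homotopy.\<close>

lemma mod_hom_from_stalk:
  assumes N: "\<And>i. right_module A (N i)" and z: "z \<in> carrier (N 0)"
  shows "(\<lambda>x\<in>carrier (obj (regular_stalk A) i). if i = 0 then x \<odot>\<^bsub>N i\<^esub> z else \<zero>\<^bsub>N i\<^esub>)
    \<in> mod_hom A (obj (regular_stalk A) i) (N i)"
proof -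
  interpret N: right_module A "N i" for i by (rule N)
  show ?thesis
    using z by (intro mod_homI) (auto simp: stalk_obj regular_def mk_module_def N.smult_l_distr
        N.smult_assoc split: if_splits)
qed

text \<open>The map out of the free module on one generator that sends 1 to \<open>z\<close>,
  extended by zero to the other degrees of the stalk complex.\<close>

definition elt_map :: "'a ring \<Rightarrow> ('a, 'm) cochain \<Rightarrow> 'm \<Rightarrow> int \<Rightarrow> 'a \<Rightarrow> 'm" where
  "elt_map A X z i = (\<lambda>x\<in>carrier (obj (regular_stalk A) i).
     if i = 0 then x \<odot>\<^bsub>obj X i\<^esub> z else \<zero>\<^bsub>obj X i\<^esub>)"

definition elt_class :: "'a ring \<Rightarrow> ('a, 'm) cochain \<Rightarrow> 'm \<Rightarrow> (int \<Rightarrow> 'a \<Rightarrow> 'm) set" where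
  "elt_class A X z = k_class A (regular_stalk A) X (elt_map A X z)"

context mod_complex
begin

lemma regular_stalk_complex: "mod_complex A (regular_stalk A)"
  by (rule stalk_complex[OF right_module_regular[OF ring_axioms]])

lemma elt_map_chain_map:
  assumes z: "z \<in> cocycles X 0"
  shows "elt_map A X z \<in> chain_maps A (regular_stalk A) X"
  unfolding elt_map_def
proof (rule chain_mapsI)
  interpret M: right_module A "obj X i" for i by (rule obj_module)
  have zc: "z \<in> carrier (obj X 0)" "dif X 0 z = \<zero>\<^bsub>obj X 1\<^esub>" using z by (simp_all add: cocycles_def)
  show "(\<lambda>x\<in>carrier (obj (regular_stalk A) i). if i = 0 then x \<odot>\<^bsub>obj X i\<^esub> z else \<zero>\<^bsub>obj X i\<^esub>)
      \<in> mod_hom A (obj (regular_stalk A) i) (obj X i)" for i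
    by (rule mod_hom_from_stalk[of A "obj X" z, OF obj_module zc(1)])
  fix i x assume x: "x \<in> carrier (obj (regular_stalk A) i)"
  show "(\<lambda>x\<in>carrier (obj (regular_stalk A) (i + 1)). if i + 1 = 0 then x \<odot>\<^bsub>obj X (i + 1)\<^esub> z else \<zero>\<^bsub>obj X (i + 1)\<^esub>)
      (dif (regular_stalk A) i x) =
    dif X i ((\<lambda>x\<in>carrier (obj (regular_stalk A) i). if i = 0 then x \<odot>\<^bsub>obj X i\<^esub> z else \<zero>\<^bsub>obj X i\<^esub>) x)"
    using x zc mod_hom_smult[OF dif_hom[of 0]]
    by (auto simp: stalk_dif stalk_obj regular_def mk_module_def mod_hom_zero[OF dif_hom obj_group obj_group])
qed

text \<open>Linearity determines f in degree 0 by its value at 1, and the other degrees of the stalk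
  are zero. The value is a cocycle because the differential of the stalk vanishes.\<close>

lemma chain_map_from_stalk:
  assumes f: "f \<in> chain_maps A (regular_stalk A) X"
  shows "f 0 \<one>\<^bsub>A\<^esub> \<in> cocycles X 0" "f = elt_map A X (f 0 \<one>\<^bsub>A\<^esub>)"
proof -
  interpret A: ring A by (rule ring_axioms)
  interpret S: mod_complex A "regular_stalk A" by (rule regular_stalk_complex)
  have S0: "carrier (obj (regular_stalk A) 0) = carrier A" by (simp add: stalk_obj regular_def)
  have Sz: "\<zero>\<^bsub>obj (regular_stalk A) i\<^esub> = \<zero>\<^bsub>A\<^esub>" for i by (simp add: stalk_obj regular_def)
  have fz: "f i \<zero>\<^bsub>A\<^esub> = \<zero>\<^bsub>obj X i\<^esub>" for i
    using mod_hom_zero[OF chain_map_hom[OF f] S.obj_group obj_group] by (simp add: Sz)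
  show Z: "f 0 \<one>\<^bsub>A\<^esub> \<in> cocycles X 0"
    using chain_map_closed[OF f, of "\<one>\<^bsub>A\<^esub>" 0] chain_map_dif[OF f, of "\<one>\<^bsub>A\<^esub>" 0] fz[of 1]
    by (simp add: S0 cocycles_def stalk_dif) (simp add: regular_def)
  show "f = elt_map A X (f 0 \<one>\<^bsub>A\<^esub>)"
  proof (rule chain_map_eqI[OF f elt_map_chain_map[OF Z]])
    fix i x assume x: "x \<in> carrier (obj (regular_stalk A) i)"
    show "f i x = elt_map A X (f 0 \<one>\<^bsub>A\<^esub>) i x"
    proof (cases "i = 0")
      case True
      then have "x \<in> carrier A" using x by (simp add: S0)
      then show ?thesis
        using mod_hom_smult[OF chain_map_hom[OF f, of 0], of x "\<one>\<^bsub>A\<^esub>"] True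
        by (simp add: elt_map_def stalk_obj regular_def)
    next
      case False
      then have "x = \<zero>\<^bsub>A\<^esub>" using x by (simp add: stalk_obj regular_def)
      then show ?thesis using False x fz by (simp add: elt_map_def)
    qed
  qed
qed

text \<open>A homotopy out of the stalk lives in degree 0 only, where it is given by the image w of
  1 in degree -1 of X; it changes \<open>z\<close> by the differential of w. Hence Hom(A, X) is the
  cohomology of X in degree 0.\<close>

lemma elt_class_eq_iff:
  assumes z: "z \<in> cocycles X 0" and z': "z' \<in> cocycles X 0"
  shows "elt_class A X z = elt_class A X z' \<longleftrightarrow> (\<exists>b\<in>coboundaries X 0. z = z' \<oplus>\<^bsub>obj X 0\<^esub> b)"
proof -
  interpret M: right_module A "obj X i" for i by (rule obj_module)
  interpret S: mod_complex A "regular_stalk A" by (rule regular_stalk_complex)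
  let ?S = "regular_stalk A"
  have zc: "z \<in> carrier (obj X 0)" "z' \<in> carrier (obj X 0)" using z z' cocycles_carrier by auto
  have S0: "carrier (obj ?S 0) = carrier A" by (simp add: stalk_obj regular_def)
  have "elt_class A X z = elt_class A X z' \<longleftrightarrow> (elt_map A X z, elt_map A X z') \<in> homotopic A ?S X"
    unfolding elt_class_def
    by (rule k_class_eq_iff[OF S.mod_complex_axioms mod_complex_axioms elt_map_chain_map[OF z] elt_map_chain_map[OF z']])
  also have "\<dots> \<longleftrightarrow> (\<exists>b\<in>coboundaries X 0. z = z' \<oplus>\<^bsub>obj X 0\<^esub> b)"
  proof
    assume "(elt_map A X z, elt_map A X z') \<in> homotopic A ?S X"
    with S.mod_complex_axioms mod_complex_axioms show "\<exists>b\<in>coboundaries X 0. z = z' \<oplus>\<^bsub>obj X 0\<^esub> b"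
    proof (rule homotopicE)
      fix s
      assume s: "\<And>i. s i \<in> mod_hom A (obj ?S i) (obj X (i - 1))"
        and e: "\<And>i x. x \<in> carrier (obj ?S i) \<Longrightarrow> elt_map A X z i x =
           elt_map A X z' i x \<oplus>\<^bsub>obj X i\<^esub> (dif X (i - 1) (s i x) \<oplus>\<^bsub>obj X i\<^esub> s (i + 1) (dif ?S i x))"
      have s0: "s 0 \<one>\<^bsub>A\<^esub> \<in> carrier (obj X (- 1))"
        using mod_hom_closed[OF s, of "\<one>\<^bsub>A\<^esub>" 0] by (simp add: S0)
      have s1: "s 1 (dif ?S 0 \<one>\<^bsub>A\<^esub>) = \<zero>\<^bsub>obj X 0\<^esub>"
        using mod_hom_zero[OF s[of 1] S.obj_group obj_group] S0
        by (simp add: stalk_dif) (simp add: stalk_obj)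
      have d: "dif X (- 1) (s 0 \<one>\<^bsub>A\<^esub>) \<in> carrier (obj X 0)"
        using dif_closed[OF s0] by simp
      have "z = z' \<oplus>\<^bsub>obj X 0\<^esub> dif X (- 1) (s 0 \<one>\<^bsub>A\<^esub>)"
        using e[of "\<one>\<^bsub>A\<^esub>" 0] zc s1 d S0 by (simp add: elt_map_def)
      then show ?thesis using s0 by (auto simp: coboundaries_def)
    qed
  next
    assume "\<exists>b\<in>coboundaries X 0. z = z' \<oplus>\<^bsub>obj X 0\<^esub> b"
    then obtain w where w: "w \<in> carrier (obj X (- 1))" "z = z' \<oplus>\<^bsub>obj X 0\<^esub> dif X (- 1) w"
      by (auto simp: coboundaries_def)
    have d: "dif X (- 1) w \<in> carrier (obj X 0)"
      using dif_closed[OF w(1)] by simp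
    \<comment> \<open>Conversely, the preimage \<open>w\<close> of the coboundary gives the homotopy
      that sends 1 to \<open>w\<close>.\<close>
    let ?s = "\<lambda>i. \<lambda>x\<in>carrier (obj ?S i). if i = 0 then x \<odot>\<^bsub>obj X (i - 1)\<^esub> w else \<zero>\<^bsub>obj X (i - 1)\<^esub>"
    show "(elt_map A X z, elt_map A X z') \<in> homotopic A ?S X"
    proof (rule homotopicI[OF S.mod_complex_axioms mod_complex_axioms elt_map_chain_map[OF z] elt_map_chain_map[OF z'], of ?s])
      show "?s i \<in> mod_hom A (obj ?S i) (obj X (i - 1))" for i
        using w by (intro mod_hom_from_stalk obj_module) simp
      fix i x assume x: "x \<in> carrier (obj ?S i)"
      have dx: "dif ?S i x \<in> carrier (obj ?S (i + 1))" "dif ?S i x = \<zero>\<^bsub>A\<^esub>"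
        using S.dif_closed[OF x] x by (auto simp: stalk_dif regular_def)
      show "elt_map A X z i x = elt_map A X z' i x \<oplus>\<^bsub>obj X i\<^esub>
          (dif X (i - 1) (?s i x) \<oplus>\<^bsub>obj X i\<^esub> ?s (i + 1) (dif ?S i x))"
      proof (cases "i = 0")
        case True
        then show ?thesis
          using x zc w d dx mod_hom_smult[OF dif_hom[of "- 1"], of x w]
          by (simp add: elt_map_def S0 M.smult_r_distr)
      next
        case False
        \<comment> \<open>Degree -1 is special: there \<open>?s (i + 1)\<close> takes its nonzero
          branch, but it is applied to the zero element.\<close>
        then show ?thesis
          using x w dx
          by (cases "i = - 1") (auto simp: elt_map_def mod_hom_zero[OF dif_pred_hom obj_group obj_group]
              mod_hom_zero[OF dif_pred_hom[of "- 1"] obj_group obj_group, simplified])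
      qed
    qed
  qed
  finally show ?thesis .
qed

lemma khom_regular_stalk: "khom A (regular_stalk A) X = elt_class A X ` cocycles X 0"
proof -
  have "F \<in> khom A (regular_stalk A) X \<longleftrightarrow> F \<in> elt_class A X ` cocycles X 0" for F
  proof
    assume "F \<in> khom A (regular_stalk A) X"
    then obtain f where f: "f \<in> chain_maps A (regular_stalk A) X" "F = k_class A (regular_stalk A) X f"
      using khom_iff[OF regular_stalk_complex mod_complex_axioms] by blast
    then have "F = elt_class A X (f 0 \<one>\<^bsub>A\<^esub>)"
      unfolding elt_class_def using chain_map_from_stalk(2)[OF f(1)] by simp
    then show "F \<in> elt_class A X ` cocycles X 0" using chain_map_from_stalk(1)[OF f(1)] by blast
  next
    assume "F \<in> elt_class A X ` cocycles X 0"
    then show "F \<in> khom A (regular_stalk A) X"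
      using khom_iff[OF regular_stalk_complex mod_complex_axioms] elt_map_chain_map
      by (auto simp: elt_class_def)
  qed
  then show ?thesis by blast
qed

lemma carrier_khom_module: "carrier (khom_module A X) = elt_class A X ` cocycles X 0"
  by (simp add: khom_module_def Let_def khom_regular_stalk)

lemma zero_khom_module: "\<zero>\<^bsub>khom_module A X\<^esub> = elt_class A X \<zero>\<^bsub>obj X 0\<^esub>"
proof -
  interpret M: right_module A "obj X i" for i by (rule obj_module)
  have "ch_zero (regular_stalk A) X = elt_map A X \<zero>\<^bsub>obj X 0\<^esub>"
    by (rule chain_map_eqI[OF ch_zero_chain_map[OF regular_stalk_complex mod_complex_axioms]
          elt_map_chain_map[OF cocycles_closed(1)]])
      (auto simp: ch_zero_def elt_map_def stalk_obj regular_def)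
  then show ?thesis by (simp add: khom_module_def Let_def k_zero_def elt_class_def)
qed

lemma add_khom_module:
  assumes z: "z \<in> cocycles X 0" and z': "z' \<in> cocycles X 0"
  shows "elt_class A X z \<oplus>\<^bsub>khom_module A X\<^esub> elt_class A X z' = elt_class A X (z \<oplus>\<^bsub>obj X 0\<^esub> z')"
proof -
  interpret M: right_module A "obj X i" for i by (rule obj_module)
  note S = regular_stalk_complex mod_complex_axioms
  note zz = elt_map_chain_map[OF z] elt_map_chain_map[OF z']
  have "ch_add (regular_stalk A) X (elt_map A X z) (elt_map A X z') = elt_map A X (z \<oplus>\<^bsub>obj X 0\<^esub> z')"
    by (rule chain_map_eqI[OF ch_add_chain_map[OF S zz] elt_map_chain_map[OF cocycles_closed(2)[OF z z']]])
      (use cocycles_carrier[OF z] cocycles_carrier[OF z'] in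
        \<open>auto simp: ch_add_def elt_map_def stalk_obj regular_def M.smult_r_distr\<close>)
  then show ?thesis by (simp add: khom_module_def Let_def elt_class_def k_add_class[OF S zz])
qed

text \<open>Left multiplication by \<open>a\<close> sends 1 to \<open>a\<close>, which the chain map
  of \<open>z\<close> sends to \<open>za\<close>; a chain map out of the stalk is known from its
  value at 1.\<close>

lemma smult_khom_module:
  assumes a: "a \<in> carrier A" and z: "z \<in> cocycles X 0"
  shows "a \<odot>\<^bsub>khom_module A X\<^esub> elt_class A X z = elt_class A X (a \<odot>\<^bsub>obj X 0\<^esub> z)"
proof -
  interpret M: right_module A "obj X i" for i by (rule obj_module)
  interpret S: mod_complex A "regular_stalk A" by (rule regular_stalk_complex)
  note S = regular_stalk_complex
  have l: "lmult A a \<in> chain_maps A (regular_stalk A) (regular_stalk A)"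
    unfolding lmult_def
    by (rule chain_mapsI, rule mod_homI)
      (use a in \<open>auto simp: stalk_obj stalk_dif regular_def mk_module_def M.R.r_distr M.R.m_assoc split: if_splits\<close>)
  have "ch_comp (regular_stalk A) (elt_map A X z) (lmult A a) = elt_map A X (a \<odot>\<^bsub>obj X 0\<^esub> z)"
    by (rule chain_map_eqI[OF ch_comp_chain_map[OF S l elt_map_chain_map[OF z]] elt_map_chain_map[OF cocycles_closed(4)[OF a z]]])
      (use a cocycles_carrier[OF z] in
        \<open>auto simp: ch_comp_def compose_def lmult_def elt_map_def stalk_obj regular_def mk_module_def M.smult_assoc[symmetric]\<close>)
  then show ?thesis
    by (simp add: khom_module_def Let_def elt_class_def
        k_comp_class[OF S S mod_complex_axioms l elt_map_chain_map[OF z]])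
qed

lemma right_module_khom_module: "right_module A (khom_module A X)"
proof -
  interpret M: right_module A "obj X i" for i by (rule obj_module)
  note simps = carrier_khom_module zero_khom_module add_khom_module smult_khom_module
    cocycles_closed cocycles_carrier
  have "abelian_group (khom_module A X)"
  proof (rule abelian_groupI)
    fix F assume "F \<in> carrier (khom_module A X)"
    then obtain z where z: "z \<in> cocycles X 0" "F = elt_class A X z" by (auto simp: simps)
    then show "\<exists>G\<in>carrier (khom_module A X). G \<oplus>\<^bsub>khom_module A X\<^esub> F = \<zero>\<^bsub>khom_module A X\<^esub>"
      by (intro bexI[of _ "elt_class A X (\<ominus>\<^bsub>obj X 0\<^esub> z)"]) (simp_all add: simps M.M.l_neg)
  qed (auto simp: simps M.M.a_ac)
  then show ?thesis
    by (rule right_moduleI[OF ring_axioms])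
      (auto simp: simps M.smult_l_distr M.smult_r_distr M.smult_assoc M.M.a_comm)
qed

text \<open>Postcomposition moves the image of 1 by \<open>t\<close> in degree 0. Both actions of B
  are evaluated through this.\<close>

lemma comp_elt_class:
  assumes Y: "mod_complex A Y" and t: "t \<in> chain_maps A X Y" and z: "z \<in> cocycles X 0"
  shows "t 0 z \<in> cocycles Y 0"
    and "k_comp A (regular_stalk A) Y (k_class A X Y t) (elt_class A X z) = elt_class A Y (t 0 z)"
proof -
  interpret Y: mod_complex A Y by (rule Y)
  interpret M: right_module A "obj X i" for i by (rule obj_module)
  interpret N: right_module A "obj Y i" for i by (rule Y.obj_module)
  note S = regular_stalk_complex
  have "dif X 0 z = \<zero>\<^bsub>obj X 1\<^esub>" using z by (simp add: cocycles_def)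
  then have "dif Y 0 (t 0 z) = \<zero>\<^bsub>obj Y 1\<^esub>"
    using chain_map_dif[OF t cocycles_carrier[OF z]]
      mod_hom_zero[OF chain_map_hom[OF t, of 1] obj_group Y.obj_group] by simp
  then show tz: "t 0 z \<in> cocycles Y 0"
    using chain_map_closed[OF t cocycles_carrier[OF z]] by (simp add: cocycles_def)
  have "ch_comp (regular_stalk A) t (elt_map A X z) = elt_map A Y (t 0 z)"
    by (rule chain_map_eqI[OF ch_comp_chain_map[OF S elt_map_chain_map[OF z] t] Y.elt_map_chain_map[OF tz]])
      (use cocycles_carrier[OF z] mod_hom_zero[OF chain_map_hom[OF t] obj_group Y.obj_group]
         mod_hom_smult[OF chain_map_hom[OF t]] in
        \<open>auto simp: ch_comp_def compose_def elt_map_def stalk_obj regular_def\<close>)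
  then show "k_comp A (regular_stalk A) Y (k_class A X Y t) (elt_class A X z) = elt_class A Y (t 0 z)"
    by (simp add: elt_class_def k_comp_class[OF S mod_complex_axioms Y elt_map_chain_map[OF z] t])
qed

end

section \<open>Faithful quotients of representations\<close>

lemma ring_mod_end:
  assumes "right_module A M"
  shows "ring (mod_end A M)"
proof -
  interpret M: right_module A M by fact
  let ?E = "mod_end A M" and ?H = "mod_hom A M M"
  note M = M.right_module_axioms
  note cl = mod_hom_plus[OF _ _ M M] mod_hom_compose[where N = M and P = M, OF _ _ M] mod_hom_zero_map[OF M M] M.mod_hom_id
  note ext = mod_hom_eqI[of _ A M M _ M]
  have c: "carrier ?E = ?H" "\<zero>\<^bsub>?E\<^esub> = (\<lambda>x\<in>carrier M. \<zero>\<^bsub>M\<^esub>)" "\<one>\<^bsub>?E\<^esub> = (\<lambda>x\<in>carrier M. x)"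
    "f \<oplus>\<^bsub>?E\<^esub> g = (\<lambda>x\<in>carrier M. f x \<oplus>\<^bsub>M\<^esub> g x)" "f \<otimes>\<^bsub>?E\<^esub> g = compose (carrier M) f g" for f g
    by (simp_all add: mod_end_def)
  show ?thesis
  proof (rule ringI)
    show "abelian_group ?E"
    proof (rule abelian_groupI, unfold c)
      fix f assume f: "f \<in> ?H"
      show "\<exists>g\<in>?H. (\<lambda>x\<in>carrier M. g x \<oplus>\<^bsub>M\<^esub> f x) = (\<lambda>x\<in>carrier M. \<zero>\<^bsub>M\<^esub>)"
        using mod_hom_closed[OF f]
        by (intro bexI[OF _ mod_hom_uminus[OF f M M]]) (auto simp: M.M.l_neg intro!: restrict_ext)
      show "(\<lambda>x\<in>carrier M. (\<lambda>x\<in>carrier M. \<zero>\<^bsub>M\<^esub>) x \<oplus>\<^bsub>M\<^esub> f x) = f"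
        using f by (intro ext cl) (auto simp: mod_hom_closed)
    qed (auto intro!: ext cl restrict_ext simp: mod_hom_closed M.M.a_ac)
    show "monoid ?E"
      by (rule monoidI, unfold c)
        (auto intro!: ext cl simp: compose_eq mod_hom_closed)
  qed (unfold c, auto intro!: ext cl simp: compose_eq mod_hom_closed mod_hom_add)
qed

section \<open>Passing to the quotient by an annihilating ideal, and the isomorphism theorem for an
  action\<close>

context
  fixes A :: "'a ring" and M :: "('a, 'm) module" and I :: "'a set"
  assumes M: "right_module A M" and I: "ideal I A"
    and ann: "\<And>a x. \<lbrakk>a \<in> I; x \<in> carrier M\<rbrakk> \<Longrightarrow> a \<odot>\<^bsub>M\<^esub> x = \<zero>\<^bsub>M\<^esub>"
begin

interpretation M: right_module A M by (rule M)
interpretation I: ideal I A by (rule I)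

text \<open>All members of a coset of \<open>I\<close> act alike because \<open>I\<close> kills
  \<open>M\<close>; so the description by \<open>THE\<close> has a unique witness.\<close>

lemma smult_quot_module:
  assumes a: "a \<in> carrier A" and x: "x \<in> carrier M"
  shows "(I +>\<^bsub>A\<^esub> a) \<odot>\<^bsub>quot_module M\<^esub> x = a \<odot>\<^bsub>M\<^esub> x"
proof -
  have "c \<odot>\<^bsub>M\<^esub> x = a \<odot>\<^bsub>M\<^esub> x" if "c \<in> I +>\<^bsub>A\<^esub> a" for c
    using that a x by (auto simp: a_r_coset_def' M.smult_l_distr ann)
  moreover have "a \<in> I +>\<^bsub>A\<^esub> a" using a by (rule I.a_rcos_self)
  ultimately have "(THE y. \<forall>c\<in>I +>\<^bsub>A\<^esub> a. c \<odot>\<^bsub>M\<^esub> x = y) = a \<odot>\<^bsub>M\<^esub> x"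
    by (intro the_equality) metis+
  then show ?thesis by (simp add: quot_module_def)
qed

text \<open>Linearity over A/I and over A are the same condition on the same functions, so the two
  rings are literally equal and not just isomorphic.\<close>

lemma mod_end_quot_module: "mod_end (A Quot I) (quot_module M) = mod_end A M"
proof -
  have c: "carrier (quot_module M) = carrier M" "\<zero>\<^bsub>quot_module M\<^esub> = \<zero>\<^bsub>M\<^esub>"
    "x \<oplus>\<^bsub>quot_module M\<^esub> y = x \<oplus>\<^bsub>M\<^esub> y" for x y
    by (simp_all add: quot_module_def)
  have car: "carrier (A Quot I) = (\<lambda>a. I +>\<^bsub>A\<^esub> a) ` carrier A"
    by (auto simp: FactRing_def A_RCOSETS_def')
  have "mod_hom (A Quot I) (quot_module M) (quot_module M) = mod_hom A M M"
    unfolding mod_hom_def c car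
    by (auto simp: smult_quot_module smult_quot_module[OF _ PiE_mem[of _ "carrier M" "\<lambda>_. carrier M"]])
  then show ?thesis by (simp add: mod_end_def c)
qed

text \<open>The isomorphism theorem for the representation of \<open>B\<close> on \<open>M\<close>:
  its kernel is the annihilator by definition, and \<open>surj\<close> makes it onto. The theorem
  yields a map out of the quotient of \<open>B\<close>, so it has to be inverted.\<close>

lemma algebra_iso_faithful_quotient:
  fixes B :: "'b ring" and act :: "'b \<Rightarrow> 'm \<Rightarrow> 'm"
  assumes B: "ring B" and \<phi>: "\<phi> \<in> carrier R \<rightarrow> carrier A" and \<beta>: "\<beta> \<in> carrier R \<rightarrow> carrier B"
    and hom: "\<And>b. b \<in> carrier B \<Longrightarrow> (\<lambda>x\<in>carrier M. act b x) \<in> mod_hom A M M"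
    and surj: "\<And>f. f \<in> mod_hom A M M \<Longrightarrow> \<exists>b\<in>carrier B. \<forall>x\<in>carrier M. act b x = f x"
    and act_add: "\<And>b c x. \<lbrakk>b \<in> carrier B; c \<in> carrier B; x \<in> carrier M\<rbrakk> \<Longrightarrow>
        act (b \<oplus>\<^bsub>B\<^esub> c) x = act b x \<oplus>\<^bsub>M\<^esub> act c x"
    and act_mult: "\<And>b c x. \<lbrakk>b \<in> carrier B; c \<in> carrier B; x \<in> carrier M\<rbrakk> \<Longrightarrow>
        act (b \<otimes>\<^bsub>B\<^esub> c) x = act b (act c x)"
    and act_one: "\<And>x. x \<in> carrier M \<Longrightarrow> act \<one>\<^bsub>B\<^esub> x = x"
    and act_str: "\<And>r x. \<lbrakk>r \<in> carrier R; x \<in> carrier M\<rbrakk> \<Longrightarrow> act (\<beta> r) x = \<phi> r \<odot>\<^bsub>M\<^esub> x"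
  shows "algebra_iso R
           (mod_end (A Quot I) (quot_module M)) (mod_end_str (quot_module M) (quot_str A I \<phi>))
           (B Quot annihilator B act M) (quot_str B (annihilator B act M) \<beta>)"
proof -
  let ?E = "mod_end A M" and ?K = "annihilator B act M"
  define \<rho> where "\<rho> b = (\<lambda>x\<in>carrier M. act b x)" for b
  have c: "carrier ?E = mod_hom A M M" "\<zero>\<^bsub>?E\<^esub> = (\<lambda>x\<in>carrier M. \<zero>\<^bsub>M\<^esub>)" "\<one>\<^bsub>?E\<^esub> = (\<lambda>x\<in>carrier M. x)"
    "f \<oplus>\<^bsub>?E\<^esub> g = (\<lambda>x\<in>carrier M. f x \<oplus>\<^bsub>M\<^esub> g x)" "f \<otimes>\<^bsub>?E\<^esub> g = compose (carrier M) f g" for f g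
    by (simp_all add: mod_end_def)
  have cl: "act b x \<in> carrier M" if "b \<in> carrier B" "x \<in> carrier M" for b x
    using mod_hom_closed[OF hom[OF that(1)] that(2)] that by simp
  have "\<rho> \<in> ring_hom B ?E"
    unfolding \<rho>_def
    by (rule ring_hom_memI)
      (auto simp: c hom act_add act_mult act_one compose_def cl intro!: restrict_ext)
  then interpret \<rho>: ring_hom_ring B ?E \<rho>
    by (intro ring_hom_ringI2 B ring_mod_end M)
  have ker: "a_kernel B ?E \<rho> = ?K"
    unfolding a_kernel_def' annihilator_def c \<rho>_def
    by (auto simp: fun_eq_iff restrict_def cong: conj_cong)
  have im: "\<rho> ` carrier B = carrier ?E"
  proof
    show "\<rho> ` carrier B \<subseteq> carrier ?E" by auto
    show "carrier ?E \<subseteq> \<rho> ` carrier B"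
    proof
      fix f assume "f \<in> carrier ?E"
      then have f: "f \<in> mod_hom A M M" by (simp add: c)
      obtain b where b: "b \<in> carrier B" "\<forall>x\<in>carrier M. act b x = f x" using surj[OF f] by blast
      have "f = \<rho> b"
        unfolding \<rho>_def using b by (intro mod_hom_eqI[OF f hom[OF b(1)]]) auto
      with b show "f \<in> \<rho> ` carrier B" by blast
    qed
  qed
  \<comment> \<open>\<open>\<rho>\<close> is constant on a coset of its kernel, so its image is a
    singleton.\<close>
  define h where "h X = the_elem (\<rho> ` X)" for X
  have h: "h \<in> ring_iso (B Quot ?K) ?E"
    unfolding h_def using \<rho>.FactRing_iso_set[OF im] by (simp add: ker)
  have Q: "ring (B Quot ?K)"
    using \<rho>.kernel_is_ideal by (simp add: ker ideal.quotient_is_ring)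
  have inv: "inv_into (carrier (B Quot ?K)) h \<in> ring_iso ?E (B Quot ?K)"
    by (rule ring_iso_set_sym[OF Q h])
  \<comment> \<open>Compatibility with the structure maps is checked for \<open>h\<close> and then
    read backwards for its inverse.\<close>
  have "inv_into (carrier (B Quot ?K)) h (mod_end_str (quot_module M) (quot_str A I \<phi>) r) = quot_str B ?K \<beta> r"
    if r: "r \<in> carrier R" for r
  proof -
    have \<beta>r: "\<beta> r \<in> carrier B" and \<phi>r: "\<phi> r \<in> carrier A" using r \<beta> \<phi> by auto
    have "h (quot_str B ?K \<beta> r) = \<rho> (\<beta> r)"
      unfolding h_def quot_str_def ker[symmetric] by (rule \<rho>.the_elem_simp[OF \<beta>r])
    also have "\<dots> = mod_end_str (quot_module M) (quot_str A I \<phi>) r"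
    proof -
      have "carrier (quot_module M) = carrier M" by (simp add: quot_module_def)
      then show ?thesis
        unfolding \<rho>_def mod_end_str_def quot_str_def
        using r \<phi>r by (auto simp: act_str smult_quot_module intro!: restrict_ext)
    qed
    finally have eq: "h (quot_str B ?K \<beta> r) = mod_end_str (quot_module M) (quot_str A I \<phi>) r" .
    have "quot_str B ?K \<beta> r \<in> carrier (B Quot ?K)"
      using \<beta>r by (auto simp: quot_str_def FactRing_def A_RCOSETS_def')
    with h show ?thesis
      unfolding eq[symmetric] by (intro inv_into_f_f) (auto simp: ring_iso_def bij_betw_def)
  qed
  then show ?thesis
    unfolding algebra_iso_def mod_end_quot_module using inv by blast
qed

end

section \<open>Endomorphisms of the cokernel\<close>

lemma (in mod_complex) elt_class_eq_zero_iff: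
  assumes "z \<in> cocycles X 0"
  shows "elt_class A X z = elt_class A X \<zero>\<^bsub>obj X 0\<^esub> \<longleftrightarrow> z \<in> coboundaries X 0"
proof -
  interpret M: right_module A "obj X 0" by (rule obj_module)
  have "\<zero>\<^bsub>obj X 0\<^esub> \<oplus>\<^bsub>obj X 0\<^esub> b = b" if "b \<in> coboundaries X 0" for b
    using that coboundaries_subset cocycles_carrier by (intro M.M.l_zero) blast
  then show ?thesis using elt_class_eq_iff[OF assms cocycles_closed(1)] by metis
qed

text \<open>Working with a dual basis frees the lifting property from the test universe of
  \<open>projective\<close>: the target may be Hom(A, T), and \<open>e\<close> need only reach the
  image of \<open>h\<close>. Preimages are chosen for the values of \<open>h\<close> on the dual
  basis.\<close>

lemma projective_lift:
  assumes P: "projective A P" and M: "right_module A M" and N: "right_module A N"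
    and e: "e \<in> mod_hom A M N" and h: "h \<in> mod_hom A P N" and sub: "h ` carrier P \<subseteq> e ` carrier M"
  shows "\<exists>k\<in>mod_hom A P M. \<forall>x\<in>carrier P. e (k x) = h x"
proof -
  have Pm: "right_module A P" using P by (simp add: projective_def fg_module_def)
  interpret P: right_module A P by (rule Pm)
  interpret M: right_module A M by (rule M)
  interpret N: right_module A N by (rule N)
  obtain G \<xi> where G: "finite G" "G \<subseteq> carrier P"
    and \<xi>: "\<And>g. g \<in> G \<Longrightarrow> \<xi> g \<in> mod_hom A P (regular A)"
    and gen: "\<And>x. x \<in> carrier P \<Longrightarrow> x = (\<Oplus>\<^bsub>P\<^esub>g\<in>G. \<xi> g x \<odot>\<^bsub>P\<^esub> g)"
    using projective_dual_basis[OF P] by blast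
  have "\<forall>g\<in>G. \<exists>y\<in>carrier M. e y = h g" using sub G by (force simp: subset_iff image_iff)
  then obtain y where y: "\<And>g. g \<in> G \<Longrightarrow> y g \<in> carrier M" "\<And>g. g \<in> G \<Longrightarrow> e (y g) = h g" by metis
  let ?k = "\<lambda>x\<in>carrier P. \<Oplus>\<^bsub>M\<^esub>g\<in>G. \<xi> g x \<odot>\<^bsub>M\<^esub> y g"
  have "e (?k x) = h x" if x: "x \<in> carrier P" for x
  proof -
    have c: "\<xi> g x \<in> carrier A" if "g \<in> G" for g
      using mod_hom_closed[OF \<xi>[OF that] x] by (simp add: regular_def)
    have "e (?k x) = (\<Oplus>\<^bsub>N\<^esub>g\<in>G. e (\<xi> g x \<odot>\<^bsub>M\<^esub> y g))"
      using x c y mod_hom_finsum[OF e M.M.abelian_group_axioms N.M.abelian_group_axioms G(1)] by auto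
    also have "\<dots> = (\<Oplus>\<^bsub>N\<^esub>g\<in>G. h (\<xi> g x \<odot>\<^bsub>P\<^esub> g))"
      using c y G mod_hom_closed[OF h]
      by (intro N.M.finsum_cong') (auto simp: mod_hom_smult[OF e] mod_hom_smult[OF h] subset_iff)
    also have "\<dots> = h (\<Oplus>\<^bsub>P\<^esub>g\<in>G. \<xi> g x \<odot>\<^bsub>P\<^esub> g)"
      using c G by (intro mod_hom_finsum[OF h P.M.abelian_group_axioms N.M.abelian_group_axioms, symmetric])
        (auto simp: subset_iff)
    finally show ?thesis using gen[OF x] by simp
  qed
  moreover have "?k \<in> mod_hom A P M" by (rule mod_hom_finsum_smult[OF Pm M G(1) \<xi> y(1)])
  ultimately show ?thesis by blast
qed

text \<open>The only square with content is the one from degree -1 to degree 0. The square leaving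
  degree 0 ends in a zero module, and the remaining ones start in one.\<close>

lemma two_term_chain_map:
  assumes X: "mod_complex A X" and two: "two_term X"
    and f: "f \<in> mod_hom A (obj X (-1)) (obj X (-1))" and g: "g \<in> mod_hom A (obj X 0) (obj X 0)"
    and comm: "\<And>x. x \<in> carrier (obj X (-1)) \<Longrightarrow> g (dif X (-1) x) = dif X (-1) (f x)"
  shows "\<exists>t\<in>chain_maps A X X. t (-1) = f \<and> t 0 = g"
proof -
  interpret X: mod_complex A X by (rule X)
  have zero: "carrier (obj X i) = {\<zero>\<^bsub>obj X i\<^esub>}" if "i \<noteq> -1" "i \<noteq> 0" for i
    using two that by (auto simp: two_term_def zero_module_def)
  \<comment> \<open>Away from degrees -1 and 0 the identity serves as a default; it is a map between
    zero modules.\<close>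
  let ?t = "\<lambda>i. if i = 0 then g else if i = -1 then f else (\<lambda>x\<in>carrier (obj X i). x)"
  have h: "?t i \<in> mod_hom A (obj X i) (obj X i)" for i
    using f g right_module.mod_hom_id[OF X.obj_module] by simp
  have "?t \<in> chain_maps A X X"
  proof (rule chain_mapsI[OF h])
    fix i x assume x: "x \<in> carrier (obj X i)"
    show "?t (i + 1) (dif X i x) = dif X i (?t i x)"
    proof (cases "i = -1")
      case True
      then show ?thesis using comm x by simp
    next
      case False
      have dz: "dif X i \<zero>\<^bsub>obj X i\<^esub> = \<zero>\<^bsub>obj X (i + 1)\<^esub>"
        by (rule mod_hom_zero[OF X.dif_hom X.obj_group X.obj_group])
      have tz: "?t j \<zero>\<^bsub>obj X j\<^esub> = \<zero>\<^bsub>obj X j\<^esub>" for j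
        by (rule mod_hom_zero[OF h X.obj_group X.obj_group])
      show ?thesis
      proof (cases "i = 0")
        case True
        have "carrier (obj X (i + 1)) = {\<zero>\<^bsub>obj X (i + 1)\<^esub>}" using True by (intro zero) auto
        moreover have "?t (i + 1) (dif X i x) \<in> carrier (obj X (i + 1))"
          "dif X i (?t i x) \<in> carrier (obj X (i + 1))"
          using mod_hom_closed[OF h] X.dif_closed x by metis+
        ultimately show ?thesis by (metis singletonD)
      next
        case nz: False
        then have "x = \<zero>\<^bsub>obj X i\<^esub>" using False zero[of i] x by simp
        then show ?thesis using dz tz by metis
      qed
    qed
  qed
  then show ?thesis by (intro bexI[of _ ?t]) simp_all
qed

text \<open>Multiplication by \<open>\<phi> r\<close> is A-linear because \<open>\<phi> r\<close> is
  central. Its class is the value of the structure map of B at \<open>r\<close>.\<close>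

lemma (in artin_algebra) scalar_chain_map:
  assumes X: "mod_complex A X" and r: "r \<in> carrier R"
  shows "(\<lambda>i. \<lambda>x\<in>carrier (obj X i). \<phi> r \<odot>\<^bsub>obj X i\<^esub> x) \<in> chain_maps A X X"
proof (rule chain_mapsI)
  interpret X: mod_complex A X by (rule X)
  interpret M: right_module A "obj X i" for i by (rule X.obj_module)
  have \<phi>: "\<phi> r \<in> carrier A" using str_hom r by (auto simp: ring_hom_def)
  show "(\<lambda>x\<in>carrier (obj X i). \<phi> r \<odot>\<^bsub>obj X i\<^esub> x) \<in> mod_hom A (obj X i) (obj X i)" for i
    using \<phi> by (intro mod_homI) (auto simp: M.smult_r_distr M.smult_assoc[symmetric] str_central[OF r])
  fix i x assume x: "x \<in> carrier (obj X i)"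
  then show "(\<lambda>x\<in>carrier (obj X (i + 1)). \<phi> r \<odot>\<^bsub>obj X (i + 1)\<^esub> x) (dif X i x) =
      dif X i ((\<lambda>x\<in>carrier (obj X i). \<phi> r \<odot>\<^bsub>obj X i\<^esub> x) x)"
    using \<phi> by (simp add: X.dif_closed mod_hom_smult[OF X.dif_hom])
qed

text \<open>Common frame of both isomorphisms. \<open>\<theta> t\<close> is the effect of a chain
  map \<open>t\<close> of T on the degree 0 term of X: the component of \<open>t\<close> in degree 0
  when X is T, and the Nakayama image of its component in degree -1 when X is \<nu>T[-1]. What is
  left to prove in each case is essentially \<open>surj\<close>.\<close>

lemma (in artin_algebra) algebra_iso_action:
  fixes T :: "('a, 'm) cochain" and X :: "('a, 'n) cochain"
    and \<theta> :: "(int \<Rightarrow> 'm \<Rightarrow> 'm) \<Rightarrow> 'n \<Rightarrow> 'n"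
  assumes T: "mod_complex A T" and X: "mod_complex A X" and I: "ideal I A"
    and kill: "\<And>a z. \<lbrakk>a \<in> I; z \<in> cocycles X 0\<rbrakk> \<Longrightarrow> a \<odot>\<^bsub>obj X 0\<^esub> z \<in> coboundaries X 0"
    and act: "\<And>t z. \<lbrakk>t \<in> chain_maps A T T; z \<in> cocycles X 0\<rbrakk> \<Longrightarrow>
        act (k_class A T T t) (elt_class A X z) = elt_class A X (\<theta> t z)"
    and cocycle: "\<And>t z. \<lbrakk>t \<in> chain_maps A T T; z \<in> cocycles X 0\<rbrakk> \<Longrightarrow> \<theta> t z \<in> cocycles X 0"
    and hom: "\<And>t. t \<in> chain_maps A T T \<Longrightarrow> \<theta> t \<in> mod_hom A (obj X 0) (obj X 0)"
    and add: "\<And>t t' z. \<lbrakk>t \<in> chain_maps A T T; t' \<in> chain_maps A T T; z \<in> cocycles X 0\<rbrakk> \<Longrightarrow>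
        \<theta> (ch_add T T t t') z = \<theta> t z \<oplus>\<^bsub>obj X 0\<^esub> \<theta> t' z"
    and comp: "\<And>t t' z. \<lbrakk>t \<in> chain_maps A T T; t' \<in> chain_maps A T T; z \<in> cocycles X 0\<rbrakk> \<Longrightarrow>
        \<theta> (ch_comp T t t') z = \<theta> t (\<theta> t' z)"
    and id: "\<And>z. z \<in> cocycles X 0 \<Longrightarrow> \<theta> (ch_id T) z = z"
    and str: "\<And>r z. \<lbrakk>r \<in> carrier R; z \<in> cocycles X 0\<rbrakk> \<Longrightarrow>
        \<theta> (\<lambda>i. \<lambda>x\<in>carrier (obj T i). \<phi> r \<odot>\<^bsub>obj T i\<^esub> x) z = \<phi> r \<odot>\<^bsub>obj X 0\<^esub> z"
    and surj: "\<And>f. f \<in> mod_hom A (khom_module A X) (khom_module A X) \<Longrightarrow>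
        \<exists>t\<in>chain_maps A T T. \<forall>z\<in>cocycles X 0. f (elt_class A X z) = elt_class A X (\<theta> t z)"
  shows "algebra_iso R
           (mod_end (A Quot I) (quot_module (khom_module A X)))
           (mod_end_str (quot_module (khom_module A X)) (quot_str A I \<phi>))
           (k_end A T Quot annihilator (k_end A T) act (khom_module A X))
           (quot_str (k_end A T) (annihilator (k_end A T) act (khom_module A X)) (k_end_str A T \<phi>))"
proof -
  interpret T: mod_complex A T by (rule T)
  interpret X: mod_complex A X by (rule X)
  interpret M: right_module A "obj X i" for i by (rule X.obj_module)
  let ?H = "khom_module A X" and ?B = "k_end A T" and ?Ch = "chain_maps A T T"
  interpret H: right_module A ?H by (rule X.right_module_khom_module)
  note ch = ch_add_chain_map[OF T T] ch_comp_chain_map[OF T, of _ T _ T] T.ch_id_chain_map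
  have E: "\<exists>t\<in>?Ch. b = k_class A T T t" if "b \<in> carrier ?B" for b
    using that khom_iff[OF T T] by (simp add: k_end_def)
  have C: "k_class A T T t \<in> carrier ?B" if "t \<in> ?Ch" for t
    using that khom_iff[OF T T] by (auto simp: k_end_def)
  have Badd: "k_class A T T t \<oplus>\<^bsub>?B\<^esub> k_class A T T t' = k_class A T T (ch_add T T t t')"
    if "t \<in> ?Ch" "t' \<in> ?Ch" for t t'
    using that by (simp add: k_end_def k_add_class[OF T T])
  have Bmult: "k_class A T T t \<otimes>\<^bsub>?B\<^esub> k_class A T T t' = k_class A T T (ch_comp T t t')"
    if "t \<in> ?Ch" "t' \<in> ?Ch" for t t'
    using that by (simp add: k_end_def k_comp_class[OF T T T])
  have Bone: "\<one>\<^bsub>?B\<^esub> = k_class A T T (ch_id T)" by (simp add: k_end_def k_id_def)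
  have Hc: "\<exists>z\<in>cocycles X 0. F = elt_class A X z" if "F \<in> carrier ?H" for F
    using that by (auto simp: X.carrier_khom_module)
  have Hi: "elt_class A X z \<in> carrier ?H" if "z \<in> cocycles X 0" for z
    using that by (auto simp: X.carrier_khom_module)
  note H = X.add_khom_module X.smult_khom_module
  note cl = X.cocycles_closed X.cocycles_carrier
  show ?thesis
  proof (rule algebra_iso_faithful_quotient[OF H.right_module_axioms I _ ring_k_end[OF T]])
    show "\<phi> \<in> carrier R \<rightarrow> carrier A" using str_hom by (auto simp: ring_hom_def)
    then have \<phi>: "\<phi> r \<in> carrier A" if "r \<in> carrier R" for r using that by auto
    show "k_end_str A T \<phi> \<in> carrier R \<rightarrow> carrier ?B"
      using C[OF scalar_chain_map[OF T]] by (auto simp: k_end_str_def)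
    show "act (k_end_str A T \<phi> r) F = \<phi> r \<odot>\<^bsub>?H\<^esub> F" if r: "r \<in> carrier R" and F: "F \<in> carrier ?H" for r F
      using Hc[OF F] act[OF scalar_chain_map[OF T r]] str[OF r] H(2)[OF \<phi>[OF r]]
      by (auto simp: k_end_str_def)
  next
    fix a F assume a: "a \<in> I" and F: "F \<in> carrier ?H"
    interpret I: ideal I A by (rule I)
    have aA: "a \<in> carrier A" using a by (rule I.a_Hcarr)
    obtain z where z: "z \<in> cocycles X 0" "F = elt_class A X z" using Hc[OF F] by blast
    have "elt_class A X (a \<odot>\<^bsub>obj X 0\<^esub> z) = elt_class A X \<zero>\<^bsub>obj X 0\<^esub>"
      using kill[OF a z(1)] z aA
      by (subst X.elt_class_eq_zero_iff) (auto simp: cl)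
    then show "a \<odot>\<^bsub>?H\<^esub> F = \<zero>\<^bsub>?H\<^esub>" using z aA by (simp add: H X.zero_khom_module)
  next
    fix b assume "b \<in> carrier ?B"
    then obtain t where t: "t \<in> ?Ch" "b = k_class A T T t" using E by blast
    show "(\<lambda>F\<in>carrier ?H. act b F) \<in> mod_hom A ?H ?H"
    proof (rule mod_homI)
      fix F assume F: "F \<in> carrier ?H"
      then obtain z where z: "z \<in> cocycles X 0" "F = elt_class A X z" using Hc by blast
      then show "(\<lambda>F\<in>carrier ?H. act b F) F \<in> carrier ?H" using t F by (simp add: act Hi cocycle)
      fix F' assume F': "F' \<in> carrier ?H"
      then obtain z' where z': "z' \<in> cocycles X 0" "F' = elt_class A X z'" using Hc by blast
      show "(\<lambda>F\<in>carrier ?H. act b F) (F \<oplus>\<^bsub>?H\<^esub> F') =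
          (\<lambda>F\<in>carrier ?H. act b F) F \<oplus>\<^bsub>?H\<^esub> (\<lambda>F\<in>carrier ?H. act b F) F'"
        using F F' z z' t by (simp add: H act cocycle cl Hi mod_hom_add[OF hom])
    next
      fix a F assume a: "a \<in> carrier A" and F: "F \<in> carrier ?H"
      then obtain z where z: "z \<in> cocycles X 0" "F = elt_class A X z" using Hc by blast
      then show "(\<lambda>F\<in>carrier ?H. act b F) (a \<odot>\<^bsub>?H\<^esub> F) = a \<odot>\<^bsub>?H\<^esub> (\<lambda>F\<in>carrier ?H. act b F) F"
        using F a t by (simp add: H act cocycle cl Hi mod_hom_smult[OF hom])
    qed auto
    fix c assume "c \<in> carrier ?B"
    then obtain t' where t': "t' \<in> ?Ch" "c = k_class A T T t'" using E by blast
    fix F assume F: "F \<in> carrier ?H"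
    then obtain z where z: "z \<in> cocycles X 0" "F = elt_class A X z" using Hc by blast
    show "act (b \<oplus>\<^bsub>?B\<^esub> c) F = act b F \<oplus>\<^bsub>?H\<^esub> act c F"
      using t t' z by (simp add: Badd act add cocycle ch H)
    show "act (b \<otimes>\<^bsub>?B\<^esub> c) F = act b (act c F)"
      using t t' z by (simp add: Bmult act comp cocycle ch)
  next
    fix F assume F: "F \<in> carrier ?H"
    then obtain z where z: "z \<in> cocycles X 0" "F = elt_class A X z" using Hc by blast
    then show "act \<one>\<^bsub>?B\<^esub> F = F" by (simp add: Bone act ch id)
  next
    fix f assume "f \<in> mod_hom A ?H ?H"
    then obtain t where t: "t \<in> ?Ch" "\<forall>z\<in>cocycles X 0. f (elt_class A X z) = elt_class A X (\<theta> t z)"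
      using surj by blast
    have "act (k_class A T T t) F = f F" if "F \<in> carrier ?H" for F
      using Hc[OF that] t by (auto simp: act)
    then show "\<exists>b\<in>carrier ?B. \<forall>F\<in>carrier ?H. act b F = f F" using C[OF t(1)] by blast
  qed
qed

lemma (in artin_algebra) algebra_iso_hom_regular:
  fixes T :: "('a, 'm) cochain"
  assumes kb: "Kb_proj A T" and two: "two_term T"
  defines "I \<equiv> annihilator A (smult (cohomology T 0)) (cohomology T 0)"
  shows "algebra_iso R
           (mod_end (A Quot I) (quot_module (khom_module A T)))
           (mod_end_str (quot_module (khom_module A T)) (quot_str A I \<phi>))
           (k_end A T Quot annihilator (k_end A T) (act_T A T) (khom_module A T))
           (quot_str (k_end A T) (annihilator (k_end A T) (act_T A T) (khom_module A T)) (k_end_str A T \<phi>))"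
proof -
  have T: "mod_complex A T" using kb by (simp add: Kb_proj_def is_complex_imp_mod_complex)
  have proj: "projective A (obj T i)" for i using kb by (simp add: Kb_proj_def)
  interpret T: mod_complex A T by (rule T)
  interpret M: right_module A "obj T i" for i by (rule T.obj_module)
  interpret H: right_module A "khom_module A T" by (rule T.right_module_khom_module)
  have "carrier (obj T 1) = {\<zero>\<^bsub>obj T 1\<^esub>}" using two by (simp add: two_term_def zero_module_def)
  \<comment> \<open>T vanishes in degree 1, so every element of degree 0 is a cocycle and
    \<open>?E\<close> below is the projection onto Cok \<alpha>.\<close>
  then have Z: "cocycles T 0 = carrier (obj T 0)"
    using T.dif_closed[of _ 0] by (auto simp: cocycles_def)
  let ?E = "\<lambda>z\<in>carrier (obj T 0). elt_class A T z"
  have E: "?E \<in> mod_hom A (obj T 0) (khom_module A T)"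
    by (rule mod_homI) (auto simp: T.carrier_khom_module T.add_khom_module T.smult_khom_module Z)
  show ?thesis
    unfolding I_def
  proof (rule algebra_iso_action[OF T T, where \<theta> = "\<lambda>t. t 0"])
    show "ideal (annihilator A (smult (cohomology T 0)) (cohomology T 0)) A"
      by (rule T.ideal_annihilator_cohomology)
    show "a \<odot>\<^bsub>obj T 0\<^esub> z \<in> coboundaries T 0"
      if "a \<in> annihilator A (smult (cohomology T 0)) (cohomology T 0)" "z \<in> cocycles T 0" for a z
      using that unfolding T.annihilator_cohomology by blast
    show "act_T A T (k_class A T T t) (elt_class A T z) = elt_class A T (t 0 z)"
      if "t \<in> chain_maps A T T" "z \<in> cocycles T 0" for t z
      unfolding act_T_def by (rule T.comp_elt_class(2)[OF T that])
    show "t 0 z \<in> cocycles T 0" if "t \<in> chain_maps A T T" "z \<in> cocycles T 0" for t z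
      by (rule T.comp_elt_class(1)[OF T that])
    fix f assume f: "f \<in> mod_hom A (khom_module A T) (khom_module A T)"
    have fE: "compose (carrier (obj T 0)) f ?E \<in> mod_hom A (obj T 0) (khom_module A T)"
      by (rule mod_hom_compose[OF E f T.obj_module])
    have "?E ` carrier (obj T 0) = carrier (khom_module A T)"
      by (auto simp: T.carrier_khom_module Z)
    then have "compose (carrier (obj T 0)) f ?E ` carrier (obj T 0) \<subseteq> ?E ` carrier (obj T 0)"
      using mod_hom_closed[OF fE] by blast
    \<comment> \<open>The given endomorphism, pulled back to the degree 0 term, is lifted along the
      projection onto the cokernel.\<close>
    then obtain g where g: "g \<in> mod_hom A (obj T 0) (obj T 0)"
      "\<And>x. x \<in> carrier (obj T 0) \<Longrightarrow> ?E (g x) = compose (carrier (obj T 0)) f ?E x"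
      using projective_lift[OF proj T.obj_module H.right_module_axioms E fE] by blast
    have gE: "f (elt_class A T x) = elt_class A T (g x)" if "x \<in> carrier (obj T 0)" for x
      using g(2)[OF that] that mod_hom_closed[OF g(1) that] by (simp add: compose_eq)
    have d: "dif T (-1) \<in> mod_hom A (obj T (-1)) (obj T 0)" using T.dif_hom[of "-1"] by simp
    have gd: "compose (carrier (obj T (-1))) g (dif T (-1)) \<in> mod_hom A (obj T (-1)) (obj T 0)"
      by (rule mod_hom_compose[OF d g(1) T.obj_module])
    \<comment> \<open>\<open>g\<close> preserves the image of \<alpha>: such an element has class
      zero, \<open>f\<close> fixes zero, and the class of its image under \<open>g\<close> is
      therefore zero as well.\<close>
    have "g (dif T (-1) x) \<in> dif T (-1) ` carrier (obj T (-1))" if x: "x \<in> carrier (obj T (-1))" for x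
    proof -
      have dx: "dif T (-1) x \<in> carrier (obj T 0)" by (rule mod_hom_closed[OF d x])
      have "dif T (-1) x \<in> coboundaries T 0" using x by (simp add: coboundaries_def)
      then have "elt_class A T (dif T (-1) x) = elt_class A T \<zero>\<^bsub>obj T 0\<^esub>"
        using dx by (subst T.elt_class_eq_zero_iff) (auto simp: Z)
      then have "f (elt_class A T (dif T (-1) x)) = elt_class A T \<zero>\<^bsub>obj T 0\<^esub>"
        using mod_hom_zero[OF f H.M.abelian_group_axioms H.M.abelian_group_axioms]
        by (simp add: T.zero_khom_module)
      then have "elt_class A T (g (dif T (-1) x)) = elt_class A T \<zero>\<^bsub>obj T 0\<^esub>"
        using gE[OF dx] by simp
      then have "g (dif T (-1) x) \<in> coboundaries T 0"
        using mod_hom_closed[OF g(1) dx]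
        by (subst (asm) T.elt_class_eq_zero_iff) (auto simp: Z)
      then show ?thesis by (simp add: coboundaries_def)
    qed
    \<comment> \<open>Second lift, now along \<alpha> onto its image; it completes \<open>g\<close>
      to a chain map.\<close>
    then obtain k where k: "k \<in> mod_hom A (obj T (-1)) (obj T (-1))"
      "\<And>x. x \<in> carrier (obj T (-1)) \<Longrightarrow> dif T (-1) (k x) = g (dif T (-1) x)"
      using projective_lift[OF proj T.obj_module T.obj_module d gd] by (force simp: compose_eq)
    obtain t where "t \<in> chain_maps A T T" "t (-1) = k" "t 0 = g"
      using two_term_chain_map[OF T two k(1) g(1)] k(2) by metis
    with gE show "\<exists>t\<in>chain_maps A T T. \<forall>z\<in>cocycles T 0. f (elt_class A T z) = elt_class A T (t 0 z)"
      by (auto simp: Z)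
  qed (auto simp: chain_map_hom ch_add_def ch_comp_def ch_id_def compose_eq T.cocycles_carrier)
qed

section \<open>Duality over an Artinian local ring\<close>

text \<open>\<open>injective_module\<close> speaks of the library's \<open>module\<close>, the
  remaining theory of \<open>right_module\<close>; commutativity reconciles the two orders of
  scalars in associativity.\<close>

lemma (in cring) module_iff_right_module: "module R M \<longleftrightarrow> right_module R M"
proof
  assume "module R M"
  then interpret M: module R M .
  show "right_module R M"
    by (rule right_moduleI)
      (auto simp: ring_axioms M.abelian_group_axioms M.smult_l_distr M.smult_r_distr M.smult_assoc1[symmetric] m_comm)
next
  assume "right_module R M"
  then interpret M: right_module R M .
  show "module R M"
    by (rule moduleI)
      (auto simp: is_cring M.M.abelian_group_axioms M.smult_l_distr M.smult_r_distr M.smult_assoc[symmetric] m_comm)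
qed

text \<open>Closure under negatives comes for free from the scalar -1.\<close>

lemma (in right_module) submoduleI:
  assumes "N \<subseteq> carrier M" "\<zero>\<^bsub>M\<^esub> \<in> N" "\<And>x y. \<lbrakk>x \<in> N; y \<in> N\<rbrakk> \<Longrightarrow> x \<oplus>\<^bsub>M\<^esub> y \<in> N"
    and "\<And>a x. \<lbrakk>a \<in> carrier R; x \<in> N\<rbrakk> \<Longrightarrow> a \<odot>\<^bsub>M\<^esub> x \<in> N"
  shows "submodule N R M"
proof -
  have "\<ominus>\<^bsub>M\<^esub> x \<in> N" if "x \<in> N" for x
    using assms(4)[of "\<ominus>\<^bsub>R\<^esub> \<one>\<^bsub>R\<^esub>" x] that assms(1) by (auto simp: smult_l_minus)
  then show ?thesis
    using assms by (intro submodule.intro submodule_axioms.intro M.add.subgroupI) (auto simp: a_inv_def)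
qed

lemma (in abelian_group) eq_if_minus_zero:
  assumes "x \<in> carrier G" "y \<in> carrier G" "x \<ominus> y = \<zero>"
  shows "x = y"
  using assms minus_equality[of x "\<ominus> y"] by (simp add: minus_eq)

lemma submoduleD:
  assumes "submodule N R M"
  shows "N \<subseteq> carrier M" "\<zero>\<^bsub>M\<^esub> \<in> N" "\<And>x y. \<lbrakk>x \<in> N; y \<in> N\<rbrakk> \<Longrightarrow> x \<oplus>\<^bsub>M\<^esub> y \<in> N"
    and "\<And>a x. \<lbrakk>a \<in> carrier R; x \<in> N\<rbrakk> \<Longrightarrow> a \<odot>\<^bsub>M\<^esub> x \<in> N"
proof -
  interpret submodule N R M by fact
  show "N \<subseteq> carrier M" "\<zero>\<^bsub>M\<^esub> \<in> N" "\<And>x y. \<lbrakk>x \<in> N; y \<in> N\<rbrakk> \<Longrightarrow> x \<oplus>\<^bsub>M\<^esub> y \<in> N"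
    "\<And>a x. \<lbrakk>a \<in> carrier R; x \<in> N\<rbrakk> \<Longrightarrow> a \<odot>\<^bsub>M\<^esub> x \<in> N"
    using subset one_closed m_closed by auto
qed

context artinian_local_ring
begin

text \<open>Otherwise choosing strictly smaller members again and again gives a strictly descending
  sequence. This minimum condition stands in for induction on length.\<close>

lemma minimal_ideal:
  assumes ne: "I0 \<in> S" and id: "\<And>I. I \<in> S \<Longrightarrow> ideal I R"
  shows "\<exists>I\<in>S. \<forall>J\<in>S. J \<subseteq> I \<longrightarrow> J = I"
proof (rule ccontr)
  assume "\<not> ?thesis"
  then have "\<forall>I\<in>S. \<exists>J\<in>S. J \<subset> I" by blast
  then obtain f where f: "\<And>I. I \<in> S \<Longrightarrow> f I \<in> S \<and> f I \<subset> I" by metis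
  define I where "I k = (f ^^ k) I0" for k :: nat
  have S: "I k \<in> S" for k by (induction k) (use f ne in \<open>auto simp: I_def\<close>)
  have sub: "I (Suc k) \<subset> I k" for k using f[OF S[of k]] by (simp add: I_def)
  obtain n where "\<forall>k\<ge>n. I k = I n"
    using descending_chain[of I] id[OF S] sub by blast
  then show False using sub[of n] by (metis le_SucI order_refl psubset_eq)
qed

text \<open>If \<open>r\<close> had no inverse, the ideals containing \<open>r\<close> but not 1
  would have a maximal member by Zorn's lemma. That member is a maximal ideal, hence equal to
  \<open>m\<close>, which does not contain \<open>r\<close>.\<close>

lemma unit_if_not_mem:
  assumes r: "r \<in> carrier R" "r \<notin> m"
  shows "\<exists>s\<in>carrier R. s \<otimes> r = \<one>"
proof (rule ccontr)
  assume neg: "\<not> ?thesis"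
  let ?S = "{J. ideal J R \<and> r \<in> J \<and> \<one> \<notin> J}"
  have "PIdl r \<in> ?S"
    using r neg cgenideal_ideal[OF r(1)] cgenideal_self[OF r(1)] by (auto simp: cgenideal_def)
  moreover have "\<Union>C \<in> ?S" if C: "C \<noteq> {}" "subset.chain ?S C" for C
  proof -
    have CS: "\<And>J. J \<in> C \<Longrightarrow> ideal J R \<and> r \<in> J \<and> \<one> \<notin> J"
      using C(2) unfolding subset_chain_def by blast
    have "subset.chain {J. ideal J R} C" using C(2) unfolding subset_chain_def by blast
    then have "ideal (if C = {} then {\<zero>} else \<Union>C) R" by (rule chain_Union_is_ideal)
    then have "ideal (\<Union>C) R" using C(1) by simp
    moreover obtain J where "J \<in> C" using C(1) by blast
    then have "r \<in> \<Union>C" using CS by (intro UnionI) auto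
    moreover have "\<one> \<notin> \<Union>C" using CS by auto
    ultimately show ?thesis by simp
  qed
  ultimately obtain M where M: "M \<in> ?S" "\<forall>X\<in>?S. M \<subseteq> X \<longrightarrow> X = M"
    using subset_Zorn_nonempty[of ?S] by blast
  have "maximalideal M R"
  proof (rule maximalidealI)
    show "carrier R \<noteq> M" using M(1) by auto
    fix J assume J: "ideal J R" "M \<subseteq> J" "J \<subseteq> carrier R"
    show "J = M \<or> J = carrier R"
      using M J ideal.one_imp_carrier[OF J(1)] by blast
  qed (use M in blast)
  then show False using maximal_unique[of M] M(1) r by blast
qed

end

section \<open>The envelope of the residue field: its socle, and separation of elements from
  submodules\<close>

locale artinian_local_envelope = artinian_local_ring m R
  for m and R :: "'r ring" (structure) +
  fixes E :: "('r, 'e) module"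
  assumes envelope: "injective_envelope R (residue_module R m) E"
begin

lemma injective_E: "injective_module R E"
  using envelope by (simp add: injective_envelope_def)

lemma right_module_E: "right_module R E"
  using injective_E module_iff_right_module[of E] by (simp add: injective_module_def)

sublocale E: right_module R E
  by (rule right_module_E)

text \<open>The image \<open>e\<close> of the residue class of 1 has annihilator \<open>m\<close>
  since the embedding is injective. If \<open>m\<close> kills a nonzero \<open>x\<close>,
  essentiality makes Rx meet Re, and locality turns this into \<open>x\<close> lying in Re.\<close>

lemma socle_generator:
  "\<exists>e\<in>carrier E. (\<forall>r\<in>carrier R. r \<odot>\<^bsub>E\<^esub> e = \<zero>\<^bsub>E\<^esub> \<longleftrightarrow> r \<in> m) \<and>
     (\<forall>x\<in>carrier E. (\<forall>r\<in>m. r \<odot>\<^bsub>E\<^esub> x = \<zero>\<^bsub>E\<^esub>) \<longrightarrow> (\<exists>r\<in>carrier R. x = r \<odot>\<^bsub>E\<^esub> e))"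
proof -
  let ?K = "residue_module R m"
  have K: "carrier ?K = carrier (R Quot m)" "\<zero>\<^bsub>?K\<^esub> = m"
    "r \<odot>\<^bsub>?K\<^esub> C = (m +> r) \<otimes>\<^bsub>R Quot m\<^esub> C" for r C
    by (simp_all add: residue_module_def FactRing_def)
  have kc: "m +> r \<in> carrier ?K" if "r \<in> carrier R" for r
    using that by (auto simp: K FactRing_def A_RCOSETS_def')
  have k1: "r \<odot>\<^bsub>?K\<^esub> (m +> \<one>) = m +> r" if "r \<in> carrier R" for r
    using that by (simp add: K FactRing_def rcoset_mult_add)
  have kr: "m +> r = m \<longleftrightarrow> r \<in> m" if "r \<in> carrier R" for r
    using that a_rcos_const a_rcos_self by metis
  obtain i where i: "i \<in> mod_hom R ?K E" "inj_on i (carrier ?K)"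
    and ess: "\<And>N. \<lbrakk>submodule N R E; N \<inter> i ` carrier ?K = {\<zero>\<^bsub>E\<^esub>}\<rbrakk> \<Longrightarrow> N = {\<zero>\<^bsub>E\<^esub>}"
    using envelope unfolding injective_envelope_def by blast
  define e where "e = i (m +> \<one>)"
  have e: "e \<in> carrier E" unfolding e_def by (rule mod_hom_closed[OF i(1) kc]) simp
  have re: "r \<odot>\<^bsub>E\<^esub> e = i (m +> r)" if "r \<in> carrier R" for r
    using mod_hom_smult[OF i(1) that kc[OF one_closed]] k1[OF that] by (simp add: e_def)
  have z: "\<zero> \<in> carrier R" by simp
  have im: "i (m +> \<zero>) = \<zero>\<^bsub>E\<^esub>" using re[of \<zero>] e by simp
  have zero: "r \<odot>\<^bsub>E\<^esub> e = \<zero>\<^bsub>E\<^esub> \<longleftrightarrow> r \<in> m" if r: "r \<in> carrier R" for r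
  proof -
    have "r \<odot>\<^bsub>E\<^esub> e = \<zero>\<^bsub>E\<^esub> \<longleftrightarrow> i (m +> r) = i (m +> \<zero>)" using re[OF r] im by simp
    also have "\<dots> \<longleftrightarrow> m +> r = m +> \<zero>"
      using inj_on_eq_iff[OF i(2) kc[OF r] kc[OF z]] .
    also have "\<dots> \<longleftrightarrow> r \<in> m" using kr[OF r] kr[OF z] by simp
    finally show ?thesis .
  qed
  have "\<exists>r\<in>carrier R. x = r \<odot>\<^bsub>E\<^esub> e" if x: "x \<in> carrier E" "\<forall>r\<in>m. r \<odot>\<^bsub>E\<^esub> x = \<zero>\<^bsub>E\<^esub>" for x
  proof (cases "x = \<zero>\<^bsub>E\<^esub>")
    case True
    then show ?thesis using e by (intro bexI[of _ \<zero>]) simp_all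
  next
    case False
    let ?N = "(\<lambda>r. r \<odot>\<^bsub>E\<^esub> x) ` carrier R"
    have N: "submodule ?N R E"
    proof (rule E.submoduleI)
      show "\<zero>\<^bsub>E\<^esub> \<in> ?N" using x by (intro image_eqI[of _ _ \<zero>]) auto
      show "u \<oplus>\<^bsub>E\<^esub> v \<in> ?N" if "u \<in> ?N" "v \<in> ?N" for u v
        using that x by (auto simp: E.smult_l_distr[symmetric])
      show "a \<odot>\<^bsub>E\<^esub> u \<in> ?N" if "a \<in> carrier R" "u \<in> ?N" for a u
        using that x by (auto simp: E.smult_assoc[symmetric])
    qed (use x in auto)
    have "x \<in> ?N" using x by (intro image_eqI[of _ _ \<one>]) auto
    then have "?N \<noteq> {\<zero>\<^bsub>E\<^esub>}" using False by blast
    moreover have "\<zero>\<^bsub>E\<^esub> \<in> ?N \<inter> i ` carrier ?K"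
      using submoduleD(2)[OF N] im kc[OF z] by (metis IntI imageI)
    ultimately obtain u where u: "u \<in> ?N" "u \<in> i ` carrier ?K" "u \<noteq> \<zero>\<^bsub>E\<^esub>" using ess[OF N] by blast
    obtain s where s: "s \<in> carrier R" "u = s \<odot>\<^bsub>E\<^esub> x" using u(1) by blast
    obtain r where r: "r \<in> carrier R" "u = r \<odot>\<^bsub>E\<^esub> e"
      using u(2) re by (auto simp: K FactRing_def A_RCOSETS_def')
    \<comment> \<open>The common element s x = r e is nonzero while \<open>m\<close> kills
      \<open>x\<close>; so \<open>s\<close> is a unit, and \<open>x\<close> is recovered as a
      multiple of \<open>e\<close>.\<close>
    have "s \<notin> m" using s u(3) x(2) by auto
    then obtain t where t: "t \<in> carrier R" "t \<otimes> s = \<one>" using unit_if_not_mem[OF s(1)] by blast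
    have "x = (s \<otimes> t) \<odot>\<^bsub>E\<^esub> x" using t s x by (simp add: m_comm)
    also have "\<dots> = (r \<otimes> t) \<odot>\<^bsub>E\<^esub> e"
      using s t r x e by (simp add: E.smult_assoc)
    finally show ?thesis using r t by blast
  qed
  with zero e show ?thesis by blast
qed

text \<open>A fixed generator of the socle of \<open>E\<close>, which is a copy of the residue
  field.\<close>

definition soc :: 'e where
  "soc = (SOME e. e \<in> carrier E \<and> (\<forall>r\<in>carrier R. r \<odot>\<^bsub>E\<^esub> e = \<zero>\<^bsub>E\<^esub> \<longleftrightarrow> r \<in> m) \<and>
     (\<forall>x\<in>carrier E. (\<forall>r\<in>m. r \<odot>\<^bsub>E\<^esub> x = \<zero>\<^bsub>E\<^esub>) \<longrightarrow> (\<exists>r\<in>carrier R. x = r \<odot>\<^bsub>E\<^esub> e)))"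

lemma soc_closed [simp]: "soc \<in> carrier E"
  and smult_soc: "r \<in> carrier R \<Longrightarrow> r \<odot>\<^bsub>E\<^esub> soc = \<zero>\<^bsub>E\<^esub> \<longleftrightarrow> r \<in> m"
  and socE: "\<lbrakk>x \<in> carrier E; \<And>r. r \<in> m \<Longrightarrow> r \<odot>\<^bsub>E\<^esub> x = \<zero>\<^bsub>E\<^esub>\<rbrakk> \<Longrightarrow> \<exists>r\<in>carrier R. x = r \<odot>\<^bsub>E\<^esub> soc"
proof -
  have "\<exists>e. e \<in> carrier E \<and> (\<forall>r\<in>carrier R. r \<odot>\<^bsub>E\<^esub> e = \<zero>\<^bsub>E\<^esub> \<longleftrightarrow> r \<in> m) \<and>
     (\<forall>x\<in>carrier E. (\<forall>r\<in>m. r \<odot>\<^bsub>E\<^esub> x = \<zero>\<^bsub>E\<^esub>) \<longrightarrow> (\<exists>r\<in>carrier R. x = r \<odot>\<^bsub>E\<^esub> e))"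
    using socle_generator by blast
  from someI_ex[OF this, folded soc_def]
  show "soc \<in> carrier E" "r \<in> carrier R \<Longrightarrow> r \<odot>\<^bsub>E\<^esub> soc = \<zero>\<^bsub>E\<^esub> \<longleftrightarrow> r \<in> m"
    "\<lbrakk>x \<in> carrier E; \<And>r. r \<in> m \<Longrightarrow> r \<odot>\<^bsub>E\<^esub> x = \<zero>\<^bsub>E\<^esub>\<rbrakk> \<Longrightarrow> \<exists>r\<in>carrier R. x = r \<odot>\<^bsub>E\<^esub> soc"
    by blast+
qed

lemma one_not_mem: "\<one> \<notin> m"
  using I_notcarr one_imp_carrier by blast

text \<open>Injectivity of \<open>E\<close> is available for test modules in \<open>'r univ\<close>
  only; so \<open>M\<close>, and \<open>N\<close> with it, is replaced by an isomorphic copy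
  there.\<close>

lemma extend_functional:
  fixes M :: "('r, 'n) module"
  assumes M: "fg_module R M" and N: "submodule N R M" and f: "f \<in> mod_hom R (M\<lparr>carrier := N\<rparr>) E"
  shows "\<exists>h\<in>mod_hom R M E. \<forall>x\<in>N. h x = f x"
proof -
  have Mr: "right_module R M" using M by (simp add: fg_module_def)
  interpret M: right_module R M by (rule Mr)
  obtain M' :: "('r, 'r univ) module" and j where M': "fg_module R M'"
    and j: "j \<in> mod_hom R M M'" "bij_betw j (carrier M) (carrier M')"
    using fg_module_in_univ[OF M] by (auto simp: mod_iso_def)
  interpret M': right_module R M' using M' by (simp add: fg_module_def)
  have mM': "module R M'" by (simp add: module_iff_right_module M'.right_module_axioms)
  note ND = submoduleD[OF N]
  have jN: "submodule (j ` N) R M'"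
  proof (rule M'.submoduleI)
    show "j ` N \<subseteq> carrier M'" using ND(1) mod_hom_closed[OF j(1)] by blast
    show "\<zero>\<^bsub>M'\<^esub> \<in> j ` N"
      using mod_hom_zero[OF j(1) M.M.abelian_group_axioms M'.M.abelian_group_axioms] ND(2) by force
    show "u \<oplus>\<^bsub>M'\<^esub> v \<in> j ` N" if "u \<in> j ` N" "v \<in> j ` N" for u v
    proof -
      obtain x y where "x \<in> N" "y \<in> N" "u = j x" "v = j y" using \<open>u \<in> j ` N\<close> \<open>v \<in> j ` N\<close> by blast
      then show ?thesis using ND(1,3) mod_hom_add[OF j(1), of x y, symmetric] by (auto simp: subset_iff)
    qed
    show "a \<odot>\<^bsub>M'\<^esub> u \<in> j ` N" if "a \<in> carrier R" "u \<in> j ` N" for a u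
    proof -
      obtain x where "x \<in> N" "u = j x" using \<open>u \<in> j ` N\<close> by blast
      then show ?thesis using \<open>a \<in> carrier R\<close> ND(1,4) mod_hom_smult[OF j(1), of a x, symmetric] by auto
    qed
  qed
  let ?N' = "M'\<lparr>carrier := j ` N\<rparr>"
  have mN': "module R ?N'" by (rule submodule.submodule_is_module[OF jN mM'])
  have inj: "inj_on j N" using j(2) ND(1) by (auto simp: bij_betw_def intro: inj_on_subset)
  have i: "(\<lambda>y\<in>j ` N. y) \<in> mod_hom R ?N' M'"
    using submoduleD[OF jN] by (intro mod_homI) auto
  have f': "(\<lambda>y\<in>j ` N. f (inv_into N j y)) \<in> mod_hom R ?N' E"
  proof (rule mod_homI)
    fix u v assume "u \<in> carrier ?N'" "v \<in> carrier ?N'"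
    then obtain x y where xy: "x \<in> N" "y \<in> N" "u = j x" "v = j y" by auto
    then have "u \<oplus>\<^bsub>M'\<^esub> v = j (x \<oplus>\<^bsub>M\<^esub> y)" using ND(1) mod_hom_add[OF j(1)] by auto
    then show "(\<lambda>y\<in>j ` N. f (inv_into N j y)) (u \<oplus>\<^bsub>?N'\<^esub> v) =
        (\<lambda>y\<in>j ` N. f (inv_into N j y)) u \<oplus>\<^bsub>E\<^esub> (\<lambda>y\<in>j ` N. f (inv_into N j y)) v"
      using xy ND mod_hom_add[OF f] by (simp add: inv_into_f_f[OF inj])
  next
    fix a u assume a: "a \<in> carrier R" and "u \<in> carrier ?N'"
    then obtain x where x: "x \<in> N" "u = j x" by auto
    then have "a \<odot>\<^bsub>M'\<^esub> u = j (a \<odot>\<^bsub>M\<^esub> x)" using a ND(1) mod_hom_smult[OF j(1)] by auto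
    then show "(\<lambda>y\<in>j ` N. f (inv_into N j y)) (a \<odot>\<^bsub>?N'\<^esub> u) = a \<odot>\<^bsub>E\<^esub> (\<lambda>y\<in>j ` N. f (inv_into N j y)) u"
      using a x ND mod_hom_smult[OF f] by (simp add: inv_into_f_f[OF inj])
  qed (use mod_hom_closed[OF f] inj in auto)
  have "inj_on (\<lambda>y\<in>j ` N. y) (carrier ?N')" by (simp add: inj_on_def)
  then obtain g where g: "g \<in> mod_hom R M' E"
    "\<forall>y\<in>carrier ?N'. g ((\<lambda>y\<in>j ` N. y) y) = (\<lambda>y\<in>j ` N. f (inv_into N j y)) y"
    using injective_E mN' mM' i f' unfolding injective_module_def by blast
  have "compose (carrier M) g j \<in> mod_hom R M E" by (rule mod_hom_compose[OF j(1) g(1) Mr])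
  moreover have "compose (carrier M) g j x = f x" if "x \<in> N" for x
    using that ND(1) g(2) by (auto simp: compose_eq inv_into_f_f[OF inj])
  ultimately show ?thesis by blast
qed

text \<open>E is a cogenerator. On N + Rx the rule sending n + r x to r \<open>soc\<close> is well
  defined, because \<open>x\<close> not in \<open>N\<close> forces the scalars that carry
  \<open>x\<close> into \<open>N\<close> to lie in \<open>m\<close>; injectivity extends it to
  \<open>M\<close>.\<close>

lemma separating_functional:
  fixes M :: "('r, 'n) module"
  assumes M: "fg_module R M" and N: "submodule N R M" and x: "x \<in> carrier M" "x \<notin> N"
  shows "\<exists>h\<in>mod_hom R M E. (\<forall>y\<in>N. h y = \<zero>\<^bsub>E\<^esub>) \<and> h x = soc"
proof -
  interpret M: right_module R M using M by (simp add: fg_module_def)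
  note ND = submoduleD[OF N]
  have Nc: "n \<in> carrier M" if "n \<in> N" for n using that ND(1) by blast
  \<comment> \<open>A scalar outside \<open>m\<close> is a unit and would bring \<open>x\<close>
    itself into \<open>N\<close>.\<close>
  have ann: "r \<in> m" if r: "r \<in> carrier R" "r \<odot>\<^bsub>M\<^esub> x \<in> N" for r
  proof (rule ccontr)
    assume "r \<notin> m"
    then obtain s where s: "s \<in> carrier R" "s \<otimes> r = \<one>" using unit_if_not_mem r by blast
    then have "x = s \<odot>\<^bsub>M\<^esub> (r \<odot>\<^bsub>M\<^esub> x)" using r x by (simp add: M.smult_assoc[symmetric] m_comm)
    then show False using ND(4)[OF s(1) r(2)] x(2) by simp
  qed
  define L where "L = {n \<oplus>\<^bsub>M\<^esub> r \<odot>\<^bsub>M\<^esub> x | n r. n \<in> N \<and> r \<in> carrier R}"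
  have L: "submodule L R M"
  proof (rule M.submoduleI)
    show "L \<subseteq> carrier M" using Nc x by (auto simp: L_def)
    show "\<zero>\<^bsub>M\<^esub> \<in> L" unfolding L_def using ND(2) x by (intro CollectI exI[of _ "\<zero>\<^bsub>M\<^esub>"] exI[of _ \<zero>]) auto
    show "u \<oplus>\<^bsub>M\<^esub> v \<in> L" if uv: "u \<in> L" "v \<in> L" for u v
    proof -
      obtain n r n' r' where *: "n \<in> N" "r \<in> carrier R" "u = n \<oplus>\<^bsub>M\<^esub> r \<odot>\<^bsub>M\<^esub> x"
        "n' \<in> N" "r' \<in> carrier R" "v = n' \<oplus>\<^bsub>M\<^esub> r' \<odot>\<^bsub>M\<^esub> x" using uv by (auto simp: L_def)
      then have "u \<oplus>\<^bsub>M\<^esub> v = (n \<oplus>\<^bsub>M\<^esub> n') \<oplus>\<^bsub>M\<^esub> (r \<oplus> r') \<odot>\<^bsub>M\<^esub> x"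
        using x Nc by (simp add: M.smult_l_distr M.M.a_ac)
      with * ND(3) show ?thesis unfolding L_def by blast
    qed
    show "a \<odot>\<^bsub>M\<^esub> u \<in> L" if a: "a \<in> carrier R" and u: "u \<in> L" for a u
    proof -
      obtain n r where *: "n \<in> N" "r \<in> carrier R" "u = n \<oplus>\<^bsub>M\<^esub> r \<odot>\<^bsub>M\<^esub> x" using u by (auto simp: L_def)
      then have "a \<odot>\<^bsub>M\<^esub> u = a \<odot>\<^bsub>M\<^esub> n \<oplus>\<^bsub>M\<^esub> (r \<otimes> a) \<odot>\<^bsub>M\<^esub> x"
        using a x Nc by (simp add: M.smult_r_distr M.smult_assoc)
      with * a ND(4) show ?thesis unfolding L_def by blast
    qed
  qed
  define f where "f = (\<lambda>u\<in>L. THE y. \<exists>n\<in>N. \<exists>r\<in>carrier R. u = n \<oplus>\<^bsub>M\<^esub> r \<odot>\<^bsub>M\<^esub> x \<and> y = r \<odot>\<^bsub>E\<^esub> soc)"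
  have f: "f (n \<oplus>\<^bsub>M\<^esub> r \<odot>\<^bsub>M\<^esub> x) = r \<odot>\<^bsub>E\<^esub> soc" if nr: "n \<in> N" "r \<in> carrier R" for n r
  proof -
    \<comment> \<open>Two decompositions of one element differ by (r' - r)x in \<open>N\<close>, so
      r' - r lies in \<open>m\<close> and kills \<open>soc\<close>. This legitimates the
      \<open>THE\<close> in \<open>f\<close>.\<close>
    have uniq: "r' \<odot>\<^bsub>E\<^esub> soc = r \<odot>\<^bsub>E\<^esub> soc"
      if *: "n' \<in> N" "r' \<in> carrier R" "n \<oplus>\<^bsub>M\<^esub> r \<odot>\<^bsub>M\<^esub> x = n' \<oplus>\<^bsub>M\<^esub> r' \<odot>\<^bsub>M\<^esub> x" for n' r'
    proof -
      have c: "n \<in> carrier M" "n' \<in> carrier M" using nr * Nc by auto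
      have "(r' \<ominus> r) \<odot>\<^bsub>M\<^esub> x = r' \<odot>\<^bsub>M\<^esub> x \<ominus>\<^bsub>M\<^esub> r \<odot>\<^bsub>M\<^esub> x"
        using nr * x by (simp add: minus_eq M.M.minus_eq M.smult_l_distr M.smult_l_minus)
      also have "\<dots> = n \<ominus>\<^bsub>M\<^esub> n'"
      proof -
        have "n \<oplus>\<^bsub>M\<^esub> \<ominus>\<^bsub>M\<^esub> n' = (n \<oplus>\<^bsub>M\<^esub> r \<odot>\<^bsub>M\<^esub> x) \<oplus>\<^bsub>M\<^esub> (\<ominus>\<^bsub>M\<^esub> n' \<oplus>\<^bsub>M\<^esub> \<ominus>\<^bsub>M\<^esub> (r \<odot>\<^bsub>M\<^esub> x))"
          using c nr x by (simp add: M.M.a_ac M.M.r_neg)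
        also have "\<dots> = (n' \<oplus>\<^bsub>M\<^esub> r' \<odot>\<^bsub>M\<^esub> x) \<oplus>\<^bsub>M\<^esub> (\<ominus>\<^bsub>M\<^esub> n' \<oplus>\<^bsub>M\<^esub> \<ominus>\<^bsub>M\<^esub> (r \<odot>\<^bsub>M\<^esub> x))"
          by (simp add: *(3))
        also have "\<dots> = (n' \<oplus>\<^bsub>M\<^esub> \<ominus>\<^bsub>M\<^esub> n') \<oplus>\<^bsub>M\<^esub> (r' \<odot>\<^bsub>M\<^esub> x \<oplus>\<^bsub>M\<^esub> \<ominus>\<^bsub>M\<^esub> (r \<odot>\<^bsub>M\<^esub> x))"
          using c nr * x by (simp only: M.M.a_ac M.M.a_inv_closed M.smult_closed M.M.a_closed)
        finally show ?thesis using c nr * x by (simp add: M.M.minus_eq M.M.r_neg)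
      qed
      also have "\<dots> \<in> N"
        using ND(3)[OF nr(1) ND(4)[of "\<ominus> \<one>" n']] * c by (simp add: M.M.minus_eq M.smult_l_minus)
      finally have "(r' \<ominus> r) \<odot>\<^bsub>E\<^esub> soc = \<zero>\<^bsub>E\<^esub>" using ann nr * by (simp add: smult_soc)
      then have "r' \<odot>\<^bsub>E\<^esub> soc \<ominus>\<^bsub>E\<^esub> r \<odot>\<^bsub>E\<^esub> soc = \<zero>\<^bsub>E\<^esub>"
        using nr(2) *(2) by (simp add: minus_eq E.M.minus_eq E.smult_l_distr E.smult_l_minus)
      moreover have "r' \<odot>\<^bsub>E\<^esub> soc \<in> carrier E" "r \<odot>\<^bsub>E\<^esub> soc \<in> carrier E" using nr(2) *(2) by auto
      ultimately show ?thesis by (rule E.M.eq_if_minus_zero[rotated 2])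
    qed
    have "n \<oplus>\<^bsub>M\<^esub> r \<odot>\<^bsub>M\<^esub> x \<in> L" using nr by (auto simp: L_def)
    moreover have "(THE y. \<exists>n'\<in>N. \<exists>r'\<in>carrier R. n \<oplus>\<^bsub>M\<^esub> r \<odot>\<^bsub>M\<^esub> x = n' \<oplus>\<^bsub>M\<^esub> r' \<odot>\<^bsub>M\<^esub> x \<and>
        y = r' \<odot>\<^bsub>E\<^esub> soc) = r \<odot>\<^bsub>E\<^esub> soc"
    proof (rule the_equality)
      show "\<exists>n'\<in>N. \<exists>r'\<in>carrier R. n \<oplus>\<^bsub>M\<^esub> r \<odot>\<^bsub>M\<^esub> x = n' \<oplus>\<^bsub>M\<^esub> r' \<odot>\<^bsub>M\<^esub> x \<and>
        r \<odot>\<^bsub>E\<^esub> soc = r' \<odot>\<^bsub>E\<^esub> soc"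
        using nr by (intro bexI[of _ n] bexI[of _ r] conjI refl)
      show "y = r \<odot>\<^bsub>E\<^esub> soc" if "\<exists>n'\<in>N. \<exists>r'\<in>carrier R. n \<oplus>\<^bsub>M\<^esub> r \<odot>\<^bsub>M\<^esub> x = n' \<oplus>\<^bsub>M\<^esub> r' \<odot>\<^bsub>M\<^esub> x \<and>
        y = r' \<odot>\<^bsub>E\<^esub> soc" for y
        using that uniq by (elim bexE conjE) simp
    qed
    ultimately show ?thesis unfolding f_def by simp
  qed
  have "f \<in> mod_hom R (M\<lparr>carrier := L\<rparr>) E"
  proof (rule mod_homI)
    show "f \<in> extensional (carrier (M\<lparr>carrier := L\<rparr>))" by (simp add: f_def)
  next
    fix u assume "u \<in> carrier (M\<lparr>carrier := L\<rparr>)"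
    then show "f u \<in> carrier E" using f by (auto simp: L_def)
    fix v assume "v \<in> carrier (M\<lparr>carrier := L\<rparr>)"
    with \<open>u \<in> _\<close> obtain n r n' r' where *: "n \<in> N" "r \<in> carrier R" "u = n \<oplus>\<^bsub>M\<^esub> r \<odot>\<^bsub>M\<^esub> x"
        "n' \<in> N" "r' \<in> carrier R" "v = n' \<oplus>\<^bsub>M\<^esub> r' \<odot>\<^bsub>M\<^esub> x" by (auto simp: L_def)
    then have "u \<oplus>\<^bsub>M\<^esub> v = (n \<oplus>\<^bsub>M\<^esub> n') \<oplus>\<^bsub>M\<^esub> (r \<oplus> r') \<odot>\<^bsub>M\<^esub> x"
      using x Nc by (simp add: M.smult_l_distr M.M.a_ac)
    then show "f (u \<oplus>\<^bsub>M\<lparr>carrier := L\<rparr>\<^esub> v) = f u \<oplus>\<^bsub>E\<^esub> f v"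
      using * ND(3) f by (simp add: E.smult_l_distr)
  next
    fix a u assume a: "a \<in> carrier R" and "u \<in> carrier (M\<lparr>carrier := L\<rparr>)"
    then obtain n r where *: "n \<in> N" "r \<in> carrier R" "u = n \<oplus>\<^bsub>M\<^esub> r \<odot>\<^bsub>M\<^esub> x" by (auto simp: L_def)
    then have "a \<odot>\<^bsub>M\<^esub> u = a \<odot>\<^bsub>M\<^esub> n \<oplus>\<^bsub>M\<^esub> (r \<otimes> a) \<odot>\<^bsub>M\<^esub> x"
      using a x Nc by (simp add: M.smult_r_distr M.smult_assoc)
    then show "f (a \<odot>\<^bsub>M\<lparr>carrier := L\<rparr>\<^esub> u) = a \<odot>\<^bsub>E\<^esub> f u"
      using * a ND(4) f by (simp add: E.smult_assoc)
  qed
  from extend_functional[OF M L this] obtain h where h: "h \<in> mod_hom R M E" "\<And>u. u \<in> L \<Longrightarrow> h u = f u"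
    by blast
  have z: "\<zero> \<in> carrier R" by simp
  have "h y = \<zero>\<^bsub>E\<^esub>" if "y \<in> N" for y
  proof -
    have "y = y \<oplus>\<^bsub>M\<^esub> \<zero> \<odot>\<^bsub>M\<^esub> x" using that Nc x by simp
    then show ?thesis using h(2)[of y] f[OF that z] that by (auto simp: L_def)
  qed
  moreover have "h x = soc"
  proof -
    have "x = \<zero>\<^bsub>M\<^esub> \<oplus>\<^bsub>M\<^esub> \<one> \<odot>\<^bsub>M\<^esub> x" using x by simp
    then show ?thesis using h(2)[of x] f[OF ND(2) one_closed] ND(2) by (auto simp: L_def)
  qed
  ultimately show ?thesis using h(1) by blast
qed

end

section \<open>Matlis duality: functionals on an orthogonal complement are evaluations\<close>

context artinian_local_envelope
begin

lemma fg_module_regular: "fg_module R (regular R)"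
proof -
  interpret M: right_module R "regular R" by (rule right_module_regular[OF ring_axioms])
  have "fin_gen R (regular R)"
  proof (rule fin_gen_indexed[OF M.right_module_axioms])
    show "finite {\<one>}" by simp
    fix x assume x: "x \<in> carrier (regular R)"
    moreover have "\<one> \<in> carrier (regular R)" by (simp add: regular_def)
    ultimately have "(\<Oplus>\<^bsub>regular R\<^esub>i\<in>{\<one>}. x \<odot>\<^bsub>regular R\<^esub> i) = x \<odot>\<^bsub>regular R\<^esub> \<one>"
      using x M.smult_closed[of x \<one>] by (simp add: regular_def[THEN arg_cong[where f = carrier]])
    moreover have "x \<odot>\<^bsub>regular R\<^esub> \<one> = x" using x by (simp add: regular_def)
    ultimately show "\<exists>c\<in>{\<one>} \<rightarrow> carrier R. x = (\<Oplus>\<^bsub>regular R\<^esub>i\<in>{\<one>}. c i \<odot>\<^bsub>regular R\<^esub> i)"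
      using x by (intro bexI[of _ "\<lambda>_. x"]) (auto simp: regular_def)
  qed (simp add: regular_def)
  then show ?thesis by (simp add: fg_module_def M.right_module_axioms)
qed

text \<open>
  Choosing \<open>(a)\<close> minimal with \<open>aI \<noteq> 0\<close> makes \<open>aI\<close> a nonzero subspace of the socle; a
  functional on \<open>R\<close> that does not vanish on it cuts out the hyperplane.
\<close>

lemma ideal_hyperplane:
  assumes I: "ideal I R" and nz: "I \<noteq> {\<zero>}"
  shows "\<exists>J x. ideal J R \<and> J \<subseteq> I \<and> x \<in> I \<and> x \<notin> J \<and>
    (\<forall>i\<in>I. \<exists>j\<in>J. \<exists>r\<in>carrier R. i = j \<oplus> r \<otimes> x) \<and> (\<forall>y\<in>m. y \<otimes> x \<in> J)"
proof -
  interpret I: ideal I R by (rule I)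
  have mc: "y \<in> carrier R" if "y \<in> m" for y using that a_subset by blast
  have Ic: "i \<in> carrier R" if "i \<in> I" for i using that I.a_subset by blast
  \<comment> \<open>The ideals whose product with \<open>I\<close> is nonzero; a minimal one
    supplies \<open>a\<close>.\<close>
  let ?S = "{J. ideal J R \<and> (\<exists>a\<in>J. \<exists>i\<in>I. a \<otimes> i \<noteq> \<zero>)}"
  have "carrier R \<in> ?S"
  proof -
    obtain i where "i \<in> I" "i \<noteq> \<zero>" using nz I.zero_closed by blast
    then have "\<exists>a\<in>carrier R. \<exists>i\<in>I. a \<otimes> i \<noteq> \<zero>" by (intro bexI[of _ \<one>] bexI[of _ i]) (auto simp: Ic)
    then show ?thesis by (simp add: oneideal)
  qed
  then have "\<exists>J\<in>?S. \<forall>K\<in>?S. K \<subseteq> J \<longrightarrow> K = J" by (rule minimal_ideal) simp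
  then obtain J where J: "J \<in> ?S" "\<forall>K\<in>?S. K \<subseteq> J \<longrightarrow> K = J" by (rule bexE)
  from J(1) obtain a x where ax: "a \<in> J" "x \<in> I" "a \<otimes> x \<noteq> \<zero>" and idJ: "ideal J R" by auto
  have a: "a \<in> carrier R" using ax(1) idJ by (meson ideal.Icarr)
  \<comment> \<open>Nakayama's argument: if (ya)I were nonzero, minimality would give a = r y a, and
    the unit 1 - r y would kill \<open>a\<close>.\<close>
  have kill: "y \<otimes> a \<otimes> i = \<zero>" if y: "y \<in> m" and i: "i \<in> I" for y i
  proof (rule ccontr)
    assume ne: "y \<otimes> a \<otimes> i \<noteq> \<zero>"
    have ya: "y \<otimes> a \<in> carrier R" using mc[OF y] a by simp
    have "PIdl (y \<otimes> a) \<in> ?S"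
      using ne i cgenideal_ideal[OF ya] cgenideal_self[OF ya] by blast
    moreover have "PIdl (y \<otimes> a) \<subseteq> J"
      using ax(1) y mc by (intro cgenideal_minimal[OF idJ]) (simp add: ideal.I_l_closed[OF idJ])
    ultimately have "a \<in> PIdl (y \<otimes> a)" using J(2) ax(1) by blast
    then obtain r where r: "r \<in> carrier R" "a = r \<otimes> (y \<otimes> a)" by (auto simp: cgenideal_def)
    have ry: "r \<otimes> y \<in> m" using r y by (simp add: I_l_closed)
    have "\<one> \<ominus> r \<otimes> y \<notin> m"
    proof
      assume "\<one> \<ominus> r \<otimes> y \<in> m"
      then have "(\<one> \<ominus> r \<otimes> y) \<oplus> r \<otimes> y \<in> m" using ry by (rule a_closed)
      moreover have "(\<one> \<ominus> r \<otimes> y) \<oplus> r \<otimes> y = \<one>"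
        using r mc[OF y] by (simp add: minus_eq a_assoc l_neg)
      ultimately show False using one_not_mem by simp
    qed
    moreover have c1: "\<one> \<ominus> r \<otimes> y \<in> carrier R" using r mc[OF y] by simp
    ultimately obtain s where s: "s \<in> carrier R" "s \<otimes> (\<one> \<ominus> r \<otimes> y) = \<one>" using unit_if_not_mem by blast
    have "(\<one> \<ominus> r \<otimes> y) \<otimes> a = a \<ominus> r \<otimes> (y \<otimes> a)"
      using r mc[OF y] a by (simp add: minus_eq l_distr l_minus m_assoc)
    also have "\<dots> = a \<ominus> a" using r by simp
    also have "\<dots> = \<zero>" using a by (simp add: minus_eq r_neg)
    finally have "s \<otimes> ((\<one> \<ominus> r \<otimes> y) \<otimes> a) = \<zero>" using s by simp
    then have "a = \<zero>" using s a c1 by (simp add: m_assoc[symmetric])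
    then show False using ax Ic by simp
  qed
  interpret M: right_module R "regular R" by (rule right_module_regular[OF ring_axioms])
  have "submodule {\<zero>} R (regular R)" by (rule M.submoduleI) (auto simp: regular_def)
  moreover have "a \<otimes> x \<in> carrier (regular R)" "a \<otimes> x \<notin> {\<zero>}"
    using a ax Ic by (auto simp: regular_def)
  ultimately obtain h where h: "h \<in> mod_hom R (regular R) E" "h \<zero> = \<zero>\<^bsub>E\<^esub>" "h (a \<otimes> x) = soc"
    using separating_functional[OF fg_module_regular] by blast
  have hc: "h u \<in> carrier E" if "u \<in> carrier R" for u
    using mod_hom_closed[OF h(1)] that by (simp add: regular_def)
  have hadd: "h (u \<oplus> v) = h u \<oplus>\<^bsub>E\<^esub> h v" if "u \<in> carrier R" "v \<in> carrier R" for u v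
    using mod_hom_add[OF h(1)] that by (simp add: regular_def)
  have hmul: "h (r \<otimes> u) = r \<odot>\<^bsub>E\<^esub> h u" if "u \<in> carrier R" "r \<in> carrier R" for u r
    using mod_hom_smult[OF h(1), of r u] that by (simp add: regular_def m_comm)
  \<comment> \<open>By \<open>kill\<close> every value h(ai) lies in the socle, thus in the
    multiples of h(ax) = \<open>soc\<close>. So the kernel of i -> h(ai) on \<open>I\<close> misses
    only the multiples of \<open>x\<close>.\<close>
  let ?J = "{i \<in> I. h (a \<otimes> i) = \<zero>\<^bsub>E\<^esub>}"
  have smulJ: "r \<otimes> i \<in> ?J" if "r \<in> carrier R" "i \<in> ?J" for r i
  proof -
    have "a \<otimes> (r \<otimes> i) = r \<otimes> (a \<otimes> i)" using that a Ic by (simp add: m_lcomm)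
    then show ?thesis using that a Ic by (simp add: hmul I.I_l_closed)
  qed
  have "ideal ?J R"
  proof (rule idealI[OF ring_axioms])
    show "subgroup ?J (add_monoid R)"
    proof (rule add.subgroupI)
      show "?J \<noteq> {}" using I.zero_closed a h(2) by (intro ex_in_conv[THEN iffD1] exI[of _ \<zero>]) simp
      show "u \<oplus> v \<in> ?J" if "u \<in> ?J" "v \<in> ?J" for u v
        using that a Ic by (simp add: r_distr hadd I.a_closed)
      show "\<ominus> u \<in> ?J" if "u \<in> ?J" for u
        using smulJ[of "\<ominus> \<one>" u] that Ic by (simp add: l_minus)
    qed (use Ic in auto)
    show "i \<otimes> r \<in> ?J" "r \<otimes> i \<in> ?J" if "i \<in> ?J" "r \<in> carrier R" for i r
      using smulJ[OF that(2,1)] that Ic by (simp_all add: m_comm)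
  qed
  moreover have "x \<notin> ?J" using h(3) smult_soc[of \<one>] one_not_mem by auto
  moreover have "\<exists>j\<in>?J. \<exists>r\<in>carrier R. i = j \<oplus> r \<otimes> x" if i: "i \<in> I" for i
  proof -
    have "y \<odot>\<^bsub>E\<^esub> h (a \<otimes> i) = \<zero>\<^bsub>E\<^esub>" if y: "y \<in> m" for y
      using hmul[of "a \<otimes> i" y] kill[OF y i] mc[OF y] a Ic[OF i] h(2) by (simp add: m_assoc)
    then obtain r where r: "r \<in> carrier R" "h (a \<otimes> i) = r \<odot>\<^bsub>E\<^esub> soc"
      using socE[OF hc[of "a \<otimes> i"]] a Ic[OF i] by auto
    \<comment> \<open>The scalar \<open>r\<close> is read off from h(ai) = r h(ax), so subtracting r
      x lands in the kernel.\<close>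
    let ?j = "i \<oplus> (\<ominus> r) \<otimes> x"
    have x: "x \<in> carrier R" using ax Ic by blast
    have "a \<otimes> ?j = a \<otimes> i \<oplus> (\<ominus> r) \<otimes> (a \<otimes> x)"
      using a x r Ic[OF i] by (simp add: r_distr m_lcomm)
    then have "h (a \<otimes> ?j) = h (a \<otimes> i) \<oplus>\<^bsub>E\<^esub> (\<ominus> r) \<odot>\<^bsub>E\<^esub> soc"
      using a x r Ic[OF i] h(3) hmul[of "a \<otimes> x" "\<ominus> r"] by (simp add: hadd)
    then have "?j \<in> ?J"
      using r i ax by (simp add: E.smult_l_minus E.M.r_neg I.a_closed I.I_l_closed)
    moreover have "i = ?j \<oplus> r \<otimes> x" using r x Ic[OF i] by (simp add: l_minus a_assoc l_neg)
    ultimately show ?thesis using r by blast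
  qed
  moreover have "y \<otimes> x \<in> ?J" if y: "y \<in> m" for y
  proof -
    have "a \<otimes> (y \<otimes> x) = y \<otimes> a \<otimes> x" using a mc[OF y] Ic[OF ax(2)] by (simp add: m_assoc m_lcomm)
    then show ?thesis using kill[OF y ax(2)] mc[OF y] ax h(2) by (simp add: I.I_l_closed)
  qed
  ultimately show ?thesis using ax(2) by blast
qed

text \<open>For a submodule \<open>S\<close> this is Hom(M/S, E), kept as functionals on
  \<open>M\<close> so that no quotient module is formed.\<close>

definition perp :: "('r, 'n) module \<Rightarrow> 'n set \<Rightarrow> ('n \<Rightarrow> 'e) set" where
  "perp M S = {h \<in> mod_hom R M E. \<forall>y\<in>S. h y = \<zero>\<^bsub>E\<^esub>}"

lemma perp_add:
  assumes "right_module R M" "h \<in> perp M S" "h' \<in> perp M S" "S \<subseteq> carrier M"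
  shows "(\<lambda>x\<in>carrier M. h x \<oplus>\<^bsub>E\<^esub> h' x) \<in> perp M S"
  using assms mod_hom_plus[of h R M E h'] right_module_E by (auto simp: perp_def)

lemma perp_smult:
  assumes M: "right_module R M" and h: "h \<in> perp M S" and S: "S \<subseteq> carrier M" and r: "r \<in> carrier R"
  shows "(\<lambda>x\<in>carrier M. r \<odot>\<^bsub>E\<^esub> h x) \<in> perp M S"
proof -
  interpret M: right_module R M by (rule M)
  have hM: "h \<in> mod_hom R M E" using h by (simp add: perp_def)
  have "(\<lambda>x\<in>carrier M. r \<odot>\<^bsub>E\<^esub> h x) \<in> mod_hom R M E"
    using r by (intro mod_homI)
      (auto simp: mod_hom_closed[OF hM] mod_hom_add[OF hM] mod_hom_smult[OF hM] E.smult_r_distr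
        E.smult_assoc[symmetric] m_comm)
  with h S r show ?thesis by (auto simp: perp_def)
qed

context
  fixes M :: "('r, 'n) module" and N :: "'n set" and lam :: "('n \<Rightarrow> 'e) \<Rightarrow> 'e"
  assumes fg: "fg_module R M" and N: "submodule N R M"
    and lam_closed: "\<And>h. h \<in> perp M N \<Longrightarrow> lam h \<in> carrier E"
    and lam_add: "\<And>h h'. \<lbrakk>h \<in> perp M N; h' \<in> perp M N\<rbrakk> \<Longrightarrow>
        lam (\<lambda>x\<in>carrier M. h x \<oplus>\<^bsub>E\<^esub> h' x) = lam h \<oplus>\<^bsub>E\<^esub> lam h'"
    and lam_smult: "\<And>r h. \<lbrakk>r \<in> carrier R; h \<in> perp M N\<rbrakk> \<Longrightarrow>
        lam (\<lambda>x\<in>carrier M. r \<odot>\<^bsub>E\<^esub> h x) = r \<odot>\<^bsub>E\<^esub> lam h"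
begin

interpretation M: right_module R M
  using fg by (simp add: fg_module_def)

text \<open>
  Goodness descends from \<open>M\<close> to \<open>N\<close> through steps with simple quotient, the representing element
  being corrected by a multiple of the generator of that quotient.
\<close>

definition good :: "'n set \<Rightarrow> bool" where
  "good S \<longleftrightarrow> (\<exists>x\<in>carrier M. \<forall>h\<in>perp M S. lam h = h x)"

text \<open>The comparison is made between complements and not between the sets: a set and the
  submodule it spans have the same complement.\<close>

lemma good_mono: "\<lbrakk>good S; perp M S' \<subseteq> perp M S\<rbrakk> \<Longrightarrow> good S'"
  unfolding good_def by blast

text \<open>Modulo the functionals that also vanish at \<open>x\<close>, the complement of
  \<open>L\<close> is spanned by one \<open>g\<close> with g(x) = \<open>soc\<close>. If
  \<open>y\<close> represents \<open>lam\<close> on the former, the error at \<open>g\<close> is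
  some c \<open>soc\<close>, and y + c x represents \<open>lam\<close> on all of it.\<close>

lemma good_simple_step:
  assumes L: "submodule L R M" and NL: "N \<subseteq> L" and x: "x \<in> carrier M"
    and mx: "\<And>r. r \<in> m \<Longrightarrow> r \<odot>\<^bsub>M\<^esub> x \<in> L" and good: "good (insert x L)"
  shows "good L"
proof (cases "x \<in> L")
  case True
  then show ?thesis using good by (simp add: insert_absorb)
next
  case False
  note LD = submoduleD[OF L]
  obtain g where g: "g \<in> mod_hom R M E" "\<forall>y\<in>L. g y = \<zero>\<^bsub>E\<^esub>" "g x = soc"
    using separating_functional[OF fg L x False] by blast
  have gL: "g \<in> perp M L" using g by (simp add: perp_def)
  have LN: "h \<in> perp M N" if "h \<in> perp M L" for h using that NL by (auto simp: perp_def)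
  have pm: "h \<in> mod_hom R M E" if "h \<in> perp M L" for h using that by (simp add: perp_def)
  obtain y where y: "y \<in> carrier M" "\<And>h. h \<in> perp M (insert x L) \<Longrightarrow> lam h = h y"
    using good unfolding good_def by blast
  have mc: "r \<in> carrier R" if "r \<in> m" for r using that a_subset by blast
  have gy: "g y \<in> carrier E" by (rule mod_hom_closed[OF g(1) y(1)])
  have lg: "lam g \<in> carrier E" by (rule lam_closed[OF LN[OF gL]])
  let ?e = "lam g \<oplus>\<^bsub>E\<^esub> \<ominus>\<^bsub>E\<^esub> g y"
  \<comment> \<open>For \<open>r\<close> in \<open>m\<close> the multiple r g also vanishes at
    \<open>x\<close>, so \<open>y\<close> represents \<open>lam\<close> there; thus \<open>m\<close>
    kills the error, which therefore lies in the socle.\<close>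
  have "r \<odot>\<^bsub>E\<^esub> ?e = \<zero>\<^bsub>E\<^esub>" if r: "r \<in> m" for r
  proof -
    let ?h = "\<lambda>x\<in>carrier M. r \<odot>\<^bsub>E\<^esub> g x"
    have "?h \<in> perp M L" by (rule perp_smult[OF M.right_module_axioms gL LD(1) mc[OF r]])
    moreover have "?h x = \<zero>\<^bsub>E\<^esub>" using x g(3) r mc[OF r] by (simp add: smult_soc)
    ultimately have "lam ?h = ?h y" by (intro y(2)) (simp add: perp_def)
    then have "r \<odot>\<^bsub>E\<^esub> lam g = r \<odot>\<^bsub>E\<^esub> g y" using lam_smult[OF mc[OF r] LN[OF gL]] y(1) by simp
    then show ?thesis using mc[OF r] gy lg by (simp add: E.smult_r_distr E.smult_r_minus E.M.r_neg)
  qed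
  then obtain c where c: "c \<in> carrier R" "?e = c \<odot>\<^bsub>E\<^esub> soc" using socE[of ?e] gy lg by auto
  have "lam h = h (y \<oplus>\<^bsub>M\<^esub> c \<odot>\<^bsub>M\<^esub> x)" if h: "h \<in> perp M L" for h
  proof -
    have hM: "h \<in> mod_hom R M E" by (rule pm[OF h])
    have hc: "h y \<in> carrier E" "h x \<in> carrier E" "lam h \<in> carrier E"
      using mod_hom_closed[OF hM] x y lam_closed[OF LN[OF h]] by auto
    have "r \<odot>\<^bsub>E\<^esub> h x = \<zero>\<^bsub>E\<^esub>" if r: "r \<in> m" for r
      using mx[OF r] h mod_hom_smult[OF hM mc[OF r] x] by (auto simp: perp_def)
    then obtain s where s: "s \<in> carrier R" "h x = s \<odot>\<^bsub>E\<^esub> soc" using socE[OF hc(2)] by blast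
    \<comment> \<open>\<open>m\<close> carries \<open>x\<close> into \<open>L\<close>, so h(x) is a
      socle element s \<open>soc\<close>; then h - s g vanishes at \<open>x\<close> and falls under
      the assumption on \<open>y\<close>.\<close>
    let ?g = "\<lambda>x\<in>carrier M. (\<ominus> s) \<odot>\<^bsub>E\<^esub> g x"
    let ?h = "\<lambda>x\<in>carrier M. h x \<oplus>\<^bsub>E\<^esub> ?g x"
    have g': "?g \<in> perp M L" using s by (intro perp_smult[OF M.right_module_axioms gL LD(1)]) simp
    have "?h \<in> perp M L" by (rule perp_add[OF M.right_module_axioms h g' LD(1)])
    moreover have "?h x = \<zero>\<^bsub>E\<^esub>" using x g(3) s by (simp add: E.smult_l_minus E.M.r_neg)
    ultimately have "lam ?h = ?h y" by (intro y(2)) (simp add: perp_def)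
    moreover have "lam ?h = lam h \<oplus>\<^bsub>E\<^esub> (\<ominus> s) \<odot>\<^bsub>E\<^esub> lam g"
      using lam_add[OF LN[OF h] LN[OF g']] lam_smult[OF _ LN[OF gL], of "\<ominus> s"] s by simp
    ultimately have eq: "lam h \<oplus>\<^bsub>E\<^esub> \<ominus>\<^bsub>E\<^esub> (s \<odot>\<^bsub>E\<^esub> lam g) = h y \<oplus>\<^bsub>E\<^esub> \<ominus>\<^bsub>E\<^esub> (s \<odot>\<^bsub>E\<^esub> g y)"
      using y(1) s gy lg by (simp add: E.smult_l_minus)
    have "lam h = (lam h \<oplus>\<^bsub>E\<^esub> \<ominus>\<^bsub>E\<^esub> (s \<odot>\<^bsub>E\<^esub> lam g)) \<oplus>\<^bsub>E\<^esub> s \<odot>\<^bsub>E\<^esub> lam g"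
      using hc s lg by (simp add: E.M.a_assoc E.M.l_neg)
    also have "\<dots> = h y \<oplus>\<^bsub>E\<^esub> s \<odot>\<^bsub>E\<^esub> ?e"
      unfolding eq using hc s lg gy by (simp add: E.M.a_ac E.smult_r_distr E.smult_r_minus)
    also have "\<dots> = h y \<oplus>\<^bsub>E\<^esub> c \<odot>\<^bsub>E\<^esub> h x"
      unfolding c(2) s(2) using s c by (simp add: E.smult_assoc[symmetric] m_comm)
    also have "\<dots> = h (y \<oplus>\<^bsub>M\<^esub> c \<odot>\<^bsub>M\<^esub> x)"
      using x y c by (simp add: mod_hom_add[OF hM] mod_hom_smult[OF hM])
    finally show ?thesis .
  qed
  then show ?thesis unfolding good_def using x y c by (intro bexI[of _ "y \<oplus>\<^bsub>M\<^esub> c \<odot>\<^bsub>M\<^esub> x"]) auto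
qed

lemma submodule_plus_ideal:
  assumes L: "submodule L R M" and x: "x \<in> carrier M" and I: "ideal I R"
  shows "submodule {l \<oplus>\<^bsub>M\<^esub> i \<odot>\<^bsub>M\<^esub> x | l i. l \<in> L \<and> i \<in> I} R M" (is "submodule ?L R M")
proof -
  interpret I: ideal I R by (rule I)
  note LD = submoduleD[OF L]
  have Lc: "l \<in> carrier M" if "l \<in> L" for l using that LD(1) by blast
  show ?thesis
  proof (rule M.submoduleI)
    show "?L \<subseteq> carrier M" using Lc x by auto
    have "\<zero>\<^bsub>M\<^esub> = \<zero>\<^bsub>M\<^esub> \<oplus>\<^bsub>M\<^esub> \<zero> \<odot>\<^bsub>M\<^esub> x" using x by simp
    then show "\<zero>\<^bsub>M\<^esub> \<in> ?L" using LD(2) I.zero_closed by blast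
    fix u assume "u \<in> ?L"
    then obtain l i where *: "l \<in> L" "i \<in> I" "u = l \<oplus>\<^bsub>M\<^esub> i \<odot>\<^bsub>M\<^esub> x" by blast
    show "a \<odot>\<^bsub>M\<^esub> u \<in> ?L" if a: "a \<in> carrier R" for a
    proof -
      have "a \<odot>\<^bsub>M\<^esub> u = a \<odot>\<^bsub>M\<^esub> l \<oplus>\<^bsub>M\<^esub> (i \<otimes> a) \<odot>\<^bsub>M\<^esub> x"
        using a x * Lc by (simp add: M.smult_r_distr M.smult_assoc)
      with a * LD(4) I.I_r_closed show ?thesis by blast
    qed
    fix v assume "v \<in> ?L"
    then obtain l' i' where **: "l' \<in> L" "i' \<in> I" "v = l' \<oplus>\<^bsub>M\<^esub> i' \<odot>\<^bsub>M\<^esub> x" by blast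
    have "u \<oplus>\<^bsub>M\<^esub> v = (l \<oplus>\<^bsub>M\<^esub> l') \<oplus>\<^bsub>M\<^esub> (i \<oplus> i') \<odot>\<^bsub>M\<^esub> x"
      using * ** x Lc by (simp add: M.smult_l_distr M.M.a_ac)
    with * ** LD(3) I.a_closed show "u \<oplus>\<^bsub>M\<^esub> v \<in> ?L" by blast
  qed
qed

text \<open>The way from L + Rg down to L leads through L + Ig for ideals \<open>I\<close>. A
  minimal good \<open>I\<close> is zero, since a nonzero one has a hyperplane \<open>J\<close> and
  the simple step makes \<open>J\<close> good too.\<close>

lemma good_cyclic_step:
  assumes L: "submodule L R M" and NL: "N \<subseteq> L" and g: "g \<in> carrier M" and good: "good (insert g L)"
  shows "good L"
proof -
  note LD = submoduleD[OF L]
  let ?P = "\<lambda>I. L \<union> (\<lambda>i. i \<odot>\<^bsub>M\<^esub> g) ` I"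
  let ?S = "{I. ideal I R \<and> good (?P I)}"
  have "perp M (?P (carrier R)) \<subseteq> perp M (insert g L)"
  proof
    fix h assume h: "h \<in> perp M (?P (carrier R))"
    then have "h (\<one> \<odot>\<^bsub>M\<^esub> g) = \<zero>\<^bsub>E\<^esub>" unfolding perp_def by blast
    then show "h \<in> perp M (insert g L)" using h g by (auto simp: perp_def)
  qed
  then have "carrier R \<in> ?S" using good_mono[OF good] by (simp add: oneideal)
  \<comment> \<open>The family is inhabited by the unit ideal, for which goodness is the
    hypothesis.\<close>
  then obtain I where I: "I \<in> ?S" "\<And>J. \<lbrakk>J \<in> ?S; J \<subseteq> I\<rbrakk> \<Longrightarrow> J = I"
    using minimal_ideal[of "carrier R" ?S] by blast
  have idI: "ideal I R" and gI: "good (?P I)" using I(1) by auto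
  interpret I: ideal I R by (rule idI)
  show ?thesis
  proof (cases "I = {\<zero>}")
    case True
    have "perp M L \<subseteq> perp M (?P I)"
      unfolding True using g LD(2) by (auto simp: perp_def)
    then show ?thesis by (rule good_mono[OF gI])
  next
    case False
    then obtain J x where J: "ideal J R" "J \<subseteq> I" "x \<in> I" "x \<notin> J"
      and dec: "\<And>i. i \<in> I \<Longrightarrow> \<exists>j\<in>J. \<exists>r\<in>carrier R. i = j \<oplus> r \<otimes> x" and mx: "\<And>y. y \<in> m \<Longrightarrow> y \<otimes> x \<in> J"
      using ideal_hyperplane[OF idI] by metis
    interpret J: ideal J R by (rule J(1))
    have Jc: "j \<in> carrier R" if "j \<in> J" for j using that J.a_subset by blast
    have xc: "x \<in> carrier R" using J(3) I.a_subset by blast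
    let ?L = "{l \<oplus>\<^bsub>M\<^esub> j \<odot>\<^bsub>M\<^esub> g | l j. l \<in> L \<and> j \<in> J}"
    have L': "submodule ?L R M" by (rule submodule_plus_ideal[OF L g J(1)])
    have LL: "L \<subseteq> ?L"
    proof
      fix l assume l: "l \<in> L"
      then have "l = l \<oplus>\<^bsub>M\<^esub> \<zero> \<odot>\<^bsub>M\<^esub> g" using g LD(1) by auto
      then show "l \<in> ?L" using l J.zero_closed by blast
    qed
    have JL: "j \<odot>\<^bsub>M\<^esub> g \<in> ?L" if j: "j \<in> J" for j
    proof -
      have "j \<odot>\<^bsub>M\<^esub> g = \<zero>\<^bsub>M\<^esub> \<oplus>\<^bsub>M\<^esub> j \<odot>\<^bsub>M\<^esub> g" using g Jc[OF j] by simp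
      then show ?thesis using LD(2) j by blast
    qed
    \<comment> \<open>\<open>I\<close> is spanned by \<open>J\<close> and \<open>x\<close>, so a
      functional killing L + Jg and xg kills L and Ig.\<close>
    have "perp M (insert (x \<odot>\<^bsub>M\<^esub> g) ?L) \<subseteq> perp M (?P I)"
    proof
      fix h assume h: "h \<in> perp M (insert (x \<odot>\<^bsub>M\<^esub> g) ?L)"
      then have hM: "h \<in> mod_hom R M E" and hx: "h (x \<odot>\<^bsub>M\<^esub> g) = \<zero>\<^bsub>E\<^esub>"
        and hL: "\<And>l. l \<in> ?L \<Longrightarrow> h l = \<zero>\<^bsub>E\<^esub>" unfolding perp_def by blast+
      have "h (i \<odot>\<^bsub>M\<^esub> g) = \<zero>\<^bsub>E\<^esub>" if i: "i \<in> I" for i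
      proof -
        obtain j r where jr: "j \<in> J" "r \<in> carrier R" "i = j \<oplus> r \<otimes> x" using dec[OF i] by blast
        then have "i \<odot>\<^bsub>M\<^esub> g = j \<odot>\<^bsub>M\<^esub> g \<oplus>\<^bsub>M\<^esub> r \<odot>\<^bsub>M\<^esub> (x \<odot>\<^bsub>M\<^esub> g)"
          using xc Jc g by (simp add: M.smult_l_distr M.smult_assoc[symmetric] m_comm)
        then show ?thesis
          using jr xc Jc g hx hL[OF JL[OF jr(1)]] by (simp add: mod_hom_add[OF hM] mod_hom_smult[OF hM])
      qed
      then show "h \<in> perp M (?P I)" using hM hL LL unfolding perp_def by blast
    qed
    then have good': "good (insert (x \<odot>\<^bsub>M\<^esub> g) ?L)" by (rule good_mono[OF gI])
    have "good ?L"
    proof (rule good_simple_step[OF L' order_trans[OF NL LL] _ _ good'])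
      show "x \<odot>\<^bsub>M\<^esub> g \<in> carrier M" using xc g by simp
      fix r assume r: "r \<in> m"
      then have "r \<in> carrier R" using a_subset by blast
      then have "r \<odot>\<^bsub>M\<^esub> (x \<odot>\<^bsub>M\<^esub> g) = (r \<otimes> x) \<odot>\<^bsub>M\<^esub> g"
        using xc g by (simp add: M.smult_assoc[symmetric] m_comm)
      then show "r \<odot>\<^bsub>M\<^esub> (x \<odot>\<^bsub>M\<^esub> g) \<in> ?L" using JL[OF mx[OF r]] by simp
    qed
    moreover have "perp M (?P J) \<subseteq> perp M ?L"
    proof
      fix h assume h: "h \<in> perp M (?P J)"
      then have hM: "h \<in> mod_hom R M E" and hL: "\<And>l. l \<in> L \<Longrightarrow> h l = \<zero>\<^bsub>E\<^esub>"
        and hJ: "\<And>j. j \<in> J \<Longrightarrow> h (j \<odot>\<^bsub>M\<^esub> g) = \<zero>\<^bsub>E\<^esub>" unfolding perp_def by blast+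
      have "h (l \<oplus>\<^bsub>M\<^esub> j \<odot>\<^bsub>M\<^esub> g) = \<zero>\<^bsub>E\<^esub>" if "l \<in> L" "j \<in> J" for l j
        using that LD(1) Jc g hL hJ by (subst mod_hom_add[OF hM]) auto
      then show "h \<in> perp M ?L" using hM unfolding perp_def by blast
    qed
    ultimately have "good (?P J)" by (rule good_mono)
    then have "J = I" using I(2)[of J] J by blast
    then show ?thesis using J by blast
  qed
qed

text \<open>Generators are shed one at a time. The induction hypothesis, applied to L + Rg in place
  of L, removes \<open>F\<close>; the cyclic step then removes \<open>g\<close>. This is why
  \<open>L\<close> is generalised.\<close>

lemma good_finite_step:
  assumes "finite F" "F \<subseteq> carrier M" "submodule L R M" "N \<subseteq> L" "good (L \<union> F)"
  shows "good L"
  using assms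
proof (induction F arbitrary: L)
  case empty
  then show ?case by simp
next
  case (insert g F)
  have g: "g \<in> carrier M" and F: "F \<subseteq> carrier M" using insert.prems by auto
  note LD = submoduleD[OF insert.prems(2)]
  let ?L = "{l \<oplus>\<^bsub>M\<^esub> i \<odot>\<^bsub>M\<^esub> g | l i. l \<in> L \<and> i \<in> carrier R}"
  have L': "submodule ?L R M" by (rule submodule_plus_ideal[OF insert.prems(2) g oneideal])
  have LL: "insert g L \<subseteq> ?L"
  proof -
    have "l = l \<oplus>\<^bsub>M\<^esub> \<zero> \<odot>\<^bsub>M\<^esub> g" if "l \<in> L" for l using that g LD(1) by auto
    moreover have "g = \<zero>\<^bsub>M\<^esub> \<oplus>\<^bsub>M\<^esub> \<one> \<odot>\<^bsub>M\<^esub> g" using g by simp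
    moreover have "\<zero> \<in> carrier R" by simp
    ultimately show ?thesis using LD(2) one_closed by blast
  qed
  have "perp M (?L \<union> F) \<subseteq> perp M (L \<union> insert g F)" using LL unfolding perp_def by blast
  then have "good (?L \<union> F)" by (rule good_mono[OF insert.prems(4)])
  then have "good ?L" using insert.IH[OF F L'] LL insert.prems(3) by blast
  moreover have "perp M (insert g L) \<subseteq> perp M ?L"
  proof
    fix h assume h: "h \<in> perp M (insert g L)"
    then have hM: "h \<in> mod_hom R M E" and hL: "\<And>l. l \<in> L \<Longrightarrow> h l = \<zero>\<^bsub>E\<^esub>" and hg: "h g = \<zero>\<^bsub>E\<^esub>"
      unfolding perp_def by blast+
    have "h (l \<oplus>\<^bsub>M\<^esub> i \<odot>\<^bsub>M\<^esub> g) = \<zero>\<^bsub>E\<^esub>" if "l \<in> L" "i \<in> carrier R" for l i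
      using that LD(1) g hL hg by (subst mod_hom_add[OF hM]) (auto simp: mod_hom_smult[OF hM])
    then show "h \<in> perp M ?L" using hM unfolding perp_def by blast
  qed
  ultimately have "good (insert g L)" by (rule good_mono)
  then show ?case by (rule good_cyclic_step[OF insert.prems(2,3) g])
qed

text \<open>Surjectivity of M onto the double dual of M/N. The descent starts at \<open>N\<close>
  together with generators of \<open>M\<close>, where the complement is zero and any point
  represents \<open>lam\<close>.\<close>

lemma functional_is_evaluation: "\<exists>x\<in>carrier M. \<forall>h\<in>perp M N. lam h = h x"
proof -
  obtain G where G: "finite G" "G \<subseteq> carrier M"
    and gen: "\<And>x. x \<in> carrier M \<Longrightarrow> \<exists>c\<in>G \<rightarrow> carrier R. x = (\<Oplus>\<^bsub>M\<^esub>g\<in>G. c g \<odot>\<^bsub>M\<^esub> g)"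
    using fg unfolding fg_module_def fin_gen_def by blast
  have "lam h = h \<zero>\<^bsub>M\<^esub>" if h: "h \<in> perp M (N \<union> G)" for h
  proof -
    have hM: "h \<in> mod_hom R M E" and hN: "h \<in> perp M N" and hG: "\<And>g. g \<in> G \<Longrightarrow> h g = \<zero>\<^bsub>E\<^esub>"
      using h unfolding perp_def by blast+
    have "h x = \<zero>\<^bsub>E\<^esub>" if x: "x \<in> carrier M" for x
    proof -
      obtain c where c: "c \<in> G \<rightarrow> carrier R" "x = (\<Oplus>\<^bsub>M\<^esub>g\<in>G. c g \<odot>\<^bsub>M\<^esub> g)" using gen[OF x] by blast
      have "h x = (\<Oplus>\<^bsub>E\<^esub>g\<in>G. h (c g \<odot>\<^bsub>M\<^esub> g))"
        unfolding c(2) using c(1) G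
        by (intro mod_hom_finsum[OF hM M.M.abelian_group_axioms E.M.abelian_group_axioms]) auto
      also have "\<dots> = (\<Oplus>\<^bsub>E\<^esub>g\<in>G. \<zero>\<^bsub>E\<^esub>)"
        using c(1) G hG by (intro E.M.finsum_cong') (auto simp: mod_hom_smult[OF hM] Pi_iff subset_iff)
      finally show ?thesis by simp
    qed
    \<comment> \<open>The zero functional is written as a multiple by 0, so that homogeneity of
      \<open>lam\<close> gives the value 0.\<close>
    then have "h = (\<lambda>x\<in>carrier M. \<zero> \<odot>\<^bsub>E\<^esub> h x)"
      using mod_hom_closed[OF hM]
      by (intro extensionalityI[OF mod_hom_extensional[OF hM]]) auto
    from arg_cong[OF this, of lam] have "lam h = \<zero> \<odot>\<^bsub>E\<^esub> lam h" using lam_smult[OF _ hN, of \<zero>] by simp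
    then show ?thesis
      using lam_closed[OF hN] mod_hom_zero[OF hM M.M.abelian_group_axioms E.M.abelian_group_axioms]
      by simp
  qed
  then have "good (N \<union> G)" unfolding good_def by blast
  then show ?thesis
    using good_finite_step[OF G N order_refl] by (simp add: good_def)
qed

end

end

section \<open>Tensor products\<close>

lemma comm_group_tensor_free: "comm_group (tensor_free X D)"
  unfolding tensor_free_def by (rule abelian_free_Abelian_group)

lemma tensor_free_simps [simp]:
  "u \<otimes>\<^bsub>tensor_free X D\<^esub> v = u + v" "\<one>\<^bsub>tensor_free X D\<^esub> = 0"
  by (simp_all add: tensor_free_def)

lemma tensor_free_carrier:
  shows "frag_of (x, d) \<in> carrier (tensor_free X D) \<longleftrightarrow> x \<in> carrier X \<and> d \<in> carrier D"
    and "0 \<in> carrier (tensor_free X D)"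
    and "\<lbrakk>u \<in> carrier (tensor_free X D); v \<in> carrier (tensor_free X D)\<rbrakk> \<Longrightarrow> u + v \<in> carrier (tensor_free X D)"
    and "\<lbrakk>u \<in> carrier (tensor_free X D); v \<in> carrier (tensor_free X D)\<rbrakk> \<Longrightarrow> u - v \<in> carrier (tensor_free X D)"
  using keys_add[of u v] keys_diff[of u v] unfolding tensor_free_def by auto

lemma tensor_free_inv:
  "u \<in> carrier (tensor_free X D) \<Longrightarrow> inv\<^bsub>tensor_free X D\<^esub> u = - u"
  by (simp add: tensor_free_def)

text \<open>Commutation of the two actions is what lets the right action on \<open>D\<close> descend
  to the tensor product. The locale is stated for a general bimodule; DA is plugged in
  later.\<close>

locale tensor_bimodule =
  fixes A :: "'a ring" and D :: "('a, 'd) bimodule"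
  assumes D_module: "right_module A D"
    and lsmult_closed: "\<lbrakk>a \<in> carrier A; d \<in> carrier D\<rbrakk> \<Longrightarrow> lsmult D a d \<in> carrier D"
    and lsmult_smult: "\<lbrakk>a \<in> carrier A; b \<in> carrier A; d \<in> carrier D\<rbrakk> \<Longrightarrow>
        lsmult D a (b \<odot>\<^bsub>D\<^esub> d) = b \<odot>\<^bsub>D\<^esub> lsmult D a d"
begin

sublocale D: right_module A D
  by (rule D_module)

definition tensor_gens :: "('a, 'm) module \<Rightarrow> (('m \<times> 'd) \<Rightarrow>\<^sub>0 int) set" where
  "tensor_gens X =
     {frag_of (x \<oplus>\<^bsub>X\<^esub> y, d) - frag_of (x, d) - frag_of (y, d) |x y d.
         x \<in> carrier X \<and> y \<in> carrier X \<and> d \<in> carrier D} \<union>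
     {frag_of (x, d \<oplus>\<^bsub>D\<^esub> d') - frag_of (x, d) - frag_of (x, d') |x d d'.
         x \<in> carrier X \<and> d \<in> carrier D \<and> d' \<in> carrier D} \<union>
     {frag_of (a \<odot>\<^bsub>X\<^esub> x, d) - frag_of (x, lsmult D a d) |a x d.
         a \<in> carrier A \<and> x \<in> carrier X \<and> d \<in> carrier D}"

lemma tensor_rel_eq: "tensor_rel A X D = generate (tensor_free X D) (tensor_gens X)"
  by (simp add: tensor_rel_def tensor_gens_def)

lemma tensor_gensE:
  assumes "u \<in> tensor_gens X"
  obtains (add_l) x y d where "x \<in> carrier X" "y \<in> carrier X" "d \<in> carrier D"
      "u = frag_of (x \<oplus>\<^bsub>X\<^esub> y, d) - frag_of (x, d) - frag_of (y, d)"
    | (add_r) x d d' where "x \<in> carrier X" "d \<in> carrier D" "d' \<in> carrier D"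
      "u = frag_of (x, d \<oplus>\<^bsub>D\<^esub> d') - frag_of (x, d) - frag_of (x, d')"
    | (balanced) a x d where "a \<in> carrier A" "x \<in> carrier X" "d \<in> carrier D"
      "u = frag_of (a \<odot>\<^bsub>X\<^esub> x, d) - frag_of (x, lsmult D a d)"
  using assms unfolding tensor_gens_def
proof (elim UnE)
  show thesis if "u \<in> {frag_of (x \<oplus>\<^bsub>X\<^esub> y, d) - frag_of (x, d) - frag_of (y, d) |x y d.
         x \<in> carrier X \<and> y \<in> carrier X \<and> d \<in> carrier D}"
    using that add_l by auto
  show thesis if "u \<in> {frag_of (x, d \<oplus>\<^bsub>D\<^esub> d') - frag_of (x, d) - frag_of (x, d') |x d d'.
         x \<in> carrier X \<and> d \<in> carrier D \<and> d' \<in> carrier D}"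
    using that add_r by auto
  show thesis if "u \<in> {frag_of (a \<odot>\<^bsub>X\<^esub> x, d) - frag_of (x, lsmult D a d) |a x d.
         a \<in> carrier A \<and> x \<in> carrier X \<and> d \<in> carrier D}"
    using that balanced by auto
qed

lemma tensor_gensI:
  shows "\<lbrakk>x \<in> carrier X; y \<in> carrier X; d \<in> carrier D\<rbrakk> \<Longrightarrow>
      frag_of (x \<oplus>\<^bsub>X\<^esub> y, d) - frag_of (x, d) - frag_of (y, d) \<in> tensor_gens X"
    and "\<lbrakk>x \<in> carrier X; d \<in> carrier D; d' \<in> carrier D\<rbrakk> \<Longrightarrow>
      frag_of (x, d \<oplus>\<^bsub>D\<^esub> d') - frag_of (x, d) - frag_of (x, d') \<in> tensor_gens X"
    and "\<lbrakk>a \<in> carrier A; x \<in> carrier X; d \<in> carrier D\<rbrakk> \<Longrightarrow>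
      frag_of (a \<odot>\<^bsub>X\<^esub> x, d) - frag_of (x, lsmult D a d) \<in> tensor_gens X"
  unfolding tensor_gens_def by blast+

lemma tensor_gens_subset:
  assumes "right_module A X"
  shows "tensor_gens X \<subseteq> carrier (tensor_free X D)"
proof
  interpret X: right_module A X by fact
  fix u assume "u \<in> tensor_gens X"
  then show "u \<in> carrier (tensor_free X D)"
    by (cases rule: tensor_gensE) (simp_all add: tensor_free_carrier lsmult_closed)
qed

lemma tensor_rel_subset_iff:
  assumes "right_module A X" "subgroup H (tensor_free X D)" "tensor_gens X \<subseteq> H"
  shows "tensor_rel A X D \<subseteq> H"
  unfolding tensor_rel_eq
  using assms group.generate_subgroup_incl[of "tensor_free X D" "tensor_gens X" H]
    comm_group_tensor_free[of X D] by (simp add: comm_group_def)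

text \<open>The pure tensor of \<open>x\<close> and \<open>d\<close>.\<close>

definition elem :: "('a, 'm) module \<Rightarrow> 'm \<Rightarrow> 'd \<Rightarrow> (('m \<times> 'd) \<Rightarrow>\<^sub>0 int) set" where
  "elem X x d = tensor_class A X D (frag_of (x, d))"

lemma tensor_smult_eq: "a \<odot>\<^bsub>tensor A X D\<^esub> C =
    (\<Union>u\<in>C. tensor_class A X D (frag_extend (\<lambda>(x, d). frag_of (x, a \<odot>\<^bsub>D\<^esub> d)) u))"
  by (simp add: tensor_def Let_def)

context
  fixes X :: "('a, 'm) module"
  assumes X: "right_module A X"
begin

interpretation X: right_module A X by (rule X)
interpretation F: comm_group "tensor_free X D" by (rule comm_group_tensor_free)

lemma subgroup_tensor_rel: "subgroup (tensor_rel A X D) (tensor_free X D)"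
  unfolding tensor_rel_eq by (rule F.generate_is_subgroup[OF tensor_gens_subset[OF X]])

interpretation N: normal "tensor_rel A X D" "tensor_free X D"
  by (rule F.subgroup_imp_normal[OF subgroup_tensor_rel])

lemma tensor_carrier: "carrier (tensor A X D) = tensor_class A X D ` carrier (tensor_free X D)"
  by (auto simp: tensor_def Let_def FactGroup_def RCOSETS_def tensor_class_def)

lemma tensor_class_closed: "u \<in> carrier (tensor_free X D) \<Longrightarrow> tensor_class A X D u \<in> carrier (tensor A X D)"
  by (simp add: tensor_carrier)

lemma tensor_class_add:
  "\<lbrakk>u \<in> carrier (tensor_free X D); v \<in> carrier (tensor_free X D)\<rbrakk> \<Longrightarrow>
    tensor_class A X D u \<oplus>\<^bsub>tensor A X D\<^esub> tensor_class A X D v = tensor_class A X D (u + v)"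
  using N.rcos_sum[of u v] by (simp add: tensor_def Let_def FactGroup_def tensor_class_def)

lemma tensor_class_zero: "\<zero>\<^bsub>tensor A X D\<^esub> = tensor_class A X D 0"
  using F.coset_mult_one[OF N.subset] by (simp add: tensor_def Let_def FactGroup_def tensor_class_def)

lemma tensor_class_eq_iff:
  assumes "u \<in> carrier (tensor_free X D)" "v \<in> carrier (tensor_free X D)"
  shows "tensor_class A X D u = tensor_class A X D v \<longleftrightarrow> u - v \<in> tensor_rel A X D"
proof -
  have "u - v \<in> tensor_rel A X D \<longleftrightarrow> u \<in> tensor_class A X D v"
    using N.rcos_module[OF F.is_group assms(2,1)] assms by (simp add: tensor_class_def tensor_free_inv)
  also have "\<dots> \<longleftrightarrow> tensor_class A X D u = tensor_class A X D v"
    using F.repr_independence[OF _ assms(2) subgroup_tensor_rel, of u]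
      F.rcos_self[OF assms(1) subgroup_tensor_rel] by (auto simp: tensor_class_def)
  finally show ?thesis by blast
qed

lemma mem_tensor_class:
  assumes "u \<in> carrier (tensor_free X D)" "v \<in> tensor_class A X D u"
  shows "v \<in> carrier (tensor_free X D)" "v - u \<in> tensor_rel A X D"
proof -
  show v: "v \<in> carrier (tensor_free X D)"
    using F.r_coset_subset_G[OF N.subset assms(1)] assms(2) by (auto simp: tensor_class_def)
  show "v - u \<in> tensor_rel A X D"
    using N.rcos_module[OF F.is_group assms(1) v] assms by (simp add: tensor_class_def tensor_free_inv)
qed

lemma self_mem_tensor_class: "u \<in> carrier (tensor_free X D) \<Longrightarrow> u \<in> tensor_class A X D u"
  using F.rcos_self[OF _ subgroup_tensor_rel] by (simp add: tensor_class_def)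

lemma abelian_group_tensor: "abelian_group (tensor A X D)"
proof (rule abelian_groupI)
  fix U assume "U \<in> carrier (tensor A X D)"
  then obtain u where u: "u \<in> carrier (tensor_free X D)" "U = tensor_class A X D u"
    by (auto simp: tensor_carrier)
  then have "- u \<in> carrier (tensor_free X D)" using tensor_free_carrier(4)[OF tensor_free_carrier(2) u(1)] by simp
  with u show "\<exists>V\<in>carrier (tensor A X D). V \<oplus>\<^bsub>tensor A X D\<^esub> U = \<zero>\<^bsub>tensor A X D\<^esub>"
    by (intro bexI[of _ "tensor_class A X D (- u)"]) (simp_all add: tensor_class_add tensor_class_zero tensor_class_closed)
qed (auto simp: tensor_carrier tensor_class_add tensor_class_zero tensor_free_carrier add_ac)

lemma elem_closed: "\<lbrakk>x \<in> carrier X; d \<in> carrier D\<rbrakk> \<Longrightarrow> elem X x d \<in> carrier (tensor A X D)"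
  by (simp add: elem_def tensor_class_closed tensor_free_carrier)

lemma gens_in_rel: "u \<in> tensor_gens X \<Longrightarrow> u \<in> tensor_rel A X D"
  unfolding tensor_rel_eq by (rule generate.incl)

lemma elem_add_left:
  assumes "x \<in> carrier X" "y \<in> carrier X" "d \<in> carrier D"
  shows "elem X (x \<oplus>\<^bsub>X\<^esub> y) d = elem X x d \<oplus>\<^bsub>tensor A X D\<^esub> elem X y d"
proof -
  have "frag_of (x \<oplus>\<^bsub>X\<^esub> y, d) - frag_of (x, d) - frag_of (y, d) \<in> tensor_gens X"
    using assms by (rule tensor_gensI)
  from gens_in_rel[OF this] have "frag_of (x \<oplus>\<^bsub>X\<^esub> y, d) - (frag_of (x, d) + frag_of (y, d)) \<in> tensor_rel A X D"
    by (simp add: algebra_simps)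
  then show ?thesis
    using assms by (simp add: elem_def tensor_class_add tensor_free_carrier tensor_class_eq_iff)
qed

lemma elem_add_right:
  assumes "x \<in> carrier X" "d \<in> carrier D" "d' \<in> carrier D"
  shows "elem X x (d \<oplus>\<^bsub>D\<^esub> d') = elem X x d \<oplus>\<^bsub>tensor A X D\<^esub> elem X x d'"
proof -
  have "frag_of (x, d \<oplus>\<^bsub>D\<^esub> d') - frag_of (x, d) - frag_of (x, d') \<in> tensor_gens X"
    using assms by (rule tensor_gensI)
  from gens_in_rel[OF this] have "frag_of (x, d \<oplus>\<^bsub>D\<^esub> d') - (frag_of (x, d) + frag_of (x, d')) \<in> tensor_rel A X D"
    by (simp add: algebra_simps)
  then show ?thesis
    using assms by (simp add: elem_def tensor_class_add tensor_free_carrier tensor_class_eq_iff)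
qed

lemma elem_balanced:
  assumes "a \<in> carrier A" "x \<in> carrier X" "d \<in> carrier D"
  shows "elem X (a \<odot>\<^bsub>X\<^esub> x) d = elem X x (lsmult D a d)"
proof -
  have "frag_of (a \<odot>\<^bsub>X\<^esub> x, d) - frag_of (x, lsmult D a d) \<in> tensor_gens X"
    using assms by (rule tensor_gensI)
  from gens_in_rel[OF this] show ?thesis
    using assms by (simp add: elem_def tensor_free_carrier tensor_class_eq_iff lsmult_closed)
qed

lemma elem_zero_left:
  assumes "d \<in> carrier D" shows "elem X \<zero>\<^bsub>X\<^esub> d = \<zero>\<^bsub>tensor A X D\<^esub>"
proof -
  interpret T: abelian_group "tensor A X D" by (rule abelian_group_tensor)
  have "elem X \<zero>\<^bsub>X\<^esub> d \<oplus>\<^bsub>tensor A X D\<^esub> elem X \<zero>\<^bsub>X\<^esub> d = elem X \<zero>\<^bsub>X\<^esub> d"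
    using elem_add_left[of "\<zero>\<^bsub>X\<^esub>" "\<zero>\<^bsub>X\<^esub>" d] assms by simp
  then show ?thesis using elem_closed[of "\<zero>\<^bsub>X\<^esub>" d] assms by simp
qed

text \<open>Pure tensors generate the tensor product as an abelian group. Nearly all later
  identities, from the module axioms to the pairing, are reduced to pure tensors by this.\<close>

lemma tensor_eqI:
  fixes G :: "('g, 'l) ring_scheme"
  assumes G: "abelian_group G" and u: "u \<in> carrier (tensor A X D)"
    and f: "\<And>u. u \<in> carrier (tensor A X D) \<Longrightarrow> f u \<in> carrier G"
    and fadd: "\<And>u v. \<lbrakk>u \<in> carrier (tensor A X D); v \<in> carrier (tensor A X D)\<rbrakk> \<Longrightarrow>
        f (u \<oplus>\<^bsub>tensor A X D\<^esub> v) = f u \<oplus>\<^bsub>G\<^esub> f v"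
    and g: "\<And>u. u \<in> carrier (tensor A X D) \<Longrightarrow> g u \<in> carrier G"
    and gadd: "\<And>u v. \<lbrakk>u \<in> carrier (tensor A X D); v \<in> carrier (tensor A X D)\<rbrakk> \<Longrightarrow>
        g (u \<oplus>\<^bsub>tensor A X D\<^esub> v) = g u \<oplus>\<^bsub>G\<^esub> g v"
    and eq: "\<And>x d. \<lbrakk>x \<in> carrier X; d \<in> carrier D\<rbrakk> \<Longrightarrow> f (elem X x d) = g (elem X x d)"
  shows "f u = g u"
proof -
  interpret G: abelian_group G by (rule G)
  interpret T: abelian_group "tensor A X D" by (rule abelian_group_tensor)
  obtain v where v: "v \<in> carrier (tensor_free X D)" "u = tensor_class A X D v"
    using u by (auto simp: tensor_carrier)
  have k: "Poly_Mapping.keys v \<subseteq> carrier X \<times> carrier D" using v(1) by (simp add: tensor_free_def)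
  have c: "w \<in> carrier (tensor_free X D)" if "Poly_Mapping.keys w \<subseteq> carrier X \<times> carrier D" for w
    using that by (simp add: tensor_free_def)
  have "f (tensor_class A X D v) = g (tensor_class A X D v)"
    using k
  proof (rule free_Abelian_group_induct)
    have z: "h \<zero>\<^bsub>tensor A X D\<^esub> = \<zero>\<^bsub>G\<^esub>" if "\<And>u. u \<in> carrier (tensor A X D) \<Longrightarrow> h u \<in> carrier G"
      "\<And>u v. \<lbrakk>u \<in> carrier (tensor A X D); v \<in> carrier (tensor A X D)\<rbrakk> \<Longrightarrow>
        h (u \<oplus>\<^bsub>tensor A X D\<^esub> v) = h u \<oplus>\<^bsub>G\<^esub> h v" for h
      using that(1)[of "\<zero>\<^bsub>tensor A X D\<^esub>"] that(2)[of "\<zero>\<^bsub>tensor A X D\<^esub>" "\<zero>\<^bsub>tensor A X D\<^esub>"] by simp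
    show "f (tensor_class A X D 0) = g (tensor_class A X D 0)"
      using z[OF f fadd] z[OF g gadd] by (simp add: tensor_class_zero[symmetric])
  next
    fix v w assume vw: "Poly_Mapping.keys v \<subseteq> carrier X \<times> carrier D" "Poly_Mapping.keys w \<subseteq> carrier X \<times> carrier D"
      "f (tensor_class A X D v) = g (tensor_class A X D v)" "f (tensor_class A X D w) = g (tensor_class A X D w)"
    have d: "v - w \<in> carrier (tensor_free X D)" using c[OF vw(1)] c[OF vw(2)] by (rule tensor_free_carrier(4))
    \<comment> \<open>The induction principle works with differences while \<open>f\<close> and
      \<open>g\<close> respect sums; so v is split as (v - w) + w and the value at w is
      cancelled.\<close>
    have "tensor_class A X D v = tensor_class A X D (v - w) \<oplus>\<^bsub>tensor A X D\<^esub> tensor_class A X D w"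
      using tensor_class_add[OF d c[OF vw(2)]] by simp
    then have "f (tensor_class A X D (v - w)) \<oplus>\<^bsub>G\<^esub> f (tensor_class A X D w) =
        g (tensor_class A X D (v - w)) \<oplus>\<^bsub>G\<^esub> f (tensor_class A X D w)"
      using vw fadd gadd tensor_class_closed[OF d] tensor_class_closed[OF c[OF vw(2)]] by metis
    then show "f (tensor_class A X D (v - w)) = g (tensor_class A X D (v - w))"
      using f g tensor_class_closed[OF d] tensor_class_closed[OF c[OF vw(2)]] by simp
  next
    fix p assume "p \<in> carrier X \<times> carrier D"
    then show "f (tensor_class A X D (frag_of p)) = g (tensor_class A X D (frag_of p))"
      using eq[of "fst p" "snd p"] by (auto simp: elem_def)
  qed
  then show ?thesis using v(2) by simp
qed

text \<open>Operations on cosets are defined as unions over representatives. If \<open>k\<close>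
  carries the generating relations into relations, all members of the union agree and one
  representative suffices.\<close>

lemma tensor_class_frag_extend:
  fixes Y :: "('a, 'n) module"
  assumes Y: "right_module A Y"
    and c: "\<And>x d. \<lbrakk>x \<in> carrier X; d \<in> carrier D\<rbrakk> \<Longrightarrow> k (x, d) \<in> carrier (tensor_free Y D)"
    and rel: "\<And>u. u \<in> tensor_gens X \<Longrightarrow> frag_extend k u \<in> tensor_rel A Y D"
    and u: "u \<in> carrier (tensor_free X D)"
  shows "(\<Union>v\<in>tensor_class A X D u. tensor_class A Y D (frag_extend k v)) = tensor_class A Y D (frag_extend k u)"
    and "frag_extend k u \<in> carrier (tensor_free Y D)"
proof -
  interpret FY: comm_group "tensor_free Y D" by (rule comm_group_tensor_free)
  have NY: "subgroup (tensor_rel A Y D) (tensor_free Y D)"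
    unfolding tensor_rel_eq by (rule FY.generate_is_subgroup[OF tensor_gens_subset[OF Y]])
  have cl: "frag_extend k v \<in> carrier (tensor_free Y D)" if "v \<in> carrier (tensor_free X D)" for v
  proof -
    have "Poly_Mapping.keys v \<subseteq> carrier X \<times> carrier D" using that by (simp add: tensor_free_def)
    then show ?thesis
      by (rule free_Abelian_group_induct) (auto simp: frag_extend_diff c tensor_free_carrier)
  qed
  then show "frag_extend k u \<in> carrier (tensor_free Y D)" using u .
  \<comment> \<open>The preimage of the relations is a subgroup, so it is enough that it contains
    the generators.\<close>
  let ?H = "{v \<in> carrier (tensor_free X D). frag_extend k v \<in> tensor_rel A Y D}"
  have "subgroup ?H (tensor_free X D)"
  proof (rule F.subgroupI)
    show "?H \<noteq> {}" using tensor_free_carrier(2) subgroup.one_closed[OF NY] by force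
    show "inv\<^bsub>tensor_free X D\<^esub> v \<in> ?H" if "v \<in> ?H" for v
      using that F.inv_closed[of v] subgroup.m_inv_closed[OF NY, of "frag_extend k v"] cl[of v]
      by (auto simp: tensor_free_inv frag_extend_minus)
    show "v \<otimes>\<^bsub>tensor_free X D\<^esub> w \<in> ?H" if "v \<in> ?H" "w \<in> ?H" for v w
      using that subgroup.m_closed[OF NY] by (auto simp: frag_extend_add tensor_free_carrier)
  qed auto
  then have N: "tensor_rel A X D \<subseteq> ?H"
    using rel tensor_gens_subset[OF X] by (intro tensor_rel_subset_iff[OF X]) auto
  have "tensor_class A Y D (frag_extend k v) = tensor_class A Y D (frag_extend k u)"
    if v: "v \<in> tensor_class A X D u" for v
  proof -
    note m = mem_tensor_class[OF u v]
    have "frag_extend k v - frag_extend k u \<in> tensor_rel A Y D"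
      using N m(2) by (auto simp: frag_extend_diff)
    moreover have "frag_extend k v = (frag_extend k v - frag_extend k u) \<otimes>\<^bsub>tensor_free Y D\<^esub> frag_extend k u" by simp
    ultimately have "frag_extend k v \<in> tensor_class A Y D (frag_extend k u)"
      unfolding tensor_class_def r_coset_def by blast
    then show ?thesis
      unfolding tensor_class_def using FY.repr_independence[OF _ cl[OF u] NY] by metis
  qed
  then show "(\<Union>v\<in>tensor_class A X D u. tensor_class A Y D (frag_extend k v)) = tensor_class A Y D (frag_extend k u)"
    using self_mem_tensor_class[OF u] by blast
qed

end

text \<open>Acting on the second factor respects the balancing relation because the left and right
  actions on \<open>D\<close> commute; the module axioms then follow from those of \<open>D\<close>
  on pure tensors.\<close>

lemma right_module_tensor:
  assumes X: "right_module A X"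
  shows "right_module A (tensor A X D)"
    and "\<lbrakk>a \<in> carrier A; x \<in> carrier X; d \<in> carrier D\<rbrakk> \<Longrightarrow>
      a \<odot>\<^bsub>tensor A X D\<^esub> elem X x d = elem X x (a \<odot>\<^bsub>D\<^esub> d)"
proof -
  interpret X: right_module A X by (rule X)
  interpret T: abelian_group "tensor A X D" by (rule abelian_group_tensor[OF X])
  let ?T = "tensor A X D" and ?c = "tensor_class A X D"
  note add = tensor_class_add[OF X] and cl = tensor_class_closed[OF X]
  define k where "k a = (\<lambda>(x :: 'b, d). frag_of (x, a \<odot>\<^bsub>D\<^esub> d))" for a
  have rel: "frag_extend (k a) u \<in> tensor_rel A X D" if a: "a \<in> carrier A" and "u \<in> tensor_gens X" for a u
    using that(2)
  proof (cases rule: tensor_gensE)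
    case (add_l x y d)
    then have "frag_extend (k a) u \<in> tensor_gens X"
      using a by (auto simp: frag_extend_diff k_def intro: tensor_gensI)
    then show ?thesis by (rule gens_in_rel[OF X])
  next
    case (add_r x d d')
    then have "frag_extend (k a) u \<in> tensor_gens X"
      using a by (auto simp: frag_extend_diff k_def D.smult_r_distr intro: tensor_gensI)
    then show ?thesis by (rule gens_in_rel[OF X])
  next
    case (balanced b x d)
    then have "frag_extend (k a) u \<in> tensor_gens X"
      using a by (auto simp: frag_extend_diff k_def lsmult_smult[symmetric] intro: tensor_gensI)
    then show ?thesis by (rule gens_in_rel[OF X])
  qed
  have sm: "a \<odot>\<^bsub>?T\<^esub> ?c u = ?c (frag_extend (k a) u)" "frag_extend (k a) u \<in> carrier (tensor_free X D)"
    if "a \<in> carrier A" "u \<in> carrier (tensor_free X D)" for a u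
    using tensor_class_frag_extend[OF X X _ rel[OF that(1)] that(2)] that(1)
    unfolding tensor_smult_eq by (auto simp: k_def tensor_free_carrier)
  have smc: "a \<odot>\<^bsub>?T\<^esub> U \<in> carrier ?T" if "a \<in> carrier A" "U \<in> carrier ?T" for a U
    using that sm cl by (auto simp: tensor_carrier[OF X])
  have sma: "a \<odot>\<^bsub>?T\<^esub> (U \<oplus>\<^bsub>?T\<^esub> V) = a \<odot>\<^bsub>?T\<^esub> U \<oplus>\<^bsub>?T\<^esub> a \<odot>\<^bsub>?T\<^esub> V"
    if "a \<in> carrier A" "U \<in> carrier ?T" "V \<in> carrier ?T" for a U V
    using that by (auto simp: tensor_carrier[OF X] add sm tensor_free_carrier frag_extend_add)
  show el: "a \<odot>\<^bsub>?T\<^esub> elem X x d = elem X x (a \<odot>\<^bsub>D\<^esub> d)"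
    if "a \<in> carrier A" "x \<in> carrier X" "d \<in> carrier D" for a x d
    using that by (simp add: elem_def sm tensor_free_carrier) (simp add: k_def)
  note eqI = tensor_eqI[OF X T.abelian_group_axioms]
  show "right_module A ?T"
  proof (rule right_moduleI[OF D.R.ring_axioms T.abelian_group_axioms smc _ sma])
    fix a b U assume ab: "a \<in> carrier A" "b \<in> carrier A" and U: "U \<in> carrier ?T"
    show "(a \<oplus>\<^bsub>A\<^esub> b) \<odot>\<^bsub>?T\<^esub> U = a \<odot>\<^bsub>?T\<^esub> U \<oplus>\<^bsub>?T\<^esub> b \<odot>\<^bsub>?T\<^esub> U"
      by (rule eqI[OF U]) (use ab in \<open>simp_all add: smc sma el D.smult_l_distr elem_add_right[OF X] T.a_ac\<close>)
    show "(a \<otimes>\<^bsub>A\<^esub> b) \<odot>\<^bsub>?T\<^esub> U = b \<odot>\<^bsub>?T\<^esub> (a \<odot>\<^bsub>?T\<^esub> U)"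
      by (rule eqI[OF U]) (use ab in \<open>simp_all add: smc sma el D.smult_assoc\<close>)
  next
    fix U assume U: "U \<in> carrier ?T"
    show "\<one>\<^bsub>A\<^esub> \<odot>\<^bsub>?T\<^esub> U = U"
      by (rule eqI[OF U]) (simp_all add: smc sma el)
  qed
qed

lemma tensor_map_hom:
  fixes X :: "('a, 'm) module" and Y :: "('a, 'n) module"
  assumes X: "right_module A X" and Y: "right_module A Y" and f: "f \<in> mod_hom A X Y"
  shows "tensor_map A X Y D f \<in> mod_hom A (tensor A X D) (tensor A Y D)"
    and "\<lbrakk>x \<in> carrier X; d \<in> carrier D\<rbrakk> \<Longrightarrow> tensor_map A X Y D f (elem X x d) = elem Y (f x) d"
proof -
  interpret X: right_module A X by (rule X)
  interpret Y: right_module A Y by (rule Y)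
  interpret TX: right_module A "tensor A X D" by (rule right_module_tensor(1)[OF X])
  interpret TY: right_module A "tensor A Y D" by (rule right_module_tensor(1)[OF Y])
  let ?T = "tensor A X D" and ?c = "tensor_class A X D" and ?f = "tensor_map A X Y D f"
  define k where "k = (\<lambda>(x, d :: 'd). frag_of (f x, d))"
  note fc = mod_hom_closed[OF f]
  have rel: "frag_extend k u \<in> tensor_rel A Y D" if "u \<in> tensor_gens X" for u
    using that
  proof (cases rule: tensor_gensE)
    case (add_l x y d)
    then have "frag_extend k u \<in> tensor_gens Y"
      using fc by (auto simp: frag_extend_diff k_def mod_hom_add[OF f] intro: tensor_gensI)
    then show ?thesis by (rule gens_in_rel[OF Y])
  next
    case (add_r x d d')
    then have "frag_extend k u \<in> tensor_gens Y"
      using fc by (auto simp: frag_extend_diff k_def intro: tensor_gensI)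
    then show ?thesis by (rule gens_in_rel[OF Y])
  next
    case (balanced b x d)
    then have "frag_extend k u \<in> tensor_gens Y"
      using fc by (auto simp: frag_extend_diff k_def mod_hom_smult[OF f] intro: tensor_gensI)
    then show ?thesis by (rule gens_in_rel[OF Y])
  qed
  have tm: "?f (?c u) = tensor_class A Y D (frag_extend k u)" "frag_extend k u \<in> carrier (tensor_free Y D)"
    if "u \<in> carrier (tensor_free X D)" for u
    using tensor_class_frag_extend[OF X Y _ rel that] that fc
    by (auto simp: tensor_map_def tensor_carrier[OF X] k_def tensor_free_carrier)
  have cl: "?f U \<in> carrier (tensor A Y D)" if "U \<in> carrier ?T" for U
    using that tm tensor_class_closed[OF Y] by (auto simp: tensor_carrier[OF X])
  have ad: "?f (U \<oplus>\<^bsub>?T\<^esub> V) = ?f U \<oplus>\<^bsub>tensor A Y D\<^esub> ?f V" if "U \<in> carrier ?T" "V \<in> carrier ?T" for U V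
    using that by (auto simp: tensor_carrier[OF X] tensor_class_add[OF X] tensor_class_add[OF Y] tm
        tensor_free_carrier frag_extend_add)
  show el: "?f (elem X x d) = elem Y (f x) d" if "x \<in> carrier X" "d \<in> carrier D" for x d
    using that by (simp add: elem_def tm tensor_free_carrier) (simp add: k_def)
  show "?f \<in> mod_hom A ?T (tensor A Y D)"
  proof (rule mod_homI[OF _ cl ad])
    show "?f \<in> extensional (carrier ?T)" by (simp add: tensor_map_def)
    fix a U assume a: "a \<in> carrier A" and U: "U \<in> carrier ?T"
    show "?f (a \<odot>\<^bsub>?T\<^esub> U) = a \<odot>\<^bsub>tensor A Y D\<^esub> ?f U"
      by (rule tensor_eqI[OF X TY.M.abelian_group_axioms U])
        (use a in \<open>simp_all add: cl ad TX.smult_r_distr TY.smult_r_distr el right_module_tensor(2)[OF X]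
          right_module_tensor(2)[OF Y] fc elem_closed[OF X]\<close>)
  qed
qed

lemma tensor_map_eqI:
  assumes X: "right_module A X" and G: "right_module A G"
    and f: "f \<in> mod_hom A (tensor A X D) G" and g: "g \<in> mod_hom A (tensor A X D) G"
    and eq: "\<And>x d. \<lbrakk>x \<in> carrier X; d \<in> carrier D\<rbrakk> \<Longrightarrow> f (elem X x d) = g (elem X x d)"
  shows "f = g"
proof -
  interpret G: right_module A G by (rule G)
  show ?thesis
    by (rule mod_hom_eqI[OF f g], rule tensor_eqI[OF X G.M.abelian_group_axioms])
      (simp_all add: mod_hom_closed[OF f] mod_hom_closed[OF g] mod_hom_add[OF f] mod_hom_add[OF g] eq)
qed

text \<open>\<open>\<beta>\<close> extends to the free abelian group, and the kernel of the
  extension contains each generating relation; so the extension is constant on classes.\<close>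

lemma tensor_universal:
  fixes G :: "('g, 'l) ring_scheme"
  assumes X: "right_module A X" and G: "abelian_group G"
    and c: "\<And>x d. \<lbrakk>x \<in> carrier X; d \<in> carrier D\<rbrakk> \<Longrightarrow> \<beta> x d \<in> carrier G"
    and l: "\<And>x y d. \<lbrakk>x \<in> carrier X; y \<in> carrier X; d \<in> carrier D\<rbrakk> \<Longrightarrow> \<beta> (x \<oplus>\<^bsub>X\<^esub> y) d = \<beta> x d \<oplus>\<^bsub>G\<^esub> \<beta> y d"
    and r: "\<And>x d d'. \<lbrakk>x \<in> carrier X; d \<in> carrier D; d' \<in> carrier D\<rbrakk> \<Longrightarrow> \<beta> x (d \<oplus>\<^bsub>D\<^esub> d') = \<beta> x d \<oplus>\<^bsub>G\<^esub> \<beta> x d'"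
    and b: "\<And>a x d. \<lbrakk>a \<in> carrier A; x \<in> carrier X; d \<in> carrier D\<rbrakk> \<Longrightarrow> \<beta> (a \<odot>\<^bsub>X\<^esub> x) d = \<beta> x (lsmult D a d)"
  shows "\<exists>h. (\<forall>u\<in>carrier (tensor A X D). h u \<in> carrier G) \<and>
    (\<forall>u\<in>carrier (tensor A X D). \<forall>v\<in>carrier (tensor A X D). h (u \<oplus>\<^bsub>tensor A X D\<^esub> v) = h u \<oplus>\<^bsub>G\<^esub> h v) \<and>
    (\<forall>x\<in>carrier X. \<forall>d\<in>carrier D. h (elem X x d) = \<beta> x d)"
proof -
  interpret X: right_module A X by (rule X)
  interpret G: abelian_group G by (rule G)
  interpret F: comm_group "tensor_free X D" by (rule comm_group_tensor_free)
  have "(\<lambda>(x, d). \<beta> x d) ` (carrier X \<times> carrier D) \<subseteq> carrier (add_monoid G)" using c by auto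
  then obtain h where h: "h \<in> hom (tensor_free X D) (add_monoid G)"
    "\<And>p. p \<in> carrier X \<times> carrier D \<Longrightarrow> h (frag_of p) = (case p of (x, d) \<Rightarrow> \<beta> x d)"
    unfolding tensor_free_def by (rule comm_group.free_Abelian_group_universal[OF G.a_comm_group]) blast
  have hc: "h u \<in> carrier G" if "u \<in> carrier (tensor_free X D)" for u
    using h(1) that by (auto simp: hom_def)
  have ha: "h (u + v) = h u \<oplus>\<^bsub>G\<^esub> h v" if "u \<in> carrier (tensor_free X D)" "v \<in> carrier (tensor_free X D)" for u v
    using h(1) that by (auto simp: hom_def)
  have hd: "h u = h (u - v) \<oplus>\<^bsub>G\<^esub> h v" if "u \<in> carrier (tensor_free X D)" "v \<in> carrier (tensor_free X D)" for u v
    using ha[OF tensor_free_carrier(4)[OF that] that(2)] by simp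
  have hz: "h 0 = \<zero>\<^bsub>G\<^esub>"
    using ha[OF tensor_free_carrier(2) tensor_free_carrier(2)] hc[OF tensor_free_carrier(2)] by simp
  have he: "h u = h v \<longleftrightarrow> h (u - v) = \<zero>\<^bsub>G\<^esub>" if "u \<in> carrier (tensor_free X D)" "v \<in> carrier (tensor_free X D)" for u v
    using hd[OF that] hc[OF that(2)] hc[OF tensor_free_carrier(4)[OF that]] by simp
  let ?H = "{u \<in> carrier (tensor_free X D). h u = \<zero>\<^bsub>G\<^esub>}"
  have "subgroup ?H (tensor_free X D)"
  proof (rule F.subgroupI)
    show "?H \<noteq> {}" using hz tensor_free_carrier(2) by auto
    show "inv\<^bsub>tensor_free X D\<^esub> v \<in> ?H" if "v \<in> ?H" for v
    proof -
      have v: "v \<in> carrier (tensor_free X D)" "h v = \<zero>\<^bsub>G\<^esub>" using that by auto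
      then have "h (0 - v) = \<zero>\<^bsub>G\<^esub>" using he[OF tensor_free_carrier(2) v(1)] hz by simp
      then show ?thesis using v F.inv_closed[OF v(1)] by (simp add: tensor_free_inv)
    qed
    show "v \<otimes>\<^bsub>tensor_free X D\<^esub> w \<in> ?H" if "v \<in> ?H" "w \<in> ?H" for v w
      using that by (auto simp: ha tensor_free_carrier)
  qed auto
  moreover have "tensor_gens X \<subseteq> ?H"
  proof
    fix u assume u: "u \<in> tensor_gens X"
    then have uc: "u \<in> carrier (tensor_free X D)" using tensor_gens_subset[OF X] by blast
    from u have "h u = \<zero>\<^bsub>G\<^esub>"
    proof (cases rule: tensor_gensE)
      case (add_l x y d)
      have "h (frag_of (x \<oplus>\<^bsub>X\<^esub> y, d)) = h (frag_of (x, d) + frag_of (y, d))"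
        using add_l by (simp add: ha tensor_free_carrier h(2) l)
      then have "h (frag_of (x \<oplus>\<^bsub>X\<^esub> y, d) - (frag_of (x, d) + frag_of (y, d))) = \<zero>\<^bsub>G\<^esub>"
        using add_l by (subst (asm) he) (auto simp: tensor_free_carrier)
      then show ?thesis using add_l by (simp add: diff_diff_eq)
    next
      case (add_r x d d')
      have "h (frag_of (x, d \<oplus>\<^bsub>D\<^esub> d')) = h (frag_of (x, d) + frag_of (x, d'))"
        using add_r by (simp add: ha tensor_free_carrier h(2) r)
      then have "h (frag_of (x, d \<oplus>\<^bsub>D\<^esub> d') - (frag_of (x, d) + frag_of (x, d'))) = \<zero>\<^bsub>G\<^esub>"
        using add_r by (subst (asm) he) (auto simp: tensor_free_carrier)
      then show ?thesis using add_r by (simp add: diff_diff_eq)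
    next
      case (balanced a x d)
      have "h (frag_of (a \<odot>\<^bsub>X\<^esub> x, d)) = h (frag_of (x, lsmult D a d))"
        using balanced by (simp add: h(2) b lsmult_closed)
      then show ?thesis
        using balanced by (subst (asm) he) (auto simp: tensor_free_carrier lsmult_closed)
    qed
    then show "u \<in> ?H" using uc by simp
  qed
  ultimately have N: "tensor_rel A X D \<subseteq> ?H" by (rule tensor_rel_subset_iff[OF X])
  \<comment> \<open>The common value of \<open>h\<close> on a class.\<close>
  define g where "g C = the_elem (h ` C)" for C
  have g: "g (tensor_class A X D u) = h u" if u: "u \<in> carrier (tensor_free X D)" for u
  proof -
    have "h v = h u" if "v \<in> tensor_class A X D u" for v
      using N mem_tensor_class[OF X u that] he[OF _ u] by blast
    then have "h ` tensor_class A X D u = {h u}" using self_mem_tensor_class[OF X u] by blast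
    then show ?thesis by (simp add: g_def)
  qed
  show ?thesis
    by (intro exI[of _ g])
      (auto simp: tensor_carrier[OF X] tensor_class_add[OF X] g hc ha tensor_free_carrier elem_def h(2))
qed

end

section \<open>Shifts\<close>

lemma obj_shift: "obj (shift n X) i = obj X (i + n)"
  and dif_shift: "dif (shift n X) i = (if even n then dif X (i + n)
                else (\<lambda>x\<in>carrier (obj X (i + n)). \<ominus>\<^bsub>obj X (i + n + 1)\<^esub> dif X (i + n) x))"
  by (simp_all add: shift_def)

lemma shift_complex:
  assumes "mod_complex A X"
  shows "mod_complex A (shift n X)"
proof -
  interpret X: mod_complex A X by fact
  interpret M: right_module A "obj X i" for i by (rule X.obj_module)
  have i: "i + 1 + n = i + n + 1" "i + 2 + n = i + n + 2" for i :: int by simp_all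
  show ?thesis
  proof (rule mod_complex.intro)
    show "right_module A (obj (shift n X) j)" for j by (simp add: obj_shift X.obj_module)
    show "dif (shift n X) j \<in> mod_hom A (obj (shift n X) j) (obj (shift n X) (j + 1))" for j
      using X.dif_hom mod_hom_uminus[OF X.dif_hom X.obj_module X.obj_module]
      by (simp add: obj_shift dif_shift i)
    show "dif (shift n X) (j + 1) (dif (shift n X) j x) = \<zero>\<^bsub>obj (shift n X) (j + 2)\<^esub>"
      if "x \<in> carrier (obj (shift n X) j)" for j x
    proof -
      have x: "x \<in> carrier (obj X (j + n))" using that by (simp add: obj_shift)
      have d: "dif X (j + n + 1) (dif X (j + n) x) = \<zero>\<^bsub>obj X (j + n + 2)\<^esub>" by (rule X.dif_dif[OF x])
      have d': "dif X (j + n + 1) (\<ominus>\<^bsub>obj X (j + n + 1)\<^esub> dif X (j + n) x) = \<zero>\<^bsub>obj X (j + n + 2)\<^esub>"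
        using mod_hom_minus[OF X.dif_hom X.obj_group X.obj_group X.dif_closed[OF x]] d
        by (simp add: add.assoc)
      have z: "\<ominus>\<^bsub>obj X (j + n + 1 + 1)\<^esub> \<zero>\<^bsub>obj X (j + n + 2)\<^esub> = \<zero>\<^bsub>obj X (j + n + 2)\<^esub>"
        by (simp add: add.assoc)
      show ?thesis using x d d' z by (simp add: obj_shift dif_shift i X.dif_closed)
    qed
  qed
qed

lemma shift_chain_map:
  assumes X: "mod_complex A X" and Y: "mod_complex A Y" and f: "f \<in> chain_maps A X Y"
  shows "(\<lambda>i. f (i + n)) \<in> chain_maps A (shift n X) (shift n Y)"
proof (rule chain_mapsI)
  interpret X: mod_complex A X by fact
  interpret Y: mod_complex A Y by fact
  show "f (i + n) \<in> mod_hom A (obj (shift n X) i) (obj (shift n Y) i)" for i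
    using chain_map_hom[OF f] by (simp add: obj_shift)
  fix i x assume "x \<in> carrier (obj (shift n X) i)"
  then have x: "x \<in> carrier (obj X (i + n))" by (simp add: obj_shift)
  have i: "i + 1 + n = i + n + 1" by simp
  show "f (i + 1 + n) (dif (shift n X) i x) = dif (shift n Y) i (f (i + n) x)"
    using x by (simp add: dif_shift i chain_map_dif[OF f] chain_map_closed[OF f]
        mod_hom_minus[OF chain_map_hom[OF f] X.obj_group Y.obj_group] X.dif_closed)
qed

text \<open>For odd \<open>n\<close> both differentials change sign but \<open>f\<close> and
  \<open>g\<close> do not; so the homotopy has to change sign too.\<close>

lemma shift_homotopic:
  assumes X: "mod_complex A X" and Y: "mod_complex A Y" and fg: "(f, g) \<in> homotopic A X Y"
  shows "(\<lambda>i. f (i + n), \<lambda>i. g (i + n)) \<in> homotopic A (shift n X) (shift n Y)"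
  using X Y fg
proof (rule homotopicE)
  fix s
  assume f: "f \<in> chain_maps A X Y" and g: "g \<in> chain_maps A X Y"
    and s: "\<And>i. s i \<in> mod_hom A (obj X i) (obj Y (i - 1))"
    and e: "\<And>i x. x \<in> carrier (obj X i) \<Longrightarrow>
           f i x = g i x \<oplus>\<^bsub>obj Y i\<^esub> (dif Y (i - 1) (s i x) \<oplus>\<^bsub>obj Y i\<^esub> s (i + 1) (dif X i x))"
    and c: "\<And>i x. x \<in> carrier (obj X i) \<Longrightarrow> dif Y (i - 1) (s i x) \<in> carrier (obj Y i)"
      "\<And>i x. x \<in> carrier (obj X i) \<Longrightarrow> s (i + 1) (dif X i x) \<in> carrier (obj Y i)"
  interpret X: mod_complex A X by (rule X)
  interpret Y: mod_complex A Y by (rule Y)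
  interpret M: right_module A "obj X i" for i by (rule X.obj_module)
  interpret N: right_module A "obj Y i" for i by (rule Y.obj_module)
  let ?s = "\<lambda>i. if even n then s (i + n)
    else (\<lambda>x\<in>carrier (obj X (i + n)). \<ominus>\<^bsub>obj Y (i + n - 1)\<^esub> s (i + n) x)"
  have i: "i + 1 + n = i + n + 1" "i - 1 + n = i + n - 1" "i + n - 1 + 1 = i + n" "i + n + 1 - 1 = i + n" for i :: int
    by simp_all
  show ?thesis
  proof (rule homotopicI[OF shift_complex[OF X] shift_complex[OF Y]
        shift_chain_map[OF X Y f] shift_chain_map[OF X Y g], of ?s])
    show "?s j \<in> mod_hom A (obj (shift n X) j) (obj (shift n Y) (j - 1))" for j
      using s[of "j + n"] mod_hom_uminus[OF s X.obj_module Y.obj_module, of "j + n"]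
      by (simp add: obj_shift i)
    fix j x assume "x \<in> carrier (obj (shift n X) j)"
    then have x: "x \<in> carrier (obj X (j + n))" by (simp add: obj_shift)
    have sx: "s (j + n) x \<in> carrier (obj Y (j + n - 1))" by (rule mod_hom_closed[OF s x])
    have 1: "dif Y (j + n - 1) (\<ominus>\<^bsub>obj Y (j + n - 1)\<^esub> s (j + n) x) =
        \<ominus>\<^bsub>obj Y (j + n)\<^esub> dif Y (j + n - 1) (s (j + n) x)"
      by (rule mod_hom_minus[OF Y.dif_pred_hom Y.obj_group Y.obj_group sx])
    have 2: "s (j + n + 1) (\<ominus>\<^bsub>obj X (j + n + 1)\<^esub> dif X (j + n) x) =
        \<ominus>\<^bsub>obj Y (j + n)\<^esub> s (j + n + 1) (dif X (j + n) x)"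
      using mod_hom_minus[OF s X.obj_group Y.obj_group X.dif_closed[OF x]] by simp
    show "f (j + n) x = g (j + n) x \<oplus>\<^bsub>obj (shift n Y) j\<^esub>
        (dif (shift n Y) (j - 1) (?s j x) \<oplus>\<^bsub>obj (shift n Y) j\<^esub> ?s (j + 1) (dif (shift n X) j x))"
      using x sx e[OF x] 1 2 c[OF x] X.dif_closed[OF x] by (simp add: obj_shift dif_shift i)
  qed
qed

lemma k_shift_class:
  assumes X: "mod_complex A X" and Y: "mod_complex A Y" and f: "f \<in> chain_maps A X Y"
  shows "k_shift A n X Y (k_class A X Y f) = k_class A (shift n X) (shift n Y) (\<lambda>i. f (i + n))"
proof -
  have "k_class A (shift n X) (shift n Y) (\<lambda>i. g (i + n)) = k_class A (shift n X) (shift n Y) (\<lambda>i. f (i + n))"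
    if "g \<in> k_class A X Y f" for g
    using that shift_homotopic[OF X Y, of f g]
    by (intro k_classI[OF shift_complex[OF X] shift_complex[OF Y], symmetric]) (simp add: k_class_def)
  moreover have "f \<in> k_class A X Y f" using homotopic_refl[OF X Y f] by (simp add: k_class_def)
  ultimately show ?thesis unfolding k_shift_def by blast
qed

section \<open>Tensoring complexes\<close>

context tensor_bimodule
begin

lemma tensor_map_compose:
  assumes X: "right_module A X" and Y: "right_module A Y" and Z: "right_module A Z"
    and f: "f \<in> mod_hom A X Y" and g: "g \<in> mod_hom A Y Z"
  shows "tensor_map A X Z D (compose (carrier X) g f) =
    compose (carrier (tensor A X D)) (tensor_map A Y Z D g) (tensor_map A X Y D f)"
  by (rule tensor_map_eqI[OF X right_module_tensor(1)[OF Z]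
        tensor_map_hom(1)[OF X Z mod_hom_compose[OF f g X]]
        mod_hom_compose[OF tensor_map_hom(1)[OF X Y f] tensor_map_hom(1)[OF Y Z g] right_module_tensor(1)[OF X]]])
    (simp add: tensor_map_hom(2)[OF X Z mod_hom_compose[OF f g X]] tensor_map_hom(2)[OF X Y f]
      tensor_map_hom(2)[OF Y Z g] compose_eq elem_closed[OF X] mod_hom_closed[OF f])

lemma tensor_map_comp:
  assumes X: "right_module A X" and Y: "right_module A Y" and Z: "right_module A Z"
    and f: "f \<in> mod_hom A X Y" and g: "g \<in> mod_hom A Y Z" and u: "u \<in> carrier (tensor A X D)"
  shows "tensor_map A Y Z D g (tensor_map A X Y D f u) = tensor_map A X Z D (compose (carrier X) g f) u"
  using u by (simp add: tensor_map_compose[OF X Y Z f g] compose_eq)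

lemma tensor_map_plus:
  assumes X: "right_module A X" and Y: "right_module A Y"
    and f: "f \<in> mod_hom A X Y" and g: "g \<in> mod_hom A X Y" and u: "u \<in> carrier (tensor A X D)"
  shows "tensor_map A X Y D (\<lambda>x\<in>carrier X. f x \<oplus>\<^bsub>Y\<^esub> g x) u =
    tensor_map A X Y D f u \<oplus>\<^bsub>tensor A Y D\<^esub> tensor_map A X Y D g u"
proof -
  note T = right_module_tensor(1)[OF X] right_module_tensor(1)[OF Y]
  note p = mod_hom_plus[OF f g X Y]
  have "tensor_map A X Y D (\<lambda>x\<in>carrier X. f x \<oplus>\<^bsub>Y\<^esub> g x) =
      (\<lambda>u\<in>carrier (tensor A X D). tensor_map A X Y D f u \<oplus>\<^bsub>tensor A Y D\<^esub> tensor_map A X Y D g u)"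
    by (rule tensor_map_eqI[OF X T(2) tensor_map_hom(1)[OF X Y p]
          mod_hom_plus[OF tensor_map_hom(1)[OF X Y f] tensor_map_hom(1)[OF X Y g] T]])
      (simp add: tensor_map_hom(2)[OF X Y] f g p elem_closed[OF X] elem_add_left[OF Y]
        mod_hom_closed[OF f] mod_hom_closed[OF g])
  with u show ?thesis by simp
qed

lemma tensor_map_id:
  assumes X: "right_module A X" and u: "u \<in> carrier (tensor A X D)"
  shows "tensor_map A X X D (\<lambda>x\<in>carrier X. x) u = u"
proof -
  note T = right_module_tensor(1)[OF X] and i = right_module.mod_hom_id[OF X]
  have "tensor_map A X X D (\<lambda>x\<in>carrier X. x) = (\<lambda>u\<in>carrier (tensor A X D). u)"
    by (rule tensor_map_eqI[OF X T tensor_map_hom(1)[OF X X i] right_module.mod_hom_id[OF T]])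
      (simp add: tensor_map_hom(2)[OF X X i] elem_closed[OF X])
  with u show ?thesis by simp
qed

lemma tensor_map_zero:
  assumes X: "right_module A X" and Y: "right_module A Y" and u: "u \<in> carrier (tensor A X D)"
  shows "tensor_map A X Y D (\<lambda>x\<in>carrier X. \<zero>\<^bsub>Y\<^esub>) u = \<zero>\<^bsub>tensor A Y D\<^esub>"
proof -
  note T = right_module_tensor(1)[OF X] right_module_tensor(1)[OF Y]
  note z = mod_hom_zero_map[OF X Y]
  have "tensor_map A X Y D (\<lambda>x\<in>carrier X. \<zero>\<^bsub>Y\<^esub>) = (\<lambda>u\<in>carrier (tensor A X D). \<zero>\<^bsub>tensor A Y D\<^esub>)"
    by (rule tensor_map_eqI[OF X T(2) tensor_map_hom(1)[OF X Y z] mod_hom_zero_map[OF T]])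
      (simp add: tensor_map_hom(2)[OF X Y z] elem_closed[OF X] elem_zero_left[OF Y])
  with u show ?thesis by simp
qed

text \<open>On a zero module the identity is the zero map, and by functoriality the same holds after
  tensoring.\<close>

lemma tensor_zero_module:
  assumes X: "right_module A X" and z: "carrier X = {\<zero>\<^bsub>X\<^esub>}" and u: "u \<in> carrier (tensor A X D)"
  shows "u = \<zero>\<^bsub>tensor A X D\<^esub>"
proof -
  have "(\<lambda>x\<in>carrier X. x) = (\<lambda>x\<in>carrier X. \<zero>\<^bsub>X\<^esub>)" using z by (intro restrict_ext) auto
  then show ?thesis using tensor_map_id[OF X u] tensor_map_zero[OF X X u] by simp
qed

text \<open>For the bimodule DA this is the Nakayama functor on complexes.\<close>

definition tensor_complex :: "('a, 'm) cochain \<Rightarrow> ('a, (('m \<times> 'd) \<Rightarrow>\<^sub>0 int) set) cochain" where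
  "tensor_complex X = \<lparr>obj = (\<lambda>i. tensor A (obj X i) D),
     dif = (\<lambda>i. tensor_map A (obj X i) (obj X (i + 1)) D (dif X i))\<rparr>"

definition tensor_chain ::
  "('a, 'm) cochain \<Rightarrow> ('a, 'n) cochain \<Rightarrow> (int \<Rightarrow> 'm \<Rightarrow> 'n) \<Rightarrow>
   int \<Rightarrow> (('m \<times> 'd) \<Rightarrow>\<^sub>0 int) set \<Rightarrow> (('n \<times> 'd) \<Rightarrow>\<^sub>0 int) set" where
  "tensor_chain X Y f i = tensor_map A (obj X i) (obj Y i) D (f i)"

lemma tensor_complex_simps:
  "obj (tensor_complex X) i = tensor A (obj X i) D"
  "dif (tensor_complex X) i = tensor_map A (obj X i) (obj X (i + 1)) D (dif X i)"
  by (simp_all add: tensor_complex_def)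

lemma tensor_complex:
  assumes "mod_complex A X"
  shows "mod_complex A (tensor_complex X)"
proof -
  interpret X: mod_complex A X by fact
  note m = X.obj_module
  show ?thesis
  proof (rule mod_complex.intro)
    show "right_module A (obj (tensor_complex X) i)" for i
      by (simp add: tensor_complex_simps right_module_tensor(1)[OF m])
    show "dif (tensor_complex X) i \<in> mod_hom A (obj (tensor_complex X) i) (obj (tensor_complex X) (i + 1))" for i
      by (simp add: tensor_complex_simps tensor_map_hom(1)[OF m m X.dif_hom])
    fix i u assume "u \<in> carrier (obj (tensor_complex X) i)"
    then have u: "u \<in> carrier (tensor A (obj X i) D)" by (simp add: tensor_complex_simps)
    have d: "dif X (i + 1) \<in> mod_hom A (obj X (i + 1)) (obj X (i + 2))"
      using X.dif_hom[of "i + 1"] by (simp add: add.assoc)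
    have "compose (carrier (obj X i)) (dif X (i + 1)) (dif X i) = (\<lambda>x\<in>carrier (obj X i). \<zero>\<^bsub>obj X (i + 2)\<^esub>)"
      unfolding compose_def by (intro restrict_ext) (simp add: X.dif_dif)
    then show "dif (tensor_complex X) (i + 1) (dif (tensor_complex X) i u) = \<zero>\<^bsub>obj (tensor_complex X) (i + 2)\<^esub>"
      using tensor_map_comp[OF m m m X.dif_hom d u] tensor_map_zero[OF m m u]
      by (simp add: tensor_complex_simps add.assoc)
  qed
qed

lemma tensor_chain_map:
  assumes X: "mod_complex A X" and Y: "mod_complex A Y" and f: "f \<in> chain_maps A X Y"
  shows "tensor_chain X Y f \<in> chain_maps A (tensor_complex X) (tensor_complex Y)"
proof (rule chain_mapsI)
  interpret X: mod_complex A X by fact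
  interpret Y: mod_complex A Y by fact
  note m = X.obj_module Y.obj_module and h = chain_map_hom[OF f]
  show "tensor_chain X Y f i \<in> mod_hom A (obj (tensor_complex X) i) (obj (tensor_complex Y) i)" for i
    by (simp add: tensor_complex_simps tensor_chain_def tensor_map_hom(1)[OF m h])
  fix i u assume "u \<in> carrier (obj (tensor_complex X) i)"
  then have u: "u \<in> carrier (tensor A (obj X i) D)" by (simp add: tensor_complex_simps)
  have "compose (carrier (obj X i)) (f (i + 1)) (dif X i) = compose (carrier (obj X i)) (dif Y i) (f i)"
    unfolding compose_def by (intro restrict_ext) (simp add: chain_map_dif[OF f])
  then show "tensor_chain X Y f (i + 1) (dif (tensor_complex X) i u) = dif (tensor_complex Y) i (tensor_chain X Y f i u)"
    by (simp add: tensor_complex_simps tensor_chain_def tensor_map_comp[OF m(1,1,2) X.dif_hom h u]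
        tensor_map_comp[OF m(1,2,2) h Y.dif_hom u])
qed

text \<open>Tensoring is an additive functor, so it carries a homotopy to a homotopy.\<close>

lemma tensor_homotopic:
  assumes X: "mod_complex A X" and Y: "mod_complex A Y" and fg: "(f, g) \<in> homotopic A X Y"
  shows "(tensor_chain X Y f, tensor_chain X Y g) \<in> homotopic A (tensor_complex X) (tensor_complex Y)"
  using X Y fg
proof (rule homotopicE)
  fix s
  assume f: "f \<in> chain_maps A X Y" and g: "g \<in> chain_maps A X Y"
    and s: "\<And>i. s i \<in> mod_hom A (obj X i) (obj Y (i - 1))"
    and e: "\<And>i x. x \<in> carrier (obj X i) \<Longrightarrow>
           f i x = g i x \<oplus>\<^bsub>obj Y i\<^esub> (dif Y (i - 1) (s i x) \<oplus>\<^bsub>obj Y i\<^esub> s (i + 1) (dif X i x))"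
  interpret X: mod_complex A X by (rule X)
  interpret Y: mod_complex A Y by (rule Y)
  note m = X.obj_module Y.obj_module
  show ?thesis
  proof (rule homotopicI[OF tensor_complex[OF X] tensor_complex[OF Y] tensor_chain_map[OF X Y f]
        tensor_chain_map[OF X Y g], of "\<lambda>i. tensor_map A (obj X i) (obj Y (i - 1)) D (s i)"])
    show "tensor_map A (obj X i) (obj Y (i - 1)) D (s i) \<in> mod_hom A (obj (tensor_complex X) i) (obj (tensor_complex Y) (i - 1))" for i
      by (simp add: tensor_complex_simps tensor_map_hom(1)[OF m s])
    fix i u assume "u \<in> carrier (obj (tensor_complex X) i)"
    then have u: "u \<in> carrier (tensor A (obj X i) D)" by (simp add: tensor_complex_simps)
    have s1: "s (i + 1) \<in> mod_hom A (obj X (i + 1)) (obj Y i)" using s[of "i + 1"] by simp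
    let ?C = "carrier (obj X i)"
    let ?p = "compose ?C (dif Y (i - 1)) (s i)" and ?q = "compose ?C (s (i + 1)) (dif X i)"
    have p: "?p \<in> mod_hom A (obj X i) (obj Y i)" by (rule mod_hom_compose[OF s Y.dif_pred_hom m(1)])
    have q: "?q \<in> mod_hom A (obj X i) (obj Y i)" by (rule mod_hom_compose[OF X.dif_hom s1 m(1)])
    let ?r = "\<lambda>x\<in>?C. ?p x \<oplus>\<^bsub>obj Y i\<^esub> ?q x"
    have r: "?r \<in> mod_hom A (obj X i) (obj Y i)" by (rule mod_hom_plus[OF p q m])
    \<comment> \<open>The pointwise identity is first turned into an equality of linear maps, since
      only maps can be tensored.\<close>
    have "f i = (\<lambda>x\<in>?C. g i x \<oplus>\<^bsub>obj Y i\<^esub> ?r x)"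
      by (rule mod_hom_eqI[OF chain_map_hom[OF f] mod_hom_plus[OF chain_map_hom[OF g] r m]])
        (simp add: e compose_eq)
    then have "tensor_map A (obj X i) (obj Y i) D (f i) u = tensor_map A (obj X i) (obj Y i) D (g i) u
        \<oplus>\<^bsub>tensor A (obj Y i) D\<^esub> (tensor_map A (obj X i) (obj Y i) D ?p u
        \<oplus>\<^bsub>tensor A (obj Y i) D\<^esub> tensor_map A (obj X i) (obj Y i) D ?q u)"
      using tensor_map_plus[OF m chain_map_hom[OF g] r u] tensor_map_plus[OF m p q u] by simp
    then show "tensor_chain X Y f i u = tensor_chain X Y g i u \<oplus>\<^bsub>obj (tensor_complex Y) i\<^esub>
        (dif (tensor_complex Y) (i - 1) (tensor_map A (obj X i) (obj Y (i - 1)) D (s i) u) \<oplus>\<^bsub>obj (tensor_complex Y) i\<^esub>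
         tensor_map A (obj X (i + 1)) (obj Y (i + 1 - 1)) D (s (i + 1)) (dif (tensor_complex X) i u))"
      by (simp add: tensor_complex_simps tensor_chain_def tensor_map_comp[OF m(1,1,2) X.dif_hom s1 u]
          tensor_map_comp[OF m(1,2,2) s Y.dif_pred_hom u])
  qed
qed

lemma tensor_k_class:
  assumes X: "mod_complex A X" and Y: "mod_complex A Y" and f: "f \<in> chain_maps A X Y"
  shows "(\<Union>g\<in>k_class A X Y f. k_class A (tensor_complex X) (tensor_complex Y) (tensor_chain X Y g)) =
    k_class A (tensor_complex X) (tensor_complex Y) (tensor_chain X Y f)"
proof -
  have "k_class A (tensor_complex X) (tensor_complex Y) (tensor_chain X Y g) =
      k_class A (tensor_complex X) (tensor_complex Y) (tensor_chain X Y f)" if "g \<in> k_class A X Y f" for g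
    using that tensor_homotopic[OF X Y, of f g]
    by (intro k_classI[OF tensor_complex[OF X] tensor_complex[OF Y], symmetric]) (simp add: k_class_def)
  moreover have "f \<in> k_class A X Y f" using homotopic_refl[OF X Y f] by (simp add: k_class_def)
  ultimately show ?thesis by blast
qed

end

section \<open>Duality for projective modules\<close>

text \<open>Sums look only at carrier, zero and addition, so they can be moved freely between the
  A-structure and the R-structure.\<close>

lemma finsum_restrict_scalars: "finsum (restrict_scalars \<phi> M) = finsum M"
  by (simp add: finsum_def finprod_def restrict_scalars_def mk_module_def fun_eq_iff)

lemma (in abelian_monoid) finsum_Times:
  assumes "finite I" "finite J" "f \<in> I \<times> J \<rightarrow> carrier G"
  shows "(\<Oplus>p\<in>I \<times> J. f p) = (\<Oplus>i\<in>I. \<Oplus>j\<in>J. f (i, j))"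
  using assms(1,3)
proof (induction I)
  case (insert i I)
  have f: "f \<in> Pair i ` J \<rightarrow> carrier G" "f \<in> I \<times> J \<rightarrow> carrier G" using insert.prems by auto
  have "insert i I \<times> J = Pair i ` J \<union> I \<times> J" by auto
  moreover have "Pair i ` J \<inter> I \<times> J = {}" using insert.hyps by auto
  ultimately have "(\<Oplus>p\<in>insert i I \<times> J. f p) = (\<Oplus>p\<in>Pair i ` J. f p) \<oplus> (\<Oplus>p\<in>I \<times> J. f p)"
    using insert.hyps assms(2) f by (simp add: finsum_Un_disjoint)
  also have "(\<Oplus>p\<in>Pair i ` J. f p) = (\<Oplus>j\<in>J. f (i, j))"
    using f(1) by (intro finsum_reindex) (auto simp: inj_on_def)
  also have "(\<Oplus>p\<in>I \<times> J. f p) = (\<Oplus>i\<in>I. \<Oplus>j\<in>J. f (i, j))" by (rule insert.IH[OF f(2)])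
  finally show ?case
    using insert by (subst finsum_insert) (auto intro!: finsum_closed)
qed simp

text \<open>A finite sum of images of a finitely generated module is generated by the images of its
  generators. It will be applied to Hom(P, A), a sum of images of A.\<close>

lemma fin_gen_finite_sum:
  assumes M: "right_module R M" and F: "fg_module R F" and I: "finite I"
    and \<alpha>: "\<And>i. i \<in> I \<Longrightarrow> \<alpha> i \<in> mod_hom R F M"
    and sum: "\<And>x. x \<in> carrier M \<Longrightarrow> \<exists>a\<in>I \<rightarrow> carrier F. x = (\<Oplus>\<^bsub>M\<^esub>i\<in>I. \<alpha> i (a i))"
  shows "fin_gen R M"
proof -
  interpret M: right_module R M by (rule M)
  interpret F: right_module R F using F by (simp add: fg_module_def)
  obtain S where S: "finite S" "S \<subseteq> carrier F"
    and gen: "\<And>x. x \<in> carrier F \<Longrightarrow> \<exists>c\<in>S \<rightarrow> carrier R. x = (\<Oplus>\<^bsub>F\<^esub>s\<in>S. c s \<odot>\<^bsub>F\<^esub> s)"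
    using F unfolding fg_module_def fin_gen_def by blast
  have c\<alpha>: "\<alpha> i s \<in> carrier M" if "i \<in> I" "s \<in> S" for i s
    using mod_hom_closed[OF \<alpha>[OF that(1)]] that(2) S(2) by blast
  show ?thesis
  proof (rule fin_gen_indexed[OF M, of "I \<times> S" "\<lambda>(i, s). \<alpha> i s"])
    fix x assume "x \<in> carrier M"
    then obtain a where a: "a \<in> I \<rightarrow> carrier F" "x = (\<Oplus>\<^bsub>M\<^esub>i\<in>I. \<alpha> i (a i))" using sum by blast
    have "\<forall>i\<in>I. \<exists>c\<in>S \<rightarrow> carrier R. a i = (\<Oplus>\<^bsub>F\<^esub>s\<in>S. c s \<odot>\<^bsub>F\<^esub> s)"
      using a(1) gen by (simp add: Pi_iff)
    then obtain c where c: "\<And>i. i \<in> I \<Longrightarrow> c i \<in> S \<rightarrow> carrier R"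
      "\<And>i. i \<in> I \<Longrightarrow> a i = (\<Oplus>\<^bsub>F\<^esub>s\<in>S. c i s \<odot>\<^bsub>F\<^esub> s)" by metis
    have cc: "c i s \<odot>\<^bsub>M\<^esub> \<alpha> i s \<in> carrier M" if "i \<in> I" "s \<in> S" for i s
      using that c(1)[of i] c\<alpha> by auto
    have "\<alpha> i (a i) = (\<Oplus>\<^bsub>M\<^esub>s\<in>S. c i s \<odot>\<^bsub>M\<^esub> \<alpha> i s)" if i: "i \<in> I" for i
    proof -
      have "\<alpha> i (a i) = (\<Oplus>\<^bsub>M\<^esub>s\<in>S. \<alpha> i (c i s \<odot>\<^bsub>F\<^esub> s))"
        unfolding c(2)[OF i] using c(1)[OF i] S
        by (intro mod_hom_finsum[OF \<alpha>[OF i] F.M.abelian_group_axioms M.M.abelian_group_axioms]) auto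
      also have "\<dots> = (\<Oplus>\<^bsub>M\<^esub>s\<in>S. c i s \<odot>\<^bsub>M\<^esub> \<alpha> i s)"
        using c(1)[OF i] S i cc by (intro M.M.finsum_cong') (auto simp: mod_hom_smult[OF \<alpha>[OF i]] Pi_iff subset_iff)
      finally show ?thesis .
    qed
    then have "x = (\<Oplus>\<^bsub>M\<^esub>i\<in>I. \<Oplus>\<^bsub>M\<^esub>s\<in>S. c i s \<odot>\<^bsub>M\<^esub> \<alpha> i s)"
      unfolding a(2) using cc by (intro M.M.finsum_cong') (auto intro!: M.M.finsum_closed)
    also have "\<dots> = (\<Oplus>\<^bsub>M\<^esub>p\<in>I \<times> S. (\<lambda>(i, s). c i s) p \<odot>\<^bsub>M\<^esub> (\<lambda>(i, s). \<alpha> i s) p)"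
      by (subst M.M.finsum_Times[OF I S(1)]) (use cc in auto)
    finally show "\<exists>c\<in>I \<times> S \<rightarrow> carrier R. x = (\<Oplus>\<^bsub>M\<^esub>p\<in>I \<times> S. c p \<odot>\<^bsub>M\<^esub> (\<lambda>(i, s). \<alpha> i s) p)"
      using c(1) by (intro bexI[of _ "\<lambda>(i, s). c i s"]) auto
  qed (use I S c\<alpha> in auto)
qed

section \<open>The bimodule DA\<close>

locale artin_duality = artin_algebra R A \<phi> + L: artinian_local_envelope m R E
  for m and R :: "'r ring" and A :: "'a ring" and \<phi> and E :: "('r, 'e) module"
begin

lemma str_closed: "r \<in> carrier R \<Longrightarrow> \<phi> r \<in> carrier A"
  and str_add: "\<lbrakk>r \<in> carrier R; s \<in> carrier R\<rbrakk> \<Longrightarrow> \<phi> (r \<oplus>\<^bsub>R\<^esub> s) = \<phi> r \<oplus>\<^bsub>A\<^esub> \<phi> s"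
  and str_mult: "\<lbrakk>r \<in> carrier R; s \<in> carrier R\<rbrakk> \<Longrightarrow> \<phi> (r \<otimes>\<^bsub>R\<^esub> s) = \<phi> r \<otimes>\<^bsub>A\<^esub> \<phi> s"
  and str_one: "\<phi> \<one>\<^bsub>R\<^esub> = \<one>\<^bsub>A\<^esub>"
  using str_hom by (auto simp: ring_hom_def)

lemma right_module_restrict_scalars:
  assumes "right_module A N"
  shows "right_module R (restrict_scalars \<phi> N)"
proof -
  interpret N: right_module A N by fact
  have "abelian_group (restrict_scalars \<phi> N)"
    by (rule abelian_groupI) (auto simp: restrict_scalars_def N.M.a_ac intro!: N.M.add.l_inv_ex)
  then show ?thesis
    by (rule right_moduleI[OF R.ring_axioms])
      (auto simp: restrict_scalars_def str_closed str_add str_mult str_one N.smult_l_distr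
        N.smult_r_distr N.smult_assoc)
qed

abbreviation RA :: "('r, 'a) module" where
  "RA \<equiv> restrict_scalars \<phi> (regular A)"

lemma RA_simps:
  "carrier RA = carrier A" "x \<oplus>\<^bsub>RA\<^esub> y = x \<oplus>\<^bsub>A\<^esub> y" "r \<odot>\<^bsub>RA\<^esub> x = x \<otimes>\<^bsub>A\<^esub> \<phi> r"
  by (simp_all add: restrict_scalars_def regular_def)

lemma fg_RA: "fg_module R RA"
  using str_fin_gen right_module_restrict_scalars[OF right_module_regular[OF A.ring_axioms]]
  by (simp add: fg_module_def)

abbreviation D :: "('a, 'a \<Rightarrow> 'e) bimodule" where
  "D \<equiv> dual_bimodule R A \<phi> E"

lemma D_simps:
  "carrier D = mod_hom R RA E" "\<zero>\<^bsub>D\<^esub> = (\<lambda>x\<in>carrier A. \<zero>\<^bsub>E\<^esub>)"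
  "f \<oplus>\<^bsub>D\<^esub> g = (\<lambda>x\<in>carrier A. f x \<oplus>\<^bsub>E\<^esub> g x)"
  "a \<odot>\<^bsub>D\<^esub> f = (\<lambda>x\<in>carrier A. f (a \<otimes>\<^bsub>A\<^esub> x))" "lsmult D a f = (\<lambda>x\<in>carrier A. f (x \<otimes>\<^bsub>A\<^esub> a))"
  by (simp_all add: dual_bimodule_def)

lemma D_closed: "\<lbrakk>d \<in> carrier D; x \<in> carrier A\<rbrakk> \<Longrightarrow> d x \<in> carrier E"
  and D_add: "\<lbrakk>d \<in> carrier D; x \<in> carrier A; y \<in> carrier A\<rbrakk> \<Longrightarrow> d (x \<oplus>\<^bsub>A\<^esub> y) = d x \<oplus>\<^bsub>E\<^esub> d y"
  and D_smult: "\<lbrakk>d \<in> carrier D; x \<in> carrier A; r \<in> carrier R\<rbrakk> \<Longrightarrow> d (x \<otimes>\<^bsub>A\<^esub> \<phi> r) = r \<odot>\<^bsub>E\<^esub> d x"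
  and D_extensional: "d \<in> carrier D \<Longrightarrow> d \<in> extensional (carrier A)"
  using mod_hom_closed[of d R RA E x] mod_hom_add[of d R RA E x y] mod_hom_smult[of d R RA E r x]
    mod_hom_extensional[of d R RA E] by (simp_all add: D_simps(1) RA_simps)

lemma D_smult_left: "\<lbrakk>d \<in> carrier D; x \<in> carrier A; r \<in> carrier R\<rbrakk> \<Longrightarrow> d (\<phi> r \<otimes>\<^bsub>A\<^esub> x) = r \<odot>\<^bsub>E\<^esub> d x"
  by (simp add: D_smult str_central)

lemma D_eqI:
  assumes "d \<in> carrier D" "d' \<in> carrier D" "\<And>x. x \<in> carrier A \<Longrightarrow> d x = d' x"
  shows "d = d'"
  using assms by (intro extensionalityI[OF D_extensional D_extensional]) auto

lemma D_I:
  assumes "d \<in> extensional (carrier A)" "\<And>x. x \<in> carrier A \<Longrightarrow> d x \<in> carrier E"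
    and "\<And>x y. \<lbrakk>x \<in> carrier A; y \<in> carrier A\<rbrakk> \<Longrightarrow> d (x \<oplus>\<^bsub>A\<^esub> y) = d x \<oplus>\<^bsub>E\<^esub> d y"
    and "\<And>x r. \<lbrakk>x \<in> carrier A; r \<in> carrier R\<rbrakk> \<Longrightarrow> d (x \<otimes>\<^bsub>A\<^esub> \<phi> r) = r \<odot>\<^bsub>E\<^esub> d x"
  shows "d \<in> carrier D"
  unfolding D_simps(1) using assms by (intro mod_homI) (auto simp: RA_simps)

lemma D_ops_closed:
  shows "\<zero>\<^bsub>D\<^esub> \<in> carrier D"
    and "\<lbrakk>d \<in> carrier D; d' \<in> carrier D\<rbrakk> \<Longrightarrow> d \<oplus>\<^bsub>D\<^esub> d' \<in> carrier D"
    and "\<lbrakk>a \<in> carrier A; d \<in> carrier D\<rbrakk> \<Longrightarrow> a \<odot>\<^bsub>D\<^esub> d \<in> carrier D"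
    and "\<lbrakk>a \<in> carrier A; d \<in> carrier D\<rbrakk> \<Longrightarrow> lsmult D a d \<in> carrier D"
proof -
  show "\<zero>\<^bsub>D\<^esub> \<in> carrier D" by (rule D_I) (auto simp: D_simps str_closed)
  show "d \<oplus>\<^bsub>D\<^esub> d' \<in> carrier D" if "d \<in> carrier D" "d' \<in> carrier D"
    using that by (intro D_I)
      (auto simp: D_simps(2-) str_closed D_closed D_add D_smult L.E.smult_r_distr L.E.M.a_ac)
  show "a \<odot>\<^bsub>D\<^esub> d \<in> carrier D" if "a \<in> carrier A" "d \<in> carrier D"
    using that by (intro D_I)
      (auto simp: D_simps(2-) str_closed D_closed D_add D_smult A.r_distr A.m_assoc[symmetric])
  show "lsmult D a d \<in> carrier D" if "a \<in> carrier A" "d \<in> carrier D"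
  proof (rule D_I)
    fix x r assume x: "x \<in> carrier A" and r: "r \<in> carrier R"
    \<comment> \<open>Right multiplication by \<open>a\<close> on A is R-linear because
      \<open>\<phi> r\<close> is central.\<close>
    have "x \<otimes>\<^bsub>A\<^esub> \<phi> r \<otimes>\<^bsub>A\<^esub> a = x \<otimes>\<^bsub>A\<^esub> a \<otimes>\<^bsub>A\<^esub> \<phi> r"
      using x that str_closed[OF r] by (simp add: A.m_assoc str_central[OF r])
    then show "lsmult D a d (x \<otimes>\<^bsub>A\<^esub> \<phi> r) = r \<odot>\<^bsub>E\<^esub> lsmult D a d x"
      using x r that by (simp add: D_simps(2-) str_closed D_smult)
  qed (use that in \<open>auto simp: D_simps(2-) D_closed D_add A.l_distr\<close>)
qed

lemma right_module_D: "right_module A D"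
proof -
  have "abelian_group D"
  proof (rule abelian_groupI)
    fix d assume d: "d \<in> carrier D"
    have "(\<lambda>x\<in>carrier A. \<ominus>\<^bsub>E\<^esub> d x) \<in> carrier D"
      using d by (intro D_I)
        (auto simp: str_closed D_closed D_add D_smult L.E.smult_r_minus L.E.M.minus_add)
    then show "\<exists>d'\<in>carrier D. d' \<oplus>\<^bsub>D\<^esub> d = \<zero>\<^bsub>D\<^esub>"
      using d by (intro bexI) (auto simp: D_simps(2-) D_closed L.E.M.l_neg intro!: restrict_ext)
  qed (auto simp: D_ops_closed intro!: D_eqI, auto simp: D_simps(2-) D_closed L.E.M.a_ac)
  then show ?thesis
    by (rule right_moduleI[OF A.ring_axioms])
      (auto simp: D_ops_closed intro!: D_eqI, auto simp: D_simps(2-) D_closed D_add A.l_distr A.m_assoc)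
qed

sublocale tb: tensor_bimodule A D
proof (rule tensor_bimodule.intro[OF right_module_D])
  show "lsmult D a (b \<odot>\<^bsub>D\<^esub> d) = b \<odot>\<^bsub>D\<^esub> lsmult D a d"
    if "a \<in> carrier A" "b \<in> carrier A" "d \<in> carrier D" for a b d
    using that by (intro D_eqI) (auto simp: D_ops_closed, auto simp: D_simps(2-) A.m_assoc)
qed (rule D_ops_closed)

section \<open>The dual Hom(P, A) and its pairing with the tensor product of P and DA\<close>

definition hom_module :: "('a, 'm) module \<Rightarrow> ('r, 'm \<Rightarrow> 'a) module" where
  "hom_module P = mk_module (mod_hom A P (regular A)) (\<lambda>x\<in>carrier P. \<zero>\<^bsub>A\<^esub>)
     (\<lambda>f g. \<lambda>x\<in>carrier P. f x \<oplus>\<^bsub>A\<^esub> g x) (\<lambda>r f. \<lambda>x\<in>carrier P. \<phi> r \<otimes>\<^bsub>A\<^esub> f x)"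

text \<open>The left A-action on Hom(P, A). It is kept outside \<open>hom_module\<close>, which is
  an R-module so that Matlis duality over R applies to it.\<close>

definition lact :: "('a, 'm) module \<Rightarrow> 'a \<Rightarrow> ('m \<Rightarrow> 'a) \<Rightarrow> 'm \<Rightarrow> 'a" where
  "lact P a \<xi> = (\<lambda>x\<in>carrier P. a \<otimes>\<^bsub>A\<^esub> \<xi> x)"

lemma hom_module_simps:
  "carrier (hom_module P) = mod_hom A P (regular A)" "\<zero>\<^bsub>hom_module P\<^esub> = (\<lambda>x\<in>carrier P. \<zero>\<^bsub>A\<^esub>)"
  "f \<oplus>\<^bsub>hom_module P\<^esub> g = (\<lambda>x\<in>carrier P. f x \<oplus>\<^bsub>A\<^esub> g x)"
  "r \<odot>\<^bsub>hom_module P\<^esub> f = lact P (\<phi> r) f"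
  by (simp_all add: hom_module_def lact_def)

lemma hom_module_closed: "\<lbrakk>\<xi> \<in> carrier (hom_module P); x \<in> carrier P\<rbrakk> \<Longrightarrow> \<xi> x \<in> carrier A"
  and hom_module_add: "\<lbrakk>\<xi> \<in> carrier (hom_module P); x \<in> carrier P; y \<in> carrier P\<rbrakk> \<Longrightarrow>
      \<xi> (x \<oplus>\<^bsub>P\<^esub> y) = \<xi> x \<oplus>\<^bsub>A\<^esub> \<xi> y"
  and hom_module_smult: "\<lbrakk>\<xi> \<in> carrier (hom_module P); x \<in> carrier P; a \<in> carrier A\<rbrakk> \<Longrightarrow>
      \<xi> (a \<odot>\<^bsub>P\<^esub> x) = \<xi> x \<otimes>\<^bsub>A\<^esub> a"
  using mod_hom_closed[of \<xi> A P "regular A" x] mod_hom_add[of \<xi> A P "regular A" x y]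
    mod_hom_smult[of \<xi> A P "regular A" a x] by (simp_all add: hom_module_simps(1) regular_def)

lemma hom_module_eqI:
  "\<lbrakk>\<xi> \<in> carrier (hom_module P); \<xi>' \<in> carrier (hom_module P); \<And>x. x \<in> carrier P \<Longrightarrow> \<xi> x = \<xi>' x\<rbrakk> \<Longrightarrow> \<xi> = \<xi>'"
  unfolding hom_module_simps by (rule mod_hom_eqI)

context
  fixes P :: "('a, 'm) module"
  assumes P: "right_module A P"
begin

interpretation P: right_module A P by (rule P)

lemma hom_moduleI:
  assumes "\<xi> \<in> extensional (carrier P)" "\<And>x. x \<in> carrier P \<Longrightarrow> \<xi> x \<in> carrier A"
    and "\<And>x y. \<lbrakk>x \<in> carrier P; y \<in> carrier P\<rbrakk> \<Longrightarrow> \<xi> (x \<oplus>\<^bsub>P\<^esub> y) = \<xi> x \<oplus>\<^bsub>A\<^esub> \<xi> y"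
    and "\<And>x a. \<lbrakk>x \<in> carrier P; a \<in> carrier A\<rbrakk> \<Longrightarrow> \<xi> (a \<odot>\<^bsub>P\<^esub> x) = \<xi> x \<otimes>\<^bsub>A\<^esub> a"
  shows "\<xi> \<in> carrier (hom_module P)"
  unfolding hom_module_simps(1) using assms by (intro mod_homI) (auto simp: regular_def)

lemma lact_closed:
  assumes "a \<in> carrier A" "\<xi> \<in> carrier (hom_module P)"
  shows "lact P a \<xi> \<in> carrier (hom_module P)"
  using assms by (intro hom_moduleI)
    (auto simp: lact_def hom_module_closed hom_module_add hom_module_smult A.r_distr A.m_assoc)

lemma right_module_hom_module: "right_module R (hom_module P)"
proof -
  note cl = hom_module_closed
  have add: "f \<oplus>\<^bsub>hom_module P\<^esub> g \<in> carrier (hom_module P)"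
    if "f \<in> carrier (hom_module P)" "g \<in> carrier (hom_module P)" for f g
    using that by (intro hom_moduleI)
      (auto simp: hom_module_simps(2-) cl hom_module_add hom_module_smult A.a_ac A.l_distr)
  have zero: "\<zero>\<^bsub>hom_module P\<^esub> \<in> carrier (hom_module P)"
    by (intro hom_moduleI) (auto simp: hom_module_simps(2-))
  have "abelian_group (hom_module P)"
  proof (rule abelian_groupI)
    fix f assume f: "f \<in> carrier (hom_module P)"
    have m: "\<ominus>\<^bsub>A\<^esub> \<one>\<^bsub>A\<^esub> \<in> carrier A" by simp
    show "\<exists>g\<in>carrier (hom_module P). g \<oplus>\<^bsub>hom_module P\<^esub> f = \<zero>\<^bsub>hom_module P\<^esub>"
      using f by (intro bexI[OF _ lact_closed[OF m f]])
        (auto simp: hom_module_simps(2-) lact_def cl A.l_minus A.l_neg intro!: restrict_ext)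
  qed (auto simp: add zero intro!: hom_module_eqI[of _ P], auto simp: hom_module_simps(2-) cl A.a_ac)
  moreover have str_mult': "\<phi> (r \<otimes>\<^bsub>R\<^esub> s) = \<phi> s \<otimes>\<^bsub>A\<^esub> \<phi> r" if "r \<in> carrier R" "s \<in> carrier R" for r s
    using str_central[OF that(1) str_closed[OF that(2)]] that by (simp add: str_mult)
  ultimately show ?thesis
    by (intro right_moduleI[OF R.ring_axioms])
      (auto simp: add zero lact_closed str_closed hom_module_simps(4) intro!: hom_module_eqI[of _ P],
       auto simp: hom_module_simps(2-3) lact_def cl str_closed str_add str_mult' str_one A.l_distr
         A.r_distr A.m_assoc)
qed

interpretation H: right_module R "hom_module P" by (rule right_module_hom_module)
interpretation TP: right_module A "tensor A P D" by (rule tb.right_module_tensor(1)[OF P])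

lemma eval_hom: "x \<in> carrier P \<Longrightarrow> (\<lambda>\<xi>\<in>carrier (hom_module P). \<xi> x) \<in> mod_hom R (hom_module P) RA"
  by (intro mod_homI)
    (auto simp: hom_module_closed RA_simps, auto simp: hom_module_simps(3,4) lact_def str_central hom_module_closed)

definition pair :: "('m \<Rightarrow> 'a) \<Rightarrow> (('m \<times> ('a \<Rightarrow> 'e)) \<Rightarrow>\<^sub>0 int) set \<Rightarrow> 'e" where
  "pair \<xi> = (SOME h. (\<forall>u\<in>carrier (tensor A P D). h u \<in> carrier E) \<and>
    (\<forall>u\<in>carrier (tensor A P D). \<forall>v\<in>carrier (tensor A P D). h (u \<oplus>\<^bsub>tensor A P D\<^esub> v) = h u \<oplus>\<^bsub>E\<^esub> h v) \<and>
    (\<forall>x\<in>carrier P. \<forall>d\<in>carrier D. h (tb.elem P x d) = d (\<xi> x)))"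

text \<open>The assignment of d(\<xi> x) to (x, d) is balanced: d(\<xi>(xa)) = d(\<xi>(x)a) is the
  value of the left multiple of d by a at \<xi>(x). Hence a map as described in \<open>pair\<close>
  exists.\<close>

lemma pair_props:
  assumes \<xi>: "\<xi> \<in> carrier (hom_module P)"
  shows "(\<forall>u\<in>carrier (tensor A P D). pair \<xi> u \<in> carrier E) \<and>
    (\<forall>u\<in>carrier (tensor A P D). \<forall>v\<in>carrier (tensor A P D). pair \<xi> (u \<oplus>\<^bsub>tensor A P D\<^esub> v) = pair \<xi> u \<oplus>\<^bsub>E\<^esub> pair \<xi> v) \<and>
    (\<forall>x\<in>carrier P. \<forall>d\<in>carrier D. pair \<xi> (tb.elem P x d) = d (\<xi> x))"
proof -
  note c = hom_module_closed[OF \<xi>]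
  have "\<exists>h. (\<forall>u\<in>carrier (tensor A P D). h u \<in> carrier E) \<and>
    (\<forall>u\<in>carrier (tensor A P D). \<forall>v\<in>carrier (tensor A P D). h (u \<oplus>\<^bsub>tensor A P D\<^esub> v) = h u \<oplus>\<^bsub>E\<^esub> h v) \<and>
    (\<forall>x\<in>carrier P. \<forall>d\<in>carrier D. h (tb.elem P x d) = d (\<xi> x))"
    using c
    by (intro tb.tensor_universal[OF P L.E.M.abelian_group_axioms])
      (simp_all add: D_closed D_add D_simps(3,5) hom_module_add[OF \<xi>] hom_module_smult[OF \<xi>])
  from someI_ex[OF this, folded pair_def] show ?thesis .
qed

lemma pair_closed: "\<lbrakk>\<xi> \<in> carrier (hom_module P); u \<in> carrier (tensor A P D)\<rbrakk> \<Longrightarrow> pair \<xi> u \<in> carrier E"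
  and pair_add: "\<lbrakk>\<xi> \<in> carrier (hom_module P); u \<in> carrier (tensor A P D); v \<in> carrier (tensor A P D)\<rbrakk> \<Longrightarrow>
      pair \<xi> (u \<oplus>\<^bsub>tensor A P D\<^esub> v) = pair \<xi> u \<oplus>\<^bsub>E\<^esub> pair \<xi> v"
  and pair_elem: "\<lbrakk>\<xi> \<in> carrier (hom_module P); x \<in> carrier P; d \<in> carrier D\<rbrakk> \<Longrightarrow>
      pair \<xi> (tb.elem P x d) = d (\<xi> x)"
  using pair_props by blast+

text \<open>On a pure tensor both sides are d(a \<xi>(x)). This adjunction is what moves
  coefficients in A from functionals to elements.\<close>

lemma pair_lact:
  assumes a: "a \<in> carrier A" and \<xi>: "\<xi> \<in> carrier (hom_module P)" and u: "u \<in> carrier (tensor A P D)"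
  shows "pair (lact P a \<xi>) u = pair \<xi> (a \<odot>\<^bsub>tensor A P D\<^esub> u)"
  by (rule tb.tensor_eqI[OF P L.E.M.abelian_group_axioms u, of "pair (lact P a \<xi>)" "\<lambda>u. pair \<xi> (a \<odot>\<^bsub>tensor A P D\<^esub> u)"])
    (use a \<xi> in \<open>simp_all add: pair_closed pair_add lact_closed TP.smult_r_distr pair_elem
      tb.right_module_tensor(2)[OF P] D_ops_closed\<close>,
     use a \<xi> in \<open>simp add: D_simps(4) lact_def hom_module_closed\<close>)

text \<open>On a pure tensor this is d(\<phi>(r) \<xi>(x)) = r d(\<xi>(x)), where centrality brings
  \<phi>(r) to the side on which d is known to be R-linear.\<close>

lemma pair_str:
  assumes r: "r \<in> carrier R" and \<xi>: "\<xi> \<in> carrier (hom_module P)" and u: "u \<in> carrier (tensor A P D)"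
  shows "pair \<xi> (\<phi> r \<odot>\<^bsub>tensor A P D\<^esub> u) = r \<odot>\<^bsub>E\<^esub> pair \<xi> u"
  by (rule tb.tensor_eqI[OF P L.E.M.abelian_group_axioms u, of "\<lambda>u. pair \<xi> (\<phi> r \<odot>\<^bsub>tensor A P D\<^esub> u)" "\<lambda>u. r \<odot>\<^bsub>E\<^esub> pair \<xi> u"])
    (use r \<xi> in \<open>simp_all add: pair_closed pair_add TP.smult_r_distr L.E.smult_r_distr pair_elem str_closed
      tb.right_module_tensor(2)[OF P] D_ops_closed\<close>,
     use r \<xi> in \<open>simp add: D_simps(4) hom_module_closed D_smult_left\<close>)

lemma pair_hom:
  assumes u: "u \<in> carrier (tensor A P D)"
  shows "(\<lambda>\<xi>\<in>carrier (hom_module P). pair \<xi> u) \<in> mod_hom R (hom_module P) E"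
proof (rule mod_homI)
  fix \<xi> \<xi>' assume \<xi>: "\<xi> \<in> carrier (hom_module P)" "\<xi>' \<in> carrier (hom_module P)"
  have "pair (\<xi> \<oplus>\<^bsub>hom_module P\<^esub> \<xi>') u = pair \<xi> u \<oplus>\<^bsub>E\<^esub> pair \<xi>' u"
    by (rule tb.tensor_eqI[OF P L.E.M.abelian_group_axioms u, of "pair (\<xi> \<oplus>\<^bsub>hom_module P\<^esub> \<xi>')" "\<lambda>u. pair \<xi> u \<oplus>\<^bsub>E\<^esub> pair \<xi>' u"])
      (use \<xi> in \<open>simp_all add: pair_closed pair_add pair_elem L.E.M.a_ac\<close>,
       use \<xi> in \<open>simp add: hom_module_simps(3) D_add hom_module_closed\<close>)
  then show "(\<lambda>\<xi>\<in>carrier (hom_module P). pair \<xi> u) (\<xi> \<oplus>\<^bsub>hom_module P\<^esub> \<xi>') =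
      (\<lambda>\<xi>\<in>carrier (hom_module P). pair \<xi> u) \<xi> \<oplus>\<^bsub>E\<^esub> (\<lambda>\<xi>\<in>carrier (hom_module P). pair \<xi> u) \<xi>'"
    using \<xi> by simp
next
  fix r \<xi> assume r: "r \<in> carrier R" and \<xi>: "\<xi> \<in> carrier (hom_module P)"
  then show "(\<lambda>\<xi>\<in>carrier (hom_module P). pair \<xi> u) (r \<odot>\<^bsub>hom_module P\<^esub> \<xi>) =
      r \<odot>\<^bsub>E\<^esub> (\<lambda>\<xi>\<in>carrier (hom_module P). pair \<xi> u) \<xi>"
    using u by (simp add: hom_module_simps(4) lact_closed str_closed pair_lact pair_str)
qed (use u in \<open>auto simp: pair_closed\<close>)

lemma pair_finsum_left:
  assumes u: "u \<in> carrier (tensor A P D)" and I: "finite I" and \<xi>: "\<xi> \<in> I \<rightarrow> carrier (hom_module P)"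
  shows "pair (\<Oplus>\<^bsub>hom_module P\<^esub>i\<in>I. \<xi> i) u = (\<Oplus>\<^bsub>E\<^esub>i\<in>I. pair (\<xi> i) u)"
proof -
  have "pair (\<Oplus>\<^bsub>hom_module P\<^esub>i\<in>I. \<xi> i) u = (\<Oplus>\<^bsub>E\<^esub>i\<in>I. (\<lambda>\<xi>\<in>carrier (hom_module P). pair \<xi> u) (\<xi> i))"
    using mod_hom_finsum[OF pair_hom[OF u] H.M.abelian_group_axioms L.E.M.abelian_group_axioms I \<xi>]
      H.M.finsum_closed[OF \<xi>] by simp
  also have "\<dots> = (\<Oplus>\<^bsub>E\<^esub>i\<in>I. pair (\<xi> i) u)"
    using \<xi> u by (intro L.E.M.finsum_cong') (auto simp: pair_closed Pi_iff)
  finally show ?thesis .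
qed

lemma pair_finsum_right:
  assumes \<xi>: "\<xi> \<in> carrier (hom_module P)" and I: "finite I" and u: "u \<in> I \<rightarrow> carrier (tensor A P D)"
  shows "pair \<xi> (\<Oplus>\<^bsub>tensor A P D\<^esub>i\<in>I. u i) = (\<Oplus>\<^bsub>E\<^esub>i\<in>I. pair \<xi> (u i))"
proof -
  \<comment> \<open>Over R the pairing is linear in its second argument, so the general rule for
    sums applies.\<close>
  let ?T = "restrict_scalars \<phi> (tensor A P D)"
  have c: "carrier ?T = carrier (tensor A P D)" by (simp add: restrict_scalars_def)
  interpret T: right_module R ?T by (rule right_module_restrict_scalars[OF TP.right_module_axioms])
  let ?p = "\<lambda>u\<in>carrier (tensor A P D). pair \<xi> u"
  have p: "?p \<in> mod_hom R ?T E"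
    using \<xi> by (intro mod_homI) (auto simp: restrict_scalars_def pair_closed pair_add pair_str str_closed)
  have "?p (\<Oplus>\<^bsub>?T\<^esub>i\<in>I. u i) = (\<Oplus>\<^bsub>E\<^esub>i\<in>I. ?p (u i))"
    using mod_hom_finsum[OF p T.M.abelian_group_axioms L.E.M.abelian_group_axioms I] u c by simp
  also have "\<dots> = (\<Oplus>\<^bsub>E\<^esub>i\<in>I. pair \<xi> (u i))"
    using \<xi> u by (intro L.E.M.finsum_cong') (auto simp: pair_closed Pi_iff)
  finally show ?thesis using TP.M.finsum_closed[OF u] by (simp add: finsum_restrict_scalars)
qed


end

text \<open>A functional pulls its values on the \<open>y i\<close> out as left coefficients. So
  composing with a map of dual basis shape becomes a linear combination in Hom(P, A), to which the
  pairing can be applied.\<close>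

lemma compose_finsum_smult:
  assumes P: "right_module A P" and Q: "right_module A Q" and I: "finite I"
    and \<eta>: "\<And>i. i \<in> I \<Longrightarrow> \<eta> i \<in> carrier (hom_module P)" and y: "\<And>i. i \<in> I \<Longrightarrow> y i \<in> carrier Q"
    and \<zeta>: "\<zeta> \<in> carrier (hom_module Q)"
  shows "compose (carrier P) \<zeta> (\<lambda>x\<in>carrier P. \<Oplus>\<^bsub>Q\<^esub>i\<in>I. \<eta> i x \<odot>\<^bsub>Q\<^esub> y i) =
    (\<Oplus>\<^bsub>hom_module P\<^esub>i\<in>I. lact P (\<zeta> (y i)) (\<eta> i))"
proof -
  interpret P: right_module A P by (rule P)
  interpret Q: right_module A Q by (rule Q)
  interpret H: right_module R "hom_module P" by (rule right_module_hom_module[OF P])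
  interpret AA: right_module A "regular A" by (rule right_module_regular[OF A.ring_axioms])
  interpret RA: right_module R RA by (rule right_module_restrict_scalars[OF AA.right_module_axioms])
  let ?f = "\<lambda>x\<in>carrier P. \<Oplus>\<^bsub>Q\<^esub>i\<in>I. \<eta> i x \<odot>\<^bsub>Q\<^esub> y i"
  have f: "?f \<in> mod_hom A P Q"
    using \<eta> y by (intro mod_hom_finsum_smult[OF P Q I]) (auto simp: hom_module_simps(1))
  have \<zeta>': "\<zeta> \<in> mod_hom A Q (regular A)" using \<zeta> by (simp add: hom_module_simps(1))
  have \<zeta>y: "\<zeta> (y i) \<in> carrier A" if "i \<in> I" for i using hom_module_closed[OF \<zeta> y[OF that]] .
  have l: "(\<lambda>i. lact P (\<zeta> (y i)) (\<eta> i)) \<in> I \<rightarrow> carrier (hom_module P)"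
    using \<zeta>y \<eta> by (auto intro: lact_closed[OF P])
  have "compose (carrier P) \<zeta> ?f \<in> carrier (hom_module P)"
    unfolding hom_module_simps(1) by (rule mod_hom_compose[OF f \<zeta>' P])
  then show ?thesis
  proof (rule hom_module_eqI[OF _ H.M.finsum_closed[OF l]])
    fix x assume x: "x \<in> carrier P"
    have \<eta>x: "\<eta> i x \<in> carrier A" if "i \<in> I" for i using hom_module_closed[OF \<eta>[OF that] x] .
    have "compose (carrier P) \<zeta> ?f x = \<zeta> (\<Oplus>\<^bsub>Q\<^esub>i\<in>I. \<eta> i x \<odot>\<^bsub>Q\<^esub> y i)" using x by (simp add: compose_eq)
    also have "\<dots> = (\<Oplus>\<^bsub>regular A\<^esub>i\<in>I. \<zeta> (\<eta> i x \<odot>\<^bsub>Q\<^esub> y i))"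
      using \<eta>x y by (intro mod_hom_finsum[OF \<zeta>' Q.M.abelian_group_axioms AA.M.abelian_group_axioms I]) auto
    \<comment> \<open>The sum is reread over R, where evaluation at \<open>x\<close> is a linear map
      out of Hom(P, A) and can be pulled in front.\<close>
    also have "\<dots> = (\<Oplus>\<^bsub>RA\<^esub>i\<in>I. \<zeta> (\<eta> i x \<odot>\<^bsub>Q\<^esub> y i))" by (simp add: finsum_restrict_scalars)
    also have "\<dots> = (\<Oplus>\<^bsub>RA\<^esub>i\<in>I. (\<lambda>\<xi>\<in>carrier (hom_module P). \<xi> x) (lact P (\<zeta> (y i)) (\<eta> i)))"
      using \<eta>x \<zeta>y y x \<eta> by (intro RA.M.finsum_cong')
        (auto simp: hom_module_smult[OF \<zeta>] lact_closed[OF P] RA_simps, simp_all add: lact_def)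
    also have "\<dots> = (\<lambda>\<xi>\<in>carrier (hom_module P). \<xi> x) (\<Oplus>\<^bsub>hom_module P\<^esub>i\<in>I. lact P (\<zeta> (y i)) (\<eta> i))"
      by (rule mod_hom_finsum[OF eval_hom[OF P x] H.M.abelian_group_axioms RA.M.abelian_group_axioms I l, symmetric])
    finally show "compose (carrier P) \<zeta> ?f x = (\<Oplus>\<^bsub>hom_module P\<^esub>i\<in>I. lact P (\<zeta> (y i)) (\<eta> i)) x"
      using H.M.finsum_closed[OF l] by simp
  qed
qed

text \<open>Both sides give d(\<zeta>(f x)) on pure tensors. In terms of the pairing, tensoring a
  map is adjoint to composing with it, which makes Ker \<nu>(\<alpha>) an orthogonal
  complement.\<close>

lemma pair_tensor_map:
  assumes P: "right_module A P" and Q: "right_module A Q" and f: "f \<in> mod_hom A P Q"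
    and \<zeta>: "\<zeta> \<in> carrier (hom_module Q)" and u: "u \<in> carrier (tensor A P D)"
  shows "pair Q \<zeta> (tensor_map A P Q D f u) = pair P (compose (carrier P) \<zeta> f) u"
proof -
  note t = tb.tensor_map_hom[OF P Q f]
  have c: "compose (carrier P) \<zeta> f \<in> carrier (hom_module P)"
    using \<zeta> unfolding hom_module_simps(1) by (rule mod_hom_compose[OF f _ P])
  show ?thesis
    by (rule tb.tensor_eqI[OF P L.E.M.abelian_group_axioms u, of "\<lambda>u. pair Q \<zeta> (tensor_map A P Q D f u)"
          "pair P (compose (carrier P) \<zeta> f)"])
      (simp_all add: pair_closed[OF Q \<zeta>] pair_closed[OF P c] mod_hom_closed[OF t(1)] mod_hom_add[OF t(1)]
        pair_add[OF Q \<zeta>] pair_add[OF P c] t(2) pair_elem[OF Q \<zeta>] pair_elem[OF P c] mod_hom_closed[OF f] compose_eq)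
qed

section \<open>The pairing is perfect when P has a dual basis\<close>

context
  fixes P :: "('a, 'm) module" and G :: "'m set" and \<xi> :: "'m \<Rightarrow> 'm \<Rightarrow> 'a"
  assumes P: "right_module A P" and G: "finite G" "G \<subseteq> carrier P"
    and \<xi>: "\<And>g. g \<in> G \<Longrightarrow> \<xi> g \<in> mod_hom A P (regular A)"
    and dual: "\<And>x. x \<in> carrier P \<Longrightarrow> x = (\<Oplus>\<^bsub>P\<^esub>g\<in>G. \<xi> g x \<odot>\<^bsub>P\<^esub> g)"
begin

interpretation P: right_module A P by (rule P)
interpretation H: right_module R "hom_module P" by (rule right_module_hom_module[OF P])
interpretation TP: right_module A "tensor A P D" by (rule tb.right_module_tensor(1)[OF P])

lemma dual_closed: "g \<in> G \<Longrightarrow> \<xi> g \<in> carrier (hom_module P)"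
  using \<xi> by (simp add: hom_module_simps(1))

text \<open>Applying \<open>\<eta>\<close> to the dual basis expansion of x gives \<eta>(x) as the
  sum of the \<eta>(g) \<xi>_g(x).\<close>

lemma dual_expand:
  assumes \<eta>: "\<eta> \<in> carrier (hom_module P)"
  shows "\<eta> = (\<Oplus>\<^bsub>hom_module P\<^esub>g\<in>G. lact P (\<eta> g) (\<xi> g))"
proof -
  have "compose (carrier P) \<eta> (\<lambda>x\<in>carrier P. \<Oplus>\<^bsub>P\<^esub>g\<in>G. \<xi> g x \<odot>\<^bsub>P\<^esub> g) = \<eta>"
  proof -
    have "(\<lambda>x\<in>carrier P. \<Oplus>\<^bsub>P\<^esub>g\<in>G. \<xi> g x \<odot>\<^bsub>P\<^esub> g) = (\<lambda>x\<in>carrier P. x)"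
      by (intro restrict_ext) (simp add: dual[symmetric])
    moreover have "\<eta> \<in> extensional (carrier P)"
      using \<eta> by (intro mod_hom_extensional) (simp add: hom_module_simps(1))
    ultimately show ?thesis by (intro extensionalityI[of _ "carrier P"]) (auto simp: compose_eq)
  qed
  moreover have "compose (carrier P) \<eta> (\<lambda>x\<in>carrier P. \<Oplus>\<^bsub>P\<^esub>g\<in>G. \<xi> g x \<odot>\<^bsub>P\<^esub> g) =
      (\<Oplus>\<^bsub>hom_module P\<^esub>g\<in>G. lact P (\<eta> g) (\<xi> g))"
    by (rule compose_finsum_smult[where y = "\<lambda>g. g", OF P P G(1) dual_closed _ \<eta>]) (use G(2) in auto)
  ultimately show ?thesis by simp
qed

lemma lact_hom:
  assumes g: "g \<in> G"
  shows "(\<lambda>a\<in>carrier A. lact P a (\<xi> g)) \<in> mod_hom R RA (hom_module P)"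
proof (rule mod_homI)
  note c = hom_module_closed[OF dual_closed[OF g]] and l = lact_closed[OF P _ dual_closed[OF g]]
  show "(\<lambda>a\<in>carrier A. lact P a (\<xi> g)) \<in> extensional (carrier RA)" by (simp add: RA_simps)
  show "(\<lambda>a\<in>carrier A. lact P a (\<xi> g)) x \<in> carrier (hom_module P)" if "x \<in> carrier RA" for x
    using that by (simp add: RA_simps l)
  show "(\<lambda>a\<in>carrier A. lact P a (\<xi> g)) (x \<oplus>\<^bsub>RA\<^esub> y) =
      (\<lambda>a\<in>carrier A. lact P a (\<xi> g)) x \<oplus>\<^bsub>hom_module P\<^esub> (\<lambda>a\<in>carrier A. lact P a (\<xi> g)) y"
    if "x \<in> carrier RA" "y \<in> carrier RA" for x y
    using that c by (auto simp: RA_simps hom_module_simps(3) lact_def A.l_distr intro!: restrict_ext)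
  show "(\<lambda>a\<in>carrier A. lact P a (\<xi> g)) (r \<odot>\<^bsub>RA\<^esub> x) = r \<odot>\<^bsub>hom_module P\<^esub> (\<lambda>a\<in>carrier A. lact P a (\<xi> g)) x"
    if "r \<in> carrier R" "x \<in> carrier RA" for r x
    using that c str_closed[OF that(1)] str_central[OF that(1), of x]
    by (auto simp: RA_simps hom_module_simps(4) lact_def A.m_assoc[symmetric] intro!: restrict_ext)
qed

text \<open>The \<open>\<xi> g\<close> generate Hom(P, A) over A, and A is finitely generated over
  R.\<close>

lemma fg_hom_module: "fg_module R (hom_module P)"
proof -
  have "fin_gen R (hom_module P)"
  proof (rule fin_gen_finite_sum[OF H.right_module_axioms fg_RA G(1) lact_hom])
    fix \<eta> assume \<eta>: "\<eta> \<in> carrier (hom_module P)"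
    have c: "\<eta> g \<in> carrier A" if "g \<in> G" for g using hom_module_closed[OF \<eta>] that G(2) by blast
    have "(\<Oplus>\<^bsub>hom_module P\<^esub>g\<in>G. lact P (\<eta> g) (\<xi> g)) =
        (\<Oplus>\<^bsub>hom_module P\<^esub>g\<in>G. (\<lambda>a\<in>carrier A. lact P a (\<xi> g)) (\<eta> g))"
      using c lact_closed[OF P _ dual_closed] by (intro H.M.finsum_cong') auto
    then show "\<exists>a\<in>G \<rightarrow> carrier RA. \<eta> = (\<Oplus>\<^bsub>hom_module P\<^esub>g\<in>G. (\<lambda>a\<in>carrier A. lact P a (\<xi> g)) (a g))"
      using dual_expand[OF \<eta>] c by (intro bexI[of _ \<eta>]) (auto simp: RA_simps)
  qed
  then show ?thesis using H.right_module_axioms by (simp add: fg_module_def)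
qed

text \<open>The inverse of the pairing: a functional \<open>h\<close> on Hom(P, A) is spread over
  the dual basis, with the element a -> h(a \<xi>_g) of DA placed at \<open>g\<close>.\<close>

definition unpair :: "(('m \<Rightarrow> 'a) \<Rightarrow> 'e) \<Rightarrow> (('m \<times> ('a \<Rightarrow> 'e)) \<Rightarrow>\<^sub>0 int) set" where
  "unpair h = (\<Oplus>\<^bsub>tensor A P D\<^esub>g\<in>G. tb.elem P g (\<lambda>a\<in>carrier A. h (lact P a (\<xi> g))))"

lemma unpair_summand:
  assumes h: "h \<in> mod_hom R (hom_module P) E" and g: "g \<in> G"
  shows "(\<lambda>a\<in>carrier A. h (lact P a (\<xi> g))) \<in> carrier D"
proof -
  have "(\<lambda>a\<in>carrier A. h (lact P a (\<xi> g))) = compose (carrier RA) h (\<lambda>a\<in>carrier A. lact P a (\<xi> g))"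
    by (auto simp: compose_def RA_simps intro!: restrict_ext)
  then show ?thesis
    unfolding D_simps(1) using mod_hom_compose[OF lact_hom[OF g] h] fg_RA by (simp add: fg_module_def)
qed

lemma unpair_closed:
  assumes h: "h \<in> mod_hom R (hom_module P) E"
  shows "unpair h \<in> carrier (tensor A P D)"
  unfolding unpair_def using G(2) unpair_summand[OF h]
  by (intro TP.M.finsum_closed) (auto intro!: tb.elem_closed[OF P])

text \<open>The summand at g pairs with \<open>\<eta>\<close> to h(\<eta>(g) \<xi>_g), and these add
  up to h(\<eta>) by the expansion of \<open>\<eta>\<close>.\<close>

lemma pair_unpair:
  assumes h: "h \<in> mod_hom R (hom_module P) E" and \<eta>: "\<eta> \<in> carrier (hom_module P)"
  shows "pair P \<eta> (unpair h) = h \<eta>"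
proof -
  have c: "\<eta> g \<in> carrier A" if "g \<in> G" for g using hom_module_closed[OF \<eta>] that G(2) by blast
  have l: "lact P (\<eta> g) (\<xi> g) \<in> carrier (hom_module P)" if "g \<in> G" for g
    using lact_closed[OF P c[OF that] dual_closed[OF that]] .
  have gP: "g \<in> carrier P" if "g \<in> G" for g using that G(2) by blast
  have "pair P \<eta> (unpair h) = (\<Oplus>\<^bsub>E\<^esub>g\<in>G. pair P \<eta> (tb.elem P g (\<lambda>a\<in>carrier A. h (lact P a (\<xi> g)))))"
    unfolding unpair_def using unpair_summand[OF h] gP
    by (intro pair_finsum_right[OF P \<eta> G(1)]) (auto intro!: tb.elem_closed[OF P])
  also have "\<dots> = (\<Oplus>\<^bsub>E\<^esub>g\<in>G. h (lact P (\<eta> g) (\<xi> g)))"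
    using unpair_summand[OF h] gP c mod_hom_closed[OF h l]
    by (intro L.E.M.finsum_cong') (auto simp: pair_elem[OF P \<eta>])
  also have "\<dots> = h (\<Oplus>\<^bsub>hom_module P\<^esub>g\<in>G. lact P (\<eta> g) (\<xi> g))"
    using l by (intro mod_hom_finsum[OF h H.M.abelian_group_axioms L.E.M.abelian_group_axioms G(1), symmetric]) auto
  finally show ?thesis using dual_expand[OF \<eta>] by simp
qed

lemma elem_finsum:
  assumes "finite I" "x \<in> I \<rightarrow> carrier P" "d \<in> carrier D"
  shows "tb.elem P (\<Oplus>\<^bsub>P\<^esub>i\<in>I. x i) d = (\<Oplus>\<^bsub>tensor A P D\<^esub>i\<in>I. tb.elem P (x i) d)"
  using assms(1,2)
proof (induction I)
  case empty
  then show ?case using assms(3) by (simp add: tb.elem_zero_left[OF P])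
next
  case (insert i I)
  then have "x \<in> I \<rightarrow> carrier P" "x i \<in> carrier P"
    "(\<lambda>i. tb.elem P (x i) d) \<in> I \<rightarrow> carrier (tensor A P D)"
    using tb.elem_closed[OF P _ assms(3)] by auto
  with insert assms(3) show ?case
    by (simp add: tb.elem_add_left[OF P] tb.elem_closed[OF P])
qed

text \<open>For the pure tensor of x and d the functional at g is a -> d(a \<xi>_g(x)), the left
  multiple of d by \<xi>_g(x). Balancing moves \<xi>_g(x) over to g, and the sum of the g \<xi>_g(x)
  is x.\<close>

lemma unpair_pair:
  assumes u: "u \<in> carrier (tensor A P D)"
  shows "unpair (\<lambda>\<eta>\<in>carrier (hom_module P). pair P \<eta> u) = u"
proof -
  note ph = pair_hom[OF P]
  have gP: "g \<in> carrier P" if "g \<in> G" for g using that G(2) by blast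
  show ?thesis
  proof (rule tb.tensor_eqI[OF P TP.M.abelian_group_axioms u,
        of "\<lambda>u. unpair (\<lambda>\<eta>\<in>carrier (hom_module P). pair P \<eta> u)" "\<lambda>u. u"])
    fix u v assume uv: "u \<in> carrier (tensor A P D)" "v \<in> carrier (tensor A P D)"
    define s where "s u g = (\<lambda>a\<in>carrier A. (\<lambda>\<eta>\<in>carrier (hom_module P). pair P \<eta> u) (lact P a (\<xi> g)))" for u g
    have sD: "s u g \<in> carrier D" if "g \<in> G" "u \<in> carrier (tensor A P D)" for u g
      unfolding s_def by (rule unpair_summand[OF ph[OF that(2)] that(1)])
    have s: "s (u \<oplus>\<^bsub>tensor A P D\<^esub> v) g = s u g \<oplus>\<^bsub>D\<^esub> s v g" if "g \<in> G" for g
      using uv lact_closed[OF P _ dual_closed[OF that]] unfolding s_def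
      by (auto simp: D_simps(3) pair_add[OF P] intro!: restrict_ext)
    have U: "unpair (\<lambda>\<eta>\<in>carrier (hom_module P). pair P \<eta> u) = (\<Oplus>\<^bsub>tensor A P D\<^esub>g\<in>G. tb.elem P g (s u g))" for u
      by (simp add: unpair_def s_def)
    have "(\<Oplus>\<^bsub>tensor A P D\<^esub>g\<in>G. tb.elem P g (s (u \<oplus>\<^bsub>tensor A P D\<^esub> v) g)) =
        (\<Oplus>\<^bsub>tensor A P D\<^esub>g\<in>G. tb.elem P g (s u g) \<oplus>\<^bsub>tensor A P D\<^esub> tb.elem P g (s v g))"
      using uv gP sD
      by (intro TP.M.finsum_cong') (auto simp: s tb.elem_add_right[OF P] tb.elem_closed[OF P])
    also have "\<dots> = (\<Oplus>\<^bsub>tensor A P D\<^esub>g\<in>G. tb.elem P g (s u g)) \<oplus>\<^bsub>tensor A P D\<^esub>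
        (\<Oplus>\<^bsub>tensor A P D\<^esub>g\<in>G. tb.elem P g (s v g))"
      using uv gP sD by (intro TP.M.finsum_addf) (auto simp: tb.elem_closed[OF P])
    finally show "unpair (\<lambda>\<eta>\<in>carrier (hom_module P). pair P \<eta> (u \<oplus>\<^bsub>tensor A P D\<^esub> v)) =
        unpair (\<lambda>\<eta>\<in>carrier (hom_module P). pair P \<eta> u) \<oplus>\<^bsub>tensor A P D\<^esub>
        unpair (\<lambda>\<eta>\<in>carrier (hom_module P). pair P \<eta> v)"
      unfolding U .
  next
    fix x d assume x: "x \<in> carrier P" and d: "d \<in> carrier D"
    have c: "\<xi> g x \<in> carrier A" if "g \<in> G" for g using hom_module_closed[OF dual_closed[OF that] x] .
    have "tb.elem P g (\<lambda>a\<in>carrier A. (\<lambda>\<eta>\<in>carrier (hom_module P). pair P \<eta> (tb.elem P x d)) (lact P a (\<xi> g))) =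
        tb.elem P (\<xi> g x \<odot>\<^bsub>P\<^esub> g) d" if g: "g \<in> G" for g
    proof -
      have "(\<lambda>a\<in>carrier A. (\<lambda>\<eta>\<in>carrier (hom_module P). pair P \<eta> (tb.elem P x d)) (lact P a (\<xi> g))) =
          lsmult D (\<xi> g x) d"
        unfolding D_simps(5) using lact_closed[OF P _ dual_closed[OF g]] x d
        by (intro restrict_ext) (simp add: pair_elem[OF P], simp add: lact_def)
      then show ?thesis using tb.elem_balanced[OF P c[OF g] gP[OF g] d] by simp
    qed
    then have "unpair (\<lambda>\<eta>\<in>carrier (hom_module P). pair P \<eta> (tb.elem P x d)) =
        (\<Oplus>\<^bsub>tensor A P D\<^esub>g\<in>G. tb.elem P (\<xi> g x \<odot>\<^bsub>P\<^esub> g) d)"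
      unfolding unpair_def using gP c d by (intro TP.M.finsum_cong') (auto intro!: tb.elem_closed[OF P])
    also have "\<dots> = tb.elem P (\<Oplus>\<^bsub>P\<^esub>g\<in>G. \<xi> g x \<odot>\<^bsub>P\<^esub> g) d"
      using gP c d by (intro elem_finsum[symmetric] G(1)) auto
    finally show "unpair (\<lambda>\<eta>\<in>carrier (hom_module P). pair P \<eta> (tb.elem P x d)) = tb.elem P x d"
      using dual[OF x] by simp
  next
    show "unpair (\<lambda>\<eta>\<in>carrier (hom_module P). pair P \<eta> u) \<in> carrier (tensor A P D)"
      if "u \<in> carrier (tensor A P D)" for u
      by (rule unpair_closed[OF ph[OF that]])
  qed simp_all
qed

lemma pair_separates:
  assumes "u \<in> carrier (tensor A P D)" "v \<in> carrier (tensor A P D)"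
    and "\<And>\<eta>. \<eta> \<in> carrier (hom_module P) \<Longrightarrow> pair P \<eta> u = pair P \<eta> v"
  shows "u = v"
proof -
  have "(\<lambda>\<eta>\<in>carrier (hom_module P). pair P \<eta> u) = (\<lambda>\<eta>\<in>carrier (hom_module P). pair P \<eta> v)"
    using assms(3) by (intro restrict_ext)
  from arg_cong[OF this, of unpair] show ?thesis
    unfolding unpair_pair[OF assms(1)] unpair_pair[OF assms(2)] .
qed

end

end

section \<open>Endomorphisms of the kernel\<close>

context artin_duality
begin

lemma kernel_endomorphism_lifts:
  fixes P :: "('a, 'm) module" and Q :: "('a, 'n) module"
  assumes projP: "projective A P" and projQ: "projective A Q" and \<alpha>: "\<alpha> \<in> mod_hom A P Q"
  defines "K \<equiv> {u \<in> carrier (tensor A P D). tensor_map A P Q D \<alpha> u = \<zero>\<^bsub>tensor A Q D\<^esub>}"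
  assumes \<gamma>K: "\<And>u. u \<in> K \<Longrightarrow> \<gamma> u \<in> K"
    and \<gamma>_add: "\<And>u v. \<lbrakk>u \<in> K; v \<in> K\<rbrakk> \<Longrightarrow> \<gamma> (u \<oplus>\<^bsub>tensor A P D\<^esub> v) = \<gamma> u \<oplus>\<^bsub>tensor A P D\<^esub> \<gamma> v"
    and \<gamma>_smult: "\<And>a u. \<lbrakk>a \<in> carrier A; u \<in> K\<rbrakk> \<Longrightarrow> \<gamma> (a \<odot>\<^bsub>tensor A P D\<^esub> u) = a \<odot>\<^bsub>tensor A P D\<^esub> \<gamma> u"
  shows "\<exists>f\<in>mod_hom A P P. \<exists>g\<in>mod_hom A Q Q. (\<forall>x\<in>carrier P. g (\<alpha> x) = \<alpha> (f x)) \<and>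
    (\<forall>u\<in>K. tensor_map A P P D f u = \<gamma> u)"
proof -
  have P: "right_module A P" and Q: "right_module A Q"
    using projP projQ by (simp_all add: projective_def fg_module_def)
  interpret P: right_module A P by (rule P)
  interpret Q: right_module A Q by (rule Q)
  interpret TP: right_module A "tensor A P D" by (rule tb.right_module_tensor(1)[OF P])
  interpret TQ: right_module A "tensor A Q D" by (rule tb.right_module_tensor(1)[OF Q])
  let ?M = "hom_module P" and ?T = "tensor A P D" and ?\<alpha> = "tensor_map A P Q D \<alpha>"
  interpret H: right_module R ?M by (rule right_module_hom_module[OF P])
  interpret HQ: right_module R "hom_module Q" by (rule right_module_hom_module[OF Q])
  note t\<alpha> = tb.tensor_map_hom(1)[OF P Q \<alpha>]
  obtain G \<xi> where G: "finite G" "G \<subseteq> carrier P"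
    and \<xi>: "\<And>g. g \<in> G \<Longrightarrow> \<xi> g \<in> mod_hom A P (regular A)"
    and dual: "\<And>x. x \<in> carrier P \<Longrightarrow> x = (\<Oplus>\<^bsub>P\<^esub>g\<in>G. \<xi> g x \<odot>\<^bsub>P\<^esub> g)"
    using projective_dual_basis[OF projP] by blast
  obtain G' \<zeta> where G': "finite G'" "G' \<subseteq> carrier Q"
    and \<zeta>: "\<And>g. g \<in> G' \<Longrightarrow> \<zeta> g \<in> mod_hom A Q (regular A)"
    and dual': "\<And>x. x \<in> carrier Q \<Longrightarrow> x = (\<Oplus>\<^bsub>Q\<^esub>g\<in>G'. \<zeta> g x \<odot>\<^bsub>Q\<^esub> g)"
    using projective_dual_basis[OF projQ] by blast
  have \<xi>M: "\<xi> g \<in> carrier ?M" if "g \<in> G" for g using \<xi>[OF that] by (simp add: hom_module_simps(1))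
  have \<zeta>M: "\<zeta> g \<in> carrier (hom_module Q)" if "g \<in> G'" for g using \<zeta>[OF that] by (simp add: hom_module_simps(1))
  note fg = fg_hom_module[OF P G \<xi> dual]
  have KT: "u \<in> carrier ?T" if "u \<in> K" for u using that by (simp add: K_def)
  have K0: "?\<alpha> u = \<zero>\<^bsub>tensor A Q D\<^esub>" if "u \<in> K" for u using that by (simp add: K_def)
  have K_add: "u \<oplus>\<^bsub>?T\<^esub> v \<in> K" if "u \<in> K" "v \<in> K" for u v
    using that by (simp add: K_def mod_hom_add[OF t\<alpha>])
  have K_smult: "a \<odot>\<^bsub>?T\<^esub> u \<in> K" if "a \<in> carrier A" "u \<in> K" for a u
    using that by (simp add: K_def mod_hom_smult[OF t\<alpha>])
  have pair_zero: "pair Q \<eta> \<zero>\<^bsub>tensor A Q D\<^esub> = \<zero>\<^bsub>E\<^esub>" if "\<eta> \<in> carrier (hom_module Q)" for \<eta>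
    using pair_add[OF Q that TQ.M.zero_closed TQ.M.zero_closed] pair_closed[OF Q that TQ.M.zero_closed] by simp
  let ?c = "\<lambda>\<omega>. compose (carrier P) \<omega> \<alpha>"
  have cM: "?c \<omega> \<in> carrier ?M" if "\<omega> \<in> carrier (hom_module Q)" for \<omega>
    using that unfolding hom_module_simps(1) by (rule mod_hom_compose[OF \<alpha> _ P])
  define N where "N = ?c ` carrier (hom_module Q)"
  have \<alpha>c: "\<alpha> x \<in> carrier Q" if "x \<in> carrier P" for x by (rule mod_hom_closed[OF \<alpha> that])
  have N: "submodule N R ?M"
  proof (rule H.submoduleI)
    show "N \<subseteq> carrier ?M" using cM by (auto simp: N_def)
    have "\<zero>\<^bsub>?M\<^esub> = ?c \<zero>\<^bsub>hom_module Q\<^esub>"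
      using \<alpha>c by (auto simp: hom_module_simps(2) compose_def intro!: restrict_ext)
    then show "\<zero>\<^bsub>?M\<^esub> \<in> N" unfolding N_def using HQ.M.zero_closed by (rule image_eqI)
    show "x \<oplus>\<^bsub>?M\<^esub> y \<in> N" if xy: "x \<in> N" "y \<in> N" for x y
    proof -
      obtain \<omega> \<omega>' where w: "\<omega> \<in> carrier (hom_module Q)" "\<omega>' \<in> carrier (hom_module Q)" "x = ?c \<omega>" "y = ?c \<omega>'"
        using xy by (auto simp: N_def)
      have "x \<oplus>\<^bsub>?M\<^esub> y = ?c (\<omega> \<oplus>\<^bsub>hom_module Q\<^esub> \<omega>')"
        unfolding w using \<alpha>c by (auto simp: hom_module_simps(3) compose_def intro!: restrict_ext)
      then show ?thesis unfolding N_def using HQ.M.a_closed[OF w(1,2)] by (rule image_eqI)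
    qed
    show "r \<odot>\<^bsub>?M\<^esub> x \<in> N" if r: "r \<in> carrier R" and x: "x \<in> N" for r x
    proof -
      obtain \<omega> where w: "\<omega> \<in> carrier (hom_module Q)" "x = ?c \<omega>" using x by (auto simp: N_def)
      have "r \<odot>\<^bsub>?M\<^esub> x = ?c (r \<odot>\<^bsub>hom_module Q\<^esub> \<omega>)"
        unfolding w using \<alpha>c by (auto simp: hom_module_simps(4) lact_def compose_def intro!: restrict_ext)
      then show ?thesis unfolding N_def using HQ.smult_closed[OF r w(1)] by (rule image_eqI)
    qed
  qed
  have NM: "n \<in> carrier ?M" if "n \<in> N" for n using submoduleD(1)[OF N] that by blast
  \<comment> \<open>Elements of the tensor product of Q and DA are separated by Hom(Q, A), and
    adjointness moves \<alpha> to the functional.\<close>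
  have K_iff: "u \<in> K \<longleftrightarrow> (\<forall>n\<in>N. pair P n u = \<zero>\<^bsub>E\<^esub>)" if u: "u \<in> carrier ?T" for u
  proof -
    have pc: "pair P (?c \<omega>) u = pair Q \<omega> (?\<alpha> u)" if "\<omega> \<in> carrier (hom_module Q)" for \<omega>
      by (rule pair_tensor_map[OF P Q \<alpha> that u, symmetric])
    have "u \<in> K \<longleftrightarrow> ?\<alpha> u = \<zero>\<^bsub>tensor A Q D\<^esub>" using u by (simp add: K_def)
    also have "\<dots> \<longleftrightarrow> (\<forall>\<omega>\<in>carrier (hom_module Q). pair Q \<omega> (?\<alpha> u) = \<zero>\<^bsub>E\<^esub>)"
      using pair_separates[OF Q G' \<zeta> dual' mod_hom_closed[OF t\<alpha> u] TQ.M.zero_closed] pair_zero by metis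
    also have "\<dots> \<longleftrightarrow> (\<forall>n\<in>N. pair P n u = \<zero>\<^bsub>E\<^esub>)" by (simp add: N_def pc)
    finally show ?thesis .
  qed
  \<comment> \<open>\<open>U\<close> turns functionals on Hom(P, A) into elements of the tensor
    product; those vanishing on \<open>N\<close> become the elements of \<open>K\<close>.\<close>
  define U where "U = unpair P G \<xi>"
  have ph: "h \<in> mod_hom R ?M E" and pN: "\<And>n. n \<in> N \<Longrightarrow> h n = \<zero>\<^bsub>E\<^esub>" if "h \<in> L.perp ?M N" for h
    using that by (simp_all add: L.perp_def)
  have Uc: "U h \<in> carrier ?T" and pU: "\<And>\<eta>. \<eta> \<in> carrier ?M \<Longrightarrow> pair P \<eta> (U h) = h \<eta>"
    if "h \<in> mod_hom R ?M E" for h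
    unfolding U_def using unpair_closed[OF P G \<xi> dual that] pair_unpair[OF P G \<xi> dual that] by blast+
  have UK: "U h \<in> K" if h: "h \<in> L.perp ?M N" for h
    using pU[OF ph[OF h]] NM pN[OF h] by (simp add: K_iff[OF Uc[OF ph[OF h]]])
  note sep = pair_separates[OF P G \<xi> dual]
  \<comment> \<open>The functional u -> <\<omega>, \<gamma> u> on \<open>K\<close> is transported
    along \<open>U\<close> to a functional on the complement of \<open>N\<close>, where double
    duality represents it by some \<open>\<eta>\<close>.\<close>
  have "\<exists>\<eta>\<in>carrier ?M. \<forall>u\<in>K. pair P \<omega> (\<gamma> u) = pair P \<eta> u" if \<omega>: "\<omega> \<in> carrier ?M" for \<omega>
  proof -
    have "\<exists>\<eta>\<in>carrier ?M. \<forall>h\<in>L.perp ?M N. pair P \<omega> (\<gamma> (U h)) = h \<eta>"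
    proof (rule L.functional_is_evaluation[OF fg N])
      show "pair P \<omega> (\<gamma> (U h)) \<in> carrier E" if "h \<in> L.perp ?M N" for h
        by (rule pair_closed[OF P \<omega> KT[OF \<gamma>K[OF UK[OF that]]]])
      fix h assume h: "h \<in> L.perp ?M N"
      note hK = UK[OF h] and hM = ph[OF h]
      show "pair P \<omega> (\<gamma> (U (\<lambda>x\<in>carrier ?M. h x \<oplus>\<^bsub>E\<^esub> h' x))) =
          pair P \<omega> (\<gamma> (U h)) \<oplus>\<^bsub>E\<^esub> pair P \<omega> (\<gamma> (U h'))" if h': "h' \<in> L.perp ?M N" for h'
      proof -
        note s = L.perp_add[OF H.right_module_axioms h h' submoduleD(1)[OF N]]
        \<comment> \<open>Additivity of \<open>U\<close> is seen after pairing, which separates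
          elements.\<close>
        have "U (\<lambda>x\<in>carrier ?M. h x \<oplus>\<^bsub>E\<^esub> h' x) = U h \<oplus>\<^bsub>?T\<^esub> U h'"
          by (rule sep) (simp_all add: Uc ph[OF s] hM ph[OF h'] pU pair_add[OF P])
        then show ?thesis
          using \<gamma>_add[OF hK UK[OF h']] pair_add[OF P \<omega> KT[OF \<gamma>K[OF hK]] KT[OF \<gamma>K[OF UK[OF h']]]] by simp
      qed
      show "pair P \<omega> (\<gamma> (U (\<lambda>x\<in>carrier ?M. r \<odot>\<^bsub>E\<^esub> h x))) = r \<odot>\<^bsub>E\<^esub> pair P \<omega> (\<gamma> (U h))"
        if r: "r \<in> carrier R" for r
      proof -
        note s = L.perp_smult[OF H.right_module_axioms h submoduleD(1)[OF N] r]
        have "U (\<lambda>x\<in>carrier ?M. r \<odot>\<^bsub>E\<^esub> h x) = \<phi> r \<odot>\<^bsub>?T\<^esub> U h"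
          by (rule sep) (simp_all add: Uc ph[OF s] hM pU pair_str[OF P r] str_closed[OF r])
        then show ?thesis
          using \<gamma>_smult[OF str_closed[OF r] hK] pair_str[OF P r \<omega> KT[OF \<gamma>K[OF hK]]] by simp
      qed
    qed
    then obtain \<eta> where \<eta>: "\<eta> \<in> carrier ?M" "\<And>h. h \<in> L.perp ?M N \<Longrightarrow> pair P \<omega> (\<gamma> (U h)) = h \<eta>" by blast
    have "pair P \<omega> (\<gamma> u) = pair P \<eta> u" if u: "u \<in> K" for u
    proof -
      \<comment> \<open>Every \<open>u\<close> in \<open>K\<close> is \<open>U\<close> of the
        functional it defines, so the representation carries back to \<open>K\<close>.\<close>
      let ?h = "\<lambda>\<eta>\<in>carrier ?M. pair P \<eta> u"
      have "?h \<in> L.perp ?M N"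
        using pair_hom[OF P KT[OF u]] K_iff[OF KT[OF u]] u NM by (simp add: L.perp_def)
      moreover have "U ?h = u" unfolding U_def by (rule unpair_pair[OF P G \<xi> dual KT[OF u]])
      ultimately show ?thesis using \<eta>(2)[of ?h] \<eta>(1) by simp
    qed
    with \<eta>(1) show ?thesis by blast
  qed
  then have "\<forall>g\<in>G. \<exists>\<eta>\<in>carrier ?M. \<forall>u\<in>K. pair P (\<xi> g) (\<gamma> u) = pair P \<eta> u" using \<xi>M by blast
  then obtain \<eta> where \<eta>: "\<And>g. g \<in> G \<Longrightarrow> \<eta> g \<in> carrier ?M"
    "\<And>g u. \<lbrakk>g \<in> G; u \<in> K\<rbrakk> \<Longrightarrow> pair P (\<xi> g) (\<gamma> u) = pair P (\<eta> g) u" by metis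
  have gP: "g \<in> carrier P" if "g \<in> G" for g using that G(2) by blast
  define f where "f = (\<lambda>x\<in>carrier P. \<Oplus>\<^bsub>P\<^esub>g\<in>G. \<eta> g x \<odot>\<^bsub>P\<^esub> g)"
  have f: "f \<in> mod_hom A P P"
    unfolding f_def using \<eta>(1) gP by (intro mod_hom_finsum_smult[OF P P G(1)]) (auto simp: hom_module_simps(1))
  have tf: "tensor_map A P P D f u = \<gamma> u" if u: "u \<in> K" for u
  proof (rule sep)
    show "tensor_map A P P D f u \<in> carrier ?T"
      by (rule mod_hom_closed[OF tb.tensor_map_hom(1)[OF P P f] KT[OF u]])
    show "\<gamma> u \<in> carrier ?T" by (rule KT[OF \<gamma>K[OF u]])
    fix \<omega> assume \<omega>: "\<omega> \<in> carrier ?M"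
    have c: "\<omega> g \<in> carrier A" if "g \<in> G" for g using hom_module_closed[OF \<omega> gP[OF that]] .
    have "pair P \<omega> (tensor_map A P P D f u) = pair P (compose (carrier P) \<omega> f) u"
      by (rule pair_tensor_map[OF P P f \<omega> KT[OF u]])
    also have "compose (carrier P) \<omega> f = (\<Oplus>\<^bsub>?M\<^esub>g\<in>G. lact P (\<omega> g) (\<eta> g))"
      unfolding f_def by (rule compose_finsum_smult[where y = "\<lambda>g. g", OF P P G(1) \<eta>(1) gP \<omega>])
    also have "pair P \<dots> u = (\<Oplus>\<^bsub>E\<^esub>g\<in>G. pair P (lact P (\<omega> g) (\<eta> g)) u)"
      using c \<eta>(1) by (intro pair_finsum_left[OF P KT[OF u] G(1)]) (auto intro: lact_closed[OF P])
    also have "\<dots> = (\<Oplus>\<^bsub>E\<^esub>g\<in>G. pair P (lact P (\<omega> g) (\<xi> g)) (\<gamma> u))"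
    proof (intro L.E.M.finsum_cong' refl)
      show "(\<lambda>g. pair P (lact P (\<omega> g) (\<xi> g)) (\<gamma> u)) \<in> G \<rightarrow> carrier E"
        using c \<xi>M KT[OF \<gamma>K[OF u]] by (auto intro!: pair_closed[OF P] lact_closed[OF P])
      fix g assume g: "g \<in> G"
      \<comment> \<open>\<open>\<eta> g\<close> is matched with \<open>\<xi> g\<close> alone; the
        coefficient \<open>\<omega> g\<close> is moved into the argument, carried through
        \<open>\<gamma>\<close> by A-linearity, and moved back.\<close>
      have "pair P (lact P (\<omega> g) (\<eta> g)) u = pair P (\<eta> g) (\<omega> g \<odot>\<^bsub>?T\<^esub> u)"
        by (rule pair_lact[OF P c[OF g] \<eta>(1)[OF g] KT[OF u]])
      also have "\<dots> = pair P (\<xi> g) (\<gamma> (\<omega> g \<odot>\<^bsub>?T\<^esub> u))"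
        using \<eta>(2)[OF g K_smult[OF c[OF g] u]] by simp
      also have "\<dots> = pair P (lact P (\<omega> g) (\<xi> g)) (\<gamma> u)"
        by (simp add: \<gamma>_smult[OF c[OF g] u] pair_lact[OF P c[OF g] \<xi>M[OF g] KT[OF \<gamma>K[OF u]]])
      finally show "pair P (lact P (\<omega> g) (\<eta> g)) u = pair P (lact P (\<omega> g) (\<xi> g)) (\<gamma> u)" .
    qed
    also have "\<dots> = pair P (\<Oplus>\<^bsub>?M\<^esub>g\<in>G. lact P (\<omega> g) (\<xi> g)) (\<gamma> u)"
      using c \<xi>M by (intro pair_finsum_left[OF P KT[OF \<gamma>K[OF u]] G(1), symmetric]) (auto intro: lact_closed[OF P])
    also have "(\<Oplus>\<^bsub>?M\<^esub>g\<in>G. lact P (\<omega> g) (\<xi> g)) = \<omega>" by (rule dual_expand[OF P G \<xi> dual \<omega>, symmetric])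
    finally show "pair P \<omega> (tensor_map A P P D f u) = pair P \<omega> (\<gamma> u)" .
  qed
  have \<alpha>f: "compose (carrier P) \<alpha> f \<in> mod_hom A P Q" by (rule mod_hom_compose[OF f \<alpha> P])
  \<comment> \<open>Otherwise a functional \<open>h\<close> vanishes on \<open>N\<close> and takes
    the value \<open>soc\<close> here. It corresponds to \<open>U h\<close> in \<open>K\<close>,
    which \<open>f\<close> moves by \<open>\<gamma>\<close> within \<open>K\<close>, so
    \<nu>(\<alpha>) kills the result and the value is 0.\<close>
  have inN: "compose (carrier P) \<omega> (compose (carrier P) \<alpha> f) \<in> N" if \<omega>: "\<omega> \<in> carrier (hom_module Q)" for \<omega>
  proof (rule ccontr)
    let ?\<eta> = "compose (carrier P) \<omega> (compose (carrier P) \<alpha> f)"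
    assume "?\<eta> \<notin> N"
    moreover have \<eta>M: "?\<eta> \<in> carrier ?M"
      using \<omega> unfolding hom_module_simps(1) by (rule mod_hom_compose[OF \<alpha>f _ P])
    ultimately obtain h where h: "h \<in> mod_hom R ?M E" "\<forall>n\<in>N. h n = \<zero>\<^bsub>E\<^esub>" "h ?\<eta> = L.soc"
      using L.separating_functional[OF fg N] by blast
    then have hp: "h \<in> L.perp ?M N" by (simp add: L.perp_def)
    note u = UK[OF hp]
    have "L.soc = pair P ?\<eta> (U h)" using pU[OF h(1) \<eta>M] h(3) by simp
    also have "\<dots> = pair Q \<omega> (tensor_map A P Q D (compose (carrier P) \<alpha> f) (U h))"
      by (rule pair_tensor_map[OF P Q \<alpha>f \<omega> KT[OF u], symmetric])
    also have "tensor_map A P Q D (compose (carrier P) \<alpha> f) (U h) = ?\<alpha> (tensor_map A P P D f (U h))"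
      by (rule tb.tensor_map_comp[OF P P Q f \<alpha> KT[OF u], symmetric])
    also have "\<dots> = \<zero>\<^bsub>tensor A Q D\<^esub>" unfolding tf[OF u] by (rule K0[OF \<gamma>K[OF u]])
    finally have "L.soc = \<zero>\<^bsub>E\<^esub>" using pair_zero[OF \<omega>] by simp
    then show False using L.smult_soc[of "\<one>\<^bsub>R\<^esub>"] L.one_not_mem by simp
  qed
  have "\<exists>\<omega>\<in>carrier (hom_module Q). ?c \<omega> = compose (carrier P) (\<zeta> g) (compose (carrier P) \<alpha> f)" if "g \<in> G'" for g
    using inN[OF \<zeta>M[OF that]] unfolding N_def by (auto elim!: imageE)
  then obtain \<omega> where \<omega>: "\<And>g. g \<in> G' \<Longrightarrow> \<omega> g \<in> carrier (hom_module Q)"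
    "\<And>g. g \<in> G' \<Longrightarrow> ?c (\<omega> g) = compose (carrier P) (\<zeta> g) (compose (carrier P) \<alpha> f)" by metis
  \<comment> \<open>By the choice of \<open>\<omega> g\<close>, the coefficients of k(\<alpha> x)
    are those of \<alpha>(f x) in the dual basis of \<open>Q\<close>.\<close>
  define k where "k = (\<lambda>y\<in>carrier Q. \<Oplus>\<^bsub>Q\<^esub>g\<in>G'. \<omega> g y \<odot>\<^bsub>Q\<^esub> g)"
  have k: "k \<in> mod_hom A Q Q"
    unfolding k_def using \<omega>(1) G'(2) by (intro mod_hom_finsum_smult[OF Q Q G'(1)]) (auto simp: hom_module_simps(1))
  have "k (\<alpha> x) = \<alpha> (f x)" if x: "x \<in> carrier P" for x
  proof -
    have fx: "\<alpha> (f x) \<in> carrier Q" by (rule \<alpha>c[OF mod_hom_closed[OF f x]])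
    have "\<omega> g (\<alpha> x) = \<zeta> g (\<alpha> (f x))" if "g \<in> G'" for g
      using fun_cong[OF \<omega>(2)[OF that], of x] x by (simp add: compose_eq)
    moreover have "\<zeta> g (\<alpha> (f x)) \<odot>\<^bsub>Q\<^esub> g \<in> carrier Q" if "g \<in> G'" for g
      using hom_module_closed[OF \<zeta>M[OF that] fx] that G'(2) by blast
    ultimately have "k (\<alpha> x) = (\<Oplus>\<^bsub>Q\<^esub>g\<in>G'. \<zeta> g (\<alpha> (f x)) \<odot>\<^bsub>Q\<^esub> g)"
      unfolding k_def using \<alpha>c[OF x] by (auto intro!: Q.M.finsum_cong')
    then show ?thesis using dual'[OF fx] by simp
  qed
  with f k tf show ?thesis by blast
qed

lemma nakayama_eq: "nakayama R A \<phi> E X = tb.tensor_complex X"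
  by (simp add: nakayama_def tb.tensor_complex_def Let_def)

end

text \<open>The sign that the shift puts on the differential does not affect its kernel.\<close>

lemma cocycles_shift:
  assumes "mod_complex A X"
  shows "cocycles (shift (-1) X) 0 = cocycles X (-1)"
proof -
  interpret X: mod_complex A X by fact
  interpret M: right_module A "obj X i" for i by (rule X.obj_module)
  have "\<ominus>\<^bsub>obj X 0\<^esub> y = \<zero>\<^bsub>obj X 0\<^esub> \<longleftrightarrow> y = \<zero>\<^bsub>obj X 0\<^esub>" if "y \<in> carrier (obj X 0)" for y
  proof -
    have "\<ominus>\<^bsub>obj X 0\<^esub> \<zero>\<^bsub>obj X 0\<^esub> = \<zero>\<^bsub>obj X 0\<^esub>" by simp
    then show ?thesis using M.M.minus_minus[OF that] by metis
  qed
  then show ?thesis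
    using X.dif_closed[of _ "-1"] by (auto simp: cocycles_def obj_shift dif_shift)
qed

text \<open>The image is unaffected by the sign as well, because negation can be moved to the
  argument.\<close>

lemma coboundaries_shift:
  assumes "mod_complex A X"
  shows "coboundaries (shift (-1) X) 0 = coboundaries X (-1)"
proof -
  interpret X: mod_complex A X by fact
  interpret M: right_module A "obj X i" for i by (rule X.obj_module)
  have d: "dif X (-2) (\<ominus>\<^bsub>obj X (-2)\<^esub> w) = \<ominus>\<^bsub>obj X (-1)\<^esub> dif X (-2) w" if "w \<in> carrier (obj X (-2))" for w
    using mod_hom_minus[OF X.dif_hom X.obj_group X.obj_group that] by simp
  have "dif X (-2) w = \<ominus>\<^bsub>obj X (-1)\<^esub> dif X (-2) (\<ominus>\<^bsub>obj X (-2)\<^esub> w)" if "w \<in> carrier (obj X (-2))" for w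
    using d[OF that] X.dif_closed[OF that] by simp
  then show ?thesis
    using d by (auto simp: coboundaries_def obj_shift dif_shift image_iff) (metis M.M.a_inv_closed)+
qed

context artin_duality
begin

lemma algebra_iso_hom_nakayama:
  fixes T :: "('a, 'm) cochain"
  assumes kb: "Kb_proj A T" and two: "two_term T"
  defines "nuT \<equiv> nakayama R A \<phi> E T"
  defines "I \<equiv> annihilator A (smult (cohomology nuT (-1))) (cohomology nuT (-1))"
  defines "H \<equiv> khom_module A (shift (-1) nuT)"
  shows "algebra_iso R
           (mod_end (A Quot I) (quot_module H)) (mod_end_str (quot_module H) (quot_str A I \<phi>))
           (k_end A T Quot annihilator (k_end A T) (act_nuT R A \<phi> E T) H)
           (quot_str (k_end A T) (annihilator (k_end A T) (act_nuT R A \<phi> E T) H) (k_end_str A T \<phi>))"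
proof -
  have T: "mod_complex A T" using kb by (simp add: Kb_proj_def is_complex_imp_mod_complex)
  have proj: "projective A (obj T i)" for i using kb by (simp add: Kb_proj_def)
  interpret T: mod_complex A T by (rule T)
  have nuT: "nuT = tb.tensor_complex T" unfolding nuT_def by (rule nakayama_eq)
  have N: "mod_complex A nuT" unfolding nuT by (rule tb.tensor_complex[OF T])
  interpret N: mod_complex A nuT by (rule N)
  let ?X = "shift (-1) nuT" and ?P = "obj T (-1)" and ?Q = "obj T 0"
  have X: "mod_complex A ?X" by (rule shift_complex[OF N])
  interpret X: mod_complex A ?X by (rule X)
  interpret HX: right_module A "khom_module A ?X" by (rule X.right_module_khom_module)
  have X0: "obj ?X 0 = tensor A ?P D" by (simp add: obj_shift nuT tb.tensor_complex_simps)
  interpret TP: right_module A "tensor A ?P D" using X.obj_module[of 0] by (simp add: X0)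
  have dT: "dif T (-1) \<in> mod_hom A ?P ?Q" using T.dif_hom[of "-1"] by simp
  have Z: "cocycles ?X 0 = {u \<in> carrier (tensor A ?P D). tensor_map A ?P ?Q D (dif T (-1)) u = \<zero>\<^bsub>tensor A ?Q D\<^esub>}"
    by (simp add: cocycles_shift[OF N]) (simp add: cocycles_def nuT tb.tensor_complex_simps)
  \<comment> \<open>T vanishes in degree -2, hence so does \<nu>T; classes in Hom(A, \<nu>T[-1]) are
    single elements of the kernel.\<close>
  have B: "coboundaries ?X 0 = {\<zero>\<^bsub>obj ?X 0\<^esub>}"
  proof -
    have "carrier (obj T (-2)) = {\<zero>\<^bsub>obj T (-2)\<^esub>}" using two by (simp add: two_term_def zero_module_def)
    then have "w = \<zero>\<^bsub>obj nuT (-2)\<^esub>" if "w \<in> carrier (obj nuT (-2))" for w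
      using tb.tensor_zero_module[OF T.obj_module] that by (simp add: nuT tb.tensor_complex_simps)
    then have "coboundaries nuT (-1) \<subseteq> {\<zero>\<^bsub>obj nuT (-1)\<^esub>}"
      using mod_hom_zero[OF N.dif_hom N.obj_group N.obj_group, of "-2"] by (auto simp: coboundaries_def)
    then show ?thesis
      using N.coboundaries_closed(1)[of "-1"] by (auto simp: coboundaries_shift[OF N] obj_shift)
  qed
  \<comment> \<open>Degree 0 of the shifted complex is degree -1 of \<nu>T, so \<open>t\<close> acts
    there through its component in degree -1.\<close>
  define \<theta> where "\<theta> t = tensor_map A ?P ?P D (t (-1))" for t :: "int \<Rightarrow> 'm \<Rightarrow> 'm"
  have nu: "(\<lambda>i. tb.tensor_chain T T t (i + -1)) \<in> chain_maps A ?X ?X" if "t \<in> chain_maps A T T" for t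
    unfolding nuT using tb.tensor_complex[OF T] tb.tensor_chain_map[OF T T that]
    by (intro shift_chain_map)
  have \<theta>0: "tb.tensor_chain T T t (0 + -1) = \<theta> t" for t by (simp add: tb.tensor_chain_def \<theta>_def)
  have inj: "z = z'" if "z \<in> cocycles ?X 0" "z' \<in> cocycles ?X 0" "elt_class A ?X z = elt_class A ?X z'" for z z'
    using that X.cocycles_carrier[OF that(2)] by (simp add: X.elt_class_eq_iff B X0)
  show ?thesis
    unfolding H_def
  proof (rule algebra_iso_action[OF T X, where \<theta> = \<theta>])
    show "ideal I A" unfolding I_def by (rule N.ideal_annihilator_cohomology)
    show "a \<odot>\<^bsub>obj ?X 0\<^esub> z \<in> coboundaries ?X 0" if "a \<in> I" "z \<in> cocycles ?X 0" for a z
      using that unfolding I_def N.annihilator_cohomology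
      by (simp add: cocycles_shift[OF N] coboundaries_shift[OF N] obj_shift)
    show "\<theta> t \<in> mod_hom A (obj ?X 0) (obj ?X 0)" if "t \<in> chain_maps A T T" for t
      unfolding X0 \<theta>_def by (rule tb.tensor_map_hom(1)[OF T.obj_module T.obj_module chain_map_hom[OF that]])
    show "\<theta> t z \<in> cocycles ?X 0" if "t \<in> chain_maps A T T" "z \<in> cocycles ?X 0" for t z
      using X.comp_elt_class(1)[OF X nu[OF that(1)] that(2)] by (simp only: \<theta>0)
    show "act_nuT R A \<phi> E T (k_class A T T t) (elt_class A ?X z) = elt_class A ?X (\<theta> t z)"
      if t: "t \<in> chain_maps A T T" and z: "z \<in> cocycles ?X 0" for t z
    proof -
      have "k_nakayama R A \<phi> E T T (k_class A T T t) = k_class A nuT nuT (tb.tensor_chain T T t)"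
        using tb.tensor_k_class[OF T T t]
        by (simp add: k_nakayama_def nakayama_eq nuT tb.tensor_chain_def[abs_def])
      moreover have "k_shift A (-1) nuT nuT (k_class A nuT nuT (tb.tensor_chain T T t)) =
          k_class A ?X ?X (\<lambda>i. tb.tensor_chain T T t (i + -1))"
        using tb.tensor_chain_map[OF T T t] by (intro k_shift_class[OF N N]) (simp add: nuT)
      ultimately show ?thesis
        using X.comp_elt_class(2)[OF X nu[OF t] z]
        by (simp only: act_nuT_def Let_def nuT_def[symmetric] \<theta>0)
    qed
    show "\<theta> (ch_add T T t t') z = \<theta> t z \<oplus>\<^bsub>obj ?X 0\<^esub> \<theta> t' z"
      if "t \<in> chain_maps A T T" "t' \<in> chain_maps A T T" "z \<in> cocycles ?X 0" for t t' z
      using tb.tensor_map_plus[OF T.obj_module T.obj_module chain_map_hom[OF that(1)] chain_map_hom[OF that(2)]]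
        X.cocycles_carrier[OF that(3)]
      by (simp add: \<theta>_def ch_add_def[abs_def] X0)
    show "\<theta> (ch_comp T t t') z = \<theta> t (\<theta> t' z)"
      if "t \<in> chain_maps A T T" "t' \<in> chain_maps A T T" "z \<in> cocycles ?X 0" for t t' z
      using tb.tensor_map_comp[OF T.obj_module T.obj_module T.obj_module chain_map_hom[OF that(2)] chain_map_hom[OF that(1)]]
        X.cocycles_carrier[OF that(3)]
      by (simp add: \<theta>_def ch_comp_def[abs_def] X0)
    show "\<theta> (ch_id T) z = z" if "z \<in> cocycles ?X 0" for z
      using tb.tensor_map_id[OF T.obj_module] X.cocycles_carrier[OF that]
      by (simp add: \<theta>_def ch_id_def[abs_def] X0)
  next
    fix r z assume r: "r \<in> carrier R" and z: "z \<in> cocycles ?X 0"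
    let ?t = "\<lambda>i. \<lambda>x\<in>carrier (obj T i). \<phi> r \<odot>\<^bsub>obj T i\<^esub> x"
    have t: "?t (-1) \<in> mod_hom A ?P ?P" by (rule chain_map_hom[OF scalar_chain_map[OF T r]])
    note th = tb.tensor_map_hom[OF T.obj_module T.obj_module t]
    have zc: "z \<in> carrier (tensor A ?P D)" using X.cocycles_carrier[OF z] by (simp add: X0)
    have "tensor_map A ?P ?P D (?t (-1)) z = \<phi> r \<odot>\<^bsub>tensor A ?P D\<^esub> z"
    proof (rule tb.tensor_eqI[OF T.obj_module TP.M.abelian_group_axioms zc,
          of "tensor_map A ?P ?P D (?t (-1))" "\<lambda>z. \<phi> r \<odot>\<^bsub>tensor A ?P D\<^esub> z"])
      fix x d assume x: "x \<in> carrier ?P" and d: "d \<in> carrier D"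
      \<comment> \<open>Left and right multiplication by a central element agree on DA; balancing
        thus turns the action on the first factor into the one on the second.\<close>
      have "lsmult D (\<phi> r) d = \<phi> r \<odot>\<^bsub>D\<^esub> d"
        using r by (auto simp: D_simps(4,5) str_central intro!: restrict_ext)
      then show "tensor_map A ?P ?P D (?t (-1)) (tb.elem ?P x d) = \<phi> r \<odot>\<^bsub>tensor A ?P D\<^esub> tb.elem ?P x d"
        using x d str_closed[OF r]
        by (simp add: th(2) tb.elem_balanced[OF T.obj_module] tb.right_module_tensor(2)[OF T.obj_module])
    qed (use str_closed[OF r] in \<open>simp_all add: mod_hom_closed[OF th(1)] mod_hom_add[OF th(1)] TP.smult_r_distr\<close>)
    then show "\<theta> ?t z = \<phi> r \<odot>\<^bsub>obj ?X 0\<^esub> z" by (simp add: \<theta>_def X0)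
  next
    fix f assume f: "f \<in> mod_hom A (khom_module A ?X) (khom_module A ?X)"
    have ec: "elt_class A ?X z \<in> carrier (khom_module A ?X)" if "z \<in> cocycles ?X 0" for z
      using that by (simp add: X.carrier_khom_module)
    have "\<forall>z\<in>cocycles ?X 0. \<exists>y\<in>cocycles ?X 0. f (elt_class A ?X z) = elt_class A ?X y"
      using mod_hom_closed[OF f ec] by (auto simp: X.carrier_khom_module)
    \<comment> \<open>The choice is forced on cocycles, where \<open>elt_class\<close> is injective;
      this is why \<open>\<gamma>\<close> inherits additivity and linearity from
      \<open>f\<close>.\<close>
    then obtain \<gamma> where \<gamma>: "\<And>z. z \<in> cocycles ?X 0 \<Longrightarrow> \<gamma> z \<in> cocycles ?X 0"
      "\<And>z. z \<in> cocycles ?X 0 \<Longrightarrow> f (elt_class A ?X z) = elt_class A ?X (\<gamma> z)" by metis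
    have \<gamma>_add: "\<gamma> (u \<oplus>\<^bsub>obj ?X 0\<^esub> v) = \<gamma> u \<oplus>\<^bsub>obj ?X 0\<^esub> \<gamma> v" if uv: "u \<in> cocycles ?X 0" "v \<in> cocycles ?X 0" for u v
    proof (rule inj)
      have "elt_class A ?X (\<gamma> (u \<oplus>\<^bsub>obj ?X 0\<^esub> v)) = f (elt_class A ?X u \<oplus>\<^bsub>khom_module A ?X\<^esub> elt_class A ?X v)"
        by (simp add: \<gamma>(2)[symmetric] X.cocycles_closed uv X.add_khom_module)
      also have "\<dots> = elt_class A ?X (\<gamma> u \<oplus>\<^bsub>obj ?X 0\<^esub> \<gamma> v)"
        unfolding mod_hom_add[OF f ec[OF uv(1)] ec[OF uv(2)]] by (simp add: \<gamma> uv X.add_khom_module)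
      finally show "elt_class A ?X (\<gamma> (u \<oplus>\<^bsub>obj ?X 0\<^esub> v)) = elt_class A ?X (\<gamma> u \<oplus>\<^bsub>obj ?X 0\<^esub> \<gamma> v)" .
    qed (simp_all add: \<gamma>(1) X.cocycles_closed uv)
    have \<gamma>_smult: "\<gamma> (a \<odot>\<^bsub>obj ?X 0\<^esub> u) = a \<odot>\<^bsub>obj ?X 0\<^esub> \<gamma> u" if a: "a \<in> carrier A" and u: "u \<in> cocycles ?X 0" for a u
    proof (rule inj)
      have "elt_class A ?X (\<gamma> (a \<odot>\<^bsub>obj ?X 0\<^esub> u)) = f (a \<odot>\<^bsub>khom_module A ?X\<^esub> elt_class A ?X u)"
        by (simp add: \<gamma>(2)[symmetric] X.cocycles_closed u a X.smult_khom_module)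
      also have "\<dots> = elt_class A ?X (a \<odot>\<^bsub>obj ?X 0\<^esub> \<gamma> u)"
        unfolding mod_hom_smult[OF f a ec[OF u]] by (simp add: \<gamma> u a X.smult_khom_module)
      finally show "elt_class A ?X (\<gamma> (a \<odot>\<^bsub>obj ?X 0\<^esub> u)) = elt_class A ?X (a \<odot>\<^bsub>obj ?X 0\<^esub> \<gamma> u)" .
    qed (simp_all add: \<gamma>(1) X.cocycles_closed u a)
    obtain k g where kg: "k \<in> mod_hom A ?P ?P" "g \<in> mod_hom A ?Q ?Q"
      "\<And>x. x \<in> carrier ?P \<Longrightarrow> g (dif T (-1) x) = dif T (-1) (k x)"
      "\<And>u. u \<in> cocycles ?X 0 \<Longrightarrow> tensor_map A ?P ?P D k u = \<gamma> u"
      using kernel_endomorphism_lifts[OF proj proj dT, of \<gamma>, folded Z]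
        \<gamma>(1) \<gamma>_add[unfolded X0] \<gamma>_smult[unfolded X0] by blast
    obtain t where "t \<in> chain_maps A T T" "t (-1) = k" using two_term_chain_map[OF T two kg(1-3)] by blast
    then show "\<exists>t\<in>chain_maps A T T. \<forall>z\<in>cocycles ?X 0. f (elt_class A ?X z) = elt_class A ?X (\<theta> t z)"
      using kg(4) \<gamma>(2) by (intro bexI[of _ t]) (simp_all add: \<theta>_def)
  qed
qed

end

theorem theorem3p6:
  fixes R :: "'r ring" and m :: "'r set" and E :: "('r, 'e) module"
    and A :: "'a ring" and \<phi> :: "'r \<Rightarrow> 'a" and T :: "('a, 'm) cochain"
  assumes "artinian_local_ring m R"
    and "injective_envelope R (residue_module R m) E"
    and "artin_algebra R A \<phi>"
    and "connected_ring A" and "basic_ring A" and "\<not> simple_ring A"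
    and "tilting_complex A T" and "two_term T"
    and "B = k_end A T" and "\<beta> = k_end_str A T \<phi>"
    and "nuT = nakayama R A \<phi> E T"
    and "H = khom_module A T"
    and "H' = khom_module A (shift (-1) nuT)"
    and "\<aa> = annihilator A (smult (cohomology T 0)) (cohomology T 0)"
    and "\<aa>' = annihilator A (smult (cohomology nuT (-1))) (cohomology nuT (-1))"
    and "\<bb> = annihilator B (act_T A T) H"
    and "\<bb>' = annihilator B (act_nuT R A \<phi> E T) H'"
  shows "algebra_iso R
           (mod_end (A Quot \<aa>) (quot_module H)) (mod_end_str (quot_module H) (quot_str A \<aa> \<phi>))
           (B Quot \<bb>) (quot_str B \<bb> \<beta>) \<and>
         algebra_iso R
           (mod_end (A Quot \<aa>') (quot_module H')) (mod_end_str (quot_module H') (quot_str A \<aa>' \<phi>))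
           (B Quot \<bb>') (quot_str B \<bb>' \<beta>)"
proof -
  interpret artin_duality m R A \<phi> E
    using assms(1-3)
    by (intro artin_duality.intro artinian_local_envelope.intro artinian_local_envelope_axioms.intro)
  have kb: "Kb_proj A T" using assms(7) by (simp add: tilting_complex_def)
  from algebra_iso_hom_regular[OF kb assms(8)] algebra_iso_hom_nakayama[OF kb assms(8)]
  show ?thesis unfolding assms(9-17) by blast
qed

end
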